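(* Let $\Omega\subset\mathbb{R}^n$ ($n\le 3$) be a bounded Lipschitz domain and let $d_1,d_2,d_3,a_1,a_3,b_1,b_2,c_2,c_3,F,G_1,G_2$ be positive constants. Let $\{S(t)\}_{t\ge0}$ be the Oregonator semiflow on $H_+$ generated by $$\frac{\partial u}{\partial t}=d_1\Delta u+a_1u+b_1v-Fu^2-G_1uv,\qquad \frac{\partial v}{\partial t}=d_2\Delta v-b_2v+c_2w-G_2uv,\qquad \frac{\partial w}{\partial t}=d_3\Delta w+a_3u-c_3w$$ on $\Omega$ with $u=v=w=0$ on $\partial\Omega$, and let $\mathscr{A}$ be its global attractor in $H_+$. Then $\mathscr{A}$ has a finite Hausdorff dimension and a finite fractal dimension (as a subset of $H=[L^2(\Omega)]^3$).
   Context: Spaces: $H=[L^2(\Omega)]^3$ with norm $\|\cdot\|$, $E=[H_0^1(\Omega)]^3$ with norm $\|\varphi\|_E=\|\nabla\varphi\|$, $E^*=[H^{-1}(\Omega)]^3$, with $(\cdot,\cdot)$ the $(E^*,E)$ dual product. $H_+=\{\varphi\in H:\varphi_i\ge0 \text{ a.e. in }\Omega,\ i=1,2,3\}$. Operators: $A=\mathrm{diag}(d_1\Delta,d_2\Delta,d_3\Delta)$ with Dirichlet conditions, regarded also as a bounded operator $E\to E^*$, and $f:E\to H$, $f(u,v,w)=(a_1u+b_1v-Fu^2-G_1uv,\,-b_2v+c_2w-G_2uv,\,a_3u-c_3w)$. The system is written as $\frac{dg}{dt}=Ag+f(g)$, $g(0)=g_0$, with $g=(u,v,w)$. Weak solution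 on $[0,\tau]$: a function $g\in L^2(0,\tau;E)\cap C_w([0,\tau];H)$ ($C_w$: weakly continuous) with $g(0)=g_0$ such that for every $\phi\in E$, $\frac{d}{dt}(g,\phi)=(Ag,\phi)+(f(g),\phi)$ for a.e. $t\in[0,\tau]$ (time derivative in the distributional sense). A global weak solution is a function on $[0,\infty)$ that is a weak solution on every $[0,\tau]$. Oregonator semiflow: for every $g_0\in H_+$ there is a unique global weak solution $g(t;g_0)$, and it stays in $H_+$; $S(t)g_0=g(t;g_0)$, $t\ge0$. Global attractor in $H_+$ for $\{S(t)\}_{t\ge0}$: a nonempty compact (in the $H$-norm) subset $\mathscr{A}\subset H_+$ with $S(t)\mathscr{A}=\mathscr{A}$ for all $t\ge0$, and such that for every bounded $B\subset H_+$, $\sup_{x\in B}\inf_{y\in\mathscr{A}}\|S(t)x-y\|\to0$ as $t\to\infty$. Such a set exists for the Oregonator semiflow and is unique. The fractal dimension is the (upper) box-counting dimension $d_F(\mathscr{A})=\limsup_{\varepsilon\to0^+}\frac{\log N_\varepsilon(\mathscr{A})}{\log(1/\varepsilon)}$, where $N_\varepsilon(\mathscr{A})$ is the minimal number of $H$-balls of radius $\varepsilon$ covering $\mathscr{A}$. *)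

theory Defs
  imports "HOL-Analysis.Analysis"
begin

section \<open>Square-integrable functions modulo equality almost everywhere\<close>

definition square_integrable :: "('a::euclidean_space \<Rightarrow> 'b::euclidean_space) \<Rightarrow> bool" where
  "square_integrable f \<longleftrightarrow>
     f \<in> borel_measurable lebesgue \<and> integrable lebesgue (\<lambda>x. (norm (f x))\<^sup>2)"

lemma square_integrable_zero: "square_integrable (\<lambda>_. 0)"
  by (simp add: square_integrable_def)

lemma square_integrable_scaleR:
  "square_integrable f \<Longrightarrow> square_integrable (\<lambda>x. c *\<^sub>R f x)"
  by (auto simp: square_integrable_def power_mult_distrib)

lemma square_integrable_add:
  assumes "square_integrable f" "square_integrable g"
  shows "square_integrable (\<lambda>x. f x + g x)"
proof -
  have [measurable]: "f \<in> borel_measurable lebesgue" "g \<in> borel_measurable lebesgue"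
    using assms by (auto simp: square_integrable_def)
  have "integrable lebesgue (\<lambda>x. (norm (f x + g x))\<^sup>2)"
  proof (rule Bochner_Integration.integrable_bound)
    show "integrable lebesgue (\<lambda>x. 2 * (norm (f x))\<^sup>2 + 2 * (norm (g x))\<^sup>2)"
      using assms by (auto simp: square_integrable_def)
    have "(norm (f x + g x))\<^sup>2 \<le> 2 * (norm (f x))\<^sup>2 + 2 * (norm (g x))\<^sup>2" for x
    proof -
      have "(norm (f x + g x))\<^sup>2 \<le> (norm (f x) + norm (g x))\<^sup>2"
        by (simp add: norm_triangle_ineq power_mono)
      also have "\<dots> \<le> 2 * (norm (f x))\<^sup>2 + 2 * (norm (g x))\<^sup>2"
        using sum_squares_bound[of "norm (f x)" "norm (g x)"] by (simp add: power2_sum)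
      finally show ?thesis .
    qed
    then show "AE x in lebesgue. norm ((norm (f x + g x))\<^sup>2)
        \<le> norm (2 * (norm (f x))\<^sup>2 + 2 * (norm (g x))\<^sup>2)"
      by simp
  qed measurable
  then show ?thesis
    by (simp add: square_integrable_def)
qed

lemma square_integrable_uminus: "square_integrable f \<Longrightarrow> square_integrable (\<lambda>x. - f x)"
  using square_integrable_scaleR[of f "-1"] by simp

lemma square_integrable_diff:
  "square_integrable f \<Longrightarrow> square_integrable g \<Longrightarrow> square_integrable (\<lambda>x. f x - g x)"
  using square_integrable_add[of f "\<lambda>x. - g x"] square_integrable_uminus[of g] by simp

lemma square_integrable_inner:
  assumes "square_integrable f" "square_integrable g"
  shows "integrable lebesgue (\<lambda>x. f x \<bullet> g x)"
proof (rule Bochner_Integration.integrable_bound)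
  have [measurable]: "f \<in> borel_measurable lebesgue" "g \<in> borel_measurable lebesgue"
    using assms by (auto simp: square_integrable_def)
  show "(\<lambda>x. f x \<bullet> g x) \<in> borel_measurable lebesgue"
    by measurable
  show "integrable lebesgue (\<lambda>x. (norm (f x))\<^sup>2 + (norm (g x))\<^sup>2)"
    using assms by (auto simp: square_integrable_def)
  have "\<bar>f x \<bullet> g x\<bar> \<le> (norm (f x))\<^sup>2 + (norm (g x))\<^sup>2" for x
  proof -
    have "\<bar>f x \<bullet> g x\<bar> \<le> norm (f x) * norm (g x)"
      by (rule Cauchy_Schwarz_ineq2)
    also have "\<dots> \<le> 2 * norm (f x) * norm (g x)"
      by (simp add: mult_right_mono)
    also have "\<dots> \<le> (norm (f x))\<^sup>2 + (norm (g x))\<^sup>2"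
      by (rule sum_squares_bound)
    finally show ?thesis .
  qed
  then show "AE x in lebesgue. norm (f x \<bullet> g x) \<le> norm ((norm (f x))\<^sup>2 + (norm (g x))\<^sup>2)"
    by simp
qed

definition L2_eq :: "('a::euclidean_space \<Rightarrow> 'b::euclidean_space) \<Rightarrow> ('a \<Rightarrow> 'b) \<Rightarrow> bool" where
  "L2_eq f g \<longleftrightarrow> square_integrable f \<and> square_integrable g \<and> (AE x in lebesgue. f x = g x)"

quotient_type (overloaded) ('a, 'b) L2 =
  "'a::euclidean_space \<Rightarrow> 'b::euclidean_space" / partial: L2_eq
proof (rule part_equivpI)
  show "\<exists>f::'a \<Rightarrow> 'b. L2_eq f f"
    by (rule exI[of _ "\<lambda>_. 0"]) (simp add: L2_eq_def square_integrable_zero)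
  show "symp (L2_eq :: ('a \<Rightarrow> 'b) \<Rightarrow> _)"
    by (auto simp: symp_def L2_eq_def)
  show "transp (L2_eq :: ('a \<Rightarrow> 'b) \<Rightarrow> _)"
    unfolding transp_def L2_eq_def by (auto elim: AE_mp)
qed

instantiation L2 :: (euclidean_space, euclidean_space) real_inner
begin

lift_definition zero_L2 :: "('a, 'b) L2" is "\<lambda>_. 0"
  by (simp add: L2_eq_def square_integrable_zero)

lift_definition plus_L2 :: "('a, 'b) L2 \<Rightarrow> ('a, 'b) L2 \<Rightarrow> ('a, 'b) L2"
  is "\<lambda>f g x. f x + g x"
  by (auto simp: L2_eq_def square_integrable_add)

lift_definition uminus_L2 :: "('a, 'b) L2 \<Rightarrow> ('a, 'b) L2" is "\<lambda>f x. - f x"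
  by (auto simp: L2_eq_def square_integrable_uminus)

lift_definition minus_L2 :: "('a, 'b) L2 \<Rightarrow> ('a, 'b) L2 \<Rightarrow> ('a, 'b) L2"
  is "\<lambda>f g x. f x - g x"
  by (auto simp: L2_eq_def square_integrable_diff)

lift_definition scaleR_L2 :: "real \<Rightarrow> ('a, 'b) L2 \<Rightarrow> ('a, 'b) L2" is "\<lambda>c f x. c *\<^sub>R f x"
  by (auto simp: L2_eq_def square_integrable_scaleR)

lift_definition inner_L2 :: "('a, 'b) L2 \<Rightarrow> ('a, 'b) L2 \<Rightarrow> real"
  is "\<lambda>f g. LINT x|lebesgue. f x \<bullet> g x"
proof -
  fix f f' g g' :: "'a \<Rightarrow> 'b"
  assume *: "L2_eq f f'" "L2_eq g g'"
  then have "AE x in lebesgue. f x \<bullet> g x = f' x \<bullet> g' x"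
    by (auto simp: L2_eq_def)
  then show "(LINT x|lebesgue. f x \<bullet> g x) = (LINT x|lebesgue. f' x \<bullet> g' x)"
    using * by (intro integral_cong_AE)
      (auto simp: L2_eq_def intro: borel_measurable_integrable square_integrable_inner)
qed

definition norm_L2 :: "('a, 'b) L2 \<Rightarrow> real" where
  "norm_L2 u = sqrt (u \<bullet> u)"

definition dist_L2 :: "('a, 'b) L2 \<Rightarrow> ('a, 'b) L2 \<Rightarrow> real" where
  "dist_L2 u v = norm (u - v)"

definition sgn_L2 :: "('a, 'b) L2 \<Rightarrow> ('a, 'b) L2" where
  "sgn_L2 u = inverse (norm u) *\<^sub>R u"

definition uniformity_L2 :: "(('a, 'b) L2 \<times> ('a, 'b) L2) filter" where
  "uniformity_L2 = (INF e\<in>{0<..}. principal {(u, v). dist u v < e})"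

definition open_L2 :: "('a, 'b) L2 set \<Rightarrow> bool" where
  "open_L2 U \<longleftrightarrow> (\<forall>u\<in>U. \<forall>\<^sub>F (u', v) in uniformity. u' = u \<longrightarrow> v \<in> U)"

instance
proof
  fix u v w :: "('a, 'b) L2" and c c' :: real
  show "u + v + w = u + (v + w)"
    by transfer (auto simp: L2_eq_def add.assoc intro!: square_integrable_add)
  show "u + v = v + u"
    by transfer (auto simp: L2_eq_def add.commute intro!: square_integrable_add)
  show "0 + u = u"
    by transfer (auto simp: L2_eq_def)
  show "- u + u = 0"
    by transfer (auto simp: L2_eq_def square_integrable_zero)
  show "u - v = u + - v"
    by transfer (auto simp: L2_eq_def intro!: square_integrable_diff)
  show "c *\<^sub>R (u + v) = c *\<^sub>R u + c *\<^sub>R v"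
    by transfer (auto simp: L2_eq_def scaleR_add_right
        intro!: square_integrable_add square_integrable_scaleR)
  show "(c + c') *\<^sub>R u = c *\<^sub>R u + c' *\<^sub>R u"
    by transfer (auto simp: L2_eq_def scaleR_add_left
        intro!: square_integrable_add square_integrable_scaleR)
  show "c *\<^sub>R c' *\<^sub>R u = (c * c') *\<^sub>R u"
    by transfer (auto simp: L2_eq_def intro!: square_integrable_scaleR)
  show "1 *\<^sub>R u = u"
    by transfer (auto simp: L2_eq_def)
  show "u \<bullet> v = v \<bullet> u"
    by transfer (simp add: inner_commute)
  show "(u + v) \<bullet> w = u \<bullet> w + v \<bullet> w"
    by transfer (auto simp: L2_eq_def inner_add_left square_integrable_inner
        intro!: Bochner_Integration.integral_add)
  show "c *\<^sub>R u \<bullet> v = c * (u \<bullet> v)"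
    by transfer simp
  show "0 \<le> u \<bullet> u"
    by transfer (simp add: Bochner_Integration.integral_nonneg)
  show "u \<bullet> u = 0 \<longleftrightarrow> u = 0"
  proof transfer
    fix f :: "'a \<Rightarrow> 'b"
    assume "L2_eq f f"
    then have f: "square_integrable f"
      by (simp add: L2_eq_def)
    have "(LINT x|lebesgue. f x \<bullet> f x) = 0 \<longleftrightarrow> (AE x in lebesgue. f x \<bullet> f x = 0)"
      by (rule integral_nonneg_eq_0_iff_AE) (auto simp: square_integrable_inner f)
    then show "(LINT x|lebesgue. f x \<bullet> f x) = 0 \<longleftrightarrow> L2_eq f (\<lambda>_. 0)"
      by (simp add: L2_eq_def f square_integrable_zero)
  qed
qed (simp_all add: norm_L2_def dist_L2_def sgn_L2_def uniformity_L2_def open_L2_def)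

end

text \<open>
  \<open>L\<^sup>2(\<Omega>)\<close> is identified with the closed subspace of \<open>L\<^sup>2(\<real>\<^sup>n)\<close> of the functions vanishing
  outside \<open>\<Omega>\<close>. For a function \<open>f\<close>, \<^term>\<open>abs_L2 f\<close> is its class, meaningful only
  if \<open>f\<close> is square-integrable; \<^term>\<open>rep_L2 u\<close> is some representative of \<open>u\<close>.
\<close>

definition L2_on :: "'a::euclidean_space set \<Rightarrow> ('a, 'b::euclidean_space) L2 set" where
  "L2_on \<Omega> = {u. AE x in lebesgue. x \<notin> \<Omega> \<longrightarrow> rep_L2 u x = 0}"

text \<open>
  The product of two elements of \<open>L\<^sup>2\<close> is only used where it lies in \<open>L\<^sup>2\<close> again
  (as for factors in \<open>H\<^sub>0\<^sup>1(\<Omega>)\<close>, \<open>n \<le> 3\<close>).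
\<close>

definition L2_mult :: "('a::euclidean_space, real) L2 \<Rightarrow> ('a, real) L2 \<Rightarrow> ('a, real) L2" where
  "L2_mult u v = abs_L2 (\<lambda>x. rep_L2 u x * rep_L2 v x)"


section \<open>Weak derivatives and the space \<open>H\<^sub>0\<^sup>1\<close>\<close>

primrec C_k :: "nat \<Rightarrow> ('a::euclidean_space \<Rightarrow> real) \<Rightarrow> bool" where
  "C_k 0 f \<longleftrightarrow> continuous_on UNIV f"
| "C_k (Suc k) f \<longleftrightarrow> (\<exists>f'. (\<forall>x. (f has_derivative f' x) (at x)) \<and> (\<forall>v\<in>Basis. C_k k (\<lambda>x. f' x v)))"

definition test_function :: "'a::euclidean_space set \<Rightarrow> ('a \<Rightarrow> real) \<Rightarrow> bool" where
  "test_function \<Omega> \<eta> \<longleftrightarrow> (\<forall>k. C_k k \<eta>) \<and>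
     compact (closure (support_on UNIV \<eta>)) \<and> closure (support_on UNIV \<eta>) \<subseteq> \<Omega>"

definition locally_integrable :: "'a::euclidean_space set \<Rightarrow> ('a \<Rightarrow> real) \<Rightarrow> bool" where
  "locally_integrable \<Omega> p \<longleftrightarrow> (\<forall>K. compact K \<and> K \<subseteq> \<Omega> \<longrightarrow> set_integrable lebesgue K p)"

text \<open>
  Also used for distributional time derivatives, with \<open>\<Omega>\<close> an open interval and \<open>e = 1\<close>.
\<close>

definition has_weak_derivative_on ::
    "'a::euclidean_space set \<Rightarrow> 'a \<Rightarrow> ('a \<Rightarrow> real) \<Rightarrow> ('a \<Rightarrow> real) \<Rightarrow> bool" where
  "has_weak_derivative_on \<Omega> e p q \<longleftrightarrow>
     locally_integrable \<Omega> p \<and> locally_integrable \<Omega> q \<and>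
     (\<forall>\<eta>. test_function \<Omega> \<eta> \<longrightarrow>
        (LINT x:\<Omega>|lebesgue. p x * frechet_derivative \<eta> (at x) e) =
          - (LINT x:\<Omega>|lebesgue. q x * \<eta> x))"

definition is_weak_gradient ::
    "'a::euclidean_space set \<Rightarrow> ('a, real) L2 \<Rightarrow> ('a, 'a) L2 \<Rightarrow> bool" where
  "is_weak_gradient \<Omega> u \<psi> \<longleftrightarrow> \<psi> \<in> L2_on \<Omega> \<and>
     (\<forall>e\<in>Basis. has_weak_derivative_on \<Omega> e (rep_L2 u) (\<lambda>x. rep_L2 \<psi> x \<bullet> e))"

definition weak_gradient :: "'a::euclidean_space set \<Rightarrow> ('a, real) L2 \<Rightarrow> ('a, 'a) L2" where
  "weak_gradient \<Omega> u = (THE \<psi>. is_weak_gradient \<Omega> u \<psi>)"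

definition H1 :: "'a::euclidean_space set \<Rightarrow> ('a, real) L2 set" where
  "H1 \<Omega> = {u \<in> L2_on \<Omega>. \<exists>\<psi>. is_weak_gradient \<Omega> u \<psi>}"

definition H1_norm :: "'a::euclidean_space set \<Rightarrow> ('a, real) L2 \<Rightarrow> real" where
  "H1_norm \<Omega> u = sqrt ((norm u)\<^sup>2 + (norm (weak_gradient \<Omega> u))\<^sup>2)"

definition H1_0 :: "'a::euclidean_space set \<Rightarrow> ('a, real) L2 set" where
  "H1_0 \<Omega> = {u \<in> H1 \<Omega>. \<forall>\<epsilon>>0. \<exists>\<eta>. test_function \<Omega> \<eta> \<and> H1_norm \<Omega> (u - abs_L2 \<eta>) < \<epsilon>}"


section \<open>Bounded Lipschitz domains\<close>

text \<open>
  Near each boundary point, for a suitable unit vector \<open>e\<close>, the domain is the part above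
  the graph of a Lipschitz function on the hyperplane orthogonal to \<open>e\<close>.
\<close>

definition Lipschitz_boundary :: "'a::euclidean_space set \<Rightarrow> bool" where
  "Lipschitz_boundary \<Omega> \<longleftrightarrow>
     (\<forall>z\<in>frontier \<Omega>. \<exists>r>0. \<exists>e \<gamma> L. norm e = 1 \<and> L-lipschitz_on {y. y \<bullet> e = 0} \<gamma> \<and>
        \<Omega> \<inter> ball z r = {x \<in> ball z r. \<gamma> (x - (x \<bullet> e) *\<^sub>R e) < x \<bullet> e})"

definition bounded_Lipschitz_domain :: "'a::euclidean_space set \<Rightarrow> bool" where
  "bounded_Lipschitz_domain \<Omega> \<longleftrightarrow>
     open \<Omega> \<and> connected \<Omega> \<and> \<Omega> \<noteq> {} \<and> bounded \<Omega> \<and> Lipschitz_boundary \<Omega>"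


section \<open>Phase spaces and weak solutions\<close>

text \<open>The norm of the product type is the norm of \<open>H = [L\<^sup>2(\<Omega>)]\<^sup>3\<close>.\<close>

type_synonym 'a state = "('a, real) L2 \<times> ('a, real) L2 \<times> ('a, real) L2"

definition H_space :: "'a::euclidean_space set \<Rightarrow> 'a state set" where
  "H_space \<Omega> = L2_on \<Omega> \<times> L2_on \<Omega> \<times> L2_on \<Omega>"

definition H_plus :: "'a::euclidean_space set \<Rightarrow> 'a state set" where
  "H_plus \<Omega> = {(u, v, w) \<in> H_space \<Omega>.
     AE x in lebesgue. x \<in> \<Omega> \<longrightarrow> 0 \<le> rep_L2 u x \<and> 0 \<le> rep_L2 v x \<and> 0 \<le> rep_L2 w x}"

definition E_space :: "'a::euclidean_space set \<Rightarrow> 'a state set" where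
  "E_space \<Omega> = H1_0 \<Omega> \<times> H1_0 \<Omega> \<times> H1_0 \<Omega>"

definition E_norm :: "'a::euclidean_space set \<Rightarrow> 'a state \<Rightarrow> real" where
  "E_norm \<Omega> = (\<lambda>(u, v, w). norm (weak_gradient \<Omega> u, weak_gradient \<Omega> v, weak_gradient \<Omega> w))"

text \<open>\<open>L\<^sup>2(0,\<tau>;E)\<close>, with strong (Bochner) measurability into \<open>E\<close>.\<close>

definition L2_time_E :: "'a::euclidean_space set \<Rightarrow> real \<Rightarrow> (real \<Rightarrow> 'a state) \<Rightarrow> bool" where
  "L2_time_E \<Omega> \<tau> g \<longleftrightarrow>
     (AE t in lebesgue_on {0..\<tau>}. g t \<in> E_space \<Omega>) \<and>
     (\<exists>s :: nat \<Rightarrow> real \<Rightarrow> 'a state.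
        (\<forall>k. simple_function (lebesgue_on {0..\<tau>}) (s k) \<and> s k ` {0..\<tau>} \<subseteq> E_space \<Omega>) \<and>
        (AE t in lebesgue_on {0..\<tau>}. (\<lambda>k. E_norm \<Omega> (s k t - g t)) \<longlonglongrightarrow> 0)) \<and>
     (\<integral>\<^sup>+ t. ennreal ((E_norm \<Omega> (g t))\<^sup>2) \<partial>lebesgue_on {0..\<tau>}) < \<infinity>"

definition weakly_continuous_on ::
    "'a::euclidean_space set \<Rightarrow> real set \<Rightarrow> (real \<Rightarrow> 'a state) \<Rightarrow> bool" where
  "weakly_continuous_on \<Omega> I g \<longleftrightarrow>
     g ` I \<subseteq> H_space \<Omega> \<and> (\<forall>h\<in>H_space \<Omega>. continuous_on I (\<lambda>t. g t \<bullet> h))"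

text \<open>
  Weak solutions of \<open>dg/dt = A g + f(g)\<close>, \<open>g(0) = g0\<close>. An element of \<open>E\<^sup>*\<close> is represented by
  the functional \<open>\<phi> \<mapsto> (\<cdot>, \<phi>)\<close>; on elements of \<open>H\<close> this pairing is the inner product of \<open>H\<close>.
\<close>

definition weak_solution ::
    "'a::euclidean_space set \<Rightarrow> ('a state \<Rightarrow> 'a state \<Rightarrow> real) \<Rightarrow> ('a state \<Rightarrow> 'a state) \<Rightarrow>
      real \<Rightarrow> 'a state \<Rightarrow> (real \<Rightarrow> 'a state) \<Rightarrow> bool" where
  "weak_solution \<Omega> A f \<tau> g0 g \<longleftrightarrow>
     L2_time_E \<Omega> \<tau> g \<and> weakly_continuous_on \<Omega> {0..\<tau>} g \<and> g 0 = g0 \<and>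
     (\<forall>\<phi>\<in>E_space \<Omega>. has_weak_derivative_on {0<..<\<tau>} 1
        (\<lambda>t. g t \<bullet> \<phi>) (\<lambda>t. A (g t) \<phi> + f (g t) \<bullet> \<phi>))"

definition global_weak_solution ::
    "'a::euclidean_space set \<Rightarrow> ('a state \<Rightarrow> 'a state \<Rightarrow> real) \<Rightarrow> ('a state \<Rightarrow> 'a state) \<Rightarrow>
      'a state \<Rightarrow> (real \<Rightarrow> 'a state) \<Rightarrow> bool" where
  "global_weak_solution \<Omega> A f g0 g \<longleftrightarrow> (\<forall>\<tau>>0. weak_solution \<Omega> A f \<tau> g0 g)"


section \<open>The Oregonator semiflow\<close>

text \<open>
  \<open>diag(d\<^sub>1\<Delta>, d\<^sub>2\<Delta>, d\<^sub>3\<Delta>)\<close> with Dirichlet conditions, as an operator \<open>E \<rightarrow> E\<^sup>*\<close>: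
  on \<open>H\<^sub>0\<^sup>1(\<Omega>)\<close> the Laplacian is given by \<open>(\<Delta>u, \<phi>) = - (\<nabla>u, \<nabla>\<phi>)\<close>.
\<close>

definition diffusion ::
    "'a::euclidean_space set \<Rightarrow> real \<Rightarrow> real \<Rightarrow> real \<Rightarrow> 'a state \<Rightarrow> 'a state \<Rightarrow> real" where
  "diffusion \<Omega> d1 d2 d3 = (\<lambda>(u, v, w) (\<phi>1, \<phi>2, \<phi>3).
     - (d1 * (weak_gradient \<Omega> u \<bullet> weak_gradient \<Omega> \<phi>1)
      + d2 * (weak_gradient \<Omega> v \<bullet> weak_gradient \<Omega> \<phi>2)
      + d3 * (weak_gradient \<Omega> w \<bullet> weak_gradient \<Omega> \<phi>3)))"

definition oregonator_reaction ::
    "real \<Rightarrow> real \<Rightarrow> real \<Rightarrow> real \<Rightarrow> real \<Rightarrow> real \<Rightarrow> real \<Rightarrow> real \<Rightarrow> real \<Rightarrow>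
      'a::euclidean_space state \<Rightarrow> 'a state" where
  "oregonator_reaction a1 a3 b1 b2 c2 c3 F G1 G2 = (\<lambda>(u, v, w).
     (a1 *\<^sub>R u + b1 *\<^sub>R v - F *\<^sub>R L2_mult u u - G1 *\<^sub>R L2_mult u v,
      - b2 *\<^sub>R v + c2 *\<^sub>R w - G2 *\<^sub>R L2_mult u v,
      a3 *\<^sub>R u - c3 *\<^sub>R w))"

text \<open>
  \<open>S t g0\<close> is the value at time \<open>t\<close> of the unique global weak solution starting at
  \<open>g0 \<in> H\<^sub>+\<close>, which stays in \<open>H\<^sub>+\<close>. Nothing is said about other \<open>g0\<close> or about \<open>t < 0\<close>.
\<close>

definition oregonator_semiflow ::
    "'a::euclidean_space set \<Rightarrow> real \<Rightarrow> real \<Rightarrow> real \<Rightarrow> real \<Rightarrow> real \<Rightarrow> real \<Rightarrow> real \<Rightarrow> real \<Rightarrow>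
      real \<Rightarrow> real \<Rightarrow> real \<Rightarrow> real \<Rightarrow> (real \<Rightarrow> 'a state \<Rightarrow> 'a state) \<Rightarrow> bool" where
  "oregonator_semiflow \<Omega> d1 d2 d3 a1 a3 b1 b2 c2 c3 F G1 G2 S \<longleftrightarrow>
     (let solution = global_weak_solution \<Omega> (diffusion \<Omega> d1 d2 d3)
                       (oregonator_reaction a1 a3 b1 b2 c2 c3 F G1 G2)
      in \<forall>g0\<in>H_plus \<Omega>.
           solution g0 (\<lambda>t. S t g0) \<and> (\<forall>t\<ge>0. S t g0 \<in> H_plus \<Omega>) \<and>
           (\<forall>g. solution g0 g \<longrightarrow> (\<forall>t\<ge>0. g t = S t g0)))"


section \<open>Global attractors and dimensions\<close>

definition global_attractor ::
    "'a::metric_space set \<Rightarrow> (real \<Rightarrow> 'a \<Rightarrow> 'a) \<Rightarrow> 'a set \<Rightarrow> bool" where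
  "global_attractor X S \<A> \<longleftrightarrow>
     \<A> \<noteq> {} \<and> compact \<A> \<and> \<A> \<subseteq> X \<and> (\<forall>t\<ge>0. S t ` \<A> = \<A>) \<and>
     (\<forall>B\<subseteq>X. bounded B \<longrightarrow>
        ((\<lambda>t. SUP x\<in>B. ennreal (infdist (S t x) \<A>)) \<longlongrightarrow> 0) at_top)"

text \<open>
  Covering sets are required to be bounded because \<^const>\<open>diameter\<close> is real-valued.
  Only exponents \<open>s > 0\<close> are used, so that the convention for \<open>0\<^sup>0\<close> plays no role.
\<close>

definition hausdorff_premeasure :: "real \<Rightarrow> real \<Rightarrow> 'a::metric_space set \<Rightarrow> ennreal" where
  "hausdorff_premeasure s \<delta> A =
     (INF U\<in>{U :: nat \<Rightarrow> 'a set. A \<subseteq> (\<Union>i. U i) \<and> (\<forall>i. bounded (U i) \<and> diameter (U i) \<le> \<delta>)}.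
        \<Sum>i. ennreal (diameter (U i) powr s))"

definition hausdorff_measure :: "real \<Rightarrow> 'a::metric_space set \<Rightarrow> ennreal" where
  "hausdorff_measure s A = (SUP \<delta>\<in>{0<..}. hausdorff_premeasure s \<delta> A)"

definition hausdorff_dim :: "'a::metric_space set \<Rightarrow> ereal" where
  "hausdorff_dim A = Inf {ereal s | s. 0 < s \<and> hausdorff_measure s A = 0}"

definition covering_number :: "'a::metric_space set \<Rightarrow> real \<Rightarrow> 'a set \<Rightarrow> enat" where
  "covering_number X \<epsilon> A =
     (INF C\<in>{C. finite C \<and> C \<subseteq> X \<and> A \<subseteq> (\<Union>c\<in>C. ball c \<epsilon>)}. enat (card C))"

definition fractal_dim :: "'a::metric_space set \<Rightarrow> 'a set \<Rightarrow> ereal" where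
  "fractal_dim X A = Limsup (at_right 0) (\<lambda>\<epsilon>.
     case covering_number X \<epsilon> A of
       enat N \<Rightarrow> ereal (ln (real N) / ln (1 / \<epsilon>))
     | \<infinity> \<Rightarrow> \<infinity>)"

end

theory Submission
  imports Defs "HOL-Probability.Probability_Measure"
begin

text \<open>
  For two trajectories on the attractor let \<open>z\<close> be their difference. All nonlinear terms in the energy
  balance of \<open>z\<close> have the form \<open>\<integral> a z\<^sub>i z\<^sub>j\<close> with \<open>a\<close> bounded in \<open>L\<^sup>2\<close>, and for \<open>n \<le> 3\<close> they are
  dominated by \<open>\<epsilon> \<parallel>\<nabla>z\<parallel>\<^sup>2 + C \<parallel>z\<parallel>\<^sup>2\<close>; no sign condition and no regularity of the attractor is needed. Hence
  for a short time \<open>T\<close> both \<open>sup \<parallel>z\<parallel>\<^sup>2\<close> and \<open>\<integral> \<parallel>\<nabla>z\<parallel>\<^sup>2\<close> are bounded by a multiple of \<open>\<parallel>z(0)\<parallel>\<^sup>2\<close>, and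
  \<open>\<parallel>z(T)\<parallel>\<^sup>2\<close> by the time average of \<open>\<parallel>z\<parallel>\<^sup>2\<close>. The embedding of \<open>E\<close> into \<open>H\<close> is compact, so
  \<open>\<parallel>z\<parallel>\<^sup>2 \<le> \<epsilon> \<parallel>\<nabla>z\<parallel>\<^sup>2 + C \<Sum>\<^sub>h (z, h)\<^sup>2\<close> for finitely many \<open>h \<in> E\<close>, and the numbers \<open>(z(t), h)\<close> are Hoelder
  continuous in \<open>t\<close>. Sampling them at finitely many times gives
  \<open>\<parallel>z(T)\<parallel>\<^sup>2 \<le> \<parallel>z(0)\<parallel>\<^sup>2 / 8 + C \<Sum>\<^sub>i p\<^sub>i\<^sup>2\<close> with finitely many Lipschitz functionals \<open>p\<^sub>i\<close>. A set of diameter \<open>r\<close>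
  splits into a fixed number of pieces on which every \<open>p\<^sub>i\<close> is small compared with \<open>r\<close>; the time \<open>T\<close> map
  halves their diameters, and iterating it covers the attractor by \<open>K\<^sup>n\<close> sets of diameter \<open>\<rho> / 2\<^sup>n\<close>.
\<close>

section \<open>Calculus in \<open>L\<^sup>2\<close>\<close>

text \<open>The delicate point is that a weak solution is only weakly continuous in
  \<open>H\<close>, so the energy balance of the difference z cannot be read off by differentiating
  |z|^2. It is derived as an inequality, from backward difference quotients, without ever proving
  |z|^2 continuous. One direction is enough because all later estimates are upper bounds. In a
  product difference such as u v - u' v' each term keeps one undifferenced factor, which is bounded
  in \<open>H\<close> on the attractor. Symmetry of the triple integral joins the other two factors,
  and their product is estimated in L^2 through L^4 bounds. The finitely many functionals have to
  come from \<open>E\<close> and not merely from \<open>H\<close>: only against elements of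
  \<open>E\<close> does the equation control the time increments of z. Sampling in time then
  replaces a compactness theorem for functions of time. The constants are shares of 1/4 = (1/2)^2,
  the contraction of squared diameters: 1/8 for the variation of the functionals on a piece and 1/8
  for the remainder, which consists of 1/16 from compactness in space and 1/16 from sampling in
  time.\<close>

lemma L2_eq_rep_L2: "L2_eq (rep_L2 u) (rep_L2 u)"
  by (rule Quotient3_rep_reflp[OF Quotient3_L2])

lemma square_integrable_rep_L2 [simp, intro]: "square_integrable (rep_L2 u)"
  using L2_eq_rep_L2[of u] by (simp add: L2_eq_def)

lemma rep_L2_measurable [measurable]: "rep_L2 u \<in> borel_measurable lebesgue"
  using square_integrable_rep_L2[of u] by (simp add: square_integrable_def)

lemma abs_L2_rep_L2 [simp]: "abs_L2 (rep_L2 u) = u"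
  by (rule Quotient3_abs_rep[OF Quotient3_L2])

lemma abs_L2_eq_iff:
  assumes "square_integrable f" "square_integrable g"
  shows "abs_L2 f = abs_L2 g \<longleftrightarrow> (AE x in lebesgue. f x = g x)"
  using Quotient3_rel[OF Quotient3_L2, of f g] assms by (auto simp: L2_eq_def)

lemma rep_L2_abs_L2:
  assumes "square_integrable f"
  shows "AE x in lebesgue. rep_L2 (abs_L2 f) x = f x"
  using abs_L2_eq_iff[of "rep_L2 (abs_L2 f)" f] assms by simp

lemma L2_eqI:
  assumes "AE x in lebesgue. rep_L2 u x = rep_L2 v x"
  shows "u = v"
  using abs_L2_eq_iff[of "rep_L2 u" "rep_L2 v"] assms by simp

lemma abs_L2_add:
  assumes "square_integrable f" "square_integrable g"
  shows "abs_L2 f + abs_L2 g = abs_L2 (\<lambda>x. f x + g x)"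
  by (rule plus_L2.abs_eq) (use assms in \<open>auto simp: L2_eq_def\<close>)

lemma abs_L2_diff:
  assumes "square_integrable f" "square_integrable g"
  shows "abs_L2 f - abs_L2 g = abs_L2 (\<lambda>x. f x - g x)"
  by (rule minus_L2.abs_eq) (use assms in \<open>auto simp: L2_eq_def\<close>)

lemma abs_L2_scaleR:
  assumes "square_integrable f"
  shows "c *\<^sub>R abs_L2 f = abs_L2 (\<lambda>x. c *\<^sub>R f x)"
  by (rule scaleR_L2.abs_eq) (use assms in \<open>auto simp: L2_eq_def\<close>)

lemma rep_L2_add: "AE x in lebesgue. rep_L2 (u + v) x = rep_L2 u x + rep_L2 v x"
  using rep_L2_abs_L2[OF square_integrable_add[of "rep_L2 u" "rep_L2 v"]]
    abs_L2_add[of "rep_L2 u" "rep_L2 v"] by simp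

lemma rep_L2_diff: "AE x in lebesgue. rep_L2 (u - v) x = rep_L2 u x - rep_L2 v x"
  using rep_L2_abs_L2[OF square_integrable_diff[of "rep_L2 u" "rep_L2 v"]]
    abs_L2_diff[of "rep_L2 u" "rep_L2 v"] by simp

lemma rep_L2_scaleR: "AE x in lebesgue. rep_L2 (c *\<^sub>R u) x = c *\<^sub>R rep_L2 u x"
  using rep_L2_abs_L2[OF square_integrable_scaleR[of "rep_L2 u" c]]
    abs_L2_scaleR[of "rep_L2 u" c] by simp

lemma rep_L2_zero: "AE x in lebesgue. rep_L2 0 x = 0"
  unfolding zero_L2_def by (simp add: rep_L2_abs_L2 square_integrable_zero)

lemma inner_abs_L2:
  assumes "square_integrable f" "square_integrable g"
  shows "abs_L2 f \<bullet> abs_L2 g = (LINT x|lebesgue. f x \<bullet> g x)"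
  by (rule inner_L2.abs_eq) (use assms in \<open>auto simp: L2_eq_def\<close>)

lemma norm_abs_L2:
  assumes "square_integrable f"
  shows "(norm (abs_L2 f))\<^sup>2 = (LINT x|lebesgue. (norm (f x))\<^sup>2)"
  unfolding power2_norm_eq_inner by (rule inner_abs_L2) (use assms in auto)

lemma ennreal_norm_abs_L2:
  assumes "square_integrable f"
  shows "ennreal ((norm (abs_L2 f))\<^sup>2) = (\<integral>\<^sup>+x. ennreal ((norm (f x))\<^sup>2) \<partial>lebesgue)"
  unfolding norm_abs_L2[OF assms]
  by (rule nn_integral_eq_integral[symmetric]) (use assms in \<open>auto simp: square_integrable_def\<close>)

lemma square_integrable_bound:
  assumes "square_integrable g" "f \<in> borel_measurable lebesgue"
    and "AE x in lebesgue. norm (f x) \<le> norm (g x)"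
  shows "square_integrable f"
  unfolding square_integrable_def
proof (intro conjI assms(2))
  have [measurable]: "f \<in> borel_measurable lebesgue" by fact
  show "integrable lebesgue (\<lambda>x. (norm (f x))\<^sup>2)"
  proof (rule Bochner_Integration.integrable_bound)
    show "integrable lebesgue (\<lambda>x. (norm (g x))\<^sup>2)"
      using assms(1) by (simp add: square_integrable_def)
    show "AE x in lebesgue. norm ((norm (f x))\<^sup>2) \<le> norm ((norm (g x))\<^sup>2)"
      using assms(3) by eventually_elim (simp add: power_mono)
  qed measurable
qed

lemma L2_on_iff_abs:
  assumes "square_integrable f"
  shows "abs_L2 f \<in> L2_on \<Omega> \<longleftrightarrow> (AE x in lebesgue. x \<notin> \<Omega> \<longrightarrow> f x = 0)"
proof -
  note * = rep_L2_abs_L2[OF assms]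
  show ?thesis
  proof
    assume "abs_L2 f \<in> L2_on \<Omega>"
    then have "AE x in lebesgue. x \<notin> \<Omega> \<longrightarrow> rep_L2 (abs_L2 f) x = 0" by (simp add: L2_on_def)
    with * show "AE x in lebesgue. x \<notin> \<Omega> \<longrightarrow> f x = 0" by eventually_elim simp
  next
    assume "AE x in lebesgue. x \<notin> \<Omega> \<longrightarrow> f x = 0"
    with * have "AE x in lebesgue. x \<notin> \<Omega> \<longrightarrow> rep_L2 (abs_L2 f) x = 0" by eventually_elim simp
    then show "abs_L2 f \<in> L2_on \<Omega>" by (simp add: L2_on_def)
  qed
qed

lemma L2_on_add:
  assumes "u \<in> L2_on \<Omega>" "v \<in> L2_on \<Omega>"
  shows "u + v \<in> L2_on \<Omega>"
  using assms rep_L2_add[of u v] unfolding L2_on_def mem_Collect_eq by eventually_elim auto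

lemma L2_on_scaleR:
  assumes "u \<in> L2_on \<Omega>"
  shows "c *\<^sub>R u \<in> L2_on \<Omega>"
  using assms rep_L2_scaleR[of c u] unfolding L2_on_def mem_Collect_eq by eventually_elim auto

lemma L2_on_diff:
  assumes "u \<in> L2_on \<Omega>" "v \<in> L2_on \<Omega>"
  shows "u - v \<in> L2_on \<Omega>"
  using assms rep_L2_diff[of u v] unfolding L2_on_def mem_Collect_eq by eventually_elim auto

lemma square_integrable_indicator:
  assumes "A \<in> lmeasurable"
  shows "square_integrable (indicat_real A)"
proof -
  have "(norm (indicat_real A x))\<^sup>2 = indicat_real A x" for x
    by (simp add: indicator_def)
  then show ?thesis
    using assms by (auto simp: square_integrable_def fmeasurable_def)
qed

section \<open>Smooth cutoff functions\<close>

lemma C_k_const: "C_k k (\<lambda>x. c)"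
proof (induction k arbitrary: c)
  case (Suc k)
  then show ?case
    by (auto intro!: exI[of _ "\<lambda>x v. 0"])
qed simp

lemma C_k_SucE:
  assumes "C_k (Suc k) f"
  obtains f' where "\<And>x. (f has_derivative f' x) (at x)" "\<And>v. v \<in> Basis \<Longrightarrow> C_k k (\<lambda>x. f' x v)"
  using assms unfolding C_k.simps by blast

lemma C_k_SucI:
  assumes "\<And>x. (f has_derivative f' x) (at x)" "\<And>v. v \<in> Basis \<Longrightarrow> C_k k (\<lambda>x. f' x v)"
  shows "C_k (Suc k) f"
  using assms unfolding C_k.simps by blast

text \<open>\<open>C_k (Suc k)\<close> constrains only the first derivatives, so lowering the order
  takes an induction of its own, with continuity of differentiable functions as its base.\<close>

lemma C_k_SucD: "C_k (Suc k) f \<Longrightarrow> C_k k f"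
proof (induction k arbitrary: f)
  case 0
  then obtain f' where "\<And>x. (f has_derivative f' x) (at x)"
    by (rule C_k_SucE) blast
  then show ?case
    unfolding C_k.simps by (meson continuous_at_imp_continuous_on has_derivative_continuous)
next
  case (Suc k)
  from Suc.prems obtain f' where "\<And>x. (f has_derivative f' x) (at x)"
    "\<And>v. v \<in> Basis \<Longrightarrow> C_k (Suc k) (\<lambda>x. f' x v)" by (rule C_k_SucE) blast
  with Suc.IH show ?case by (blast intro: C_k_SucI)
qed

lemma C_k_continuous: "C_k k f \<Longrightarrow> continuous_on UNIV f"
  by (induction k) (auto dest: C_k_SucD simp del: C_k.simps(2))

lemma C_k_add: "C_k k f \<Longrightarrow> C_k k g \<Longrightarrow> C_k k (\<lambda>x. f x + g x)"
proof (induction k arbitrary: f g)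
  case 0
  then show ?case by (auto intro: continuous_on_add)
next
  case (Suc k)
  obtain f' where f': "\<And>x. (f has_derivative f' x) (at x)" "\<And>v. v \<in> Basis \<Longrightarrow> C_k k (\<lambda>x. f' x v)"
    using Suc.prems(1) by (rule C_k_SucE) blast
  obtain g' where g': "\<And>x. (g has_derivative g' x) (at x)" "\<And>v. v \<in> Basis \<Longrightarrow> C_k k (\<lambda>x. g' x v)"
    using Suc.prems(2) by (rule C_k_SucE) blast
  show ?case
    by (rule C_k_SucI[of _ "\<lambda>x v. f' x v + g' x v"])
      (use f' g' Suc.IH in \<open>auto intro!: derivative_eq_intros\<close>)
qed

lemma C_k_mult: "C_k k f \<Longrightarrow> C_k k g \<Longrightarrow> C_k k (\<lambda>x. f x * g x)"
proof (induction k arbitrary: f g)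
  case 0
  then show ?case by (auto intro: continuous_on_mult)
next
  case (Suc k)
  obtain f' where f': "\<And>x. (f has_derivative f' x) (at x)" "\<And>v. v \<in> Basis \<Longrightarrow> C_k k (\<lambda>x. f' x v)"
    using Suc.prems(1) by (rule C_k_SucE) blast
  obtain g' where g': "\<And>x. (g has_derivative g' x) (at x)" "\<And>v. v \<in> Basis \<Longrightarrow> C_k k (\<lambda>x. g' x v)"
    using Suc.prems(2) by (rule C_k_SucE) blast
  \<comment> \<open>The product rule keeps one factor undifferentiated, so both factors must also be
    known at the lower order.\<close>
  have fg: "C_k k f" "C_k k g" using Suc.prems C_k_SucD by blast+
  show ?case
    by (rule C_k_SucI[of _ "\<lambda>x v. f x * g' x v + f' x v * g x"])
      (use f' g' fg in \<open>auto intro!: derivative_eq_intros C_k_add Suc.IH\<close>)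
qed

lemma C_k_uminus: "C_k k f \<Longrightarrow> C_k k (\<lambda>x. - f x)"
  using C_k_mult[OF C_k_const[of k "-1"], of f] by simp

lemma C_k_diff: "C_k k f \<Longrightarrow> C_k k g \<Longrightarrow> C_k k (\<lambda>x. f x - g x)"
  using C_k_add[of k f "\<lambda>x. - g x"] C_k_uminus[of k g] by simp

lemma C_k_inverse: "(\<And>x. f x \<noteq> 0) \<Longrightarrow> C_k k f \<Longrightarrow> C_k k (\<lambda>x. inverse (f x))"
proof (induction k arbitrary: f)
  case 0
  then show ?case by (auto intro: continuous_on_inverse)
next
  case (Suc k)
  obtain f' where f': "\<And>x. (f has_derivative f' x) (at x)" "\<And>v. v \<in> Basis \<Longrightarrow> C_k k (\<lambda>x. f' x v)"
    using Suc.prems(2) by (rule C_k_SucE) blast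
  have inv: "C_k k (\<lambda>x. inverse (f x))" using Suc C_k_SucD by blast
  show ?case
  proof (rule C_k_SucI)
    show "((\<lambda>x. inverse (f x)) has_derivative (\<lambda>v. - (inverse (f x) * f' x v * inverse (f x)))) (at x)" for x
      by (rule Deriv.has_derivative_inverse) (use Suc.prems f' in auto)
    show "C_k k (\<lambda>x. - (inverse (f x) * f' x v * inverse (f x)))" if "v \<in> Basis" for v
      by (intro C_k_uminus C_k_mult inv f' that)
  qed
qed

lemma C_k_prod: "(\<And>i. i \<in> I \<Longrightarrow> C_k k (f i)) \<Longrightarrow> C_k k (\<lambda>x. \<Prod>i\<in>I. f i x)"
  by (induction I rule: infinite_finite_induct) (auto intro: C_k_const C_k_mult)

text \<open>The derivative of an affine inner map is constant. Differentiation therefore yields a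
  scalar multiple of the outer derivative composed with the same map, and the induction closes
  without a chain rule of higher order.\<close>

lemma C_k_compose_affine:
  fixes h :: "real \<Rightarrow> real" and l :: "'a::euclidean_space \<Rightarrow> real"
  assumes "bounded_linear l"
  shows "C_k k h \<Longrightarrow> C_k k (\<lambda>x. h (l x + c))"
proof (induction k arbitrary: h)
  case 0
  then show ?case
    by (auto intro!: continuous_on_compose2[of UNIV h] continuous_intros
        bounded_linear.continuous_on[OF assms])
next
  case (Suc k)
  obtain h' where h': "\<And>x. (h has_derivative h' x) (at x)" "\<And>v. v \<in> Basis \<Longrightarrow> C_k k (\<lambda>x. h' x v)"
    using Suc.prems by (rule C_k_SucE) blast
  have sc: "h' y (l v) = l v * h' y 1" for y v
    using linear_scale[OF has_derivative_linear[OF h'(1)[of y]], of "l v" 1] by simp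
  show ?case
  proof (rule C_k_SucI)
    show "((\<lambda>x. h (l x + c)) has_derivative (\<lambda>v. h' (l x + c) (l v))) (at x)" for x
      by (rule has_derivative_compose[of "\<lambda>x. l x + c" l x UNIV h "h' (l x + c)"])
        (auto intro!: derivative_eq_intros bounded_linear.has_derivative[OF assms] h')
    show "C_k k (\<lambda>x. h' (l x + c) (l v))" if "v \<in> Basis" for v
      unfolding sc by (intro C_k_mult C_k_const Suc.IH h'(2)) simp
  qed
qed

section \<open>A smooth transition function built from exp(-1/x)\<close>

definition flat_exp :: "nat \<Rightarrow> real \<Rightarrow> real" where
  "flat_exp m x = (if x > 0 then inverse x ^ m * exp (- inverse x) else 0)"

lemma flat_exp_tendsto_0: "(flat_exp m \<longlongrightarrow> 0) (at 0)"
proof -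
  have "((\<lambda>x::real. inverse x ^ m / exp (inverse x)) \<longlongrightarrow> 0) (at_right 0)"
    by (rule filterlim_compose[OF tendsto_power_div_exp_0 filterlim_inverse_at_top_right])
  then have "(flat_exp m \<longlongrightarrow> 0) (at_right 0)"
    by (rule Lim_transform_eventually)
      (auto simp: eventually_at_filter flat_exp_def exp_minus field_simps)
  moreover have "(flat_exp m \<longlongrightarrow> 0) (at_left 0)"
    by (rule Lim_transform_eventually[OF tendsto_const])
      (auto simp: eventually_at_filter flat_exp_def)
  ultimately show ?thesis by (simp add: filterlim_at_split)
qed

text \<open>The exponent m makes the family closed under differentiation: the derivative of x^(-m)
  exp(-1/x) is a combination of two other members. Smoothness of all members then follows by a
  single induction.\<close>

lemma flat_exp_deriv:
  "(flat_exp m has_real_derivative (flat_exp (m + 2) x - real m * flat_exp (m + 1) x)) (at x)"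
proof -
  consider "x > 0" | "x < 0" | "x = 0" by linarith
  then show ?thesis
  proof cases
    case 1
    have "((\<lambda>x. inverse x ^ m * exp (- inverse x)) has_real_derivative
        (flat_exp (m + 2) x - real m * flat_exp (m + 1) x)) (at x)"
    proof (cases m)
      case 0
      with 1 show ?thesis
        by (auto intro!: derivative_eq_intros simp: flat_exp_def field_simps power2_eq_square)
    next
      case (Suc k)
      have "((\<lambda>x. inverse x ^ m * exp (- inverse x)) has_real_derivative
        (real m * (- (inverse x * 1 * inverse x) * inverse x ^ k) * exp (- inverse x)
          + exp (- inverse x) * (inverse x * 1 * inverse x) * inverse x ^ m)) (at x)"
        unfolding Suc by (intro derivative_eq_intros refl) (use 1 in auto)
      then show ?thesis
        using 1 Suc by (simp add: flat_exp_def algebra_simps)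
    qed
    then show ?thesis
      by (rule has_field_derivative_transform_within_open[of _ _ _ "{0<..}"])
        (use 1 in \<open>auto simp: flat_exp_def\<close>)
  next
    case 2
    have "((\<lambda>x. 0) has_real_derivative 0) (at x)" by simp
    then have "(flat_exp m has_real_derivative 0) (at x)"
      by (rule has_field_derivative_transform_within_open[of _ _ _ "{..<0}"])
        (use 2 in \<open>auto simp: flat_exp_def\<close>)
    then show ?thesis using 2 by (simp add: flat_exp_def)
  next
    case 3
    \<comment> \<open>At 0 the difference quotient of \<open>flat_exp m\<close> is
      \<open>flat_exp (Suc m)\<close>, which tends to 0.\<close>
    have "((\<lambda>y. (flat_exp m y - flat_exp m 0) / (y - 0)) \<longlongrightarrow> 0) (at 0)"
      by (rule Lim_transform_eventually[OF flat_exp_tendsto_0[of "Suc m"]])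
        (auto simp: eventually_at_filter flat_exp_def field_simps)
    then show ?thesis
      unfolding 3 by (simp add: has_field_derivative_iff flat_exp_def)
  qed
qed

lemma C_k_flat_exp: "C_k k (flat_exp m)"
proof (induction k arbitrary: m)
  case 0
  show ?case
    using flat_exp_deriv DERIV_isCont continuous_at_imp_continuous_on by (auto simp: )  blast
next
  case (Suc k)
  have "C_k k (\<lambda>x. (flat_exp (m + 2) x - real m * flat_exp (m + 1) x) * v)" for v
    by (intro C_k_mult C_k_diff C_k_const Suc)
  then show ?case
    by (intro C_k_SucI[OF flat_exp_deriv[of m, THEN has_field_derivative_imp_has_derivative]])
qed

text \<open>The first summand of the denominator vanishes only for x \<le> 0 and the second only for
  x \<ge> 1, so the quotient is smooth, with value 0 left of 0 and value 1 right of 1.\<close>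

definition smooth_step :: "real \<Rightarrow> real" where
  "smooth_step x = flat_exp 0 x * inverse (flat_exp 0 x + flat_exp 0 (1 - x))"

lemma flat_exp_nonneg: "flat_exp m x \<ge> 0"
  by (simp add: flat_exp_def)

lemma smooth_step_denominator_pos: "flat_exp 0 x + flat_exp 0 (1 - x) > 0"
  by (auto simp: flat_exp_def add_pos_pos)

lemma C_k_smooth_step: "C_k k smooth_step"
proof -
  have "C_k k (\<lambda>x. flat_exp 0 (- x + 1))"
    by (rule C_k_compose_affine) (auto intro: bounded_linear_minus bounded_linear_ident C_k_flat_exp)
  then have "C_k k (\<lambda>x. flat_exp 0 (1 - x))" by simp
  then show ?thesis
    unfolding smooth_step_def
    by (intro C_k_mult C_k_inverse C_k_add C_k_flat_exp) (metis less_irrefl smooth_step_denominator_pos)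
qed

lemma smooth_step_eq_0: "x \<le> 0 \<Longrightarrow> smooth_step x = 0"
  by (simp add: smooth_step_def flat_exp_def)

lemma smooth_step_eq_1: "x \<ge> 1 \<Longrightarrow> smooth_step x = 1"
  by (simp add: smooth_step_def flat_exp_def)

lemma smooth_step_nonneg: "0 \<le> smooth_step x"
  by (simp add: smooth_step_def flat_exp_nonneg)

lemma smooth_step_le_1: "smooth_step x \<le> 1"
  using smooth_step_denominator_pos[of x] flat_exp_nonneg[of 0 "1 - x"]
  by (simp add: smooth_step_def field_simps)

section \<open>Cutoff functions of boxes\<close>

definition box_cutoff :: "'a::euclidean_space \<Rightarrow> 'a \<Rightarrow> real \<Rightarrow> 'a \<Rightarrow> real" where
  "box_cutoff a b \<delta> x = (\<Prod>i\<in>Basis.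
     smooth_step ((x \<bullet> i - a \<bullet> i) / \<delta>) * smooth_step ((b \<bullet> i - x \<bullet> i) / \<delta>))"

lemma box_cutoff_nonneg: "0 \<le> box_cutoff a b \<delta> x"
  by (auto simp: box_cutoff_def smooth_step_nonneg intro!: prod_nonneg)

lemma box_cutoff_le_1: "box_cutoff a b \<delta> x \<le> 1"
  unfolding box_cutoff_def
  by (rule prod_le_1) (auto simp: smooth_step_nonneg smooth_step_le_1 intro!: mult_le_one)

lemma box_cutoff_eq_0: "\<delta> > 0 \<Longrightarrow> x \<notin> box a b \<Longrightarrow> box_cutoff a b \<delta> x = 0"
  unfolding box_cutoff_def
  by (auto simp: mem_box not_less intro!: smooth_step_eq_0 divide_nonpos_pos)

text \<open>A point of the open box has a positive distance from all faces, and once \<delta> falls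
  below it the cutoff is exactly 1 there; outside the open box it is always 0. Indicators of boxes
  thus become pointwise limits of test functions.\<close>

lemma box_cutoff_tendsto:
  "((\<lambda>\<delta>. box_cutoff a b \<delta> x) \<longlongrightarrow> indicator (box a b) x) (at_right 0)"
proof (cases "x \<in> box a b")
  case True
  define d where "d = Min ((\<lambda>i. min (x \<bullet> i - a \<bullet> i) (b \<bullet> i - x \<bullet> i)) ` Basis)"
  have "d > 0" using True unfolding d_def by (auto simp: mem_box)
  have "box_cutoff a b \<delta> x = 1" if "0 < \<delta>" "\<delta> < d" for \<delta>
  proof -
    have "\<delta> \<le> x \<bullet> i - a \<bullet> i \<and> \<delta> \<le> b \<bullet> i - x \<bullet> i" if "i \<in> Basis" for i
      using \<open>\<delta> < d\<close> that unfolding d_def by auto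
    then show ?thesis
      unfolding box_cutoff_def using \<open>0 < \<delta>\<close> by (intro prod.neutral) (auto simp: smooth_step_eq_1)
  qed
  then have "\<forall>\<^sub>F \<delta> in at_right 0. box_cutoff a b \<delta> x = 1"
    using \<open>d > 0\<close> by (auto simp: eventually_at_right_field)
  then show ?thesis using True by (simp add: tendsto_eventually)
next
  case False
  then have "\<forall>\<^sub>F \<delta> in at_right 0. box_cutoff a b \<delta> x = 0"
    by (auto simp: eventually_at_right_field box_cutoff_eq_0 intro: exI[of _ 1])
  then show ?thesis using False by (simp add: tendsto_eventually)
qed

lemma C_k_box_cutoff: "C_k k (box_cutoff a b \<delta>)"
proof -
  have *: "C_k k (\<lambda>x. smooth_step (c * (x \<bullet> i) + e))" for c e and i :: 'a
    by (rule C_k_compose_affine)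
      (auto intro: bounded_linear_intros C_k_smooth_step)
  have "C_k k (\<lambda>x. smooth_step ((x \<bullet> i - a \<bullet> i) / \<delta>))" "C_k k (\<lambda>x. smooth_step ((b \<bullet> i - x \<bullet> i) / \<delta>))" for i
    using *[of "1/\<delta>" i "- (a \<bullet> i) / \<delta>"] *[of "-1/\<delta>" i "b \<bullet> i / \<delta>"]
    by (simp_all add: diff_divide_distrib add.commute)
  then show ?thesis
    unfolding box_cutoff_def by (intro C_k_prod C_k_mult)
qed

lemma test_function_box_cutoff:
  assumes "\<delta> > 0" "cbox a b \<subseteq> \<Omega>"
  shows "test_function \<Omega> (box_cutoff a b \<delta>)"
proof -
  have "support_on UNIV (box_cutoff a b \<delta>) \<subseteq> cbox a b"
    using box_cutoff_eq_0[OF assms(1)] box_subset_cbox[of a b] by (auto simp: support_on_def)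
  then have "closure (support_on UNIV (box_cutoff a b \<delta>)) \<subseteq> cbox a b"
    by (rule closure_minimal[OF _ closed_cbox])
  moreover from this have "compact (closure (support_on UNIV (box_cutoff a b \<delta>)))"
    by (meson bounded_cbox bounded_subset closed_closure compact_eq_bounded_closed)
  ultimately show ?thesis
    using assms by (auto simp: test_function_def C_k_box_cutoff)
qed

section \<open>Test functions and weak gradients\<close>

definition grad :: "('a::euclidean_space \<Rightarrow> real) \<Rightarrow> 'a \<Rightarrow> 'a" where
  "grad \<eta> x = (\<Sum>e\<in>Basis. frechet_derivative \<eta> (at x) e *\<^sub>R e)"

lemma test_function_has_derivative:
  assumes "test_function \<Omega> \<eta>"
  shows "(\<eta> has_derivative frechet_derivative \<eta> (at x)) (at x)"
proof -
  have "C_k (Suc 0) \<eta>" using assms unfolding test_function_def by blast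
  then obtain f' where "\<And>x. (\<eta> has_derivative f' x) (at x)"
    by (rule C_k_SucE) blast
  then have "\<eta> differentiable (at x)" by (auto simp: differentiable_def)
  then show ?thesis by (simp add: frechet_derivative_works)
qed

lemma test_function_has_derivative_grad:
  assumes "test_function \<Omega> \<eta>"
  shows "(\<eta> has_derivative (\<lambda>v. grad \<eta> x \<bullet> v)) (at x)"
proof -
  note d = test_function_has_derivative[OF assms, of x]
  interpret bounded_linear "frechet_derivative \<eta> (at x)" using d by (rule has_derivative_bounded_linear)
  have "frechet_derivative \<eta> (at x) v = grad \<eta> x \<bullet> v" for v
  proof -
    have "frechet_derivative \<eta> (at x) v = frechet_derivative \<eta> (at x) (\<Sum>e\<in>Basis. (v \<bullet> e) *\<^sub>R e)"
      by (simp add: euclidean_representation)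
    also have "\<dots> = (\<Sum>e\<in>Basis. (v \<bullet> e) * frechet_derivative \<eta> (at x) e)"
      by (simp add: sum scaleR)
    also have "\<dots> = grad \<eta> x \<bullet> v"
      by (simp add: grad_def inner_sum_left inner_commute[of v] mult.commute)
    finally show ?thesis .
  qed
  then show ?thesis using d by presburger
qed

lemma test_function_continuous: "test_function \<Omega> \<eta> \<Longrightarrow> continuous_on UNIV \<eta>"
  unfolding test_function_def using C_k_continuous by blast

lemma frechet_derivative_eq_0_off_closed:
  assumes "closed K" "x \<notin> K" "\<And>y. y \<notin> K \<Longrightarrow> \<eta> y = (0::real)"
  shows "frechet_derivative \<eta> (at x) = (\<lambda>v. 0)"
proof -
  have "((\<lambda>x. 0) has_derivative (\<lambda>v. 0)) (at x)" by simp
  then have "(\<eta> has_derivative (\<lambda>v. 0)) (at x)"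
    by (rule has_derivative_transform_within_open[of _ _ _ _ "- K"])
      (use assms in \<open>auto simp: open_closed\<close>)
  then show ?thesis using frechet_derivative_at by metis
qed

lemma test_function_support:
  assumes "test_function \<Omega> \<eta>"
  obtains K where "compact K" "K \<subseteq> \<Omega>" "\<And>x. x \<notin> K \<Longrightarrow> \<eta> x = 0"
    "\<And>x. x \<notin> K \<Longrightarrow> frechet_derivative \<eta> (at x) = (\<lambda>v. 0)"
proof
  let ?K = "closure (support_on UNIV \<eta>)"
  show "compact ?K" "?K \<subseteq> \<Omega>" using assms by (auto simp: test_function_def)
  show 0: "\<eta> x = 0" if "x \<notin> ?K" for x
    using that closure_subset[of "support_on UNIV \<eta>"] by (auto simp: support_on_def)
  show "frechet_derivative \<eta> (at x) = (\<lambda>v. 0)" if "x \<notin> ?K" for x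
    by (rule frechet_derivative_eq_0_off_closed[OF closed_closure that 0])
qed

lemma test_functionI:
  assumes "\<And>k. C_k k \<eta>" "compact K" "K \<subseteq> \<Omega>" "\<And>x. x \<notin> K \<Longrightarrow> \<eta> x = 0"
  shows "test_function \<Omega> \<eta>"
proof -
  have "support_on UNIV \<eta> \<subseteq> K" using assms(4) by (auto simp: support_on_def)
  then have *: "closure (support_on UNIV \<eta>) \<subseteq> K"
    by (rule closure_minimal) (use assms(2) in \<open>simp add: compact_imp_closed\<close>)
  then have "compact (closure (support_on UNIV \<eta>))"
    using assms(2) by (meson bounded_subset closed_closure compact_eq_bounded_closed)
  with * show ?thesis using assms by (auto simp: test_function_def)
qed

lemma test_function_deriv:
  assumes "test_function \<Omega> \<eta>" "e \<in> Basis"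
  shows "test_function \<Omega> (\<lambda>x. frechet_derivative \<eta> (at x) e)"
proof -
  obtain K where K: "compact K" "K \<subseteq> \<Omega>" "\<And>x. x \<notin> K \<Longrightarrow> \<eta> x = 0"
    "\<And>x. x \<notin> K \<Longrightarrow> frechet_derivative \<eta> (at x) = (\<lambda>v. 0)"
    using assms(1) by (rule test_function_support) blast
  have "C_k k (\<lambda>x. frechet_derivative \<eta> (at x) e)" for k
  proof -
    have "C_k (Suc k) \<eta>" using assms unfolding test_function_def by blast
    then obtain f' where f': "\<And>x. (\<eta> has_derivative f' x) (at x)"
      "\<And>v. v \<in> Basis \<Longrightarrow> C_k k (\<lambda>x. f' x v)" by (rule C_k_SucE) blast
    \<comment> \<open>The derivative furnished by \<open>C_k\<close> might depend on k; uniqueness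
      of derivatives identifies it with one function for all orders.\<close>
    have "frechet_derivative \<eta> (at x) = f' x" for x
      using frechet_derivative_at[OF f'(1)] by metis
    with f'(2)[OF assms(2)] show ?thesis by simp
  qed
  then show ?thesis by (rule test_functionI[OF _ K(1,2)]) (simp add: K(4))
qed

lemma test_function_add:
  assumes "test_function \<Omega> \<eta>" "test_function \<Omega> \<theta>"
  shows "test_function \<Omega> (\<lambda>x. \<eta> x + \<theta> x)"
proof -
  obtain K where K: "compact K" "K \<subseteq> \<Omega>" "\<And>x. x \<notin> K \<Longrightarrow> \<eta> x = 0"
    using assms(1) by (rule test_function_support) blast
  obtain L where L: "compact L" "L \<subseteq> \<Omega>" "\<And>x. x \<notin> L \<Longrightarrow> \<theta> x = 0"
    using assms(2) by (rule test_function_support) blast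
  show ?thesis
    by (rule test_functionI[of _ "K \<union> L"])
      (use K L assms in \<open>auto simp: test_function_def intro: C_k_add\<close>)
qed

lemma test_function_mult:
  assumes "test_function \<Omega> \<eta>" "test_function \<Omega> \<theta>"
  shows "test_function \<Omega> (\<lambda>x. \<eta> x * \<theta> x)"
proof -
  obtain K where K: "compact K" "K \<subseteq> \<Omega>" "\<And>x. x \<notin> K \<Longrightarrow> \<eta> x = 0"
    using assms(1) by (rule test_function_support) blast
  show ?thesis
    by (rule test_functionI[of _ K])
      (use K assms in \<open>auto simp: test_function_def intro: C_k_mult\<close>)
qed

lemma test_function_scale:
  assumes "test_function \<Omega> \<eta>"
  shows "test_function \<Omega> (\<lambda>x. c * \<eta> x)"
proof -
  obtain K where K: "compact K" "K \<subseteq> \<Omega>" "\<And>x. x \<notin> K \<Longrightarrow> \<eta> x = 0"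
    using assms(1) by (rule test_function_support) blast
  show ?thesis
    by (rule test_functionI[of _ K])
      (use K assms in \<open>auto simp: test_function_def intro: C_k_mult C_k_const\<close>)
qed

lemma test_function_bounded:
  assumes "test_function \<Omega> \<eta>"
  obtains C where "C \<ge> 0" "\<And>x. \<bar>\<eta> x\<bar> \<le> C"
proof -
  obtain K where K: "compact K" "\<And>x. x \<notin> K \<Longrightarrow> \<eta> x = 0"
    using assms(1) by (rule test_function_support) blast
  have "compact (\<eta> ` K)"
    using K(1) test_function_continuous[OF assms] by (meson compact_continuous_image continuous_on_subset top_greatest)
  then obtain C where C: "\<And>x. x \<in> K \<Longrightarrow> norm (\<eta> x) \<le> C"
    using compact_imp_bounded[of "\<eta> ` K"] by (auto simp: bounded_iff)
  show ?thesis
    by (rule that[of "max C 0"]) (use C K(2) in \<open>fastforce simp: le_max_iff_disj\<close>)+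
qed

lemma integrable_mult_test_function:
  assumes q: "locally_integrable \<Omega> q" and \<eta>: "test_function \<Omega> \<eta>"
  shows "integrable lebesgue (\<lambda>x. q x * \<eta> x)"
proof -
  obtain K where K: "compact K" "K \<subseteq> \<Omega>" "\<And>x. x \<notin> K \<Longrightarrow> \<eta> x = 0"
    using \<eta> by (rule test_function_support) blast
  obtain C where C: "C \<ge> 0" "\<And>x. \<bar>\<eta> x\<bar> \<le> C" using \<eta> by (rule test_function_bounded) blast
  have int: "integrable lebesgue (\<lambda>x. indicator K x *\<^sub>R q x)"
    using q K by (auto simp: locally_integrable_def set_integrable_def)
  \<comment> \<open>Local integrability says nothing near the boundary of \<Omega>; the factor
    \<eta> allows the indicator of its compact support to be inserted.\<close>
  have eq: "q x * \<eta> x = (indicator K x *\<^sub>R q x) * \<eta> x" for x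
    using K(3) by (auto simp: indicator_def)
  show ?thesis
  proof (rule Bochner_Integration.integrable_bound)
    show "integrable lebesgue (\<lambda>x. C * (indicator K x *\<^sub>R q x))"
      using int by simp
    have [measurable]: "\<eta> \<in> borel_measurable lebesgue"
      by (rule measurable_completion) (simp add: borel_measurable_continuous_onI test_function_continuous[OF \<eta>])
    have [measurable]: "(\<lambda>x. indicator K x *\<^sub>R q x) \<in> borel_measurable lebesgue"
      using int by (rule borel_measurable_integrable)
    show "(\<lambda>x. q x * \<eta> x) \<in> borel_measurable lebesgue"
      unfolding eq by measurable
    show "AE x in lebesgue. norm (q x * \<eta> x) \<le> norm (C * (indicator K x *\<^sub>R q x))"
      unfolding eq using C
      by (auto simp: abs_mult mult.commute intro!: AE_I2 mult_right_mono)
  qed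
qed

lemma set_integral_mult_test_function:
  assumes "test_function \<Omega> \<eta>"
  shows "(LINT x:\<Omega>|lebesgue. q x * \<eta> x) = (LINT x|lebesgue. q x * \<eta> x)"
proof -
  obtain K where K: "K \<subseteq> \<Omega>" "\<And>x. x \<notin> K \<Longrightarrow> \<eta> x = 0"
    using assms by (rule test_function_support) blast
  have "indicator \<Omega> x *\<^sub>R (q x * \<eta> x) = q x * \<eta> x" for x
    using K by (auto simp: indicator_def)
  then show ?thesis unfolding set_lebesgue_integral_def by presburger
qed

lemma continuous_measurable_lebesgue:
  "continuous_on UNIV f \<Longrightarrow> f \<in> borel_measurable lebesgue"
  by (rule measurable_completion) (simp add: borel_measurable_continuous_onI)

lemma square_integrable_test_function:
  assumes "test_function \<Omega> \<eta>"
  shows "square_integrable \<eta>"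
proof -
  obtain K where K: "compact K" "K \<subseteq> \<Omega>" "\<And>x. x \<notin> K \<Longrightarrow> \<eta> x = 0"
    using assms by (rule test_function_support) blast
  obtain C where C: "C \<ge> 0" "\<And>x. \<bar>\<eta> x\<bar> \<le> C" using assms by (rule test_function_bounded) blast
  show ?thesis
  proof (rule square_integrable_bound)
    show "square_integrable (\<lambda>x. C *\<^sub>R indicat_real K x)"
      using K(1) by (intro square_integrable_scaleR square_integrable_indicator lmeasurable_compact)
    show "\<eta> \<in> borel_measurable lebesgue"
      using assms by (intro continuous_measurable_lebesgue test_function_continuous)
    show "AE x in lebesgue. norm (\<eta> x) \<le> norm (C *\<^sub>R indicat_real K x)"
      using K(3) C by (intro AE_I2) (auto simp: indicator_def)
  qed
qed

lemma test_function_in_L2_on: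
  assumes "test_function \<Omega> \<eta>"
  shows "abs_L2 \<eta> \<in> L2_on \<Omega>"
proof -
  obtain K where K: "K \<subseteq> \<Omega>" "\<And>x. x \<notin> K \<Longrightarrow> \<eta> x = 0"
    using assms by (rule test_function_support) blast
  show ?thesis
    unfolding L2_on_iff_abs[OF square_integrable_test_function[OF assms]]
    using K by (auto intro!: AE_I2)
qed

lemma locally_integrable_square_integrable:
  fixes f :: "'a::euclidean_space \<Rightarrow> real"
  assumes "square_integrable f"
  shows "locally_integrable \<Omega> f"
  unfolding locally_integrable_def
proof (intro allI impI)
  fix K :: "'a set" assume "compact K \<and> K \<subseteq> \<Omega>"
  then have "square_integrable (indicat_real K)"
    by (intro square_integrable_indicator) (simp add: lmeasurable_compact)
  from square_integrable_inner[OF this assms] show "set_integrable lebesgue K f"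
    by (simp add: set_integrable_def)
qed

lemma square_integrable_scaleR_vec:
  assumes "square_integrable (f::'a::euclidean_space \<Rightarrow> real)"
  shows "square_integrable (\<lambda>x. f x *\<^sub>R (e::'b::euclidean_space))"
proof -
  have [measurable]: "f \<in> borel_measurable lebesgue" using assms by (simp add: square_integrable_def)
  show ?thesis using assms
    by (auto simp: square_integrable_def power_mult_distrib)
qed

lemma square_integrable_component:
  assumes "square_integrable (f::'a::euclidean_space \<Rightarrow> 'b::euclidean_space)"
  shows "square_integrable (\<lambda>x. f x \<bullet> e)"
proof -
  have [measurable]: "f \<in> borel_measurable lebesgue" using assms by (simp add: square_integrable_def)
  show ?thesis
    by (rule square_integrable_bound[OF square_integrable_scaleR[OF assms, of "norm e"]])
      (auto simp: mult.commute[of "norm e"] intro!: AE_I2 Cauchy_Schwarz_ineq2)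
qed

text \<open>Expressing the integrals over \<Omega> as inner products of L^2 makes linearity in u and
  \<psi> immediate and frees later arguments from integrability conditions.\<close>

lemma is_weak_gradient_iff:
  "is_weak_gradient \<Omega> u \<psi> \<longleftrightarrow> \<psi> \<in> L2_on \<Omega> \<and>
     (\<forall>e\<in>Basis. \<forall>\<eta>. test_function \<Omega> \<eta> \<longrightarrow>
        u \<bullet> abs_L2 (\<lambda>x. frechet_derivative \<eta> (at x) e) = - (\<psi> \<bullet> abs_L2 (\<lambda>x. \<eta> x *\<^sub>R e)))"
proof -
  have loc: "locally_integrable \<Omega> (rep_L2 u)" "locally_integrable \<Omega> (\<lambda>x. rep_L2 \<psi> x \<bullet> e)" for e
    by (intro locally_integrable_square_integrable square_integrable_component square_integrable_rep_L2)+
  have 1: "u \<bullet> abs_L2 (\<lambda>x. frechet_derivative \<eta> (at x) e)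
      = (LINT x:\<Omega>|lebesgue. rep_L2 u x * frechet_derivative \<eta> (at x) e)"
    if "e \<in> Basis" "test_function \<Omega> \<eta>" for e \<eta>
    using inner_abs_L2[of "rep_L2 u" "\<lambda>x. frechet_derivative \<eta> (at x) e"]
    by (simp add: set_integral_mult_test_function test_function_deriv that square_integrable_test_function[OF test_function_deriv[OF that(2,1)]])
  have 2: "\<psi> \<bullet> abs_L2 (\<lambda>x. \<eta> x *\<^sub>R e) = (LINT x:\<Omega>|lebesgue. (rep_L2 \<psi> x \<bullet> e) * \<eta> x)"
    if "e \<in> Basis" "test_function \<Omega> \<eta>" for e \<eta>
    unfolding set_integral_mult_test_function[OF that(2)]
    using inner_abs_L2[of "rep_L2 \<psi>" "\<lambda>x. \<eta> x *\<^sub>R e"]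
    by (simp add: square_integrable_scaleR_vec
        square_integrable_test_function[OF that(2)] mult.commute)
  show ?thesis
    unfolding is_weak_gradient_def has_weak_derivative_on_def using loc 1 2 by auto
qed

text \<open>Smooth cutoffs show that the integrals of q over boxes vanish, and averages over
  shrinking cubes recover q almost everywhere. A countable cover of \<Omega> by closed boxes
  finishes the argument.\<close>

lemma fundamental_lemma:
  fixes q :: "'a::euclidean_space \<Rightarrow> real"
  assumes \<Omega>: "open \<Omega>" and q: "locally_integrable \<Omega> q"
    and zero: "\<And>\<eta>. test_function \<Omega> \<eta> \<Longrightarrow> (LINT x:\<Omega>|lebesgue. q x * \<eta> x) = 0"
  shows "AE x in lebesgue. x \<in> \<Omega> \<longrightarrow> q x = 0"
proof -
  have box0: "integral (cbox a b) q = 0" if ab: "cbox a b \<subseteq> \<Omega>" for a b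
  proof -
    have int: "set_integrable lebesgue (cbox a b) q"
      using q ab by (auto simp: locally_integrable_def)
    define \<delta> where "\<delta> k = inverse (real (Suc k))" for k
    have \<delta>: "filterlim \<delta> (at_right 0) sequentially"
      unfolding \<delta>_def filterlim_at using LIMSEQ_inverse_real_of_nat
      by (auto simp: eventually_sequentially)
    have cut: "(LINT x|lebesgue. q x * box_cutoff a b (\<delta> k) x) = 0" for k
      using zero[OF test_function_box_cutoff[OF _ ab, of "\<delta> k"]]
        set_integral_mult_test_function[OF test_function_box_cutoff[OF _ ab, of "\<delta> k"], of q]
      by (simp add: \<delta>_def)
    \<comment> \<open>The cutoffs converge to the indicator of the open box, and |q| on the closed
      box is an integrable majorant.\<close>
    have "(\<lambda>k. LINT x|lebesgue. q x * box_cutoff a b (\<delta> k) x)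
        \<longlonglongrightarrow> (LINT x|lebesgue. q x * indicator (box a b) x)"
    proof (rule integral_dominated_convergence)
      have int2: "set_integrable lebesgue (box a b) q"
        by (rule set_integrable_subset[OF int]) (auto simp: box_subset_cbox)
      then show "(\<lambda>x. q x * indicator (box a b) x) \<in> borel_measurable lebesgue"
        by (auto simp: set_integrable_def mult.commute dest: borel_measurable_integrable)
      show "(\<lambda>x. q x * box_cutoff a b (\<delta> k) x) \<in> borel_measurable lebesgue" for k
        by (rule borel_measurable_integrable[OF integrable_mult_test_function[OF q test_function_box_cutoff[OF _ ab]]])
          (simp add: \<delta>_def)
      show "integrable lebesgue (\<lambda>x. \<bar>indicator (cbox a b) x *\<^sub>R q x\<bar>)"
        using int unfolding set_integrable_def by (rule integrable_abs)
      show "AE x in lebesgue. (\<lambda>k. q x * box_cutoff a b (\<delta> k) x) \<longlonglongrightarrow> q x * indicator (box a b) x"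
        by (intro AE_I2 tendsto_intros filterlim_compose[OF box_cutoff_tendsto \<delta>])
      have "\<bar>box_cutoff a b (\<delta> k) x\<bar> \<le> indicator (cbox a b) x" for x k
        using box_cutoff_nonneg[of a b "\<delta> k" x] box_cutoff_le_1[of a b "\<delta> k" x]
          box_cutoff_eq_0[of "\<delta> k" x a b] box_subset_cbox[of a b]
        by (auto simp: indicator_def \<delta>_def)
      then show "AE x in lebesgue. norm (q x * box_cutoff a b (\<delta> k) x) \<le> \<bar>indicator (cbox a b) x *\<^sub>R q x\<bar>" for k
        by (intro AE_I2) (simp add: abs_mult mult.commute mult_left_mono)
    qed
    then have "(LINT x|lebesgue. q x * indicator (box a b) x) = 0"
      unfolding cut by (simp add: LIMSEQ_const_iff)
    moreover have "set_integrable lebesgue (box a b) q"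
      by (rule set_integrable_subset[OF int]) (auto simp: box_subset_cbox)
    ultimately have "integral (box a b) q = 0"
      using set_lebesgue_integral_eq_integral(2)[of "box a b" q]
      by (simp add: set_lebesgue_integral_def mult.commute)
    then show ?thesis by (simp add: integral_open_interval)
  qed
  have local: "AE x in lebesgue. x \<in> cbox c d \<longrightarrow> q x = 0" if cd: "cbox c d \<subseteq> \<Omega>" for c d
  proof -
    \<comment> \<open>Differentiation of integrals is applied to a function integrable on every box,
      so q is replaced by 0 outside one closed box contained in \<Omega>.\<close>
    define qK where "qK x = (if x \<in> cbox c d then q x else 0)" for x
    have "q integrable_on cbox c d"
      using q cd by (intro set_lebesgue_integral_eq_integral(1)) (auto simp: locally_integrable_def)
    then have "qK integrable_on UNIV" unfolding qK_def by (simp add: integrable_restrict_UNIV)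
    then have "qK integrable_on cbox a b" for a b
      by (rule integrable_on_subcbox) auto
    then obtain N where N: "negligible N"
      "\<And>x e. \<lbrakk>x \<notin> N; 0 < e\<rbrakk> \<Longrightarrow> \<exists>d>0. \<forall>h. 0 < h \<and> h < d \<longrightarrow>
         norm (integral (cbox x (x + h *\<^sub>R One)) qK /\<^sub>R h ^ DIM('a) - qK x) < e"
      by (rule integrable_ccontinuous_explicit) blast
    have zero: "qK x = 0" if x: "x \<in> box c d" "x \<notin> N" for x
    proof (rule ccontr)
      \<comment> \<open>Short cubes with lower corner x stay inside the closed box, so their
        averages all vanish and cannot approach a nonzero value.\<close>
      assume "qK x \<noteq> 0"
      then obtain r where r: "r > 0" "\<And>h. 0 < h \<Longrightarrow> h < r \<Longrightarrow>
          norm (integral (cbox x (x + h *\<^sub>R One)) qK /\<^sub>R h ^ DIM('a) - qK x) < norm (qK x)"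
        using N(2)[OF x(2), of "norm (qK x)"] by auto
      obtain s where s: "s > 0" "\<And>i. i \<in> Basis \<Longrightarrow> s \<le> d \<bullet> i - x \<bullet> i"
      proof
        show "Min ((\<lambda>i. d \<bullet> i - x \<bullet> i) ` Basis) > 0" using x(1) by (auto simp: mem_box)
        show "Min ((\<lambda>i. d \<bullet> i - x \<bullet> i) ` Basis) \<le> d \<bullet> i - x \<bullet> i" if "i \<in> Basis" for i
          using that by simp
      qed
      define h where "h = min s r / 2"
      have h: "0 < h" "h < r" "h \<le> s" using r(1) s(1) by (auto simp: h_def)
      have sub: "cbox x (x + h *\<^sub>R One) \<subseteq> cbox c d"
      proof
        fix y assume "y \<in> cbox x (x + h *\<^sub>R One)"
        then have y: "x \<bullet> i \<le> y \<bullet> i" "y \<bullet> i \<le> x \<bullet> i + h" if "i \<in> Basis" for i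
          using that by (auto simp: mem_box inner_add_left)
        have "c \<bullet> i \<le> y \<bullet> i \<and> y \<bullet> i \<le> d \<bullet> i" if "i \<in> Basis" for i
          using y[OF that] s(2)[OF that] h(3) x(1) that by (auto simp: mem_box)
        then show "y \<in> cbox c d" by (simp add: mem_box)
      qed
      have "integral (cbox x (x + h *\<^sub>R One)) qK = integral (cbox x (x + h *\<^sub>R One)) q"
        by (rule integral_cong) (use sub in \<open>auto simp: qK_def\<close>)
      also have "\<dots> = 0" using sub cd by (intro box0) auto
      finally show False using r(2)[OF h(1,2)] by simp
    qed
    \<comment> \<open>Boundary points of the box are set aside because a cube starting there may
      leave it; they form a null set.\<close>
    have "negligible (N \<union> (cbox c d - box c d))"
      using N(1) negligible_frontier_interval by (rule negligible_Un)
    then have "AE x in lebesgue. x \<notin> N \<union> (cbox c d - box c d)"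
      unfolding negligible_iff_null_sets by (rule AE_not_in)
    then show ?thesis
      by eventually_elim (metis DiffI UnI1 UnI2 qK_def zero)
  qed
  obtain \<D> where \<D>: "countable \<D>" "\<D> \<subseteq> Pow \<Omega>" "\<And>X. X \<in> \<D> \<Longrightarrow> \<exists>a b. X = cbox a b" "\<Union>\<D> = \<Omega>"
    using open_countable_Union_open_cbox[OF \<Omega>] by metis
  have "AE x in lebesgue. \<forall>X\<in>\<D>. x \<in> X \<longrightarrow> q x = 0"
    unfolding AE_ball_countable[OF \<D>(1)]
  proof
    fix X assume "X \<in> \<D>"
    with \<D>(2,3) obtain a b where "X = cbox a b" "cbox a b \<subseteq> \<Omega>" by blast
    then show "AE x in lebesgue. x \<in> X \<longrightarrow> q x = 0" using local by simp
  qed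
  then show ?thesis
    by eventually_elim (use \<D>(4) in blast)
qed

text \<open>Uniqueness gives \<open>weak_gradient\<close>, a definite description, its meaning on
  \<open>H1\<close>. Each component of the difference vanishes inside \<Omega> by the fundamental
  lemma and outside by membership in \<open>L2_on\<close>.\<close>

lemma is_weak_gradient_unique:
  assumes "open \<Omega>" "is_weak_gradient \<Omega> u \<psi>" "is_weak_gradient \<Omega> u \<psi>'"
  shows "\<psi> = \<psi>'"
proof -
  define \<rho> where "\<rho> = \<psi> - \<psi>'"
  have on: "\<rho> \<in> L2_on \<Omega>"
    using assms(2,3) unfolding \<rho>_def is_weak_gradient_def by (blast intro: L2_on_diff)
  have "AE x in lebesgue. x \<in> \<Omega> \<longrightarrow> rep_L2 \<rho> x \<bullet> e = 0" if e: "e \<in> Basis" for e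
  proof (rule fundamental_lemma[OF assms(1)])
    show "locally_integrable \<Omega> (\<lambda>x. rep_L2 \<rho> x \<bullet> e)"
      by (intro locally_integrable_square_integrable square_integrable_component square_integrable_rep_L2)
    fix \<eta> assume \<eta>: "test_function \<Omega> \<eta>"
    have "\<rho> \<bullet> abs_L2 (\<lambda>x. \<eta> x *\<^sub>R e) = 0"
      using assms(2,3) e \<eta> by (simp add: \<rho>_def is_weak_gradient_iff inner_diff_left)
    then show "(LINT x:\<Omega>|lebesgue. (rep_L2 \<rho> x \<bullet> e) * \<eta> x) = 0"
      unfolding set_integral_mult_test_function[OF \<eta>]
      using inner_abs_L2[of "rep_L2 \<rho>" "\<lambda>x. \<eta> x *\<^sub>R e"]
      by (simp add: square_integrable_scaleR_vec square_integrable_test_function[OF \<eta>] mult.commute)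
  qed
  then have "AE x in lebesgue. \<forall>e\<in>Basis. x \<in> \<Omega> \<longrightarrow> rep_L2 \<rho> x \<bullet> e = 0"
    by (subst AE_ball_countable) (auto intro: countable_finite)
  moreover have "AE x in lebesgue. x \<notin> \<Omega> \<longrightarrow> rep_L2 \<rho> x = 0"
    using on by (simp add: L2_on_def)
  ultimately have "AE x in lebesgue. rep_L2 \<rho> x = rep_L2 0 x"
    using rep_L2_zero[where ?'a='a and ?'b='a]
  proof eventually_elim
    case (elim x)
    then have "rep_L2 \<rho> x = 0" by (cases "x \<in> \<Omega>") (auto intro: euclidean_eqI)
    with elim show ?case by simp
  qed
  then have "\<rho> = 0" by (rule L2_eqI)
  then show ?thesis by (simp add: \<rho>_def)
qed

lemma weak_gradient_eqI:
  assumes "open \<Omega>" "is_weak_gradient \<Omega> u \<psi>"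
  shows "weak_gradient \<Omega> u = \<psi>"
  unfolding weak_gradient_def using assms by (blast intro: is_weak_gradient_unique)

lemma H1_weak_gradient:
  assumes "open \<Omega>" "u \<in> H1 \<Omega>"
  shows "is_weak_gradient \<Omega> u (weak_gradient \<Omega> u)"
  using assms weak_gradient_eqI[OF assms(1)] by (auto simp: H1_def)

section \<open>Linearity of the weak gradient\<close>

lemma is_weak_gradient_add:
  assumes "is_weak_gradient \<Omega> u \<psi>" "is_weak_gradient \<Omega> v \<rho>"
  shows "is_weak_gradient \<Omega> (u + v) (\<psi> + \<rho>)"
  using assms by (auto simp: is_weak_gradient_iff inner_add_left L2_on_add)

lemma is_weak_gradient_scaleR:
  assumes "is_weak_gradient \<Omega> u \<psi>"
  shows "is_weak_gradient \<Omega> (c *\<^sub>R u) (c *\<^sub>R \<psi>)"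
  using assms by (auto simp: is_weak_gradient_iff L2_on_scaleR)

lemma H1_add: "u \<in> H1 \<Omega> \<Longrightarrow> v \<in> H1 \<Omega> \<Longrightarrow> u + v \<in> H1 \<Omega>"
  unfolding H1_def by (blast intro: L2_on_add is_weak_gradient_add)

lemma H1_scaleR: "u \<in> H1 \<Omega> \<Longrightarrow> c *\<^sub>R u \<in> H1 \<Omega>"
  unfolding H1_def by (blast intro: L2_on_scaleR is_weak_gradient_scaleR)

lemma weak_gradient_add:
  assumes "open \<Omega>" "u \<in> H1 \<Omega>" "v \<in> H1 \<Omega>"
  shows "weak_gradient \<Omega> (u + v) = weak_gradient \<Omega> u + weak_gradient \<Omega> v"
  by (intro weak_gradient_eqI is_weak_gradient_add H1_weak_gradient assms)

lemma weak_gradient_scaleR: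
  assumes "open \<Omega>" "u \<in> H1 \<Omega>"
  shows "weak_gradient \<Omega> (c *\<^sub>R u) = c *\<^sub>R weak_gradient \<Omega> u"
  by (intro weak_gradient_eqI is_weak_gradient_scaleR H1_weak_gradient assms)

lemma weak_gradient_diff:
  assumes "open \<Omega>" "u \<in> H1 \<Omega>" "v \<in> H1 \<Omega>"
  shows "weak_gradient \<Omega> (u - v) = weak_gradient \<Omega> u - weak_gradient \<Omega> v"
  using weak_gradient_add[OF assms(1,2) H1_scaleR[OF assms(3)], of "-1"]
    weak_gradient_scaleR[OF assms(1,3), of "-1"] by simp

text \<open>Translation invariance makes the integral of every difference quotient zero, and
  dominated convergence passes to the derivative.\<close>

lemma integral_partial_derivative_zero:
  fixes \<rho> :: "'a::euclidean_space \<Rightarrow> real"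
  assumes \<rho>: "test_function UNIV \<rho>" and e: "e \<in> Basis"
  shows "(LINT x|lebesgue. frechet_derivative \<rho> (at x) e) = 0"
proof -
  have ne: "norm e = 1" using e by simp
  note \<rho>' = test_function_deriv[OF \<rho> e]
  obtain C where C: "C \<ge> 0" "\<And>x. \<bar>frechet_derivative \<rho> (at x) e\<bar> \<le> C"
    using \<rho>' by (rule test_function_bounded) blast
  obtain K where K: "compact K" "\<And>x. x \<notin> K \<Longrightarrow> \<rho> x = 0"
    using \<rho> by (rule test_function_support) blast
  obtain R where R: "\<And>x. x \<in> K \<Longrightarrow> norm x \<le> R"
    using compact_imp_bounded[OF K(1)] by (auto simp: bounded_iff)
  define \<delta> where "\<delta> k = inverse (real (Suc k))" for k
  have \<delta>: "\<delta> k > 0" "\<delta> k \<le> 1" for k by (auto simp: \<delta>_def field_simps)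
  have \<delta>0: "\<delta> \<longlonglongrightarrow> 0" unfolding \<delta>_def by (rule LIMSEQ_inverse_real_of_nat)
  define D where "D k x = (\<rho> (x + \<delta> k *\<^sub>R e) - \<rho> x) / \<delta> k" for k x
  have line: "((\<lambda>s. \<rho> (x + s *\<^sub>R e)) has_real_derivative frechet_derivative \<rho> (at (x + s *\<^sub>R e)) e) (at s)" for x s
  proof -
    have "((\<lambda>s. \<rho> (x + s *\<^sub>R e)) has_derivative
        (\<lambda>h. frechet_derivative \<rho> (at (x + s *\<^sub>R e)) (h *\<^sub>R e))) (at s)"
      by (rule has_derivative_compose[OF _ test_function_has_derivative[OF \<rho>]])
        (auto intro!: derivative_eq_intros)
    then show ?thesis
      unfolding has_field_derivative_def
      by (simp add: linear_scale[OF has_derivative_linear[OF test_function_has_derivative[OF \<rho>]]]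
          mult.commute[of _ "frechet_derivative \<rho> (at (x + s *\<^sub>R e)) e"])
  qed
  \<comment> \<open>Shifts have length at most 1, so all difference quotients live in the ball
    enlarged by 1; there the mean value theorem bounds them by C.\<close>
  have bound: "\<bar>D k x\<bar> \<le> C * indicator (cball 0 (R + 1)) x" for k x
  proof (cases "x \<in> cball 0 (R + 1)")
    case True
    obtain s where "\<rho> (x + \<delta> k *\<^sub>R e) - \<rho> (x + 0 *\<^sub>R e) = (\<delta> k - 0) * frechet_derivative \<rho> (at (x + s *\<^sub>R e)) e"
      using MVT2[of 0 "\<delta> k" "\<lambda>s. \<rho> (x + s *\<^sub>R e)", OF \<delta>(1) line] by blast
    then have "D k x = frechet_derivative \<rho> (at (x + s *\<^sub>R e)) e" using \<delta>(1)[of k] by (simp add: D_def)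
    then show ?thesis using C(2) True by simp
  next
    case False
    have "norm x \<le> norm (x + \<delta> k *\<^sub>R e) + 1"
      using norm_triangle_ineq4[of "x + \<delta> k *\<^sub>R e" "\<delta> k *\<^sub>R e"] \<delta>[of k] ne by simp
    then have "x \<notin> K" "x + \<delta> k *\<^sub>R e \<notin> K" using R False by force+
    then show ?thesis using K(2) C(1) by (simp add: D_def)
  qed
  have meas: "\<rho> \<in> borel_measurable lborel" using test_function_continuous[OF \<rho>] by (simp add: borel_measurable_continuous_onI)
  have "integrable lebesgue (indicat_real L)" if "compact L" for L :: "'a set"
    using lmeasurable_compact[OF that] by (intro integrable_real_indicator) (auto simp: fmeasurable_def)
  then have intch: "integrable lborel \<rho>"
    using integrable_mult_test_function[of UNIV "\<lambda>_. 1", OF _ \<rho>] integrable_completion[OF meas]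
    by (simp add: locally_integrable_def set_integrable_def)
  have "(\<lambda>k. LINT x|lborel. D k x) \<longlonglongrightarrow> (LINT x|lborel. frechet_derivative \<rho> (at x) e)"
  proof (rule integral_dominated_convergence)
    show "(\<lambda>x. frechet_derivative \<rho> (at x) e) \<in> borel_measurable lborel"
      using test_function_continuous[OF \<rho>'] by (simp add: borel_measurable_continuous_onI)
    have "continuous_on UNIV (D k)" for k
      unfolding D_def using \<delta>(1)[of k]
      by (intro continuous_intros continuous_on_compose2[OF test_function_continuous[OF \<rho>]]) auto
    then show "D k \<in> borel_measurable lborel" for k by (simp add: borel_measurable_continuous_onI)
    show "integrable lborel (\<lambda>x::'a. C * indicator (cball 0 (R + 1)) x)"
      by (intro integrable_mult_right integrable_real_indicator) (use emeasure_bounded_finite[OF bounded_cball] in auto)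
    show "AE x in lborel. norm (D k x) \<le> C * indicator (cball 0 (R + 1)) x" for k
      using bound by simp
    have "(\<lambda>k. D k x) \<longlonglongrightarrow> frechet_derivative \<rho> (at x) e" for x
    proof -
      have "((\<lambda>s. (\<rho> (x + s *\<^sub>R e) - \<rho> x) / s) \<longlongrightarrow> frechet_derivative \<rho> (at x) e) (at 0)"
        using line[of x 0] by (simp add: has_field_derivative_iff)
      moreover have "filterlim \<delta> (at 0) sequentially"
        using \<delta>0 \<delta>(1) by (auto simp: filterlim_at less_imp_neq[symmetric])
      ultimately show ?thesis
        unfolding D_def by (rule filterlim_compose)
    qed
    then show "AE x in lborel. (\<lambda>k. D k x) \<longlonglongrightarrow> frechet_derivative \<rho> (at x) e" by simp
  qed
  moreover have "(LINT x|lborel. D k x) = 0" for k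
  proof -
    have d: "distr lborel borel ((+) (\<delta> k *\<^sub>R e)) = lborel" by (rule lborel_distr_plus)
    have m: "(+) (\<delta> k *\<^sub>R e) \<in> lborel \<rightarrow>\<^sub>M borel" by simp
    have m': "\<rho> \<in> borel_measurable borel" using meas by simp
    have "integrable lborel (\<lambda>x. \<rho> (\<delta> k *\<^sub>R e + x))"
      using intch integrable_distr_eq[OF m m'] d by simp
    moreover have "(LINT x|lborel. \<rho> (\<delta> k *\<^sub>R e + x)) = (LINT x|lborel. \<rho> x)"
      using integral_distr[OF m m'] d by simp
    ultimately show ?thesis
      using intch by (simp add: D_def add.commute)
  qed
  ultimately have "(LINT x|lborel. frechet_derivative \<rho> (at x) e) = 0"
    by (simp add: LIMSEQ_const_iff)
  then show ?thesis
    using test_function_continuous[OF \<rho>']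
    by (subst integral_completion) (auto simp: borel_measurable_continuous_onI)
qed

lemma test_function_mono: "test_function \<Omega> \<eta> \<Longrightarrow> \<Omega> \<subseteq> \<Omega>' \<Longrightarrow> test_function \<Omega>' \<eta>"
  by (auto simp: test_function_def)

lemma square_integrable_sum:
  "finite I \<Longrightarrow> (\<And>i. i \<in> I \<Longrightarrow> square_integrable (f i)) \<Longrightarrow> square_integrable (\<lambda>x. \<Sum>i\<in>I. f i x)"
  by (induction I rule: finite_induct) (auto intro: square_integrable_add square_integrable_zero)

lemma square_integrable_grad:
  assumes "test_function \<Omega> \<eta>"
  shows "square_integrable (grad \<eta>)"
  unfolding grad_def
  using square_integrable_test_function[OF test_function_deriv[OF assms]]
  by (intro square_integrable_sum square_integrable_scaleR_vec) auto

text \<open>Integration by parts: the integral of a partial derivative of the product \<eta>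
  \<theta> is zero.\<close>

lemma is_weak_gradient_test_function:
  assumes \<eta>: "test_function \<Omega> \<eta>"
  shows "is_weak_gradient \<Omega> (abs_L2 \<eta>) (abs_L2 (grad \<eta>))"
  unfolding is_weak_gradient_iff
proof (intro conjI ballI allI impI)
  obtain K where K: "K \<subseteq> \<Omega>" "\<And>x. x \<notin> K \<Longrightarrow> frechet_derivative \<eta> (at x) = (\<lambda>v. 0)"
    using \<eta> by (rule test_function_support) blast
  then have "grad \<eta> x = 0" if "x \<notin> \<Omega>" for x
  proof -
    have "frechet_derivative \<eta> (at x) = (\<lambda>v. 0)" using K that by blast
    then show ?thesis by (simp add: grad_def)
  qed
  then show "abs_L2 (grad \<eta>) \<in> L2_on \<Omega>"
    by (simp add: L2_on_iff_abs square_integrable_grad[OF \<eta>])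
  fix e :: 'a and \<theta> assume e: "e \<in> Basis" and \<theta>: "test_function \<Omega> \<theta>"
  note si = square_integrable_test_function
  note d\<eta> = test_function_deriv[OF \<eta> e] and d\<theta> = test_function_deriv[OF \<theta> e]
  have "frechet_derivative (\<lambda>x. \<eta> x * \<theta> x) (at x) =
      (\<lambda>v. \<eta> x * frechet_derivative \<theta> (at x) v + frechet_derivative \<eta> (at x) v * \<theta> x)" for x
    by (rule frechet_derivative_at[symmetric])
      (auto intro!: derivative_eq_intros test_function_has_derivative[OF \<eta>] test_function_has_derivative[OF \<theta>])
  then have "0 = (LINT x|lebesgue. \<eta> x * frechet_derivative \<theta> (at x) e + frechet_derivative \<eta> (at x) e * \<theta> x)"
    using integral_partial_derivative_zero[OF test_function_mono[OF test_function_mult[OF \<eta> \<theta>]] e] by simp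
  also have "\<dots> = (LINT x|lebesgue. \<eta> x * frechet_derivative \<theta> (at x) e) + (LINT x|lebesgue. frechet_derivative \<eta> (at x) e * \<theta> x)"
    using square_integrable_inner[OF si[OF \<eta>] si[OF d\<theta>]] square_integrable_inner[OF si[OF d\<eta>] si[OF \<theta>]]
    by (intro Bochner_Integration.integral_add) simp_all
  also have "(LINT x|lebesgue. \<eta> x * frechet_derivative \<theta> (at x) e)
      = abs_L2 \<eta> \<bullet> abs_L2 (\<lambda>x. frechet_derivative \<theta> (at x) e)"
    by (subst inner_abs_L2[OF si[OF \<eta>] si[OF d\<theta>]]) simp
  also have "(LINT x|lebesgue. frechet_derivative \<eta> (at x) e * \<theta> x) = abs_L2 (grad \<eta>) \<bullet> abs_L2 (\<lambda>x. \<theta> x *\<^sub>R e)"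
    using e by (subst inner_abs_L2[OF square_integrable_grad[OF \<eta>] square_integrable_scaleR_vec[OF si[OF \<theta>]]])
      (simp add: grad_def inner_sum_left_Basis mult.commute)
  finally show "abs_L2 \<eta> \<bullet> abs_L2 (\<lambda>x. frechet_derivative \<theta> (at x) e)
      = - (abs_L2 (grad \<eta>) \<bullet> abs_L2 (\<lambda>x. \<theta> x *\<^sub>R e))" by simp
qed

lemma test_function_in_H1: "test_function \<Omega> \<eta> \<Longrightarrow> abs_L2 \<eta> \<in> H1 \<Omega>"
  unfolding H1_def using is_weak_gradient_test_function test_function_in_L2_on by blast

lemma weak_gradient_test_function:
  "open \<Omega> \<Longrightarrow> test_function \<Omega> \<eta> \<Longrightarrow> weak_gradient \<Omega> (abs_L2 \<eta>) = abs_L2 (grad \<eta>)"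
  by (rule weak_gradient_eqI[OF _ is_weak_gradient_test_function])

section \<open>Approximation by test functions and the linear structure of
  \<open>H1_0\<close>\<close>

lemma H1_norm_eq: "H1_norm \<Omega> u = norm (u, weak_gradient \<Omega> u)"
  by (simp add: H1_norm_def norm_Pair)

lemma H1_0_H1: "u \<in> H1_0 \<Omega> \<Longrightarrow> u \<in> H1 \<Omega>"
  by (simp add: H1_0_def)

lemma H1_0_L2_on: "u \<in> H1_0 \<Omega> \<Longrightarrow> u \<in> L2_on \<Omega>"
  by (simp add: H1_0_def H1_def)

lemma test_function_zero: "test_function \<Omega> (\<lambda>_. 0)"
  by (rule test_functionI[of _ "{}"]) (auto intro: C_k_const)

lemma weak_gradient_zero: "open \<Omega> \<Longrightarrow> weak_gradient \<Omega> 0 = 0"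
  using weak_gradient_scaleR[OF _ test_function_in_H1[OF test_function_zero], of \<Omega> 0] by simp

lemma test_function_in_H1_0:
  assumes "open \<Omega>" "test_function \<Omega> \<eta>"
  shows "abs_L2 \<eta> \<in> H1_0 \<Omega>"
  unfolding H1_0_def using test_function_in_H1[OF assms(2)] assms weak_gradient_zero[OF assms(1)]
  by (auto simp: H1_norm_def intro!: exI[of _ \<eta>])

text \<open>The norm of \<open>H1\<close> is the norm of the pair formed by a function and its
  gradient, so approximation in it splits into two limits in L^2.\<close>

lemma H1_0_approx:
  assumes "open \<Omega>" "u \<in> H1_0 \<Omega>"
  obtains \<eta> where "\<And>k. test_function \<Omega> (\<eta> k)" "(\<lambda>k. abs_L2 (\<eta> k)) \<longlonglongrightarrow> u"
    "(\<lambda>k. abs_L2 (grad (\<eta> k))) \<longlonglongrightarrow> weak_gradient \<Omega> u"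
proof -
  have "\<forall>k. \<exists>\<eta>. test_function \<Omega> \<eta> \<and> H1_norm \<Omega> (u - abs_L2 \<eta>) < inverse (real (Suc k))"
    using assms(2) by (auto simp: H1_0_def)
  then obtain \<eta> where \<eta>: "\<And>k. test_function \<Omega> (\<eta> k)"
    "\<And>k. H1_norm \<Omega> (u - abs_L2 (\<eta> k)) < inverse (real (Suc k))" by metis
  have "(u - abs_L2 (\<eta> k), weak_gradient \<Omega> (u - abs_L2 (\<eta> k)))
      = (u, weak_gradient \<Omega> u) - (abs_L2 (\<eta> k), abs_L2 (grad (\<eta> k)))" for k
    using weak_gradient_diff[OF assms(1) H1_0_H1[OF assms(2)] test_function_in_H1[OF \<eta>(1)]]
      weak_gradient_test_function[OF assms(1) \<eta>(1)] by simp
  then have *: "norm ((u, weak_gradient \<Omega> u) - (abs_L2 (\<eta> k), abs_L2 (grad (\<eta> k)))) < inverse (real (Suc k))" for k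
    using \<eta>(2)[of k] by (simp add: H1_norm_eq)
  have "(\<lambda>k. (abs_L2 (\<eta> k), abs_L2 (grad (\<eta> k))) - (u, weak_gradient \<Omega> u)) \<longlonglongrightarrow> 0"
  proof (rule Lim_null_comparison[OF _ LIMSEQ_inverse_real_of_nat])
    show "\<forall>\<^sub>F k in sequentially. norm ((abs_L2 (\<eta> k), abs_L2 (grad (\<eta> k))) - (u, weak_gradient \<Omega> u))
        \<le> inverse (real (Suc k))"
      using * by (intro always_eventually allI less_imp_le) (metis norm_minus_commute)
  qed
  then have "(\<lambda>k. (abs_L2 (\<eta> k), abs_L2 (grad (\<eta> k)))) \<longlonglongrightarrow> (u, weak_gradient \<Omega> u)"
    by (simp only: LIM_zero_iff)
  from tendsto_fst[OF this] tendsto_snd[OF this] show ?thesis using that[OF \<eta>(1)] by simp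
qed

lemma H1_0I:
  assumes "open \<Omega>" "u \<in> H1 \<Omega>" "\<And>k. test_function \<Omega> (\<eta> k)" "(\<lambda>k. abs_L2 (\<eta> k)) \<longlonglongrightarrow> u"
    "(\<lambda>k. abs_L2 (grad (\<eta> k))) \<longlonglongrightarrow> weak_gradient \<Omega> u"
  shows "u \<in> H1_0 \<Omega>"
proof -
  have "\<exists>\<theta>. test_function \<Omega> \<theta> \<and> H1_norm \<Omega> (u - abs_L2 \<theta>) < \<epsilon>" if "\<epsilon> > 0" for \<epsilon>
  proof -
    have "(\<lambda>k. (abs_L2 (\<eta> k), abs_L2 (grad (\<eta> k)))) \<longlonglongrightarrow> (u, weak_gradient \<Omega> u)"
      using assms by (intro tendsto_Pair)
    then obtain k where k: "norm ((abs_L2 (\<eta> k), abs_L2 (grad (\<eta> k))) - (u, weak_gradient \<Omega> u)) < \<epsilon>"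
      using \<open>\<epsilon> > 0\<close> unfolding LIMSEQ_iff by (meson order_refl)
    have "(u - abs_L2 (\<eta> k), weak_gradient \<Omega> (u - abs_L2 (\<eta> k)))
      = (u, weak_gradient \<Omega> u) - (abs_L2 (\<eta> k), abs_L2 (grad (\<eta> k)))"
      using weak_gradient_diff[OF assms(1,2) test_function_in_H1[OF assms(3)]]
        weak_gradient_test_function[OF assms(1,3)] by simp
    with k show ?thesis
      using assms(3)[of k] by (metis H1_norm_eq norm_minus_commute)
  qed
  then show ?thesis using assms(2) by (auto simp: H1_0_def)
qed

lemma grad_add:
  assumes "test_function \<Omega> \<eta>" "test_function \<Omega> \<theta>"
  shows "grad (\<lambda>x. \<eta> x + \<theta> x) = (\<lambda>x. grad \<eta> x + grad \<theta> x)"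
proof
  fix x
  have "frechet_derivative (\<lambda>x. \<eta> x + \<theta> x) (at x) =
      (\<lambda>v. frechet_derivative \<eta> (at x) v + frechet_derivative \<theta> (at x) v)"
    by (rule frechet_derivative_at[symmetric])
      (intro has_derivative_add test_function_has_derivative[OF assms(1)] test_function_has_derivative[OF assms(2)])
  then show "grad (\<lambda>x. \<eta> x + \<theta> x) x = grad \<eta> x + grad \<theta> x"
    by (simp add: grad_def scaleR_add_left sum.distrib)
qed

lemma grad_scale:
  assumes "test_function \<Omega> \<eta>"
  shows "grad (\<lambda>x. c * \<eta> x) = (\<lambda>x. c *\<^sub>R grad \<eta> x)"
proof
  fix x
  have "frechet_derivative (\<lambda>x. c * \<eta> x) (at x) = (\<lambda>v. c * frechet_derivative \<eta> (at x) v)"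
    by (rule frechet_derivative_at[symmetric])
      (intro has_derivative_mult_right test_function_has_derivative[OF assms(1)])
  then show "grad (\<lambda>x. c * \<eta> x) x = c *\<^sub>R grad \<eta> x"
    by (simp add: grad_def scaleR_right.sum)
qed

lemma H1_0_add:
  assumes "open \<Omega>" "u \<in> H1_0 \<Omega>" "v \<in> H1_0 \<Omega>"
  shows "u + v \<in> H1_0 \<Omega>"
proof -
  obtain \<eta> where \<eta>: "\<And>k. test_function \<Omega> (\<eta> k)" "(\<lambda>k. abs_L2 (\<eta> k)) \<longlonglongrightarrow> u"
    "(\<lambda>k. abs_L2 (grad (\<eta> k))) \<longlonglongrightarrow> weak_gradient \<Omega> u"
    using assms(1,2) by (rule H1_0_approx) blast
  obtain \<theta> where \<theta>: "\<And>k. test_function \<Omega> (\<theta> k)" "(\<lambda>k. abs_L2 (\<theta> k)) \<longlonglongrightarrow> v"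
    "(\<lambda>k. abs_L2 (grad (\<theta> k))) \<longlonglongrightarrow> weak_gradient \<Omega> v"
    using assms(1,3) by (rule H1_0_approx) blast
  note u = H1_0_H1[OF assms(2)] and v = H1_0_H1[OF assms(3)]
  note g = square_integrable_grad and t = square_integrable_test_function
  show ?thesis
  proof (rule H1_0I[OF assms(1) H1_add[OF u v] test_function_add[OF \<eta>(1) \<theta>(1)]])
    show "(\<lambda>k. abs_L2 (\<lambda>x. \<eta> k x + \<theta> k x)) \<longlonglongrightarrow> u + v"
      using tendsto_add[OF \<eta>(2) \<theta>(2)] by (simp add: abs_L2_add t[OF \<eta>(1)] t[OF \<theta>(1)])
    show "(\<lambda>k. abs_L2 (grad (\<lambda>x. \<eta> k x + \<theta> k x))) \<longlonglongrightarrow> weak_gradient \<Omega> (u + v)"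
      using tendsto_add[OF \<eta>(3) \<theta>(3)]
      by (simp add: abs_L2_add g[OF \<eta>(1)] g[OF \<theta>(1)] grad_add[OF \<eta>(1) \<theta>(1)] weak_gradient_add assms(1) u v)
  qed
qed

lemma H1_0_scaleR:
  assumes "open \<Omega>" "u \<in> H1_0 \<Omega>"
  shows "c *\<^sub>R u \<in> H1_0 \<Omega>"
proof -
  obtain \<eta> where \<eta>: "\<And>k. test_function \<Omega> (\<eta> k)" "(\<lambda>k. abs_L2 (\<eta> k)) \<longlonglongrightarrow> u"
    "(\<lambda>k. abs_L2 (grad (\<eta> k))) \<longlonglongrightarrow> weak_gradient \<Omega> u"
    using assms(1,2) by (rule H1_0_approx) blast
  note u = H1_0_H1[OF assms(2)]
  note g = square_integrable_grad and t = square_integrable_test_function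
  show ?thesis
  proof (rule H1_0I[OF assms(1) H1_scaleR[OF u] test_function_scale[OF \<eta>(1)]])
    show "(\<lambda>k. abs_L2 (\<lambda>x. c * \<eta> k x)) \<longlonglongrightarrow> c *\<^sub>R u"
      using tendsto_scaleR[OF tendsto_const \<eta>(2), of c] by (simp add: abs_L2_scaleR t[OF \<eta>(1)])
    show "(\<lambda>k. abs_L2 (grad (\<lambda>x. c * \<eta> k x))) \<longlonglongrightarrow> weak_gradient \<Omega> (c *\<^sub>R u)"
      using tendsto_scaleR[OF tendsto_const \<eta>(3), of c]
      by (simp add: abs_L2_scaleR g[OF \<eta>(1)] grad_scale[OF \<eta>(1)] weak_gradient_scaleR assms(1) u)
  qed
qed

lemma H1_0_diff:
  assumes "open \<Omega>" "u \<in> H1_0 \<Omega>" "v \<in> H1_0 \<Omega>"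
  shows "u - v \<in> H1_0 \<Omega>"
  using H1_0_add[OF assms(1,2) H1_0_scaleR[OF assms(1,3), of "-1"]] by simp

section \<open>Sobolev-type inequalities for test functions\<close>

text \<open>A probability measure gives all power mean inequalities the constant 1. In dimension one
  the same measure serves as the parameter interval of paths.\<close>

definition unit_cube :: "'a::euclidean_space measure" where
  "unit_cube = uniform_measure lborel (cbox 0 One)"

lemma emeasure_lborel_unit_cube: "emeasure lborel (cbox 0 One :: 'a::euclidean_space set) = 1"
  by (simp add: emeasure_lborel_cbox)

lemma prob_space_unit_cube: "prob_space (unit_cube :: 'a::euclidean_space measure)"
  unfolding unit_cube_def
  by (rule prob_space_uniform_measure) (simp_all add: emeasure_lborel_unit_cube)

lemma sets_unit_cube [measurable_cong, simp]: "sets unit_cube = sets borel"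
  by (simp add: unit_cube_def)

lemma space_unit_cube [simp]: "space unit_cube = UNIV"
  by (simp add: unit_cube_def)

lemma nn_integral_unit_cube:
  assumes "f \<in> borel_measurable borel"
  shows "(\<integral>\<^sup>+y. f y \<partial>unit_cube) = (\<integral>\<^sup>+y. f y * indicator (cbox 0 One) y \<partial>lborel)"
  using assms unfolding unit_cube_def
  by (subst nn_integral_uniform_measure) (auto simp: emeasure_lborel_unit_cube divide_ennreal_def)

lemma AE_unit_cube: "AE y in unit_cube. y \<in> cbox 0 One"
  unfolding unit_cube_def by (rule AE_uniform_measureI) auto

interpretation unit_cube: prob_space "unit_cube :: 'a::euclidean_space measure"
  by (rule prob_space_unit_cube)

interpretation lborel_cube: pair_sigma_finite "lborel :: 'a::euclidean_space measure" "unit_cube :: 'b::euclidean_space measure"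
  by standard

interpretation cube_cube: pair_sigma_finite "unit_cube :: 'a::euclidean_space measure" "unit_cube :: 'b::euclidean_space measure"
  by standard

lemma (in prob_space) nn_integral_power2_le:
  fixes f :: "'a \<Rightarrow> ennreal"
  assumes "f \<in> borel_measurable M"
  shows "(\<integral>\<^sup>+x. f x \<partial>M)\<^sup>2 \<le> (\<integral>\<^sup>+x. (f x)\<^sup>2 \<partial>M)"
  using Cauchy_Schwarz_nn_integral[OF assms, of "\<lambda>_. 1"] by (simp add: emeasure_space_1)

text \<open>Cauchy-Schwarz against the constant 1, applied twice.\<close>

lemma (in prob_space) nn_integral_power4_le:
  fixes f :: "'a \<Rightarrow> ennreal"
  assumes [measurable]: "f \<in> borel_measurable M"
  shows "(\<integral>\<^sup>+x. f x \<partial>M) ^ 4 \<le> (\<integral>\<^sup>+x. (f x) ^ 4 \<partial>M)"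
proof -
  have "(\<integral>\<^sup>+x. f x \<partial>M) ^ 4 = ((\<integral>\<^sup>+x. f x \<partial>M)\<^sup>2)\<^sup>2" by (simp flip: power_mult)
  also have "\<dots> \<le> (\<integral>\<^sup>+x. (f x)\<^sup>2 \<partial>M)\<^sup>2"
    by (intro power_mono nn_integral_power2_le) auto
  also have "\<dots> \<le> (\<integral>\<^sup>+x. ((f x)\<^sup>2)\<^sup>2 \<partial>M)"
    by (intro nn_integral_power2_le) auto
  finally show ?thesis by (simp flip: power_mult)
qed

section \<open>Integrals under scaling, translation and averaging\<close>

lemma nn_integral_lborel_affine:
  fixes f :: "'a::euclidean_space \<Rightarrow> ennreal"
  assumes [measurable]: "f \<in> borel_measurable borel" and "c \<noteq> 0"
  shows "ennreal (\<bar>c\<bar> ^ DIM('a)) * (\<integral>\<^sup>+x. f (t + c *\<^sub>R x) \<partial>lborel) = (\<integral>\<^sup>+x. f x \<partial>lborel)"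
  by (subst (2) lborel_affine[OF \<open>c \<noteq> 0\<close>, of t])
    (simp add: nn_integral_density nn_integral_distr nn_integral_cmult)

lemma nn_integral_lborel_translate:
  fixes f :: "'a::euclidean_space \<Rightarrow> ennreal"
  assumes "f \<in> borel_measurable borel"
  shows "(\<integral>\<^sup>+x. f (x + v) \<partial>lborel) = (\<integral>\<^sup>+x. f x \<partial>lborel)"
  using nn_integral_lborel_affine[OF assms, of 1 v] by (simp add: add.commute)

text \<open>The substitution z = x + c y produces the factor c^n, after which the cube is enlarged
  to the whole space. In this way a global integral bounds a local average at the cost
  c^(-n).\<close>

lemma nn_integral_cube_le:
  fixes f :: "'a::euclidean_space \<Rightarrow> ennreal"
  assumes [measurable]: "f \<in> borel_measurable borel" and "c > 0"
  shows "ennreal (c ^ DIM('a)) * (\<integral>\<^sup>+y. f (x + c *\<^sub>R y) \<partial>unit_cube) \<le> (\<integral>\<^sup>+x. f x \<partial>lborel)"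
proof -
  have "(\<integral>\<^sup>+y. f (x + c *\<^sub>R y) \<partial>unit_cube) \<le> (\<integral>\<^sup>+y. f (x + c *\<^sub>R y) \<partial>lborel)"
    by (subst nn_integral_unit_cube) (auto intro!: nn_integral_mono simp: indicator_def)
  then have "ennreal (c ^ DIM('a)) * (\<integral>\<^sup>+y. f (x + c *\<^sub>R y) \<partial>unit_cube)
      \<le> ennreal (c ^ DIM('a)) * (\<integral>\<^sup>+y. f (x + c *\<^sub>R y) \<partial>lborel)"
    by (rule mult_left_mono) simp
  also have "\<dots> = (\<integral>\<^sup>+x. f x \<partial>lborel)"
    using nn_integral_lborel_affine[of f c x] \<open>c > 0\<close> by simp
  finally show ?thesis .
qed

text \<open>For fixed y the shift by \<open>g y\<close> leaves the integral unchanged, and averaging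
  over a probability changes nothing more. A general g covers scaled cubes as well as points along a
  segment.\<close>

lemma nn_integral_cube_average:
  fixes f :: "'a::euclidean_space \<Rightarrow> ennreal" and g :: "'b::euclidean_space \<Rightarrow> 'a"
  assumes [measurable]: "f \<in> borel_measurable borel" "g \<in> borel_measurable borel"
  shows "(\<integral>\<^sup>+x. (\<integral>\<^sup>+y. f (x + g y) \<partial>unit_cube) \<partial>lborel) = (\<integral>\<^sup>+x. f x \<partial>lborel)"
proof -
  have "(\<integral>\<^sup>+x. (\<integral>\<^sup>+y. f (x + g y) \<partial>unit_cube) \<partial>lborel) = (\<integral>\<^sup>+y. (\<integral>\<^sup>+x. f (x + g y) \<partial>lborel) \<partial>unit_cube)"
    by (rule lborel_cube.Fubini'[symmetric]) measurable
  also have "\<dots> = (\<integral>\<^sup>+x. f x \<partial>lborel)"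
    by (simp add: nn_integral_lborel_translate unit_cube.emeasure_space_1[simplified])
  finally show ?thesis .
qed

lemma norm_unit_cube:
  fixes y :: "'a::euclidean_space"
  assumes "y \<in> cbox 0 One"
  shows "norm y \<le> real DIM('a)"
proof -
  have "norm y \<le> (\<Sum>i\<in>Basis. \<bar>y \<bullet> i\<bar>)" by (rule norm_le_l1)
  also have "\<dots> \<le> (\<Sum>i\<in>(Basis::'a set). 1)"
    using assms by (intro sum_mono) (auto simp: mem_box)
  finally show ?thesis by simp
qed

lemma continuous_grad:
  assumes "test_function \<Omega> \<eta>"
  shows "continuous_on UNIV (grad \<eta>)"
  unfolding grad_def using test_function_continuous[OF test_function_deriv[OF assms]]
  by (intro continuous_intros) auto

text \<open>The fundamental theorem of calculus on a segment traversed with parameter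
  \<open>s ^ p\<close>. Exponent 1 serves the L^2 estimates and exponent 4 the L^4 estimate, where
  the path must start slowly.\<close>

lemma increment_le_path_integral:
  fixes x v :: "'a::euclidean_space" and p :: nat
  assumes \<eta>: "test_function \<Omega> \<eta>" and "p > 0"
  shows "ennreal \<bar>\<eta> (x + v) - \<eta> x\<bar> \<le>
    (\<integral>\<^sup>+s. ennreal (real p * s ^ (p - 1) * norm v * norm (grad \<eta> (x + s ^ p *\<^sub>R v))) \<partial>unit_cube)"
proof -
  define h where "h s = \<eta> (x + s ^ p *\<^sub>R v)" for s :: real
  define h' where "h' s = real p * s ^ (p - 1) * (grad \<eta> (x + s ^ p *\<^sub>R v) \<bullet> v)" for s :: real
  have cg: "continuous_on UNIV (\<lambda>s::real. grad \<eta> (x + s ^ p *\<^sub>R v))"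
    by (rule continuous_on_compose2[OF continuous_grad[OF \<eta>]]) (auto intro!: continuous_intros)
  have cont: "continuous_on UNIV h'"
    unfolding h'_def by (intro continuous_intros cg)
  have [measurable]: "grad \<eta> \<in> borel_measurable borel"
    by (rule borel_measurable_continuous_onI[OF continuous_grad[OF \<eta>]])
  have deriv: "(h has_vector_derivative h' s) (at s within {0..1})" for s
  proof -
    have "((\<lambda>s. x + s ^ p *\<^sub>R v) has_derivative (\<lambda>d. (d * (real p * s ^ (p - 1))) *\<^sub>R v)) (at s within {0..1})"
      by (auto intro!: derivative_eq_intros simp: algebra_simps)
    from has_derivative_compose[OF this test_function_has_derivative_grad[OF \<eta>]]
    show ?thesis
      unfolding h_def h'_def has_vector_derivative_def by (simp add: algebra_simps)
  qed
  have eq: "(LINT s|lborel. indicator {0..1} s *\<^sub>R h' s) = \<eta> (x + v) - \<eta> x"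
    using integral_FTC_atLeastAtMost[of 0 1 h h'] deriv cont \<open>p > 0\<close>
    by (simp add: h_def continuous_on_subset zero_power)
  have "ennreal \<bar>\<eta> (x + v) - \<eta> x\<bar> \<le> (\<integral>\<^sup>+s. ennreal (norm (indicator {0..1} s *\<^sub>R h' s)) \<partial>lborel)"
    unfolding eq[symmetric] real_norm_def[symmetric]
    by (rule integral_norm_bound_ennreal)
      (rule borel_integrable_compact, auto intro: continuous_on_subset[OF cont])
  also have "\<dots> \<le> (\<integral>\<^sup>+s. ennreal (real p * s ^ (p - 1) * norm v * norm (grad \<eta> (x + s ^ p *\<^sub>R v))) * indicator (cbox 0 One) s \<partial>lborel)"
  proof (rule nn_integral_mono)
    fix s :: real
    have "\<bar>h' s\<bar> \<le> real p * s ^ (p - 1) * norm v * norm (grad \<eta> (x + s ^ p *\<^sub>R v))" if "0 \<le> s"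
      using mult_left_mono[OF Cauchy_Schwarz_ineq2[of "grad \<eta> (x + s ^ p *\<^sub>R v)" v], of "real p * s ^ (p - 1)"] that
      by (simp add: h'_def abs_mult mult_ac)
    then show "ennreal (norm (indicator {0..1} s *\<^sub>R h' s)) \<le>
       ennreal (real p * s ^ (p - 1) * norm v * norm (grad \<eta> (x + s ^ p *\<^sub>R v))) * indicator (cbox 0 One) s"
      by (auto simp: indicator_def intro!: ennreal_leI)
  qed
  also have "\<dots> = (\<integral>\<^sup>+s. ennreal (real p * s ^ (p - 1) * norm v * norm (grad \<eta> (x + s ^ p *\<^sub>R v))) \<partial>unit_cube)"
    by (rule nn_integral_unit_cube[symmetric]) measurable
  finally show ?thesis .
qed

definition nn_L2 :: "('a::euclidean_space \<Rightarrow> real) \<Rightarrow> ennreal" where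
  "nn_L2 f = (\<integral>\<^sup>+x. ennreal ((f x)\<^sup>2) \<partial>lborel)"

abbreviation ngrad :: "('a::euclidean_space \<Rightarrow> real) \<Rightarrow> 'a \<Rightarrow> real" where
  "ngrad \<eta> x \<equiv> norm (grad \<eta> x)"

lemma ngrad_measurable: "test_function \<Omega> \<eta> \<Longrightarrow> (\<lambda>x. ngrad \<eta> x) \<in> borel_measurable borel"
  by (intro borel_measurable_continuous_onI continuous_on_norm continuous_grad)

lemma test_function_measurable: "test_function \<Omega> \<eta> \<Longrightarrow> \<eta> \<in> borel_measurable borel"
  by (intro borel_measurable_continuous_onI test_function_continuous)

lemma increment_sq_le:
  assumes \<eta>: "test_function \<Omega> \<eta>"
  shows "ennreal ((\<eta> (x + v) - \<eta> x)\<^sup>2) \<le> ennreal ((norm v)\<^sup>2) * (\<integral>\<^sup>+s. ennreal ((ngrad \<eta> (x + s *\<^sub>R v))\<^sup>2) \<partial>unit_cube)"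
proof -
  note [measurable] = ngrad_measurable[OF \<eta>]
  have "ennreal ((\<eta> (x + v) - \<eta> x)\<^sup>2) = (ennreal \<bar>\<eta> (x + v) - \<eta> x\<bar>)\<^sup>2"
    by (simp add: ennreal_power)
  also have "\<dots> \<le> (\<integral>\<^sup>+s. ennreal (norm v * ngrad \<eta> (x + s *\<^sub>R v)) \<partial>unit_cube)\<^sup>2"
    using increment_le_path_integral[OF \<eta>, of 1 x v] by (intro power_mono) simp_all
  also have "\<dots> \<le> (\<integral>\<^sup>+s. (ennreal (norm v * ngrad \<eta> (x + s *\<^sub>R v)))\<^sup>2 \<partial>unit_cube)"
    by (rule unit_cube.nn_integral_power2_le) measurable
  also have "\<dots> = (\<integral>\<^sup>+s. ennreal ((norm v)\<^sup>2) * ennreal ((ngrad \<eta> (x + s *\<^sub>R v))\<^sup>2) \<partial>unit_cube)"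
    by (simp add: ennreal_power power_mult_distrib ennreal_mult)
  also have "\<dots> = ennreal ((norm v)\<^sup>2) * (\<integral>\<^sup>+s. ennreal ((ngrad \<eta> (x + s *\<^sub>R v))\<^sup>2) \<partial>unit_cube)"
    by (rule nn_integral_cmult) measurable
  finally show ?thesis .
qed

lemma translation_L2_le:
  assumes \<eta>: "test_function \<Omega> \<eta>"
  shows "(\<integral>\<^sup>+x. ennreal ((\<eta> (x + v) - \<eta> x)\<^sup>2) \<partial>lborel) \<le> ennreal ((norm v)\<^sup>2) * nn_L2 (ngrad \<eta>)"
proof -
  note [measurable] = ngrad_measurable[OF \<eta>]
  have "(\<integral>\<^sup>+x. ennreal ((\<eta> (x + v) - \<eta> x)\<^sup>2) \<partial>lborel)
     \<le> (\<integral>\<^sup>+x. ennreal ((norm v)\<^sup>2) * (\<integral>\<^sup>+(s::real). ennreal ((ngrad \<eta> (x + s *\<^sub>R v))\<^sup>2) \<partial>unit_cube) \<partial>lborel)"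
    by (intro nn_integral_mono increment_sq_le[OF \<eta>])
  also have "\<dots> = ennreal ((norm v)\<^sup>2) * (\<integral>\<^sup>+x. (\<integral>\<^sup>+(s::real). ennreal ((ngrad \<eta> (x + s *\<^sub>R v))\<^sup>2) \<partial>unit_cube) \<partial>lborel)"
    by (rule nn_integral_cmult) measurable
  also have "(\<integral>\<^sup>+x. (\<integral>\<^sup>+(s::real). ennreal ((ngrad \<eta> (x + s *\<^sub>R v))\<^sup>2) \<partial>unit_cube) \<partial>lborel) = nn_L2 (ngrad \<eta>)"
    unfolding nn_L2_def by (rule nn_integral_cube_average) measurable
  finally show ?thesis .
qed

text \<open>A shift by 2R along a coordinate direction moves \<Omega> off itself, so on \<Omega> the
  function is minus its own increment and the translation estimate applies.\<close>

lemma Poincare_test_function: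
  fixes \<Omega> :: "'a::euclidean_space set"
  assumes \<eta>: "test_function \<Omega> \<eta>" and \<Omega>: "\<Omega> \<subseteq> ball 0 R" "R > 0"
  shows "nn_L2 \<eta> \<le> ennreal ((2 * R)\<^sup>2) * nn_L2 (ngrad \<eta>)"
proof -
  obtain e :: 'a where e: "e \<in> Basis" using nonempty_Basis by blast
  obtain K where K: "K \<subseteq> \<Omega>" "\<And>x. x \<notin> K \<Longrightarrow> \<eta> x = 0"
    using \<eta> by (rule test_function_support) blast
  have "ennreal ((\<eta> x)\<^sup>2) \<le> ennreal ((\<eta> (x + (2 * R) *\<^sub>R e) - \<eta> x)\<^sup>2)" for x
  proof (cases "x \<in> \<Omega>")
    case True
    then have "norm x < R" using \<Omega> by auto
    moreover have "2 * R \<le> norm (x + (2 * R) *\<^sub>R e) + norm x"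
      using norm_triangle_ineq4[of "x + (2 * R) *\<^sub>R e" x] e \<open>R > 0\<close> by simp
    ultimately have "x + (2 * R) *\<^sub>R e \<notin> \<Omega>" using \<Omega> by auto
    then show ?thesis using K by (metis diff_0 order_refl power2_minus subsetD)
  next
    case False
    then have "\<eta> x = 0" using K by blast
    then show ?thesis by simp
  qed
  then have "nn_L2 \<eta> \<le> (\<integral>\<^sup>+x. ennreal ((\<eta> (x + (2 * R) *\<^sub>R e) - \<eta> x)\<^sup>2) \<partial>lborel)"
    unfolding nn_L2_def by (rule nn_integral_mono)
  also have "\<dots> \<le> ennreal ((norm ((2 * R) *\<^sub>R e))\<^sup>2) * nn_L2 (ngrad \<eta>)"
    by (rule translation_L2_le[OF \<eta>])
  finally show ?thesis using e by simp
qed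

text \<open>
  Averages over the cube with corner \<open>x\<close> and side length \<open>r\<close>: every estimate below splits a test
  function into its average and the deviation from it.
\<close>

definition cube_average :: "real \<Rightarrow> ('a::euclidean_space \<Rightarrow> real) \<Rightarrow> 'a \<Rightarrow> real" where
  "cube_average r \<eta> x = (LINT y|unit_cube. \<eta> (x + r *\<^sub>R y))"

lemma integrable_cube_average:
  assumes "test_function \<Omega> \<eta>"
  shows "integrable unit_cube (\<lambda>y. \<eta> (x + r *\<^sub>R y))"
proof -
  obtain C where "\<And>x. \<bar>\<eta> x\<bar> \<le> C" using assms by (rule test_function_bounded) blast
  moreover note [measurable] = test_function_measurable[OF assms]
  ultimately show ?thesis
    by (intro unit_cube.integrable_const_bound[of _ C]) auto
qed

lemma cube_average_sq_le:
  assumes "test_function \<Omega> \<eta>"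
  shows "ennreal ((cube_average r \<eta> x)\<^sup>2) \<le> (\<integral>\<^sup>+y. ennreal ((\<eta> (x + r *\<^sub>R y))\<^sup>2) \<partial>unit_cube)"
proof -
  note [measurable] = test_function_measurable[OF assms]
  have "ennreal ((cube_average r \<eta> x)\<^sup>2) = (ennreal \<bar>cube_average r \<eta> x\<bar>)\<^sup>2" by (simp add: ennreal_power)
  also have "\<dots> \<le> (\<integral>\<^sup>+y. ennreal (norm (\<eta> (x + r *\<^sub>R y))) \<partial>unit_cube)\<^sup>2"
    unfolding cube_average_def real_norm_def[symmetric]
    by (intro power_mono integral_norm_bound_ennreal integrable_cube_average[OF assms]) simp
  also have "\<dots> \<le> (\<integral>\<^sup>+y. (ennreal (norm (\<eta> (x + r *\<^sub>R y))))\<^sup>2 \<partial>unit_cube)"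
    by (rule unit_cube.nn_integral_power2_le) measurable
  finally show ?thesis by (simp add: ennreal_power)
qed

lemma cube_average_deviation:
  fixes \<eta> :: "'a::euclidean_space \<Rightarrow> real"
  assumes "test_function \<Omega> \<eta>"
  shows "ennreal \<bar>\<eta> x - cube_average r \<eta> x\<bar> \<le> (\<integral>\<^sup>+y. ennreal \<bar>\<eta> (x + r *\<^sub>R y) - \<eta> x\<bar> \<partial>unit_cube)"
proof -
  have "cube_average r \<eta> x - \<eta> x = (LINT y|unit_cube. \<eta> (x + r *\<^sub>R y) - \<eta> x)"
    using integrable_cube_average[OF assms, of x r] unit_cube.prob_space[where 'a='a]
    by (simp add: cube_average_def)
  then have "\<bar>\<eta> x - cube_average r \<eta> x\<bar> = norm (LINT y|unit_cube. \<eta> (x + r *\<^sub>R y) - \<eta> x)"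
    by simp
  also have "ennreal \<dots> \<le> (\<integral>\<^sup>+y. ennreal (norm (\<eta> (x + r *\<^sub>R y) - \<eta> x)) \<partial>unit_cube)"
    by (rule integral_norm_bound_ennreal) (auto intro: integrable_cube_average[OF assms])
  finally show ?thesis by simp
qed

lemma cube_average_measurable:
  fixes \<eta> :: "'a::euclidean_space \<Rightarrow> real"
  assumes "test_function \<Omega> \<eta>"
  shows "cube_average r \<eta> \<in> borel_measurable borel"
proof -
  note [measurable] = test_function_measurable[OF assms]
  have "(\<lambda>x. LINT y|unit_cube. \<eta> (x + r *\<^sub>R y)) \<in> borel_measurable borel"
    by (rule unit_cube.borel_measurable_lebesgue_integral) measurable
  then show ?thesis by (simp add: cube_average_def[abs_def])
qed

text \<open>The deviation is an average of increments over shifts of length at most r n, each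
  controlled in L^2 by the gradient.\<close>

lemma cube_average_deviation_L2:
  fixes \<eta> :: "'a::euclidean_space \<Rightarrow> real"
  assumes \<eta>: "test_function \<Omega> \<eta>"
  shows "nn_L2 (\<lambda>x. \<eta> x - cube_average r \<eta> x) \<le> ennreal ((r * DIM('a))\<^sup>2) * nn_L2 (ngrad \<eta>)"
proof -
  note [measurable] = test_function_measurable[OF assms]
  have "nn_L2 (\<lambda>x. \<eta> x - cube_average r \<eta> x)
      \<le> (\<integral>\<^sup>+x. (\<integral>\<^sup>+y. ennreal ((\<eta> (x + r *\<^sub>R y) - \<eta> x)\<^sup>2) \<partial>unit_cube) \<partial>lborel)"
    unfolding nn_L2_def
  proof (rule nn_integral_mono)
    fix x
    have "ennreal ((\<eta> x - cube_average r \<eta> x)\<^sup>2) = (ennreal \<bar>\<eta> x - cube_average r \<eta> x\<bar>)\<^sup>2"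
      by (simp add: ennreal_power)
    also have "\<dots> \<le> (\<integral>\<^sup>+y. ennreal \<bar>\<eta> (x + r *\<^sub>R y) - \<eta> x\<bar> \<partial>unit_cube)\<^sup>2"
      by (intro power_mono cube_average_deviation[OF \<eta>]) simp
    also have "\<dots> \<le> (\<integral>\<^sup>+y. (ennreal \<bar>\<eta> (x + r *\<^sub>R y) - \<eta> x\<bar>)\<^sup>2 \<partial>unit_cube)"
      by (rule unit_cube.nn_integral_power2_le) measurable
    finally show "ennreal ((\<eta> x - cube_average r \<eta> x)\<^sup>2)
        \<le> (\<integral>\<^sup>+y. ennreal ((\<eta> (x + r *\<^sub>R y) - \<eta> x)\<^sup>2) \<partial>unit_cube)"
      by (simp add: ennreal_power)
  qed
  also have "\<dots> = (\<integral>\<^sup>+y. (\<integral>\<^sup>+x. ennreal ((\<eta> (x + r *\<^sub>R y) - \<eta> x)\<^sup>2) \<partial>lborel) \<partial>unit_cube)"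
    by (rule lborel_cube.Fubini'[symmetric]) measurable
  also have "\<dots> \<le> (\<integral>\<^sup>+(y::'a). ennreal ((r * DIM('a))\<^sup>2) * nn_L2 (ngrad \<eta>) \<partial>unit_cube)"
  proof (rule nn_integral_mono_AE)
    show "AE y::'a in unit_cube. (\<integral>\<^sup>+x. ennreal ((\<eta> (x + r *\<^sub>R y) - \<eta> x)\<^sup>2) \<partial>lborel)
        \<le> ennreal ((r * DIM('a))\<^sup>2) * nn_L2 (ngrad \<eta>)"
      using AE_unit_cube
    proof eventually_elim
      case (elim y)
      have "(norm (r *\<^sub>R y))\<^sup>2 \<le> (r * DIM('a))\<^sup>2"
        using power_mono[OF mult_left_mono[OF norm_unit_cube[OF elim], of "\<bar>r\<bar>"], of 2]
        by (simp add: power_mult_distrib)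
      then show ?case
        by (intro order_trans[OF translation_L2_le[OF \<eta>]] mult_right_mono ennreal_leI) auto
    qed
  qed
  also have "\<dots> = ennreal ((r * DIM('a))\<^sup>2) * nn_L2 (ngrad \<eta>)"
    by (simp add: unit_cube.emeasure_space_1[simplified])
  finally show ?thesis .
qed

lemma nn_L2_eq_norm:
  assumes "test_function \<Omega> \<eta>"
  shows "nn_L2 \<eta> = ennreal ((norm (abs_L2 \<eta>))\<^sup>2)"
  using ennreal_norm_abs_L2[OF square_integrable_test_function[OF assms]] test_function_measurable[OF assms]
  by (simp add: nn_L2_def nn_integral_completion)

lemma nn_L2_ngrad_eq_norm:
  assumes "test_function \<Omega> \<eta>"
  shows "nn_L2 (ngrad \<eta>) = ennreal ((norm (abs_L2 (grad \<eta>)))\<^sup>2)"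
proof -
  note [measurable] = ngrad_measurable[OF assms]
  show ?thesis
    unfolding ennreal_norm_abs_L2[OF square_integrable_grad[OF assms]] nn_L2_def
    by (subst nn_integral_completion) auto
qed

text \<open>
  Along the path \<open>x + s\<^sup>4 r y\<close> the fourth power of the speed \<open>4 s\<^sup>3\<close> compensates the singularity
  \<open>s\<^bsup>-4n\<^esup>\<close> of the squared sup bound for averages over cubes of side length \<open>s\<^sup>4 r\<close>, exactly as
  long as \<open>n \<le> 3\<close>.
\<close>

lemma cube_average_deviation_L4:
  fixes \<eta> :: "'a::euclidean_space \<Rightarrow> real"
  assumes \<eta>: "test_function \<Omega> \<eta>" and r: "0 < r" "r \<le> 1" and n: "DIM('a) \<le> 3"
  shows "(\<integral>\<^sup>+x. ennreal ((\<eta> x - cube_average r \<eta> x) ^ 4) \<partial>lborel)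
    \<le> ennreal (256 * real DIM('a) ^ 4 * r) * (nn_L2 (ngrad \<eta>))\<^sup>2"
proof -
  note [measurable] = ngrad_measurable[OF \<eta>] test_function_measurable[OF \<eta>]
  let ?N = "nn_L2 (ngrad \<eta>)"
  let ?K = "256 * real DIM('a) ^ 4 * r"
  define A where "A s x = (\<integral>\<^sup>+y. ennreal (ngrad \<eta> (x + (s ^ 4 * r) *\<^sub>R y)) \<partial>unit_cube)" for s :: real and x
  define B where "B s x = (\<integral>\<^sup>+y. ennreal ((ngrad \<eta> (x + (s ^ 4 * r) *\<^sub>R y))\<^sup>2) \<partial>unit_cube)" for s :: real and x
  define k where "k s = 4 * \<bar>s\<bar> ^ 3 * (real DIM('a) * r)" for s :: real
  have k: "k s \<ge> 0" for s using r by (simp add: k_def)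
  have [measurable]: "k \<in> borel_measurable borel" unfolding k_def by measurable
  have [measurable]: "(\<lambda>(s, x). A s x) \<in> borel_measurable (borel \<Otimes>\<^sub>M borel)"
    "(\<lambda>(s, x). B s x) \<in> borel_measurable (borel \<Otimes>\<^sub>M borel)"
    unfolding A_def B_def by measurable
  \<comment> \<open>Averaging the path estimate over y and exchanging the integrals turns the
    deviation into an integral over s of gradient averages on cubes of side
    \<open>s ^ 4 * r\<close>.\<close>
  have 1: "ennreal \<bar>\<eta> x - cube_average r \<eta> x\<bar> \<le> (\<integral>\<^sup>+s. ennreal (k s) * A s x \<partial>unit_cube)" for x
  proof -
    have "ennreal \<bar>\<eta> x - cube_average r \<eta> x\<bar> \<le> (\<integral>\<^sup>+y. ennreal \<bar>\<eta> (x + r *\<^sub>R y) - \<eta> x\<bar> \<partial>unit_cube)"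
      by (rule cube_average_deviation[OF \<eta>])
    also have "\<dots> \<le> (\<integral>\<^sup>+y. (\<integral>\<^sup>+s. ennreal (k s * ngrad \<eta> (x + (s ^ 4 * r) *\<^sub>R y)) \<partial>unit_cube) \<partial>unit_cube)"
    proof (rule nn_integral_mono_AE)
      show "AE y in unit_cube. ennreal \<bar>\<eta> (x + r *\<^sub>R y) - \<eta> x\<bar>
          \<le> (\<integral>\<^sup>+s. ennreal (k s * ngrad \<eta> (x + (s ^ 4 * r) *\<^sub>R y)) \<partial>unit_cube)"
        using AE_unit_cube
      proof eventually_elim
        case (elim y)
        have nv: "norm (r *\<^sub>R y) \<le> real DIM('a) * r"
          using mult_left_mono[OF norm_unit_cube[OF elim], of r] r by (simp add: mult.commute)
        have "ennreal \<bar>\<eta> (x + r *\<^sub>R y) - \<eta> x\<bar> \<le>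
            (\<integral>\<^sup>+s. ennreal (real 4 * s ^ (4 - 1) * norm (r *\<^sub>R y) * ngrad \<eta> (x + s ^ 4 *\<^sub>R r *\<^sub>R y)) \<partial>unit_cube)"
          by (rule increment_le_path_integral[OF \<eta>]) simp
        also have "\<dots> \<le> (\<integral>\<^sup>+s. ennreal (k s * ngrad \<eta> (x + (s ^ 4 * r) *\<^sub>R y)) \<partial>unit_cube)"
        proof (intro nn_integral_mono ennreal_leI)
          fix s :: real
          have "s ^ 3 * norm (r *\<^sub>R y) \<le> \<bar>s\<bar> ^ 3 * (real DIM('a) * r)"
            by (intro mult_mono nv) (auto simp flip: power_abs)
          then have "4 * (s ^ 3 * norm (r *\<^sub>R y)) * ngrad \<eta> (x + (s ^ 4 * r) *\<^sub>R y)
              \<le> 4 * (\<bar>s\<bar> ^ 3 * (real DIM('a) * r)) * ngrad \<eta> (x + (s ^ 4 * r) *\<^sub>R y)"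
            by (intro mult_right_mono mult_left_mono) auto
          then show "real 4 * s ^ (4 - 1) * norm (r *\<^sub>R y) * ngrad \<eta> (x + s ^ 4 *\<^sub>R r *\<^sub>R y)
              \<le> k s * ngrad \<eta> (x + (s ^ 4 * r) *\<^sub>R y)"
            by (simp only: k_def) (simp add: mult_ac del: norm_scaleR)
        qed
        finally show ?case .
      qed
    qed
    also have "\<dots> = (\<integral>\<^sup>+s. (\<integral>\<^sup>+y. ennreal (k s * ngrad \<eta> (x + (s ^ 4 * r) *\<^sub>R y)) \<partial>unit_cube) \<partial>unit_cube)"
      by (rule cube_cube.Fubini') measurable
    also have "\<dots> = (\<integral>\<^sup>+s. ennreal (k s) * A s x \<partial>unit_cube)"
      by (simp add: A_def ennreal_mult k nn_integral_cmult)
    finally show ?thesis .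
  qed
  have 2: "ennreal ((\<eta> x - cube_average r \<eta> x) ^ 4) \<le> ennreal ?K * ?N * (\<integral>\<^sup>+s. B s x \<partial>unit_cube)" for x
  proof -
    have "ennreal ((\<eta> x - cube_average r \<eta> x) ^ 4) = (ennreal \<bar>\<eta> x - cube_average r \<eta> x\<bar>) ^ 4"
      by (simp add: ennreal_power)
    also have "\<dots> \<le> (\<integral>\<^sup>+s. ennreal (k s) * A s x \<partial>unit_cube) ^ 4"
      by (intro power_mono 1) simp
    also have "\<dots> \<le> (\<integral>\<^sup>+s. (ennreal (k s) * A s x) ^ 4 \<partial>unit_cube)"
      by (rule unit_cube.nn_integral_power4_le) measurable
    also have "\<dots> \<le> (\<integral>\<^sup>+s. ennreal ?K * ?N * B s x \<partial>unit_cube)"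
    proof (rule nn_integral_mono_AE)
      show "AE s in unit_cube. (ennreal (k s) * A s x) ^ 4 \<le> ennreal ?K * ?N * B s x"
        using AE_unit_cube
      proof eventually_elim
        case (elim s)
        then have s: "0 \<le> s" "s \<le> 1" by auto
        have "A s x ^ 4 = ((A s x)\<^sup>2)\<^sup>2" by (simp flip: power_mult)
        also have "\<dots> \<le> (B s x)\<^sup>2"
          unfolding A_def B_def
          by (intro power_mono order_trans[OF unit_cube.nn_integral_power2_le]) (auto simp: ennreal_power)
        finally have AB: "A s x ^ 4 \<le> B s x * B s x" by (simp add: power2_eq_square)
        show ?case
        proof (cases "s = 0")
          case True
          then show ?thesis by (simp add: k_def)
        next
          case False
          then have sr: "0 < s ^ 4 * r" "s ^ 4 * r \<le> 1"
            using s r by (auto intro: mult_le_one power_le_one)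
          \<comment> \<open>Here 4^4 = 256 and (s^3)^4 = (s^4)^3. The exponent 3 may then be lowered
            to n because \<open>s ^ 4 * r\<close> is at most 1.\<close>
          have "k s ^ 4 = ?K * (s ^ 4 * r) ^ 3"
            using s by (simp add: k_def power_mult_distrib flip: power_mult) (simp add: eval_nat_numeral)
          also have "\<dots> \<le> ?K * (s ^ 4 * r) ^ DIM('a)"
            using sr n r by (intro mult_left_mono power_decreasing) auto
          finally have "ennreal (k s ^ 4) \<le> ennreal ?K * ennreal ((s ^ 4 * r) ^ DIM('a))"
            using sr r by (subst ennreal_mult[symmetric]) (auto intro: ennreal_leI)
          then have "ennreal (k s ^ 4) * (B s x * B s x)
              \<le> ennreal ?K * ennreal ((s ^ 4 * r) ^ DIM('a)) * (B s x * B s x)"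
            by (rule mult_right_mono) simp
          also have "\<dots> = ennreal ?K * (ennreal ((s ^ 4 * r) ^ DIM('a)) * B s x) * B s x"
            by (simp add: mult_ac)
          \<comment> \<open>One factor \<open>B s x\<close> is bounded by the global gradient
            integral, which uses up the power of the side length. The other is kept, so that
            integration over x yields that integral once more.\<close>
          also have "\<dots> \<le> ennreal ?K * ?N * B s x"
            unfolding B_def nn_L2_def
            by (intro mult_right_mono mult_left_mono nn_integral_cube_le sr) auto
          finally show ?thesis
            using mult_left_mono[OF AB, of "ennreal (k s ^ 4)"] k
            by (simp add: power_mult_distrib ennreal_power)
        qed
      qed
    qed
    also have "\<dots> = ennreal ?K * ?N * (\<integral>\<^sup>+s. B s x \<partial>unit_cube)"
      by (rule nn_integral_cmult) measurable
    finally show ?thesis .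
  qed
  have "(\<integral>\<^sup>+x. ennreal ((\<eta> x - cube_average r \<eta> x) ^ 4) \<partial>lborel)
      \<le> (\<integral>\<^sup>+x. ennreal ?K * ?N * (\<integral>\<^sup>+s. B s x \<partial>unit_cube) \<partial>lborel)"
    by (rule nn_integral_mono) (rule 2)
  also have "\<dots> = ennreal ?K * ?N * (\<integral>\<^sup>+x. (\<integral>\<^sup>+s. B s x \<partial>unit_cube) \<partial>lborel)"
    by (rule nn_integral_cmult) measurable
  also have "(\<integral>\<^sup>+x. (\<integral>\<^sup>+s. B s x \<partial>unit_cube) \<partial>lborel) = (\<integral>\<^sup>+s. (\<integral>\<^sup>+x. B s x \<partial>lborel) \<partial>unit_cube)"
    by (rule lborel_cube.Fubini'[symmetric]) measurable
  also have "\<dots> = (\<integral>\<^sup>+(s::real). ?N \<partial>unit_cube)"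
    unfolding B_def nn_L2_def by (intro nn_integral_cong nn_integral_cube_average) measurable
  also have "\<dots> = ?N" by (simp add: unit_cube.emeasure_space_1[simplified])
  finally show ?thesis by (simp add: power2_eq_square mult_ac)
qed

section \<open>Bounds for cube averages and compactness\<close>

lemma cube_average_sup_le:
  fixes \<eta> :: "'a::euclidean_space \<Rightarrow> real"
  assumes \<eta>: "test_function \<Omega> \<eta>" and r: "0 < r"
  shows "ennreal (r ^ DIM('a)) * ennreal ((cube_average r \<eta> x)\<^sup>2) \<le> nn_L2 \<eta>"
proof -
  note [measurable] = test_function_measurable[OF \<eta>]
  have "ennreal (r ^ DIM('a)) * ennreal ((cube_average r \<eta> x)\<^sup>2)
      \<le> ennreal (r ^ DIM('a)) * (\<integral>\<^sup>+y. ennreal ((\<eta> (x + r *\<^sub>R y))\<^sup>2) \<partial>unit_cube)"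
    by (intro mult_left_mono cube_average_sq_le[OF \<eta>]) simp
  also have "\<dots> \<le> nn_L2 \<eta>"
    unfolding nn_L2_def by (rule nn_integral_cube_le[OF _ r]) measurable
  finally show ?thesis .
qed

lemma cube_average_L2_le:
  fixes \<eta> :: "'a::euclidean_space \<Rightarrow> real"
  assumes \<eta>: "test_function \<Omega> \<eta>"
  shows "nn_L2 (cube_average r \<eta>) \<le> nn_L2 \<eta>"
proof -
  note [measurable] = test_function_measurable[OF \<eta>]
  have "nn_L2 (cube_average r \<eta>) \<le> (\<integral>\<^sup>+x. (\<integral>\<^sup>+y. ennreal ((\<eta> (x + r *\<^sub>R y))\<^sup>2) \<partial>unit_cube) \<partial>lborel)"
    unfolding nn_L2_def by (intro nn_integral_mono cube_average_sq_le[OF \<eta>])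
  also have "\<dots> = nn_L2 \<eta>"
    unfolding nn_L2_def by (rule nn_integral_cube_average) measurable
  finally show ?thesis .
qed

text \<open>Of the four factors two are estimated in the sup norm, which costs r^(-n), and two in
  L^2.\<close>

lemma cube_average_L4_le:
  fixes \<eta> :: "'a::euclidean_space \<Rightarrow> real"
  assumes \<eta>: "test_function \<Omega> \<eta>" and r: "0 < r"
  shows "ennreal (r ^ DIM('a)) * (\<integral>\<^sup>+x. ennreal ((cube_average r \<eta> x) ^ 4) \<partial>lborel) \<le> (nn_L2 \<eta>)\<^sup>2"
proof -
  note [measurable] = cube_average_measurable[OF \<eta>, of r]
  have "ennreal (r ^ DIM('a)) * (\<integral>\<^sup>+x. ennreal ((cube_average r \<eta> x) ^ 4) \<partial>lborel)
      = (\<integral>\<^sup>+x. (ennreal (r ^ DIM('a)) * ennreal ((cube_average r \<eta> x)\<^sup>2)) * ennreal ((cube_average r \<eta> x)\<^sup>2) \<partial>lborel)"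
    by (subst nn_integral_cmult[symmetric])
      (auto intro!: nn_integral_cong simp: mult.assoc ennreal_mult[symmetric] simp flip: power_add)
  also have "\<dots> \<le> (\<integral>\<^sup>+x. nn_L2 \<eta> * ennreal ((cube_average r \<eta> x)\<^sup>2) \<partial>lborel)"
    by (intro nn_integral_mono mult_right_mono cube_average_sup_le[OF \<eta> r]) simp
  also have "\<dots> = nn_L2 \<eta> * nn_L2 (cube_average r \<eta>)"
    unfolding nn_L2_def by (rule nn_integral_cmult) measurable
  also have "\<dots> \<le> nn_L2 \<eta> * nn_L2 \<eta>"
    by (intro mult_left_mono cube_average_L2_le[OF \<eta>]) simp
  finally show ?thesis by (simp add: power2_eq_square)
qed

lemma power4_add_le: "(a + b) ^ 4 \<le> 8 * (a ^ 4 + b ^ 4)" for a b :: real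
proof -
  have sq: "(x + y)\<^sup>2 \<le> 2 * (x\<^sup>2 + y\<^sup>2)" for x y :: real
    using sum_squares_bound[of x y] by (simp add: power2_sum)
  have "(a + b) ^ 4 = ((a + b)\<^sup>2)\<^sup>2" by (simp flip: power_mult)
  also have "\<dots> \<le> (2 * (a\<^sup>2 + b\<^sup>2))\<^sup>2" by (intro power_mono sq) simp
  also have "\<dots> \<le> 4 * (2 * ((a\<^sup>2)\<^sup>2 + (b\<^sup>2)\<^sup>2))" using sq[of "a\<^sup>2" "b\<^sup>2"] by (simp only: power_mult_distrib) simp
  finally show ?thesis by (simp flip: power_mult)
qed

text \<open>The side length r is the interpolation parameter: a small r makes the gradient term
  small at the expense of r^(-n) in front of the L^2 norm. The constant 2048 is 256 from the
  deviation times 8 from splitting a fourth power.\<close>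

lemma L4_test_function:
  fixes \<eta> :: "'a::euclidean_space \<Rightarrow> real"
  assumes \<eta>: "test_function \<Omega> \<eta>" and r: "0 < r" "r \<le> 1" and n: "DIM('a) \<le> 3"
  shows "(\<integral>\<^sup>+x. ennreal ((\<eta> x) ^ 4) \<partial>lborel)
    \<le> ennreal (2048 * real DIM('a) ^ 4 * r * (norm (abs_L2 (grad \<eta>))) ^ 4 + 8 / r ^ DIM('a) * (norm (abs_L2 \<eta>)) ^ 4)"
proof -
  note [measurable] = cube_average_measurable[OF \<eta>, of r] test_function_measurable[OF \<eta>]
  let ?a = "norm (abs_L2 (grad \<eta>))" and ?b = "norm (abs_L2 \<eta>)" and ?M = "cube_average r \<eta>"
  have sq: "(ennreal (c\<^sup>2))\<^sup>2 = ennreal (c ^ 4)" for c by (simp add: ennreal_power flip: power_mult)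
  have "(\<integral>\<^sup>+x. ennreal ((\<eta> x) ^ 4) \<partial>lborel)
      \<le> (\<integral>\<^sup>+x. 8 * ennreal ((\<eta> x - ?M x) ^ 4) + 8 * ennreal ((?M x) ^ 4) \<partial>lborel)"
  proof (rule nn_integral_mono)
    fix x
    have "ennreal ((\<eta> x) ^ 4) \<le> ennreal (8 * (\<eta> x - ?M x) ^ 4 + 8 * (?M x) ^ 4)"
      using power4_add_le[of "\<eta> x - ?M x" "?M x"] by (intro ennreal_leI) simp
    then show "ennreal ((\<eta> x) ^ 4) \<le> 8 * ennreal ((\<eta> x - ?M x) ^ 4) + 8 * ennreal ((?M x) ^ 4)"
      by (simp add: ennreal_plus ennreal_mult)
  qed
  also have "\<dots> = 8 * (\<integral>\<^sup>+x. ennreal ((\<eta> x - ?M x) ^ 4) \<partial>lborel) + 8 * (\<integral>\<^sup>+x. ennreal ((?M x) ^ 4) \<partial>lborel)"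
    by (simp add: nn_integral_add nn_integral_cmult)
  finally have main: "(\<integral>\<^sup>+x. ennreal ((\<eta> x) ^ 4) \<partial>lborel)
      \<le> 8 * (\<integral>\<^sup>+x. ennreal ((\<eta> x - ?M x) ^ 4) \<partial>lborel) + 8 * (\<integral>\<^sup>+x. ennreal ((?M x) ^ 4) \<partial>lborel)" .
  have I1: "(\<integral>\<^sup>+x. ennreal ((\<eta> x - ?M x) ^ 4) \<partial>lborel) \<le> ennreal (256 * real DIM('a) ^ 4 * r * ?a ^ 4)"
    using cube_average_deviation_L4[OF \<eta> r n] r
    by (simp add: nn_L2_ngrad_eq_norm[OF \<eta>] sq ennreal_mult)
  have I2: "(\<integral>\<^sup>+x. ennreal ((?M x) ^ 4) \<partial>lborel) \<le> ennreal (1 / r ^ DIM('a) * ?b ^ 4)"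
  proof -
    have "(\<integral>\<^sup>+x. ennreal ((?M x) ^ 4) \<partial>lborel)
        = ennreal (1 / r ^ DIM('a)) * (ennreal (r ^ DIM('a)) * (\<integral>\<^sup>+x. ennreal ((?M x) ^ 4) \<partial>lborel))"
      using r by (simp add: mult.assoc[symmetric] ennreal_mult[symmetric])
    also have "\<dots> \<le> ennreal (1 / r ^ DIM('a)) * ennreal (?b ^ 4)"
      using cube_average_L4_le[OF \<eta> r(1)] by (intro mult_left_mono) (simp_all add: nn_L2_eq_norm[OF \<eta>] sq)
    also have "\<dots> = ennreal (1 / r ^ DIM('a) * ?b ^ 4)"
      using r by (intro ennreal_mult[symmetric]) auto
    finally show ?thesis .
  qed
  note main
  also have "8 * (\<integral>\<^sup>+x. ennreal ((\<eta> x - ?M x) ^ 4) \<partial>lborel) + 8 * (\<integral>\<^sup>+x. ennreal ((?M x) ^ 4) \<partial>lborel)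
      \<le> 8 * ennreal (256 * real DIM('a) ^ 4 * r * ?a ^ 4) + 8 * ennreal (1 / r ^ DIM('a) * ?b ^ 4)"
    by (intro add_mono mult_left_mono I1 I2) auto
  also have "\<dots> = ennreal (8 * (256 * real DIM('a) ^ 4 * r * ?a ^ 4) + 8 * (1 / r ^ DIM('a) * ?b ^ 4))"
  proof -
    have "8 * ennreal x = ennreal (8 * x)" if "x \<ge> 0" for x using that by (simp add: ennreal_mult)
    then show ?thesis using r by (subst ennreal_plus) simp_all
  qed
  finally show ?thesis by (simp add: algebra_simps)
qed

text \<open>The increment of the average is a path integral of gradients. Integrating over the cube
  first and along the path last leaves r^(-n) times a global integral, so averages of functions with
  bounded gradient norm are equicontinuous.\<close>

lemma cube_average_lipschitz:
  fixes \<eta> :: "'a::euclidean_space \<Rightarrow> real"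
  assumes \<eta>: "test_function \<Omega> \<eta>" and r: "0 < r"
  shows "r ^ DIM('a) * (cube_average r \<eta> x' - cube_average r \<eta> x)\<^sup>2
    \<le> (norm (x' - x))\<^sup>2 * (norm (abs_L2 (grad \<eta>)))\<^sup>2"
proof -
  note [measurable] = ngrad_measurable[OF \<eta>] test_function_measurable[OF \<eta>]
  define v where "v = x' - x"
  let ?N = "nn_L2 (ngrad \<eta>)"
  have "cube_average r \<eta> x' - cube_average r \<eta> x = (LINT y|unit_cube. \<eta> (x' + r *\<^sub>R y) - \<eta> (x + r *\<^sub>R y))"
    unfolding cube_average_def
    by (rule Bochner_Integration.integral_diff[symmetric]) (rule integrable_cube_average[OF \<eta>])+
  then have "ennreal ((cube_average r \<eta> x' - cube_average r \<eta> x)\<^sup>2)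
      = (ennreal (norm (LINT y|unit_cube. \<eta> (x' + r *\<^sub>R y) - \<eta> (x + r *\<^sub>R y))))\<^sup>2"
    by (simp add: ennreal_power)
  also have "\<dots> \<le> (\<integral>\<^sup>+y. ennreal (norm (\<eta> (x' + r *\<^sub>R y) - \<eta> (x + r *\<^sub>R y))) \<partial>unit_cube)\<^sup>2"
    by (intro power_mono integral_norm_bound_ennreal Bochner_Integration.integrable_diff integrable_cube_average[OF \<eta>]) simp
  also have "\<dots> \<le> (\<integral>\<^sup>+y. (ennreal (norm (\<eta> (x' + r *\<^sub>R y) - \<eta> (x + r *\<^sub>R y))))\<^sup>2 \<partial>unit_cube)"
    by (rule unit_cube.nn_integral_power2_le) measurable
  also have "\<dots> = (\<integral>\<^sup>+y. ennreal ((\<eta> ((x + r *\<^sub>R y) + v) - \<eta> (x + r *\<^sub>R y))\<^sup>2) \<partial>unit_cube)"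
  proof -
    have "x + r *\<^sub>R y + v = x' + r *\<^sub>R y" for y by (simp add: v_def)
    then show ?thesis by (simp only: real_norm_def ennreal_power abs_ge_zero power2_abs)
  qed
  also have "\<dots> \<le> (\<integral>\<^sup>+y. ennreal ((norm v)\<^sup>2) * (\<integral>\<^sup>+(s::real). ennreal ((ngrad \<eta> ((x + r *\<^sub>R y) + s *\<^sub>R v))\<^sup>2) \<partial>unit_cube) \<partial>unit_cube)"
    by (intro nn_integral_mono increment_sq_le[OF \<eta>])
  also have "\<dots> = ennreal ((norm v)\<^sup>2) * (\<integral>\<^sup>+y. (\<integral>\<^sup>+(s::real). ennreal ((ngrad \<eta> ((x + r *\<^sub>R y) + s *\<^sub>R v))\<^sup>2) \<partial>unit_cube) \<partial>unit_cube)"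
    by (rule nn_integral_cmult) measurable
  also have "(\<integral>\<^sup>+y. (\<integral>\<^sup>+(s::real). ennreal ((ngrad \<eta> ((x + r *\<^sub>R y) + s *\<^sub>R v))\<^sup>2) \<partial>unit_cube) \<partial>unit_cube)
      = (\<integral>\<^sup>+(s::real). (\<integral>\<^sup>+y. ennreal ((ngrad \<eta> ((x + r *\<^sub>R y) + s *\<^sub>R v))\<^sup>2) \<partial>unit_cube) \<partial>unit_cube)"
    by (rule cube_cube.Fubini') measurable
  finally have le: "ennreal ((cube_average r \<eta> x' - cube_average r \<eta> x)\<^sup>2) \<le> ennreal ((norm v)\<^sup>2) *
      (\<integral>\<^sup>+(s::real). (\<integral>\<^sup>+y. ennreal ((ngrad \<eta> ((x + r *\<^sub>R y) + s *\<^sub>R v))\<^sup>2) \<partial>unit_cube) \<partial>unit_cube)" .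
  have "ennreal (r ^ DIM('a)) * (\<integral>\<^sup>+(s::real). (\<integral>\<^sup>+y. ennreal ((ngrad \<eta> ((x + r *\<^sub>R y) + s *\<^sub>R v))\<^sup>2) \<partial>unit_cube) \<partial>unit_cube)
     = (\<integral>\<^sup>+(s::real). ennreal (r ^ DIM('a)) * (\<integral>\<^sup>+y. ennreal ((ngrad \<eta> ((x + s *\<^sub>R v) + r *\<^sub>R y))\<^sup>2) \<partial>unit_cube) \<partial>unit_cube)"
    by (subst nn_integral_cmult[symmetric]) (auto simp: add_ac)
  also have "\<dots> \<le> (\<integral>\<^sup>+(s::real). ?N \<partial>unit_cube)"
    unfolding nn_L2_def by (intro nn_integral_mono nn_integral_cube_le r) measurable
  also have "\<dots> = ?N" by (simp add: unit_cube.emeasure_space_1[simplified])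
  finally have "ennreal ((norm v)\<^sup>2) * (ennreal (r ^ DIM('a)) * (\<integral>\<^sup>+(s::real). (\<integral>\<^sup>+y. ennreal ((ngrad \<eta> ((x + r *\<^sub>R y) + s *\<^sub>R v))\<^sup>2) \<partial>unit_cube) \<partial>unit_cube))
      \<le> ennreal ((norm v)\<^sup>2) * ?N" by (rule mult_left_mono) simp
  with mult_left_mono[OF le, of "ennreal (r ^ DIM('a))"]
  have "ennreal (r ^ DIM('a)) * ennreal ((cube_average r \<eta> x' - cube_average r \<eta> x)\<^sup>2) \<le> ennreal ((norm v)\<^sup>2) * ?N"
    by (simp add: mult_ac)
  then show ?thesis
    using r by (simp add: nn_L2_ngrad_eq_norm[OF \<eta>] v_def ennreal_mult[symmetric])
qed

text \<open>The representing element is the indicator of the cube divided by its volume. It is fixed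
  before \<Omega> and \<eta>, so finitely many cubes give functionals that serve all test functions
  at once.\<close>

lemma cube_average_eq_inner:
  fixes x :: "'a::euclidean_space"
  assumes r: "0 < r"
  obtains h where "\<And>\<Omega> \<eta>. test_function \<Omega> \<eta> \<Longrightarrow> cube_average r \<eta> x = abs_L2 \<eta> \<bullet> h"
proof -
  let ?Q = "cbox 0 One :: 'a set"
  define J where "J z = indicat_real ?Q ((z - x) /\<^sub>R r)" for z
  have J: "J z = indicator ((\<lambda>y. x + r *\<^sub>R y) ` ?Q) z" for z
  proof -
    have "(z - x) /\<^sub>R r \<in> ?Q \<longleftrightarrow> z \<in> (\<lambda>y. x + r *\<^sub>R y) ` ?Q"
    proof
      assume "(z - x) /\<^sub>R r \<in> ?Q"
      moreover have "z = x + r *\<^sub>R ((z - x) /\<^sub>R r)" using r by simp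
      ultimately show "z \<in> (\<lambda>y. x + r *\<^sub>R y) ` ?Q" by (rule rev_image_eqI)
    next
      assume "z \<in> (\<lambda>y. x + r *\<^sub>R y) ` ?Q"
      then obtain y where "y \<in> ?Q" "z = x + r *\<^sub>R y" by blast
      then show "(z - x) /\<^sub>R r \<in> ?Q" using r by simp
    qed
    then show ?thesis by (simp add: J_def indicator_def)
  qed
  have cpt: "compact ((\<lambda>y. x + r *\<^sub>R y) ` ?Q)"
    by (intro compact_continuous_image continuous_intros compact_cbox)
  have si: "square_integrable J"
    unfolding J[abs_def] by (intro square_integrable_indicator lmeasurable_compact cpt)
  have [measurable]: "J \<in> borel_measurable borel" unfolding J_def by measurable
  show ?thesis
  proof (rule that)
    fix \<Omega> and \<eta> :: "'a \<Rightarrow> real" assume \<eta>: "test_function \<Omega> \<eta>"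
    note [measurable] = test_function_measurable[OF \<eta>]
    have uc: "unit_cube = density lborel (\<lambda>y::'a. ennreal (indicator ?Q y))"
      by (simp add: unit_cube_def uniform_measure_def emeasure_lborel_unit_cube divide_ennreal_def ennreal_indicator)
    have "abs_L2 \<eta> \<bullet> ((1 / r ^ DIM('a)) *\<^sub>R abs_L2 J) = 1 / r ^ DIM('a) * (LINT z|lebesgue. \<eta> z * J z)"
      by (simp add: inner_abs_L2[OF square_integrable_test_function[OF \<eta>] si])
    also have "(LINT z|lebesgue. \<eta> z * J z) = (LINT z|lborel. \<eta> z * J z)"
      by (rule integral_completion) measurable
    also have "\<dots> = (LINT z|density (distr lborel borel (\<lambda>y. x + r *\<^sub>R y)) (\<lambda>_. ennreal (\<bar>r\<bar> ^ DIM('a))). \<eta> z * J z)"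
      using lborel_affine[of r x] r by simp
    also have "\<dots> = r ^ DIM('a) * (LINT y|lborel. \<eta> (x + r *\<^sub>R y) * J (x + r *\<^sub>R y))"
      using r by (subst integral_density) (auto simp: integral_distr)
    also have "(LINT y|lborel. \<eta> (x + r *\<^sub>R y) * J (x + r *\<^sub>R y)) = cube_average r \<eta> x"
      unfolding cube_average_def uc using r
      by (subst integral_density) (auto simp: J_def mult.commute)
    finally show "cube_average r \<eta> x = abs_L2 \<eta> \<bullet> ((1 / r ^ DIM('a)) *\<^sub>R abs_L2 J)"
      using r by simp
  qed
qed

text \<open>A quantitative Rellich theorem. A function is close in L^2 to its cube average; averages
  are Lipschitz with a constant governed by the gradient, so on a bounded domain their values at a
  finite net determine them up to a small error, and these values are inner products.\<close>

lemma finite_rank_approximation_test_function: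
  fixes \<Omega> :: "'a::euclidean_space set"
  assumes \<Omega>: "open \<Omega>" "bounded \<Omega>" and \<epsilon>: "\<epsilon> > 0"
  obtains F C where "finite F" "C \<ge> 0" "\<And>\<eta>. test_function \<Omega> \<eta> \<Longrightarrow>
    (norm (abs_L2 \<eta>))\<^sup>2 \<le> \<epsilon> * (norm (abs_L2 (grad \<eta>)))\<^sup>2 + C * (\<Sum>h\<in>F. (abs_L2 \<eta> \<bullet> h)\<^sup>2)"
proof -
  define n where "n = real DIM('a)"
  define m where "m = measure lborel \<Omega>"
  have n: "n \<ge> 1" by (simp add: n_def Suc_leI)
  have m: "m \<ge> 0" by (simp add: m_def)
  \<comment> \<open>This side length lets the deviation from the average take half of
    \<epsilon>.\<close>
  define r where "r = sqrt \<epsilon> / (2 * n)"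
  have r: "r > 0" using \<epsilon> n by (simp add: r_def)
  have rn: "2 * (r * n)\<^sup>2 = \<epsilon> / 2" using \<epsilon> n by (simp add: r_def power_divide power_mult_distrib)
  \<comment> \<open>The mesh of the net is set so that the Lipschitz error takes the other half; m +
    1 in place of m covers a domain of measure zero.\<close>
  define \<rho> where "\<rho> = sqrt (\<epsilon> * r ^ DIM('a) / (8 * (m + 1)))"
  have \<rho>: "\<rho> > 0" using \<epsilon> r m by (simp add: \<rho>_def)
  have \<rho>2: "4 * m * \<rho>\<^sup>2 / r ^ DIM('a) \<le> \<epsilon> / 2"
  proof -
    have "4 * m * \<rho>\<^sup>2 / r ^ DIM('a) = \<epsilon> / 2 * (m / (m + 1))"
    proof -
      have \<rho>_sq: "\<rho>\<^sup>2 = \<epsilon> * r ^ DIM('a) / (8 * (m + 1))" using \<epsilon> r m by (simp add: \<rho>_def)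
      moreover have "4 * m * (\<epsilon> * p / (8 * q)) / p = \<epsilon> / 2 * (m / q)" if "p > 0" "q > 0" for p q
        using that by (simp add: field_simps)
      ultimately show ?thesis unfolding \<rho>_sq using r m by (metis add_nonneg_pos zero_less_one zero_less_power)
    qed
    also have "\<dots> \<le> \<epsilon> / 2 * 1" using \<epsilon> m by (intro mult_left_mono) auto
    finally show ?thesis by simp
  qed
  obtain X where X: "finite X" "\<Omega> \<subseteq> (\<Union>x\<in>X. ball x \<rho>)"
  proof -
    have "compact (closure \<Omega>)" using \<Omega>(2) by simp
    then obtain X where "finite X" "closure \<Omega> \<subseteq> (\<Union>x\<in>X. ball x \<rho>)"
      unfolding compact_eq_totally_bounded using \<rho> by blast
    then show ?thesis by (intro that) (use closure_subset in fast)+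
  qed
  have "\<forall>x::'a. \<exists>h. \<forall>\<Omega> \<eta>. test_function \<Omega> \<eta> \<longrightarrow> cube_average r \<eta> x = abs_L2 \<eta> \<bullet> h"
    using cube_average_eq_inner[OF r] by meson
  then obtain H where H: "\<And>(x::'a) \<Omega> \<eta>. test_function \<Omega> \<eta> \<Longrightarrow> cube_average r \<eta> x = abs_L2 \<eta> \<bullet> H x"
    by metis
  show ?thesis
  proof (rule that[of "H ` X" "4 * m"])
    show "finite (H ` X)" using X by simp
    show "0 \<le> 4 * m" using m by simp
    fix \<eta> assume \<eta>: "test_function \<Omega> \<eta>"
    note [measurable] = cube_average_measurable[OF \<eta>, of r] test_function_measurable[OF \<eta>]
    let ?M = "cube_average r \<eta>" and ?g = "norm (abs_L2 (grad \<eta>))"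
    define T where "T = (\<Sum>h\<in>H ` X. (abs_L2 \<eta> \<bullet> h)\<^sup>2)"
    define B where "B = 2 * (\<rho>\<^sup>2 * ?g\<^sup>2 / r ^ DIM('a)) + 2 * T"
    have T: "T \<ge> 0" by (simp add: T_def sum_nonneg)
    have B: "B \<ge> 0" using T r by (simp add: B_def)
    have MB: "(?M x)\<^sup>2 \<le> B" if "x \<in> \<Omega>" for x
    proof -
      obtain y where y: "y \<in> X" "dist y x < \<rho>" using X(2) \<open>x \<in> \<Omega>\<close> by auto
      have "r ^ DIM('a) * (?M x - ?M y)\<^sup>2 \<le> (norm (x - y))\<^sup>2 * ?g\<^sup>2"
        by (rule cube_average_lipschitz[OF \<eta> r])
      also have "\<dots> \<le> \<rho>\<^sup>2 * ?g\<^sup>2"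
        using y(2) by (intro mult_right_mono power_mono) (auto simp: dist_norm norm_minus_commute)
      finally have 1: "(?M x - ?M y)\<^sup>2 \<le> \<rho>\<^sup>2 * ?g\<^sup>2 / r ^ DIM('a)"
        using r by (simp add: field_simps)
      have "(?M y)\<^sup>2 = (abs_L2 \<eta> \<bullet> H y)\<^sup>2" by (simp add: H[OF \<eta>])
      also have "\<dots> \<le> T"
        unfolding T_def using X(1) y(1) by (intro member_le_sum) auto
      finally have 2: "(?M y)\<^sup>2 \<le> T" .
      have "(?M x)\<^sup>2 \<le> 2 * (?M x - ?M y)\<^sup>2 + 2 * (?M y)\<^sup>2"
        using sum_squares_bound[of "?M x - ?M y" "?M y"] power2_sum[of "?M x - ?M y" "?M y"] by simp
      then show ?thesis using 1 2 by (simp add: B_def)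
    qed
    obtain K where K: "K \<subseteq> \<Omega>" "\<And>x. x \<notin> K \<Longrightarrow> \<eta> x = 0"
      using \<eta> by (rule test_function_support) blast
    \<comment> \<open>Since \<eta> vanishes off \<Omega>, the uniform bound B for the average is
      integrated over a set of finite measure only.\<close>
    have "nn_L2 \<eta> \<le> (\<integral>\<^sup>+x. 2 * ennreal ((\<eta> x - ?M x)\<^sup>2) + ennreal (2 * B) * indicator \<Omega> x \<partial>lborel)"
      unfolding nn_L2_def
    proof (rule nn_integral_mono)
      fix x
      show "ennreal ((\<eta> x)\<^sup>2) \<le> 2 * ennreal ((\<eta> x - ?M x)\<^sup>2) + ennreal (2 * B) * indicator \<Omega> x"
      proof (cases "x \<in> \<Omega>")
        case True
        have "(\<eta> x)\<^sup>2 \<le> 2 * (\<eta> x - ?M x)\<^sup>2 + 2 * (?M x)\<^sup>2"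
          using sum_squares_bound[of "\<eta> x - ?M x" "?M x"] power2_sum[of "\<eta> x - ?M x" "?M x"] by simp
        then have "ennreal ((\<eta> x)\<^sup>2) \<le> ennreal (2 * (\<eta> x - ?M x)\<^sup>2 + 2 * B)"
          using MB[OF True] by (intro ennreal_leI) simp
        then show ?thesis using True B by (simp add: ennreal_plus ennreal_mult)
      next
        case False
        then have "\<eta> x = 0" using K by blast
        then show ?thesis by simp
      qed
    qed
    also have "\<dots> = 2 * nn_L2 (\<lambda>x. \<eta> x - ?M x) + ennreal (2 * B) * emeasure lborel \<Omega>"
      unfolding nn_L2_def using \<Omega>(1)
      by (subst nn_integral_add) (auto simp: nn_integral_cmult nn_integral_cmult_indicator)
    also have "emeasure lborel \<Omega> = ennreal m"
      unfolding m_def using emeasure_bounded_finite[OF \<Omega>(2)]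
      by (intro emeasure_eq_ennreal_measure) auto
    also have "2 * nn_L2 (\<lambda>x. \<eta> x - ?M x) \<le> 2 * (ennreal ((r * n)\<^sup>2) * ennreal (?g\<^sup>2))"
      using cube_average_deviation_L2[OF \<eta>, of r]
      by (intro mult_left_mono) (simp_all add: n_def nn_L2_ngrad_eq_norm[OF \<eta>])
    finally have "ennreal ((norm (abs_L2 \<eta>))\<^sup>2)
        \<le> 2 * (ennreal ((r * n)\<^sup>2) * ennreal (?g\<^sup>2)) + ennreal (2 * B) * ennreal m"
      by (simp add: nn_L2_eq_norm[OF \<eta>] add_right_mono)
    also have "\<dots> = ennreal (2 * (r * n)\<^sup>2 * ?g\<^sup>2 + 2 * B * m)"
      using B m by (simp add: ennreal_plus ennreal_mult mult.assoc)
    finally have "(norm (abs_L2 \<eta>))\<^sup>2 \<le> 2 * (r * n)\<^sup>2 * ?g\<^sup>2 + 2 * B * m"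
      using B m by (subst (asm) ennreal_le_iff) auto
    also have "\<dots> = \<epsilon> / 2 * ?g\<^sup>2 + (4 * m * \<rho>\<^sup>2 / r ^ DIM('a)) * ?g\<^sup>2 + 4 * m * T"
      unfolding rn B_def by (simp add: algebra_simps)
    also have "\<dots> \<le> \<epsilon> / 2 * ?g\<^sup>2 + \<epsilon> / 2 * ?g\<^sup>2 + 4 * m * T"
      by (intro add_mono mult_right_mono \<rho>2) (use m T in auto)
    finally show "(norm (abs_L2 \<eta>))\<^sup>2 \<le> \<epsilon> * ?g\<^sup>2 + 4 * m * (\<Sum>h\<in>H ` X. (abs_L2 \<eta> \<bullet> h)\<^sup>2)"
      by (simp add: T_def)
  qed
qed

section \<open>Inequalities in \<open>H\<^sub>0\<^sup>1\<close>\<close>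

lemma H1_0_Poincare:
  fixes \<Omega> :: "'a::euclidean_space set"
  assumes \<Omega>: "open \<Omega>" "bounded \<Omega>"
  obtains C where "C > 0" "\<And>u. u \<in> H1_0 \<Omega> \<Longrightarrow> norm u \<le> C * norm (weak_gradient \<Omega> u)"
proof -
  obtain R where R: "R > 0" "\<Omega> \<subseteq> ball 0 R"
    using bounded_subset_ballD[OF \<Omega>(2), of 0] by auto
  have test: "norm (abs_L2 \<eta>) \<le> 2 * R * norm (abs_L2 (grad \<eta>))" if \<eta>: "test_function \<Omega> \<eta>" for \<eta>
  proof -
    have "ennreal ((norm (abs_L2 \<eta>))\<^sup>2) \<le> ennreal ((2 * R)\<^sup>2) * ennreal ((norm (abs_L2 (grad \<eta>)))\<^sup>2)"
      using Poincare_test_function[OF \<eta> R(2,1)] by (simp add: nn_L2_eq_norm[OF \<eta>] nn_L2_ngrad_eq_norm[OF \<eta>])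
    then have "(norm (abs_L2 \<eta>))\<^sup>2 \<le> (2 * R * norm (abs_L2 (grad \<eta>)))\<^sup>2"
      using R(1) by (simp add: ennreal_mult[symmetric] power_mult_distrib)
    then show ?thesis by (rule power2_le_imp_le) (use R(1) in simp)
  qed
  show ?thesis
  proof (rule that[of "2 * R"])
    fix u assume "u \<in> H1_0 \<Omega>"
    then obtain \<eta> where \<eta>: "\<And>k. test_function \<Omega> (\<eta> k)" "(\<lambda>k. abs_L2 (\<eta> k)) \<longlonglongrightarrow> u"
      "(\<lambda>k. abs_L2 (grad (\<eta> k))) \<longlonglongrightarrow> weak_gradient \<Omega> u"
      using H1_0_approx[OF \<Omega>(1)] by blast
    show "norm u \<le> 2 * R * norm (weak_gradient \<Omega> u)"
      by (rule LIMSEQ_le[OF tendsto_norm[OF \<eta>(2)] tendsto_mult[OF tendsto_const tendsto_norm[OF \<eta>(3)]]])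
        (use test \<eta>(1) in blast)
  qed (use R(1) in simp)
qed

lemma finite_rank_approximation_H1_0:
  fixes \<Omega> :: "'a::euclidean_space set"
  assumes \<Omega>: "open \<Omega>" "bounded \<Omega>" and \<epsilon>: "\<epsilon> > 0"
  obtains F C where "finite F" "C \<ge> 0" "\<And>u. u \<in> H1_0 \<Omega> \<Longrightarrow>
    (norm u)\<^sup>2 \<le> \<epsilon> * (norm (weak_gradient \<Omega> u))\<^sup>2 + C * (\<Sum>h\<in>F. (u \<bullet> h)\<^sup>2)"
proof -
  obtain F :: "('a, real) L2 set" and C where F: "finite F" "C \<ge> 0" and test: "\<And>\<eta>. test_function \<Omega> \<eta> \<Longrightarrow>
    (norm (abs_L2 \<eta>))\<^sup>2 \<le> \<epsilon> * (norm (abs_L2 (grad \<eta>)))\<^sup>2 + C * (\<Sum>h\<in>F. (abs_L2 \<eta> \<bullet> h)\<^sup>2)"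
    using finite_rank_approximation_test_function[OF \<Omega> \<epsilon>] by blast
  show ?thesis
  proof (rule that[OF F])
    fix u assume "u \<in> H1_0 \<Omega>"
    then obtain \<eta> where \<eta>: "\<And>k. test_function \<Omega> (\<eta> k)" "(\<lambda>k. abs_L2 (\<eta> k)) \<longlonglongrightarrow> u"
      "(\<lambda>k. abs_L2 (grad (\<eta> k))) \<longlonglongrightarrow> weak_gradient \<Omega> u"
      using H1_0_approx[OF \<Omega>(1)] by blast
    show "(norm u)\<^sup>2 \<le> \<epsilon> * (norm (weak_gradient \<Omega> u))\<^sup>2 + C * (\<Sum>h\<in>F. (u \<bullet> h)\<^sup>2)"
    proof (rule LIMSEQ_le)
      show "(\<lambda>k. (norm (abs_L2 (\<eta> k)))\<^sup>2) \<longlonglongrightarrow> (norm u)\<^sup>2"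
        by (intro tendsto_intros \<eta>)
      show "(\<lambda>k. \<epsilon> * (norm (abs_L2 (grad (\<eta> k))))\<^sup>2 + C * (\<Sum>h\<in>F. (abs_L2 (\<eta> k) \<bullet> h)\<^sup>2)) \<longlonglongrightarrow>
          \<epsilon> * (norm (weak_gradient \<Omega> u))\<^sup>2 + C * (\<Sum>h\<in>F. (u \<bullet> h)\<^sup>2)"
        by (intro tendsto_intros \<eta>)
    qed (use test \<eta>(1) in blast)
  qed
qed

text \<open>The pieces are the level sets of all values rounded to multiples of \<delta>. Their
  number depends on L and \<delta> only through the quotient, which makes it scale invariant in the
  covering argument.\<close>

lemma finite_quantization:
  fixes p :: "'i \<Rightarrow> 'b \<Rightarrow> real"
  assumes I: "finite I" and \<delta>: "\<delta> > 0" and L: "L \<le> real N * \<delta>"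
    and p: "\<And>i x y. i \<in> I \<Longrightarrow> x \<in> B \<Longrightarrow> y \<in> B \<Longrightarrow> \<bar>p i x - p i y\<bar> \<le> L"
  obtains \<P> where "finite \<P>" "card \<P> \<le> (2 * N + 1) ^ card I" "\<Union>\<P> = B"
    "\<And>P i x y. P \<in> \<P> \<Longrightarrow> i \<in> I \<Longrightarrow> x \<in> P \<Longrightarrow> y \<in> P \<Longrightarrow> \<bar>p i x - p i y\<bar> \<le> \<delta>"
proof (cases "B = {}")
  case True
  show ?thesis by (rule that[of "{}"]) (auto simp: True)
next
  case False
  then obtain x0 where x0: "x0 \<in> B" by blast
  \<comment> \<open>Values are measured from a reference point, so after scaling they lie in
    [-N, N]; adding N puts the floors into 0..2N, which is 2N + 1 values.\<close>
  define key where "key x = restrict (\<lambda>i. \<lfloor>(p i x - p i x0) / \<delta> + real N\<rfloor>) I" for x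
  have key: "key x \<in> I \<rightarrow>\<^sub>E {0..int (2 * N)}" if "x \<in> B" for x
  proof -
    have "0 \<le> \<lfloor>(p i x - p i x0) / \<delta> + real N\<rfloor> \<and> \<lfloor>(p i x - p i x0) / \<delta> + real N\<rfloor> \<le> int (2 * N)" if "i \<in> I" for i
    proof -
      have "\<bar>p i x - p i x0\<bar> \<le> real N * \<delta>" using p[OF that \<open>x \<in> B\<close> x0] L by linarith
      then have "\<bar>(p i x - p i x0) / \<delta>\<bar> \<le> real N" using \<delta> by (simp add: abs_divide divide_le_eq)
      then show ?thesis by linarith
    qed
    then show ?thesis by (auto simp: key_def)
  qed
  define \<P> where "\<P> = (\<lambda>k. {x \<in> B. key x = k}) ` key ` B"
  have sub: "key ` B \<subseteq> I \<rightarrow>\<^sub>E {0..int (2 * N)}" using key by blast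
  have fin: "finite (I \<rightarrow>\<^sub>E {0..int (2 * N)})" using I by (intro finite_PiE) auto
  show ?thesis
  proof (rule that)
    show "finite \<P>" unfolding \<P>_def using finite_subset[OF sub fin] by simp
    have "card \<P> \<le> card (key ` B)" unfolding \<P>_def by (rule card_image_le[OF finite_subset[OF sub fin]])
    also have "\<dots> \<le> card (I \<rightarrow>\<^sub>E {0..int (2 * N)})" by (rule card_mono[OF fin sub])
    also have "\<dots> = (2 * N + 1) ^ card I" using I by (simp add: card_PiE nat_add_distrib nat_mult_distrib)
    finally show "card \<P> \<le> (2 * N + 1) ^ card I" .
    show "\<Union>\<P> = B" by (auto simp: \<P>_def)
    fix P i x y assume *: "P \<in> \<P>" "i \<in> I" "x \<in> P" "y \<in> P"
    then have "key x i = key y i" by (auto simp: \<P>_def)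
    then have "\<lfloor>(p i x - p i x0) / \<delta> + real N\<rfloor> = \<lfloor>(p i y - p i x0) / \<delta> + real N\<rfloor>"
      using *(2) by (simp add: key_def)
    then have "\<bar>(p i x - p i x0) / \<delta> - (p i y - p i x0) / \<delta>\<bar> \<le> 1" by linarith
    then have "\<bar>(p i x - p i y) / \<delta>\<bar> \<le> 1" by (simp add: diff_divide_distrib)
    then show "\<bar>p i x - p i y\<bar> \<le> \<delta>" using \<delta> by (simp add: abs_divide divide_le_eq)
  qed
qed

text \<open>Total boundedness in L^2 of the unit ball for the gradient norm. The net is chosen
  inside the ball, so its elements belong to \<open>H1_0\<close>, a property the functionals of the
  finite rank estimate do not offer.\<close>

lemma finite_net_H1_0:
  fixes \<Omega> :: "'a::euclidean_space set"
  assumes \<Omega>: "open \<Omega>" "bounded \<Omega>" and \<kappa>: "\<kappa> > 0"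
  obtains F where "finite F" "F \<subseteq> H1_0 \<Omega>"
    "\<And>u. u \<in> H1_0 \<Omega> \<Longrightarrow> norm (weak_gradient \<Omega> u) \<le> 1 \<Longrightarrow> \<exists>h\<in>F. norm (u - h) \<le> \<kappa>"
proof -
  define B where "B = {u \<in> H1_0 \<Omega>. norm (weak_gradient \<Omega> u) \<le> 1}"
  obtain C0 where C0: "C0 > 0" "\<And>u. u \<in> H1_0 \<Omega> \<Longrightarrow> norm u \<le> C0 * norm (weak_gradient \<Omega> u)"
    using H1_0_Poincare[OF \<Omega>] by blast
  \<comment> \<open>Two elements of the ball differ by gradient norm at most 2, so \<kappa>^2 / 8
    contributes \<kappa>^2 / 2; the other half is left to the oscillation of the inner
    products.\<close>
  obtain G C where G: "finite G" "C \<ge> 0" and fr: "\<And>u. u \<in> H1_0 \<Omega> \<Longrightarrow>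
    (norm u)\<^sup>2 \<le> \<kappa>\<^sup>2 / 8 * (norm (weak_gradient \<Omega> u))\<^sup>2 + C * (\<Sum>h\<in>G. (u \<bullet> h)\<^sup>2)"
    using finite_rank_approximation_H1_0[OF \<Omega>, of "\<kappa>\<^sup>2 / 8"] \<kappa> by (metis divide_pos_pos zero_less_numeral zero_less_power)
  define q where "q = C * real (card G) + 1"
  have q: "q > 0" using G by (simp add: q_def add_nonneg_pos)
  define \<delta> where "\<delta> = \<kappa> / sqrt (2 * q)"
  have \<delta>: "\<delta> > 0" "q * \<delta>\<^sup>2 = \<kappa>\<^sup>2 / 2" using q \<kappa> by (simp_all add: \<delta>_def power_divide)
  define M where "M = Max (insert 0 (norm ` G))"
  have M: "norm h \<le> M" if "h \<in> G" for h using that G by (simp add: M_def)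
  obtain N :: nat where N: "2 * C0 * M / \<delta> \<le> real N" using real_arch_simple by blast
  have nB: "norm u \<le> C0" if "u \<in> B" for u
  proof -
    have "norm u \<le> C0 * norm (weak_gradient \<Omega> u)" using C0(2) that by (simp add: B_def)
    also have "\<dots> \<le> C0 * 1" using C0(1) that by (intro mult_left_mono) (auto simp: B_def)
    finally show ?thesis by simp
  qed
  have p: "\<bar>u \<bullet> h - v \<bullet> h\<bar> \<le> 2 * C0 * M" if "h \<in> G" "u \<in> B" "v \<in> B" for h u v
  proof -
    have "\<bar>u \<bullet> h - v \<bullet> h\<bar> \<le> norm (u - v) * norm h"
      by (simp add: inner_diff_left[symmetric] Cauchy_Schwarz_ineq2)
    also have "\<dots> \<le> (2 * C0) * M"
      using norm_triangle_ineq4[of u v] nB[OF that(2)] nB[OF that(3)] M[OF that(1)] C0(1)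
      by (intro mult_mono) auto
    finally show ?thesis by simp
  qed
  have LN: "2 * C0 * M \<le> real N * \<delta>" using N \<delta>(1) by (simp add: divide_le_eq)
  obtain \<P> where \<P>: "finite \<P>" "\<Union>\<P> = B"
    "\<And>P h x y. P \<in> \<P> \<Longrightarrow> h \<in> G \<Longrightarrow> x \<in> P \<Longrightarrow> y \<in> P \<Longrightarrow> \<bar>x \<bullet> h - y \<bullet> h\<bar> \<le> \<delta>"
    using finite_quantization[OF G(1) \<delta>(1) LN, of B "\<lambda>h u. u \<bullet> h"] p by metis
  define F where "F = (\<lambda>P. SOME u. u \<in> P) ` (\<P> - {{}})"
  have some: "(SOME u. u \<in> P) \<in> P" if "P \<in> \<P> - {{}}" for P
    using that by (simp add: some_in_eq)
  have FB: "F \<subseteq> B" using some \<P>(2) unfolding F_def by blast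
  show ?thesis
  proof (rule that)
    show "finite F" using \<P>(1) by (simp add: F_def)
    show "F \<subseteq> H1_0 \<Omega>" using FB by (auto simp: B_def)
    fix u assume "u \<in> H1_0 \<Omega>" "norm (weak_gradient \<Omega> u) \<le> 1"
    then have u: "u \<in> B" by (simp add: B_def)
    then obtain P where P: "P \<in> \<P>" "u \<in> P" using \<P>(2) by blast
    define h where "h = (SOME u. u \<in> P)"
    have hP: "h \<in> P" "h \<in> F" using some[of P] P by (auto simp: h_def F_def)
    then have h: "h \<in> B" using FB by blast
    have uh: "u - h \<in> H1_0 \<Omega>" using u h by (auto simp: B_def intro: H1_0_diff[OF \<Omega>(1)])
    have "norm (weak_gradient \<Omega> (u - h)) \<le> 2"
      using u h norm_triangle_ineq4[of "weak_gradient \<Omega> u" "weak_gradient \<Omega> h"]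
      by (auto simp: B_def weak_gradient_diff[OF \<Omega>(1)] H1_0_H1)
    then have g2: "(norm (weak_gradient \<Omega> (u - h)))\<^sup>2 \<le> 2\<^sup>2" by (intro power_mono) auto
    have "(\<Sum>k\<in>G. ((u - h) \<bullet> k)\<^sup>2) \<le> (\<Sum>k\<in>G. \<delta>\<^sup>2)"
    proof (rule sum_mono)
      fix k assume "k \<in> G"
      then have "\<bar>(u - h) \<bullet> k\<bar> \<le> \<delta>" using \<P>(3)[OF P(1) _ P(2) hP(1)] by (simp add: inner_diff_left)
      then show "((u - h) \<bullet> k)\<^sup>2 \<le> \<delta>\<^sup>2" using \<delta>(1) by (simp add: abs_le_square_iff[symmetric])
    qed
    then have "C * (\<Sum>k\<in>G. ((u - h) \<bullet> k)\<^sup>2) \<le> C * (real (card G) * \<delta>\<^sup>2)"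
      using G(2) by (intro mult_left_mono) simp_all
    also have "\<dots> \<le> q * \<delta>\<^sup>2" by (simp add: q_def algebra_simps)
    finally have "(norm (u - h))\<^sup>2 \<le> \<kappa>\<^sup>2 / 8 * 2\<^sup>2 + \<kappa>\<^sup>2 / 2"
      using fr[OF uh] mult_left_mono[OF g2, of "\<kappa>\<^sup>2 / 8"] \<delta>(2) by simp
    then have "(norm (u - h))\<^sup>2 \<le> \<kappa>\<^sup>2" by simp
    then have "norm (u - h) \<le> \<kappa>" by (rule power2_le_imp_le) (use \<kappa> in simp)
    then show "\<exists>h\<in>F. norm (u - h) \<le> \<kappa>" using hP(2) by blast
  qed
qed

text \<open>Replaces the functionals of the finite rank estimate by elements of \<open>H1_0\<close>,
  against which the equation can be tested. A normalised v is paired with a nearby net element h by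
  means of |v|^2 = (v, h) + (v, v - h).\<close>

lemma finite_functionals_H1_0:
  fixes \<Omega> :: "'a::euclidean_space set"
  assumes \<Omega>: "open \<Omega>" "bounded \<Omega>" and \<epsilon>: "\<epsilon> > 0"
  obtains F C where "finite F" "F \<subseteq> H1_0 \<Omega>" "C \<ge> 0" "\<And>u. u \<in> H1_0 \<Omega> \<Longrightarrow>
    (norm u)\<^sup>2 \<le> \<epsilon> * (norm (weak_gradient \<Omega> u))\<^sup>2 + C * (\<Sum>h\<in>F. (u \<bullet> h)\<^sup>2)"
proof -
  define \<kappa> where "\<kappa> = sqrt (\<epsilon> / 2)"
  have \<kappa>: "\<kappa> > 0" "2 * \<kappa>\<^sup>2 = \<epsilon>" using \<epsilon> by (simp_all add: \<kappa>_def)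
  obtain C0 where C0: "C0 > 0" "\<And>u. u \<in> H1_0 \<Omega> \<Longrightarrow> norm u \<le> C0 * norm (weak_gradient \<Omega> u)"
    using H1_0_Poincare[OF \<Omega>] by blast
  obtain F where F: "finite F" "F \<subseteq> H1_0 \<Omega>"
    "\<And>u. u \<in> H1_0 \<Omega> \<Longrightarrow> norm (weak_gradient \<Omega> u) \<le> 1 \<Longrightarrow> \<exists>h\<in>F. norm (u - h) \<le> \<kappa>"
    using finite_net_H1_0[OF \<Omega> \<kappa>(1)] by blast
  show ?thesis
  proof (rule that[OF F(1,2), of "1 / \<kappa>\<^sup>2"])
    fix u assume u: "u \<in> H1_0 \<Omega>"
    let ?g = "norm (weak_gradient \<Omega> u)" and ?S = "\<Sum>h\<in>F. (u \<bullet> h)\<^sup>2"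
    have S: "?S \<ge> 0" by (simp add: sum_nonneg)
    show "(norm u)\<^sup>2 \<le> \<epsilon> * ?g\<^sup>2 + 1 / \<kappa>\<^sup>2 * ?S"
    proof (cases "?g = 0")
      case True
      then have "u = 0" using C0(2)[OF u] by simp
      then show ?thesis using True by simp
    next
      case False
      then have g: "?g > 0" by simp
      define v where "v = (1 / ?g) *\<^sub>R u"
      have v: "v \<in> H1_0 \<Omega>" unfolding v_def by (rule H1_0_scaleR[OF \<Omega>(1) u])
      have "norm (weak_gradient \<Omega> v) = 1"
        using g by (simp add: v_def weak_gradient_scaleR[OF \<Omega>(1) H1_0_H1[OF u]])
      then obtain h where h: "h \<in> F" "norm (v - h) \<le> \<kappa>" using F(3)[OF v] by auto
      \<comment> \<open>Young's inequality absorbs half of |v|^2 and, after doubling, leaves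
        \<kappa>^2. A second use turns 2 |(v, h)| into a multiple of its square and leaves another
        \<kappa>^2, together \<epsilon>.\<close>
      have "(norm v)\<^sup>2 = v \<bullet> h + v \<bullet> (v - h)" by (simp add: inner_diff_right power2_norm_eq_inner)
      also have "\<dots> \<le> \<bar>v \<bullet> h\<bar> + norm v * \<kappa>"
        using norm_cauchy_schwarz[of v "v - h"] mult_left_mono[OF h(2), of "norm v"] by simp
      finally have 1: "(norm v)\<^sup>2 \<le> 2 * \<bar>v \<bullet> h\<bar> + \<kappa>\<^sup>2"
        using sum_squares_bound[of "norm v" \<kappa>] by simp
      have "2 * \<kappa> * (\<bar>v \<bullet> h\<bar> / \<kappa>) \<le> \<kappa>\<^sup>2 + (\<bar>v \<bullet> h\<bar> / \<kappa>)\<^sup>2" by (rule sum_squares_bound)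
      then have "(norm v)\<^sup>2 \<le> 2 * \<kappa>\<^sup>2 + 1 / \<kappa>\<^sup>2 * (v \<bullet> h)\<^sup>2"
        using 1 \<kappa>(1) by (simp add: power_divide)
      then have "?g\<^sup>2 * (norm v)\<^sup>2 \<le> ?g\<^sup>2 * (2 * \<kappa>\<^sup>2 + 1 / \<kappa>\<^sup>2 * (v \<bullet> h)\<^sup>2)"
        by (rule mult_left_mono) simp
      moreover have "?g\<^sup>2 * (norm v)\<^sup>2 = (norm u)\<^sup>2" "?g\<^sup>2 * (v \<bullet> h)\<^sup>2 = (u \<bullet> h)\<^sup>2"
        using g by (simp_all add: v_def power_mult_distrib power_divide)
      ultimately have "(norm u)\<^sup>2 \<le> \<epsilon> * ?g\<^sup>2 + 1 / \<kappa>\<^sup>2 * (u \<bullet> h)\<^sup>2"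
        by (simp add: \<kappa>(2)[symmetric] algebra_simps)
      also have "(u \<bullet> h)\<^sup>2 \<le> ?S" by (rule member_le_sum[OF h(1)]) (use F(1) in auto)
      finally show ?thesis using \<kappa>(1) by (simp add: divide_right_mono)
    qed
  qed simp
qed

text \<open>Fatou's lemma along an almost everywhere convergent subsequence of test functions
  carries the L^4 bound to the limit. Square integrability of u^2 is what makes
  \<open>L2_mult u u\<close> a meaningful class.\<close>

lemma H1_0_L4:
  fixes \<Omega> :: "'a::euclidean_space set"
  assumes \<Omega>: "open \<Omega>" and n: "DIM('a) \<le> 3" and r: "0 < r" "r \<le> 1" and u: "u \<in> H1_0 \<Omega>"
  shows "square_integrable (\<lambda>x. rep_L2 u x * rep_L2 u x)"
    and "(norm (L2_mult u u))\<^sup>2 \<le>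
      2048 * real DIM('a) ^ 4 * r * (norm (weak_gradient \<Omega> u)) ^ 4 + 8 / r ^ DIM('a) * (norm u) ^ 4"
proof -
  let ?c = "\<lambda>g b. 2048 * real DIM('a) ^ 4 * r * g ^ 4 + 8 / r ^ DIM('a) * b ^ 4"
  obtain \<eta> where \<eta>: "\<And>k. test_function \<Omega> (\<eta> k)" "(\<lambda>k. abs_L2 (\<eta> k)) \<longlonglongrightarrow> u"
    "(\<lambda>k. abs_L2 (grad (\<eta> k))) \<longlonglongrightarrow> weak_gradient \<Omega> u"
    using H1_0_approx[OF \<Omega> u] by blast
  have [measurable]: "\<eta> k \<in> borel_measurable lebesgue" for k
    by (rule continuous_measurable_lebesgue[OF test_function_continuous[OF \<eta>(1)]])
  note si = square_integrable_test_function[OF \<eta>(1)]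
  have sid: "square_integrable (\<lambda>x. \<eta> k x - rep_L2 u x)" for k
    by (intro square_integrable_diff si square_integrable_rep_L2)
  have "(\<lambda>k. (norm (abs_L2 (\<eta> k) - u))\<^sup>2) \<longlonglongrightarrow> (norm (u - u))\<^sup>2"
    by (intro tendsto_intros \<eta>(2))
  moreover have "(norm (abs_L2 (\<eta> k) - u))\<^sup>2 = (LINT x|lebesgue. norm ((\<eta> k x - rep_L2 u x)\<^sup>2))" for k
    using norm_abs_L2[OF sid[of k]] abs_L2_diff[OF si square_integrable_rep_L2, of k u] by simp
  ultimately have "(\<lambda>k. LINT x|lebesgue. norm ((\<eta> k x - rep_L2 u x)\<^sup>2)) \<longlonglongrightarrow> 0" by simp
  moreover have "integrable lebesgue (\<lambda>x. (\<eta> k x - rep_L2 u x)\<^sup>2)" for k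
    using sid[of k] by (simp add: square_integrable_def)
  \<comment> \<open>Convergence in L^2 is convergence in L^1 of the squared differences, whence a
    subsequence converges almost everywhere.\<close>
  ultimately obtain \<sigma> :: "nat \<Rightarrow> nat" where \<sigma>: "strict_mono \<sigma>"
    "AE x in lebesgue. (\<lambda>k. (\<eta> (\<sigma> k) x - rep_L2 u x)\<^sup>2) \<longlonglongrightarrow> 0"
    using tendsto_L1_AE_subseq[of lebesgue "\<lambda>k x. (\<eta> k x - rep_L2 u x)\<^sup>2"] by blast
  have "(\<integral>\<^sup>+x. ennreal ((rep_L2 u x) ^ 4) \<partial>lebesgue) \<le> (\<integral>\<^sup>+x. liminf (\<lambda>k. ennreal ((\<eta> (\<sigma> k) x) ^ 4)) \<partial>lebesgue)"
  proof (rule nn_integral_mono_AE)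
    show "AE x in lebesgue. ennreal ((rep_L2 u x) ^ 4) \<le> liminf (\<lambda>k. ennreal ((\<eta> (\<sigma> k) x) ^ 4))"
      using \<sigma>(2)
    proof eventually_elim
      case (elim x)
      then have "(\<lambda>k. \<eta> (\<sigma> k) x - rep_L2 u x) \<longlonglongrightarrow> 0"
        using tendsto_real_sqrt[OF elim] by (simp add: tendsto_rabs_zero_iff)
      then have "(\<lambda>k. \<eta> (\<sigma> k) x) \<longlonglongrightarrow> rep_L2 u x" by (simp add: LIM_zero_iff)
      then have "(\<lambda>k. ennreal ((\<eta> (\<sigma> k) x) ^ 4)) \<longlonglongrightarrow> ennreal ((rep_L2 u x) ^ 4)"
        by (intro tendsto_intros)
      from lim_imp_Liminf[OF sequentially_bot this] show ?case by simp
    qed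
  qed
  also have "\<dots> \<le> liminf (\<lambda>k. \<integral>\<^sup>+x. ennreal ((\<eta> (\<sigma> k) x) ^ 4) \<partial>lebesgue)"
    by (rule nn_integral_liminf) measurable
  also have "\<dots> \<le> liminf (\<lambda>k. ennreal (?c (norm (abs_L2 (grad (\<eta> (\<sigma> k))))) (norm (abs_L2 (\<eta> (\<sigma> k))))))"
  proof (intro Liminf_mono always_eventually allI)
    fix k
    note [measurable] = test_function_measurable[OF \<eta>(1)[of "\<sigma> k"]]
    show "(\<integral>\<^sup>+x. ennreal ((\<eta> (\<sigma> k) x) ^ 4) \<partial>lebesgue)
        \<le> ennreal (?c (norm (abs_L2 (grad (\<eta> (\<sigma> k))))) (norm (abs_L2 (\<eta> (\<sigma> k)))))"
      using L4_test_function[OF \<eta>(1) r n, of "\<sigma> k"] by (subst nn_integral_completion) auto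
  qed
  also have "\<dots> = ennreal (?c (norm (weak_gradient \<Omega> u)) (norm u))"
  proof (rule lim_imp_Liminf)
    show "(\<lambda>k. ennreal (?c (norm (abs_L2 (grad (\<eta> (\<sigma> k))))) (norm (abs_L2 (\<eta> (\<sigma> k))))))
        \<longlonglongrightarrow> ennreal (?c (norm (weak_gradient \<Omega> u)) (norm u))"
      using LIMSEQ_subseq_LIMSEQ[OF \<eta>(2) \<sigma>(1)] LIMSEQ_subseq_LIMSEQ[OF \<eta>(3) \<sigma>(1)]
      unfolding o_def by (intro tendsto_intros)
  qed simp
  finally have le: "(\<integral>\<^sup>+x. ennreal ((rep_L2 u x) ^ 4) \<partial>lebesgue) \<le> ennreal (?c (norm (weak_gradient \<Omega> u)) (norm u))" .
  have p4: "(norm (a * a))\<^sup>2 = a ^ 4" for a :: real by (simp add: power2_eq_square eval_nat_numeral)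
  show si2: "square_integrable (\<lambda>x. rep_L2 u x * rep_L2 u x)"
    unfolding square_integrable_def p4
    using le by (auto simp: integrable_iff_bounded intro: le_less_trans)
  have "ennreal ((norm (L2_mult u u))\<^sup>2) = (\<integral>\<^sup>+x. ennreal ((rep_L2 u x) ^ 4) \<partial>lebesgue)"
    unfolding L2_mult_def ennreal_norm_abs_L2[OF si2] p4 ..
  with le have "ennreal ((norm (L2_mult u u))\<^sup>2) \<le> ennreal (?c (norm (weak_gradient \<Omega> u)) (norm u))" by simp
  then show "(norm (L2_mult u u))\<^sup>2 \<le> ?c (norm (weak_gradient \<Omega> u)) (norm u)"
    using r by (subst (asm) ennreal_le_iff) auto
qed

section \<open>Products and the reaction term\<close>

lemma square_integrable_mult_H1_0:
  fixes \<Omega> :: "'a::euclidean_space set"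
  assumes "open \<Omega>" "DIM('a) \<le> 3" "u \<in> H1_0 \<Omega>" "v \<in> H1_0 \<Omega>"
  shows "square_integrable (\<lambda>x. rep_L2 u x * rep_L2 v x)"
proof (rule square_integrable_bound)
  show "square_integrable (\<lambda>x. rep_L2 u x * rep_L2 u x + rep_L2 v x * rep_L2 v x)"
    by (intro square_integrable_add H1_0_L4(1)[OF assms(1,2) zero_less_one order_refl] assms)
  have "\<bar>a * b\<bar> \<le> \<bar>a * a + b * b\<bar>" for a b :: real
  proof -
    have "0 \<le> \<bar>a * b\<bar>" "0 \<le> a * a + b * b" by simp_all
    moreover have "2 * \<bar>a * b\<bar> \<le> a * a + b * b"
      using sum_squares_bound[of "\<bar>a\<bar>" "\<bar>b\<bar>"] by (simp add: power2_eq_square abs_mult mult.assoc)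
    ultimately show ?thesis by linarith
  qed
  then show "AE x in lebesgue. norm (rep_L2 u x * rep_L2 v x)
      \<le> norm (rep_L2 u x * rep_L2 u x + rep_L2 v x * rep_L2 v x)"
    by simp
qed measurable

lemma L2_mult_commute: "L2_mult u v = L2_mult v u"
  by (simp add: L2_mult_def mult.commute)

lemma inner_L2_mult:
  fixes \<Omega> :: "'a::euclidean_space set"
  assumes "open \<Omega>" "DIM('a) \<le> 3" "u \<in> H1_0 \<Omega>" "v \<in> H1_0 \<Omega>"
  shows "L2_mult u v \<bullet> w = (LINT x|lebesgue. rep_L2 u x * rep_L2 v x * rep_L2 w x)"
  using inner_abs_L2[OF square_integrable_mult_H1_0[OF assms] square_integrable_rep_L2, of w]
  by (simp add: L2_mult_def)

text \<open>Both sides are the same triple integral. The identity lets a factor that is bounded only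
  in L^2 stand alone while the other two form the product.\<close>

lemma inner_L2_mult_shift:
  fixes \<Omega> :: "'a::euclidean_space set"
  assumes "open \<Omega>" "DIM('a) \<le> 3" "u \<in> H1_0 \<Omega>" "v \<in> H1_0 \<Omega>" "w \<in> H1_0 \<Omega>"
  shows "L2_mult u v \<bullet> w = u \<bullet> L2_mult v w"
  using inner_L2_mult[OF assms(1-4), of w] inner_L2_mult[OF assms(1,2,4,5), of u]
  by (simp add: inner_commute mult_ac)

text \<open>The integral of u^2 v^2 is also the inner product of the two squares.\<close>

lemma norm_L2_mult_le:
  fixes \<Omega> :: "'a::euclidean_space set"
  assumes "open \<Omega>" "DIM('a) \<le> 3" "u \<in> H1_0 \<Omega>" "v \<in> H1_0 \<Omega>"
  shows "(norm (L2_mult u v))\<^sup>2 \<le> norm (L2_mult u u) * norm (L2_mult v v)"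
proof -
  note si = square_integrable_mult_H1_0[OF assms(1,2)]
  have "(norm (L2_mult u v))\<^sup>2 = L2_mult u u \<bullet> L2_mult v v"
    unfolding L2_mult_def norm_abs_L2[OF si[OF assms(3,4)]]
      inner_abs_L2[OF si[OF assms(3,3)] si[OF assms(4,4)]]
    by (simp add: power2_eq_square abs_mult mult_ac)
  then show ?thesis using norm_cauchy_schwarz by simp
qed

lemma L2_mult_diff_left:
  fixes \<Omega> :: "'a::euclidean_space set"
  assumes "open \<Omega>" "DIM('a) \<le> 3" "u \<in> H1_0 \<Omega>" "u' \<in> H1_0 \<Omega>" "v \<in> H1_0 \<Omega>"
  shows "L2_mult (u - u') v = L2_mult u v - L2_mult u' v"
proof -
  note si = square_integrable_mult_H1_0[OF assms(1,2)]
  have d: "u - u' \<in> H1_0 \<Omega>" using assms by (intro H1_0_diff)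
  have "L2_mult u v - L2_mult u' v = abs_L2 (\<lambda>x. rep_L2 u x * rep_L2 v x - rep_L2 u' x * rep_L2 v x)"
    unfolding L2_mult_def by (intro abs_L2_diff si assms)
  also have "\<dots> = L2_mult (u - u') v"
    unfolding L2_mult_def
  proof (subst abs_L2_eq_iff)
    show "AE x in lebesgue. rep_L2 u x * rep_L2 v x - rep_L2 u' x * rep_L2 v x = rep_L2 (u - u') x * rep_L2 v x"
      using rep_L2_diff[of u u'] by eventually_elim (simp add: left_diff_distrib)
  qed (intro square_integrable_diff si assms d)+
  finally show ?thesis by simp
qed

lemma L2_mult_difference:
  fixes \<Omega> :: "'a::euclidean_space set"
  assumes "open \<Omega>" "DIM('a) \<le> 3" "u \<in> H1_0 \<Omega>" "u' \<in> H1_0 \<Omega>" "v \<in> H1_0 \<Omega>" "v' \<in> H1_0 \<Omega>"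
  shows "L2_mult u v - L2_mult u' v' = L2_mult u (v - v') + L2_mult (u - u') v'"
  using L2_mult_diff_left[OF assms(1-4,6)] L2_mult_diff_left[OF assms(1,2,5,6,3)]
  by (simp add: L2_mult_commute)

text \<open>The crude bound by gradients alone, from r = 1 and the Poincare inequality. It will make
  the time derivative of a difference a bounded functional on \<open>E\<close>.\<close>

lemma norm_L2_mult_gradient:
  fixes \<Omega> :: "'a::euclidean_space set"
  assumes \<Omega>: "open \<Omega>" "bounded \<Omega>" and n: "DIM('a) \<le> 3"
  obtains C where "C > 0" "\<And>u v. u \<in> H1_0 \<Omega> \<Longrightarrow> v \<in> H1_0 \<Omega> \<Longrightarrow>
    norm (L2_mult u v) \<le> C * norm (weak_gradient \<Omega> u) * norm (weak_gradient \<Omega> v)"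
proof -
  obtain C0 where C0: "C0 > 0" "\<And>u. u \<in> H1_0 \<Omega> \<Longrightarrow> norm u \<le> C0 * norm (weak_gradient \<Omega> u)"
    using H1_0_Poincare[OF \<Omega>] by blast
  define C where "C = sqrt (2048 * real DIM('a) ^ 4 + 8 * C0 ^ 4)"
  have C: "C > 0" "C\<^sup>2 = 2048 * real DIM('a) ^ 4 + 8 * C0 ^ 4"
    using C0 by (simp_all add: C_def add_pos_pos)
  have sq: "norm (L2_mult u u) \<le> C * (norm (weak_gradient \<Omega> u))\<^sup>2" if u: "u \<in> H1_0 \<Omega>" for u
  proof (rule power2_le_imp_le)
    have "(norm u) ^ 4 \<le> (C0 * norm (weak_gradient \<Omega> u)) ^ 4"
      by (intro power_mono C0(2) u) simp
    then have "(norm (L2_mult u u))\<^sup>2 \<le> 2048 * real DIM('a) ^ 4 * norm (weak_gradient \<Omega> u) ^ 4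
        + 8 * (C0 * norm (weak_gradient \<Omega> u)) ^ 4"
      using H1_0_L4(2)[OF \<Omega>(1) n zero_less_one order_refl u] by simp
    also have "\<dots> = C\<^sup>2 * norm (weak_gradient \<Omega> u) ^ 4"
      unfolding C(2) by (simp add: power_mult_distrib algebra_simps)
    finally show "(norm (L2_mult u u))\<^sup>2 \<le> (C * (norm (weak_gradient \<Omega> u))\<^sup>2)\<^sup>2"
      by (simp add: power_mult_distrib flip: power_mult)
  qed (use C in simp)
  show ?thesis
  proof (rule that[OF C(1)])
    fix u v assume uv: "u \<in> H1_0 \<Omega>" "v \<in> H1_0 \<Omega>"
    show "norm (L2_mult u v) \<le> C * norm (weak_gradient \<Omega> u) * norm (weak_gradient \<Omega> v)"
    proof (rule power2_le_imp_le)
      have "(norm (L2_mult u v))\<^sup>2 \<le> norm (L2_mult u u) * norm (L2_mult v v)"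
        by (rule norm_L2_mult_le[OF \<Omega>(1) n uv])
      also have "\<dots> \<le> (C * (norm (weak_gradient \<Omega> u))\<^sup>2) * (C * (norm (weak_gradient \<Omega> v))\<^sup>2)"
        using C by (intro mult_mono sq uv) auto
      finally show "(norm (L2_mult u v))\<^sup>2 \<le> (C * norm (weak_gradient \<Omega> u) * norm (weak_gradient \<Omega> v))\<^sup>2"
        by (simp add: power2_eq_square mult_ac)
    qed (use C in simp)
  qed
qed

text \<open>The fine bound, with r so small that diffusion can absorb the gradient part.\<close>

lemma norm_L2_mult_interpolation:
  fixes \<Omega> :: "'a::euclidean_space set"
  assumes \<Omega>: "open \<Omega>" and n: "DIM('a) \<le> 3" and \<epsilon>: "\<epsilon> > 0"
  obtains C where "C \<ge> 0" "\<And>u v. u \<in> H1_0 \<Omega> \<Longrightarrow> v \<in> H1_0 \<Omega> \<Longrightarrow>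
    norm (L2_mult u v) \<le> \<epsilon> * ((norm (weak_gradient \<Omega> u))\<^sup>2 + (norm (weak_gradient \<Omega> v))\<^sup>2)
      + C * ((norm u)\<^sup>2 + (norm v)\<^sup>2)"
proof -
  define K where "K = 2048 * real DIM('a) ^ 4"
  have "real DIM('a) ^ 4 \<ge> 1" by (intro one_le_power) (simp add: Suc_leI)
  then have K: "K \<ge> 1" unfolding K_def by linarith
  \<comment> \<open>The L^4 estimate bounds a square, so its gradient coefficient K r has to stay
    below \<epsilon>^2.\<close>
  define r where "r = min 1 (\<epsilon>\<^sup>2 / K)"
  have r: "0 < r" "r \<le> 1" "K * r \<le> \<epsilon>\<^sup>2"
    using \<epsilon> K by (auto simp: r_def min_def field_simps)
  define C where "C = sqrt (8 / r ^ DIM('a))"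
  have C: "C \<ge> 0" "C\<^sup>2 = 8 / r ^ DIM('a)" using r by (simp_all add: C_def)
  have sq: "norm (L2_mult u u) \<le> \<epsilon> * (norm (weak_gradient \<Omega> u))\<^sup>2 + C * (norm u)\<^sup>2" if u: "u \<in> H1_0 \<Omega>" for u
  proof (rule power2_le_imp_le)
    let ?g = "norm (weak_gradient \<Omega> u)"
    have "(norm (L2_mult u u))\<^sup>2 \<le> K * r * ?g ^ 4 + C\<^sup>2 * norm u ^ 4"
      using H1_0_L4(2)[OF \<Omega> n r(1,2) u] by (simp add: K_def C(2))
    also have "\<dots> \<le> \<epsilon>\<^sup>2 * ?g ^ 4 + C\<^sup>2 * norm u ^ 4"
      using r(3) by (intro add_right_mono mult_right_mono) auto
    also have "\<dots> = (\<epsilon> * ?g\<^sup>2)\<^sup>2 + (C * (norm u)\<^sup>2)\<^sup>2"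
      by (simp add: power_mult_distrib flip: power_mult)
    also have "\<dots> \<le> (\<epsilon> * ?g\<^sup>2 + C * (norm u)\<^sup>2)\<^sup>2"
      using \<epsilon> C by (simp add: power2_sum)
    finally show "(norm (L2_mult u u))\<^sup>2 \<le> (\<epsilon> * ?g\<^sup>2 + C * (norm u)\<^sup>2)\<^sup>2" .
  qed (use \<epsilon> C in simp)
  show ?thesis
  proof (rule that[OF C(1)])
    fix u v assume uv: "u \<in> H1_0 \<Omega>" "v \<in> H1_0 \<Omega>"
    have "norm (L2_mult u v) \<le> norm (L2_mult u u) + norm (L2_mult v v)"
    proof (rule power2_le_imp_le)
      show "(norm (L2_mult u v))\<^sup>2 \<le> (norm (L2_mult u u) + norm (L2_mult v v))\<^sup>2"
      proof -
        have "A * B \<le> (A + B)\<^sup>2" if "0 \<le> A" "0 \<le> B" for A B :: real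
        proof -
          have "0 \<le> A * B" using that by simp
          then show ?thesis unfolding power2_sum using zero_le_power2[of A] zero_le_power2[of B] by linarith
        qed
        from order_trans[OF norm_L2_mult_le[OF \<Omega> n uv] this] show ?thesis by simp
      qed
    qed simp
    with sq[OF uv(1)] sq[OF uv(2)]
    show "norm (L2_mult u v) \<le> \<epsilon> * ((norm (weak_gradient \<Omega> u))\<^sup>2 + (norm (weak_gradient \<Omega> v))\<^sup>2)
      + C * ((norm u)\<^sup>2 + (norm v)\<^sup>2)" by (simp add: algebra_simps)
  qed
qed

section \<open>The product spaces \<open>E\<close> and \<open>H\<close>\<close>

definition E_grad :: "'a::euclidean_space set \<Rightarrow> 'a state \<Rightarrow> ('a, 'a) L2 \<times> ('a, 'a) L2 \<times> ('a, 'a) L2" where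
  "E_grad \<Omega> = (\<lambda>(u, v, w). (weak_gradient \<Omega> u, weak_gradient \<Omega> v, weak_gradient \<Omega> w))"

text \<open>Since \<open>E_grad\<close> is linear on \<open>E\<close>, this form transfers the
  triangle inequalities from the Hilbert norm of gradients.\<close>

lemma E_norm_eq: "E_norm \<Omega> x = norm (E_grad \<Omega> x)"
  by (cases x) (simp add: E_norm_def E_grad_def)

lemma E_space_diff: "open \<Omega> \<Longrightarrow> x \<in> E_space \<Omega> \<Longrightarrow> y \<in> E_space \<Omega> \<Longrightarrow> x - y \<in> E_space \<Omega>"
  by (auto simp: E_space_def H1_0_diff)

lemma E_space_scaleR: "open \<Omega> \<Longrightarrow> x \<in> E_space \<Omega> \<Longrightarrow> c *\<^sub>R x \<in> E_space \<Omega>"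
  by (auto simp: E_space_def H1_0_scaleR)

lemma H1_0_zero: "open \<Omega> \<Longrightarrow> 0 \<in> H1_0 \<Omega>"
  using H1_0_scaleR[OF _ test_function_in_H1_0[OF _ test_function_zero], of \<Omega> 0] by simp

lemma E_space_H_space: "E_space \<Omega> \<subseteq> H_space \<Omega>"
  by (auto simp: E_space_def H_space_def H1_0_L2_on)

lemma E_grad_diff:
  "open \<Omega> \<Longrightarrow> x \<in> E_space \<Omega> \<Longrightarrow> y \<in> E_space \<Omega> \<Longrightarrow> E_grad \<Omega> (x - y) = E_grad \<Omega> x - E_grad \<Omega> y"
  by (auto simp: E_space_def E_grad_def weak_gradient_diff H1_0_H1)

lemma E_grad_add:
  "open \<Omega> \<Longrightarrow> x \<in> E_space \<Omega> \<Longrightarrow> y \<in> E_space \<Omega> \<Longrightarrow> E_grad \<Omega> (x + y) = E_grad \<Omega> x + E_grad \<Omega> y"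
  by (auto simp: E_space_def E_grad_def weak_gradient_add H1_0_H1)

lemma E_grad_scaleR:
  "open \<Omega> \<Longrightarrow> x \<in> E_space \<Omega> \<Longrightarrow> E_grad \<Omega> (c *\<^sub>R x) = c *\<^sub>R E_grad \<Omega> x"
  by (auto simp: E_space_def E_grad_def weak_gradient_scaleR H1_0_H1)

lemma norm_triple_sq: "(norm (a, b, c))\<^sup>2 = (norm a)\<^sup>2 + (norm b)\<^sup>2 + (norm c)\<^sup>2"
  by (simp add: norm_Pair)

lemma norm_triple_ge: "norm a \<le> norm (a, b, c)" "norm b \<le> norm (a, b, c)" "norm c \<le> norm (a, b, c)"
  by (rule power2_le_imp_le; simp add: norm_triple_sq)+

lemma E_Poincare:
  fixes \<Omega> :: "'a::euclidean_space set"
  assumes \<Omega>: "open \<Omega>" "bounded \<Omega>"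
  obtains C where "C > 0" "\<And>x. x \<in> E_space \<Omega> \<Longrightarrow> norm x \<le> C * E_norm \<Omega> x"
proof -
  obtain C where C: "C > 0" "\<And>u. u \<in> H1_0 \<Omega> \<Longrightarrow> norm u \<le> C * norm (weak_gradient \<Omega> u)"
    using H1_0_Poincare[OF \<Omega>] by blast
  have sq: "(norm u)\<^sup>2 \<le> C\<^sup>2 * (norm (weak_gradient \<Omega> u))\<^sup>2" if "u \<in> H1_0 \<Omega>" for u
    using power_mono[OF C(2)[OF that], of 2] by (simp add: power_mult_distrib)
  show ?thesis
  proof (rule that[OF C(1)])
    fix x assume "x \<in> E_space \<Omega>"
    then obtain u v w where x: "x = (u, v, w)" "u \<in> H1_0 \<Omega>" "v \<in> H1_0 \<Omega>" "w \<in> H1_0 \<Omega>"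
      by (auto simp: E_space_def)
    show "norm x \<le> C * E_norm \<Omega> x"
    proof (rule power2_le_imp_le)
      show "(norm x)\<^sup>2 \<le> (C * E_norm \<Omega> x)\<^sup>2"
        using sq[OF x(2)] sq[OF x(3)] sq[OF x(4)]
        by (simp add: x(1) E_norm_def norm_triple_sq power_mult_distrib algebra_simps)
    qed (use C(1) in \<open>simp add: E_norm_eq\<close>)
  qed
qed

lemma finite_functionals_E:
  fixes \<Omega> :: "'a::euclidean_space set"
  assumes \<Omega>: "open \<Omega>" "bounded \<Omega>" and \<epsilon>: "\<epsilon> > 0"
  obtains F C where "finite F" "F \<subseteq> E_space \<Omega>" "C \<ge> 0" "\<And>x. x \<in> E_space \<Omega> \<Longrightarrow>
    (norm x)\<^sup>2 \<le> \<epsilon> * (E_norm \<Omega> x)\<^sup>2 + C * (\<Sum>h\<in>F. (x \<bullet> h)\<^sup>2)"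
proof -
  obtain G C where G: "finite G" "G \<subseteq> H1_0 \<Omega>" "C \<ge> 0" and fr: "\<And>u. u \<in> H1_0 \<Omega> \<Longrightarrow>
    (norm u)\<^sup>2 \<le> \<epsilon> * (norm (weak_gradient \<Omega> u))\<^sup>2 + C * (\<Sum>h\<in>G. (u \<bullet> h)\<^sup>2)"
    using finite_functionals_H1_0[OF \<Omega> \<epsilon>] by blast
  define F :: "'a state set" where
    "F = (\<lambda>h. (h, 0, 0)) ` G \<union> (\<lambda>h. (0, h, 0)) ` G \<union> (\<lambda>h. (0, 0, h)) ` G"
  have F: "finite F" using G by (simp add: F_def)
  show ?thesis
  proof (rule that[OF F, of "3 * C"])
    show "F \<subseteq> E_space \<Omega>" using G(2) H1_0_zero[OF \<Omega>(1)] by (auto simp: F_def E_space_def)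
    show "3 * C \<ge> 0" using G by simp
    fix x assume "x \<in> E_space \<Omega>"
    then obtain u v w where x: "x = (u, v, w)" "u \<in> H1_0 \<Omega>" "v \<in> H1_0 \<Omega>" "w \<in> H1_0 \<Omega>"
      by (auto simp: E_space_def)
    let ?S = "\<Sum>h\<in>F. (x \<bullet> h)\<^sup>2"
    \<comment> \<open>The three embedded copies of G may overlap in 0, so each coordinate sum is
      bounded by the full sum over F; this is the source of the factor 3.\<close>
    have le: "(\<Sum>h\<in>G. (x \<bullet> j h)\<^sup>2) \<le> ?S" if "inj_on j G" "j ` G \<subseteq> F" for j
      using sum_mono2[OF F that(2), of "\<lambda>h. (x \<bullet> h)\<^sup>2"] by (simp add: sum.reindex[OF that(1)])
    have "(\<Sum>h\<in>G. (u \<bullet> h)\<^sup>2) \<le> ?S" "(\<Sum>h\<in>G. (v \<bullet> h)\<^sup>2) \<le> ?S" "(\<Sum>h\<in>G. (w \<bullet> h)\<^sup>2) \<le> ?S"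
      using le[of "\<lambda>h. (h, 0, 0)"] le[of "\<lambda>h. (0, h, 0)"] le[of "\<lambda>h. (0, 0, h)"]
      by (auto simp: x(1) inner_Pair F_def inj_on_def)
    then have "C * (\<Sum>h\<in>G. (u \<bullet> h)\<^sup>2) \<le> C * ?S" "C * (\<Sum>h\<in>G. (v \<bullet> h)\<^sup>2) \<le> C * ?S"
      "C * (\<Sum>h\<in>G. (w \<bullet> h)\<^sup>2) \<le> C * ?S" using G(3) by (auto intro: mult_left_mono)
    then show "(norm x)\<^sup>2 \<le> \<epsilon> * (E_norm \<Omega> x)\<^sup>2 + 3 * C * ?S"
      using fr[OF x(2)] fr[OF x(3)] fr[OF x(4)]
      by (simp add: x(1) norm_triple_sq E_norm_def algebra_simps)
  qed
qed

section \<open>Diffusion and reaction\<close>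

lemma diffusion_diff_left:
  assumes "open \<Omega>" "x \<in> E_space \<Omega>" "y \<in> E_space \<Omega>"
  shows "diffusion \<Omega> d1 d2 d3 (x - y) \<phi> = diffusion \<Omega> d1 d2 d3 x \<phi> - diffusion \<Omega> d1 d2 d3 y \<phi>"
  using E_grad_diff[OF assms]
  by (cases x; cases y; cases \<phi>) (simp add: diffusion_def E_grad_def inner_diff_left right_diff_distrib)

lemma diffusion_add_right:
  assumes "open \<Omega>" "\<phi> \<in> E_space \<Omega>" "\<psi> \<in> E_space \<Omega>"
  shows "diffusion \<Omega> d1 d2 d3 x (\<phi> + \<psi>) = diffusion \<Omega> d1 d2 d3 x \<phi> + diffusion \<Omega> d1 d2 d3 x \<psi>"
  using E_grad_add[OF assms]
  by (cases x; cases \<phi>; cases \<psi>) (simp add: diffusion_def E_grad_def inner_add_right distrib_left)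

lemma diffusion_scaleR_right:
  assumes "open \<Omega>" "\<phi> \<in> E_space \<Omega>"
  shows "diffusion \<Omega> d1 d2 d3 x (c *\<^sub>R \<phi>) = c * diffusion \<Omega> d1 d2 d3 x \<phi>"
  using E_grad_scaleR[OF assms]
  by (cases x; cases \<phi>) (simp add: diffusion_def E_grad_def distrib_left right_diff_distrib mult.left_commute)

lemma diffusion_bound:
  assumes "0 < d1" "0 < d2" "0 < d3"
  shows "\<bar>diffusion \<Omega> d1 d2 d3 x \<phi>\<bar> \<le> (d1 + d2 + d3) * E_norm \<Omega> x * E_norm \<Omega> \<phi>"
proof -
  obtain u v w where x: "x = (u, v, w)" by (cases x) auto
  obtain p q r where p: "\<phi> = (p, q, r)" by (cases \<phi>) auto
  have *: "\<bar>weak_gradient \<Omega> a \<bullet> weak_gradient \<Omega> b\<bar> \<le> E_norm \<Omega> x * E_norm \<Omega> \<phi>"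
    if "norm (weak_gradient \<Omega> a) \<le> E_norm \<Omega> x" "norm (weak_gradient \<Omega> b) \<le> E_norm \<Omega> \<phi>" for a b
    by (rule order_trans[OF Cauchy_Schwarz_ineq2]) (intro mult_mono that, auto simp: E_norm_eq)
  have "\<bar>weak_gradient \<Omega> u \<bullet> weak_gradient \<Omega> p\<bar> \<le> E_norm \<Omega> x * E_norm \<Omega> \<phi>"
    "\<bar>weak_gradient \<Omega> v \<bullet> weak_gradient \<Omega> q\<bar> \<le> E_norm \<Omega> x * E_norm \<Omega> \<phi>"
    "\<bar>weak_gradient \<Omega> w \<bullet> weak_gradient \<Omega> r\<bar> \<le> E_norm \<Omega> x * E_norm \<Omega> \<phi>"
    by (intro *; simp add: x p E_norm_def norm_triple_ge)+
  then have "d1 * \<bar>weak_gradient \<Omega> u \<bullet> weak_gradient \<Omega> p\<bar> \<le> d1 * (E_norm \<Omega> x * E_norm \<Omega> \<phi>)"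
    "d2 * \<bar>weak_gradient \<Omega> v \<bullet> weak_gradient \<Omega> q\<bar> \<le> d2 * (E_norm \<Omega> x * E_norm \<Omega> \<phi>)"
    "d3 * \<bar>weak_gradient \<Omega> w \<bullet> weak_gradient \<Omega> r\<bar> \<le> d3 * (E_norm \<Omega> x * E_norm \<Omega> \<phi>)"
    using assms by (auto intro: mult_left_mono)
  moreover have "\<bar>diffusion \<Omega> d1 d2 d3 x \<phi>\<bar> \<le> d1 * \<bar>weak_gradient \<Omega> u \<bullet> weak_gradient \<Omega> p\<bar>
      + d2 * \<bar>weak_gradient \<Omega> v \<bullet> weak_gradient \<Omega> q\<bar> + d3 * \<bar>weak_gradient \<Omega> w \<bullet> weak_gradient \<Omega> r\<bar>"
  proof -
    have "\<bar>d * s\<bar> = d * \<bar>s\<bar>" if "0 < d" for d s :: real using that by (simp add: abs_mult)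
    note this[OF assms(1), of "weak_gradient \<Omega> u \<bullet> weak_gradient \<Omega> p"]
      this[OF assms(2), of "weak_gradient \<Omega> v \<bullet> weak_gradient \<Omega> q"]
      this[OF assms(3), of "weak_gradient \<Omega> w \<bullet> weak_gradient \<Omega> r"]
    then show ?thesis unfolding diffusion_def x p prod.case by linarith
  qed
  ultimately show ?thesis by (simp add: algebra_simps)
qed

lemma diffusion_coercive:
  assumes "0 < d1" "0 < d2" "0 < d3"
  shows "diffusion \<Omega> d1 d2 d3 x x \<le> - (min d1 (min d2 d3) * (E_norm \<Omega> x)\<^sup>2)"
proof -
  obtain u v w where x: "x = (u, v, w)" by (cases x) auto
  let ?d = "min d1 (min d2 d3)"
  have "?d * (norm a)\<^sup>2 \<le> d1 * (norm a)\<^sup>2" "?d * (norm a)\<^sup>2 \<le> d2 * (norm a)\<^sup>2" "?d * (norm a)\<^sup>2 \<le> d3 * (norm a)\<^sup>2"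
    for a :: "('a, 'a) L2"
    by (intro mult_right_mono; simp)+
  note * = this(1)[of "weak_gradient \<Omega> u"] this(2)[of "weak_gradient \<Omega> v"] this(3)[of "weak_gradient \<Omega> w"]
  then show ?thesis
    by (simp add: x diffusion_def E_norm_def norm_triple_sq power2_norm_eq_inner[symmetric] distrib_left)
qed

text \<open>Each product difference is split by the Leibniz rule and the undifferenced factor is
  isolated by symmetry of the triple integral. That factor is bounded by M, while the product of a
  difference with a test component is left to the L^4 estimates. The square of u yields two such
  terms, hence \<open>2 * F\<close> in L.\<close>

lemma reaction_difference_bound:
  fixes \<Omega> :: "'a::euclidean_space set"
  assumes \<Omega>: "open \<Omega>" and n: "DIM('a) \<le> 3"
    and pos: "a1 > 0" "a3 > 0" "b1 > 0" "b2 > 0" "c2 > 0" "c3 > 0" "F > 0" "G1 > 0" "G2 > 0"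
    and xy: "(u, v, w) \<in> E_space \<Omega>" "(u', v', w') \<in> E_space \<Omega>" "(p, q, r) \<in> E_space \<Omega>"
    and M: "norm (u, v, w) \<le> M" "norm (u', v', w') \<le> M"
    and L: "L = a1 + a3 + b1 + b2 + c2 + c3 + 2 * F + G1 + G2"
    and f: "f = oregonator_reaction a1 a3 b1 b2 c2 c3 F G1 G2"
  shows "\<bar>(f (u, v, w) - f (u', v', w')) \<bullet> (p, q, r)\<bar>
    \<le> L * norm ((u, v, w) - (u', v', w')) * norm (p, q, r)
      + L * M * (norm (L2_mult (u - u') p) + norm (L2_mult (v - v') p)
          + norm (L2_mult (u - u') q) + norm (L2_mult (v - v') q))"
proof -
  define U V W where "U = u - u'" and "V = v - v'" and "W = w - w'"
  have H: "u \<in> H1_0 \<Omega>" "v \<in> H1_0 \<Omega>" "u' \<in> H1_0 \<Omega>" "v' \<in> H1_0 \<Omega>" "p \<in> H1_0 \<Omega>" "q \<in> H1_0 \<Omega>"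
    using xy by (auto simp: E_space_def)
  then have HU: "U \<in> H1_0 \<Omega>" "V \<in> H1_0 \<Omega>" unfolding U_def V_def by (auto intro: H1_0_diff[OF \<Omega>])
  note sh = inner_L2_mult_shift[OF \<Omega> n]
  have nM: "norm u \<le> M" "norm u' \<le> M" "norm v \<le> M" "norm v' \<le> M"
    by (rule order_trans[OF norm_triple_ge(1) M(1)] order_trans[OF norm_triple_ge(1) M(2)]
        order_trans[OF norm_triple_ge(2) M(1)] order_trans[OF norm_triple_ge(2) M(2)])+
  have tri: "\<bar>s \<bullet> L2_mult k l\<bar> \<le> M * norm (L2_mult k l)" if "norm s \<le> M" for s k l :: "('a, real) L2"
    by (rule order_trans[OF Cauchy_Schwarz_ineq2]) (intro mult_right_mono that, simp)
  have uu: "(L2_mult u u - L2_mult u' u') \<bullet> p = u \<bullet> L2_mult U p + u' \<bullet> L2_mult U p"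
  proof -
    have "L2_mult u u - L2_mult u' u' = L2_mult u U + L2_mult u' U"
      using L2_mult_difference[OF \<Omega> n H(1,3,1,3)] by (simp only: U_def L2_mult_commute[of "u - u'" u'])
    then show ?thesis by (simp only: inner_add_left sh[OF H(1) HU(1) H(5)] sh[OF H(3) HU(1) H(5)])
  qed
  have uv: "(L2_mult u v - L2_mult u' v') \<bullet> s = u \<bullet> L2_mult V s + v' \<bullet> L2_mult U s" if "s \<in> H1_0 \<Omega>" for s
  proof -
    have "L2_mult u v - L2_mult u' v' = L2_mult u V + L2_mult v' U"
      using L2_mult_difference[OF \<Omega> n H(1,3,2,4)] by (simp only: U_def V_def L2_mult_commute[of "u - u'" v'])
    then show ?thesis by (simp only: inner_add_left sh[OF H(1) HU(2) that] sh[OF H(4) HU(1) that])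
  qed
  let ?z = "norm ((u, v, w) - (u', v', w'))" and ?\<phi> = "norm (p, q, r)"
  have zz: "(u, v, w) - (u', v', w') = (U, V, W)" by (simp add: U_def V_def W_def)
  have lin: "\<bar>s \<bullet> t\<bar> \<le> ?z * ?\<phi>" if "norm s \<le> ?z" "norm t \<le> ?\<phi>" for s t :: "('a, real) L2"
    by (rule order_trans[OF Cauchy_Schwarz_ineq2]) (intro mult_mono that, auto)
  have UVW: "norm U \<le> ?z" "norm V \<le> ?z" "norm W \<le> ?z" unfolding zz by (rule norm_triple_ge)+
  have pqr: "norm p \<le> ?\<phi>" "norm q \<le> ?\<phi>" "norm r \<le> ?\<phi>" by (rule norm_triple_ge)+
  have expand: "(f (u, v, w) - f (u', v', w')) \<bullet> (p, q, r) =
      a1 * (U \<bullet> p) + b1 * (V \<bullet> p) - F * ((L2_mult u u - L2_mult u' u') \<bullet> p)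
      - G1 * ((L2_mult u v - L2_mult u' v') \<bullet> p) - b2 * (V \<bullet> q) + c2 * (W \<bullet> q)
      - G2 * ((L2_mult u v - L2_mult u' v') \<bullet> q) + a3 * (U \<bullet> r) - c3 * (W \<bullet> r)"
    by (simp add: f oregonator_reaction_def U_def V_def W_def inner_add_left inner_diff_left right_diff_distrib)
  have sc: "\<bar>c * s\<bar> \<le> c * t" if "c > 0" "\<bar>s\<bar> \<le> t" for c s t :: real
    using that by (simp add: abs_mult)
  note l = sc[OF pos(1) lin[OF UVW(1) pqr(1)]] sc[OF pos(3) lin[OF UVW(2) pqr(1)]]
    sc[OF pos(4) lin[OF UVW(2) pqr(2)]] sc[OF pos(5) lin[OF UVW(3) pqr(2)]]
    sc[OF pos(2) lin[OF UVW(1) pqr(3)]] sc[OF pos(6) lin[OF UVW(3) pqr(3)]]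
  let ?Up = "norm (L2_mult U p)" and ?Vp = "norm (L2_mult V p)"
  let ?Uq = "norm (L2_mult U q)" and ?Vq = "norm (L2_mult V q)"
  have "\<bar>(L2_mult u u - L2_mult u' u') \<bullet> p\<bar> \<le> 2 * (M * ?Up)"
    "\<bar>(L2_mult u v - L2_mult u' v') \<bullet> p\<bar> \<le> M * ?Vp + M * ?Up"
    "\<bar>(L2_mult u v - L2_mult u' v') \<bullet> q\<bar> \<le> M * ?Vq + M * ?Uq"
    unfolding uu uv[OF H(5)] uv[OF H(6)]
    using tri[OF nM(1), of U p] tri[OF nM(2), of U p] tri[OF nM(1), of V p] tri[OF nM(4), of U p]
      tri[OF nM(1), of V q] tri[OF nM(4), of U q] by linarith+
  note m = sc[OF pos(7) this(1)] sc[OF pos(8) this(2)] sc[OF pos(9) this(3)]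
  have sum: "\<bar>(f (u, v, w) - f (u', v', w')) \<bullet> (p, q, r)\<bar> \<le>
      a1 * (?z * ?\<phi>) + b1 * (?z * ?\<phi>) + b2 * (?z * ?\<phi>) + c2 * (?z * ?\<phi>) + a3 * (?z * ?\<phi>) + c3 * (?z * ?\<phi>)
      + F * (2 * (M * ?Up)) + G1 * (M * ?Vp + M * ?Up) + G2 * (M * ?Vq + M * ?Uq)"
    unfolding expand
    using l[THEN abs_le_D1] m[THEN abs_le_D1] l[THEN abs_le_D2] m[THEN abs_le_D2]
    by (intro abs_leI; linarith)
  have M0: "M \<ge> 0" using nM(1) norm_ge_zero order_trans by blast
  have t: "0 \<le> M * ?Up" "0 \<le> M * ?Vp" "0 \<le> M * ?Uq" "0 \<le> M * ?Vq" "0 \<le> ?z * ?\<phi>" using M0 by simp_all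
  have e: "0 \<le> c * s" if "c > 0" "0 \<le> s" for c s :: real using that by simp
  have "a1 * (?z * ?\<phi>) + b1 * (?z * ?\<phi>) + b2 * (?z * ?\<phi>) + c2 * (?z * ?\<phi>) + a3 * (?z * ?\<phi>) + c3 * (?z * ?\<phi>)
      \<le> L * (?z * ?\<phi>)"
    using e[OF pos(7) t(5)] e[OF pos(8) t(5)] e[OF pos(9) t(5)] unfolding L by (simp only: distrib_right)
  moreover have "F * (2 * (M * ?Up)) + G1 * (M * ?Vp + M * ?Up) + G2 * (M * ?Vq + M * ?Uq)
      \<le> L * (M * ?Up) + L * (M * ?Vp) + L * (M * ?Uq) + L * (M * ?Vq)"
  proof -
    have "2 * F + G1 \<le> L" "G1 \<le> L" "G2 \<le> L" using pos by (simp_all add: L)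
    note mult_right_mono[OF this(1) t(1)] mult_right_mono[OF this(2) t(2)]
      mult_right_mono[OF this(3) t(3)] mult_right_mono[OF this(3) t(4)]
    then show ?thesis by (simp add: algebra_simps)
  qed
  ultimately have "\<bar>(f (u, v, w) - f (u', v', w')) \<bullet> (p, q, r)\<bar>
     \<le> L * (?z * ?\<phi>) + (L * (M * ?Up) + L * (M * ?Vp) + L * (M * ?Uq) + L * (M * ?Vq))"
    using sum by linarith
  then show ?thesis by (simp add: U_def V_def distrib_left mult.assoc)
qed

text \<open>Boundedness and coercivity of the difference equation on a ball of \<open>H\<close>. The
  first uses the gradient bound for products and makes z' a functional on \<open>E\<close>; the
  second absorbs the interpolated products into half of the diffusion.\<close>

lemma Oregonator_difference_bounds:
  fixes \<Omega> :: "'a::euclidean_space set"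
  assumes \<Omega>: "open \<Omega>" "bounded \<Omega>" and n: "DIM('a) \<le> 3"
    and d: "d1 > 0" "d2 > 0" "d3 > 0"
    and pos: "a1 > 0" "a3 > 0" "b1 > 0" "b2 > 0" "c2 > 0" "c3 > 0" "F > 0" "G1 > 0" "G2 > 0"
    and f: "f = oregonator_reaction a1 a3 b1 b2 c2 c3 F G1 G2" and M: "M \<ge> 0"
  obtains c K C where "c > 0" "K \<ge> 0" "C > 0"
    "\<And>x y \<phi>. x \<in> E_space \<Omega> \<Longrightarrow> y \<in> E_space \<Omega> \<Longrightarrow> \<phi> \<in> E_space \<Omega> \<Longrightarrow> norm x \<le> M \<Longrightarrow> norm y \<le> M \<Longrightarrow>
      \<bar>diffusion \<Omega> d1 d2 d3 (x - y) \<phi> + (f x - f y) \<bullet> \<phi>\<bar> \<le> C * E_norm \<Omega> (x - y) * E_norm \<Omega> \<phi>"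
    "\<And>x y. x \<in> E_space \<Omega> \<Longrightarrow> y \<in> E_space \<Omega> \<Longrightarrow> norm x \<le> M \<Longrightarrow> norm y \<le> M \<Longrightarrow>
      diffusion \<Omega> d1 d2 d3 (x - y) (x - y) + (f x - f y) \<bullet> (x - y)
        \<le> - c * (E_norm \<Omega> (x - y))\<^sup>2 + K * (norm (x - y))\<^sup>2"
proof -
  define L where "L = a1 + a3 + b1 + b2 + c2 + c3 + 2 * F + G1 + G2"
  have L: "L > 0" using pos by (simp add: L_def)
  define dm where "dm = min d1 (min d2 d3)"
  have dm: "dm > 0" using d by (simp add: dm_def)
  obtain C0 where C0: "C0 > 0" "\<And>x. x \<in> E_space \<Omega> \<Longrightarrow> norm x \<le> C0 * E_norm \<Omega> x"
    using E_Poincare[OF \<Omega>] by blast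
  obtain C1 where C1: "C1 > 0" "\<And>u v. u \<in> H1_0 \<Omega> \<Longrightarrow> v \<in> H1_0 \<Omega> \<Longrightarrow>
    norm (L2_mult u v) \<le> C1 * norm (weak_gradient \<Omega> u) * norm (weak_gradient \<Omega> v)"
    using norm_L2_mult_gradient[OF \<Omega> n] by blast
  \<comment> \<open>Four product norms with 2 \<delta> each, multiplied by L M, must not exceed half
    of the smallest diffusion constant; the summand 1 avoids division by zero.\<close>
  define \<delta> where "\<delta> = dm / 2 / (8 * (L * M + 1))"
  have LM: "L * M \<ge> 0" using L M by simp
  then have \<delta>: "\<delta> > 0" using dm by (simp add: \<delta>_def)
  have \<delta>': "L * M * (8 * \<delta>) \<le> dm / 2"
  proof -
    have "L * M * (8 * \<delta>) = dm / 2 * (L * M / (L * M + 1))" using LM by (simp add: \<delta>_def field_simps)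
    also have "\<dots> \<le> dm / 2 * 1" using LM dm by (intro mult_left_mono) auto
    finally show ?thesis by simp
  qed
  obtain C2 where C2: "C2 \<ge> 0" "\<And>u v. u \<in> H1_0 \<Omega> \<Longrightarrow> v \<in> H1_0 \<Omega> \<Longrightarrow>
    norm (L2_mult u v) \<le> \<delta> * ((norm (weak_gradient \<Omega> u))\<^sup>2 + (norm (weak_gradient \<Omega> v))\<^sup>2)
      + C2 * ((norm u)\<^sup>2 + (norm v)\<^sup>2)"
    using norm_L2_mult_interpolation[OF \<Omega>(1) n \<delta>] by blast
  define C where "C = d1 + d2 + d3 + L * C0\<^sup>2 + 4 * L * M * C1"
  define K where "K = L + L * M * 8 * C2"
  show ?thesis
  proof (rule that[of "dm / 2" K C])
    show "dm / 2 > 0" using dm by simp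
    show "K \<ge> 0" using L LM C2 by (simp add: K_def)
    show "C > 0" using L LM C1 d M by (simp add: C_def add_pos_nonneg)
  next
    fix x y \<phi> assume E: "x \<in> E_space \<Omega>" "y \<in> E_space \<Omega>" "\<phi> \<in> E_space \<Omega>" and nM: "norm x \<le> M" "norm y \<le> M"
    obtain u v w where x: "x = (u, v, w)" by (cases x) auto
    obtain u' v' w' where y: "y = (u', v', w')" by (cases y) auto
    obtain p q r where \<phi>: "\<phi> = (p, q, r)" by (cases \<phi>) auto
    have zE: "x - y \<in> E_space \<Omega>" using E by (intro E_space_diff \<Omega>)
    have H: "u - u' \<in> H1_0 \<Omega>" "v - v' \<in> H1_0 \<Omega>" "p \<in> H1_0 \<Omega>" "q \<in> H1_0 \<Omega>"
      using zE E(3) by (auto simp: E_space_def x y \<phi>)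
    let ?z = "E_norm \<Omega> (x - y)" and ?\<phi> = "E_norm \<Omega> \<phi>"
    have m: "norm (L2_mult k l) \<le> C1 * (?z * ?\<phi>)" if "k \<in> H1_0 \<Omega>" "l \<in> H1_0 \<Omega>"
      "norm (weak_gradient \<Omega> k) \<le> ?z" "norm (weak_gradient \<Omega> l) \<le> ?\<phi>" for k l
    proof -
      have "norm (L2_mult k l) \<le> C1 * (norm (weak_gradient \<Omega> k) * norm (weak_gradient \<Omega> l))"
        using C1(2)[OF that(1,2)] by (simp add: mult.assoc)
      also have "\<dots> \<le> C1 * (?z * ?\<phi>)"
        using C1(1) that(3,4) by (intro mult_left_mono mult_mono) (auto simp: E_norm_eq)
      finally show ?thesis .
    qed
    have g: "norm (weak_gradient \<Omega> (u - u')) \<le> ?z" "norm (weak_gradient \<Omega> (v - v')) \<le> ?z"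
      "norm (weak_gradient \<Omega> p) \<le> ?\<phi>" "norm (weak_gradient \<Omega> q) \<le> ?\<phi>"
      by (simp_all add: x y \<phi> E_norm_def norm_triple_ge)
    have "\<bar>(f x - f y) \<bullet> \<phi>\<bar> \<le> L * norm (x - y) * norm \<phi> + L * M * (norm (L2_mult (u - u') p) + norm (L2_mult (v - v') p)
          + norm (L2_mult (u - u') q) + norm (L2_mult (v - v') q))"
      using reaction_difference_bound[OF \<Omega>(1) n pos E[unfolded x y \<phi>] nM[unfolded x y] L_def f]
      by (simp only: x y \<phi>)
    also have "\<dots> \<le> L * (C0 * ?z) * (C0 * ?\<phi>) + L * M * (C1 * (?z * ?\<phi>) + C1 * (?z * ?\<phi>) + C1 * (?z * ?\<phi>) + C1 * (?z * ?\<phi>))"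
      using L LM C0(1) M by (intro add_mono mult_mono mult_left_mono m H g C0(2) zE E mult_nonneg_nonneg) (auto simp: E_norm_eq)
    finally show "\<bar>diffusion \<Omega> d1 d2 d3 (x - y) \<phi> + (f x - f y) \<bullet> \<phi>\<bar> \<le> C * ?z * ?\<phi>"
      using diffusion_bound[OF d, of \<Omega> "x - y" \<phi>] unfolding C_def
      by (simp add: power2_eq_square algebra_simps)
  next
    fix x y assume E: "x \<in> E_space \<Omega>" "y \<in> E_space \<Omega>" and nM: "norm x \<le> M" "norm y \<le> M"
    obtain u v w where x: "x = (u, v, w)" by (cases x) auto
    obtain u' v' w' where y: "y = (u', v', w')" by (cases y) auto
    have zE: "x - y \<in> E_space \<Omega>" using E by (intro E_space_diff \<Omega>)
    have H: "u - u' \<in> H1_0 \<Omega>" "v - v' \<in> H1_0 \<Omega>" using zE by (auto simp: E_space_def x y)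
    let ?z = "E_norm \<Omega> (x - y)" and ?n = "norm (x - y)"
    have m: "norm (L2_mult k l) \<le> 2 * \<delta> * ?z\<^sup>2 + 2 * C2 * ?n\<^sup>2" if "k \<in> H1_0 \<Omega>" "l \<in> H1_0 \<Omega>"
      "norm (weak_gradient \<Omega> k) \<le> ?z" "norm (weak_gradient \<Omega> l) \<le> ?z" "norm k \<le> ?n" "norm l \<le> ?n" for k l
    proof -
      have "norm (L2_mult k l) \<le> \<delta> * ((norm (weak_gradient \<Omega> k))\<^sup>2 + (norm (weak_gradient \<Omega> l))\<^sup>2)
        + C2 * ((norm k)\<^sup>2 + (norm l)\<^sup>2)" by (rule C2(2)[OF that(1,2)])
      also have "\<dots> \<le> \<delta> * (?z\<^sup>2 + ?z\<^sup>2) + C2 * (?n\<^sup>2 + ?n\<^sup>2)"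
        using \<delta> C2(1) that(3-6) by (intro add_mono mult_left_mono power_mono) auto
      finally show ?thesis by simp
    qed
    have g: "norm (weak_gradient \<Omega> (u - u')) \<le> ?z" "norm (weak_gradient \<Omega> (v - v')) \<le> ?z"
      "norm (u - u') \<le> ?n" "norm (v - v') \<le> ?n"
      by (simp_all add: x y E_norm_def norm_triple_ge)
    let ?B = "2 * \<delta> * ?z\<^sup>2 + 2 * C2 * ?n\<^sup>2"
    have "\<bar>(f x - f y) \<bullet> (x - y)\<bar> \<le> L * ?n * ?n + L * M * (norm (L2_mult (u - u') (u - u')) + norm (L2_mult (v - v') (u - u'))
          + norm (L2_mult (u - u') (v - v')) + norm (L2_mult (v - v') (v - v')))"
      using reaction_difference_bound[OF \<Omega>(1) n pos E[unfolded x y] zE[unfolded x y diff_Pair] nM[unfolded x y] L_def f]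
      by (simp only: x y diff_Pair)
    also have "\<dots> \<le> L * ?n * ?n + L * M * (?B + ?B + ?B + ?B)"
      using LM by (intro add_mono mult_left_mono m H g order_refl)
    also have "\<dots> = L * M * (8 * \<delta>) * ?z\<^sup>2 + K * ?n\<^sup>2"
      by (simp add: K_def power2_eq_square algebra_simps)
    also have "\<dots> \<le> dm / 2 * ?z\<^sup>2 + K * ?n\<^sup>2"
      by (intro add_right_mono mult_right_mono \<delta>') simp
    finally have "(f x - f y) \<bullet> (x - y) \<le> dm / 2 * ?z\<^sup>2 + K * ?n\<^sup>2" by linarith
    moreover have "diffusion \<Omega> d1 d2 d3 (x - y) (x - y) \<le> - (dm * ?z\<^sup>2)"
      unfolding dm_def by (rule diffusion_coercive[OF d])
    ultimately show "diffusion \<Omega> d1 d2 d3 (x - y) (x - y) + (f x - f y) \<bullet> (x - y)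
        \<le> - (dm / 2) * ?z\<^sup>2 + K * ?n\<^sup>2" by simp
  qed
qed

section \<open>Distributional time derivatives\<close>

text \<open>The slope of the smooth step is a continuous kernel supported in [0, 1] with integral 1.
  Rescaled, it becomes an approximate identity acting from the right.\<close>

definition step_deriv :: "real \<Rightarrow> real" where
  "step_deriv x = frechet_derivative smooth_step (at x) 1"

lemma smooth_step_deriv: "(smooth_step has_real_derivative step_deriv x) (at x)"
  and continuous_step_deriv: "continuous_on UNIV step_deriv"
proof -
  have "C_k (Suc 0) smooth_step" by (rule C_k_smooth_step)
  then obtain f' where f': "\<And>x. (smooth_step has_derivative f' x) (at x)"
    "\<And>v. v \<in> Basis \<Longrightarrow> C_k 0 (\<lambda>x. f' x v)" by (rule C_k_SucE) blast
  have eq: "frechet_derivative smooth_step (at x) = f' x" for x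
    using frechet_derivative_at[OF f'(1)] by metis
  have "f' x h = step_deriv x * h" for h
    using linear_scale[OF has_derivative_linear[OF f'(1)[of x]], of h 1] by (simp add: step_deriv_def eq mult.commute)
  then have "f' x = (*) (step_deriv x)" by blast
  with f'(1)[of x] show "(smooth_step has_real_derivative step_deriv x) (at x)"
    by (simp add: has_field_derivative_def)
  show "continuous_on UNIV step_deriv"
    using f'(2)[of 1] unfolding step_deriv_def[abs_def] eq by simp
qed

lemma step_deriv_eq_0: "x \<notin> {0..1} \<Longrightarrow> step_deriv x = 0"
proof -
  assume x: "x \<notin> {0..1}"
  then consider "x < 0" | "x > 1" by force
  then have "(smooth_step has_real_derivative 0) (at x)"
  proof cases
    case 1
    show ?thesis
      by (rule has_field_derivative_transform_within_open[of "\<lambda>_. 0" 0 x "{..<0}"])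
        (use 1 in \<open>auto simp: smooth_step_eq_0\<close>)
  next
    case 2
    show ?thesis
      by (rule has_field_derivative_transform_within_open[of "\<lambda>_. 1" 0 x "{1<..}"])
        (use 2 in \<open>auto simp: smooth_step_eq_1\<close>)
  qed
  then show ?thesis using smooth_step_deriv DERIV_unique by blast
qed

lemma integral_step_deriv: "integrable lborel step_deriv" "(LINT x|lborel. step_deriv x) = 1"
proof -
  have eq: "step_deriv x = indicator {0..1} x *\<^sub>R step_deriv x" for x
    using step_deriv_eq_0[of x] by (auto simp: indicator_def)
  have "integrable lborel (\<lambda>x. indicator {0..1} x *\<^sub>R step_deriv x)"
    by (rule borel_integrable_compact) (auto intro: continuous_on_subset[OF continuous_step_deriv])
  moreover have fn: "(\<lambda>x. indicator {0..1} x *\<^sub>R step_deriv x) = step_deriv"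
    by (rule ext) (rule eq[symmetric])
  ultimately show "integrable lborel step_deriv" by simp
  have "(LINT x|lborel. indicator {0..1} x *\<^sub>R step_deriv x) = smooth_step 1 - smooth_step 0"
    by (rule integral_FTC_atLeastAtMost)
      (auto intro: continuous_on_subset[OF continuous_step_deriv]
        has_field_derivative_at_within smooth_step_deriv
        simp flip: has_real_derivative_iff_has_vector_derivative)
  then show "(LINT x|lborel. step_deriv x) = 1"
    unfolding fn by (simp add: smooth_step_eq_0 smooth_step_eq_1)
qed

text \<open>After the substitution x = s + \<delta> y the kernel is fixed and only the argument of p
  moves, so dominated convergence applies.\<close>

lemma step_deriv_convolution_tendsto:
  fixes p :: "real \<Rightarrow> real"
  assumes p: "continuous_on UNIV p" "\<And>x. \<bar>p x\<bar> \<le> C" and \<delta>: "\<delta> \<longlonglongrightarrow> 0" "\<And>k. \<delta> k > 0"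
  shows "integrable lborel (\<lambda>x. p x * (step_deriv ((x - s) / \<delta> k) / \<delta> k))"
    and "(\<lambda>k. LINT x|lborel. p x * (step_deriv ((x - s) / \<delta> k) / \<delta> k)) \<longlonglongrightarrow> p s"
proof -
  have [measurable]: "p \<in> borel_measurable borel" "step_deriv \<in> borel_measurable borel"
    using p(1) continuous_step_deriv by (simp_all add: borel_measurable_continuous_onI)
  have dom: "integrable lborel (\<lambda>y. C * \<bar>step_deriv y\<bar>)" using integral_step_deriv(1) by simp
  have bd: "\<bar>p x * step_deriv y\<bar> \<le> C * \<bar>step_deriv y\<bar>" for x y
    using p(2)[of x] by (simp add: abs_mult mult_right_mono)
  have int: "integrable lborel (\<lambda>y. p (s + \<delta> k * y) * step_deriv y)" for k
    by (rule Bochner_Integration.integrable_bound[OF dom]) (auto intro: order_trans[OF bd abs_ge_self])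
  have eq: "p (s + \<delta> k * y) * step_deriv y = \<delta> k * (p (s + \<delta> k * y) * (step_deriv ((s + \<delta> k * y - s) / \<delta> k) / \<delta> k))" for k y
    using \<delta>(2)[of k] by simp
  let ?F = "\<lambda>k x. p x * (step_deriv ((x - s) / \<delta> k) / \<delta> k)"
  show "integrable lborel (?F k)"
    using int[of k] lborel_integrable_real_affine_iff[of "\<delta> k" "?F k" s] \<delta>(2)[of k]
    unfolding eq by simp
  have "(LINT x|lborel. ?F k x) = (LINT y|lborel. p (s + \<delta> k * y) * step_deriv y)" for k
    using lborel_integral_real_affine[of "\<delta> k" "?F k" s] \<delta>(2)[of k] unfolding eq by simp
  moreover have "(\<lambda>k. LINT y|lborel. p (s + \<delta> k * y) * step_deriv y) \<longlonglongrightarrow> (LINT y|lborel. p s * step_deriv y)"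
  proof (rule integral_dominated_convergence[OF _ _ dom])
    show "AE y in lborel. (\<lambda>k. p (s + \<delta> k * y) * step_deriv y) \<longlonglongrightarrow> p s * step_deriv y"
    proof (intro AE_I2 tendsto_intros)
      fix y
      have "(\<lambda>k. s + \<delta> k * y) \<longlonglongrightarrow> s + 0 * y" by (intro tendsto_intros \<delta>)
      moreover have "isCont p s" using p(1) by (simp add: continuous_on_eq_continuous_at)
      ultimately show "(\<lambda>k. p (s + \<delta> k * y)) \<longlonglongrightarrow> p s" using isCont_tendsto_compose by fastforce
    qed
  qed (use bd in auto)
  ultimately show "(\<lambda>k. LINT x|lborel. ?F k x) \<longlonglongrightarrow> p s"
    by (simp add: integral_step_deriv)
qed

text \<open>The test function is a difference of two smooth steps, approximating the indicator of
  (s, t]: its derivative picks out the values of p at s and t, and the function itself the integral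
  of q. Both endpoints are interior because q is only locally integrable.\<close>

lemma weak_derivative_integral:
  fixes p q :: "real \<Rightarrow> real"
  assumes wd: "has_weak_derivative_on {0<..<\<tau>} 1 p q" and p: "continuous_on {0..\<tau>} p"
    and st: "0 < s" "s \<le> t" "t < \<tau>"
  shows "p t - p s = integral {s..t} q"
proof (cases "s = t")
  case False
  then have "s < t" using st by simp
  have q: "locally_integrable {0<..<\<tau>} q" using wd by (simp add: has_weak_derivative_on_def)
  \<comment> \<open>Freezing p at its end values gives a bounded continuous function on the whole
    line that agrees with p on all supports.\<close>
  define P where "P x = p (max 0 (min \<tau> x))" for x
  have Pcont: "continuous_on UNIV P"
    unfolding P_def using st by (intro continuous_on_compose2[OF p] continuous_intros) auto
  obtain C where C: "\<And>x. \<bar>P x\<bar> \<le> C"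
  proof -
    have "compact (p ` {0..\<tau>})" using p by (intro compact_continuous_image) auto
    then have "bounded (p ` {0..\<tau>})" by (rule compact_imp_bounded)
    then obtain C where "\<forall>y\<in>p ` {0..\<tau>}. norm y \<le> C" unfolding bounded_iff by blast
    then have "\<bar>P x\<bar> \<le> C" for x using st by (simp add: P_def)
    then show ?thesis by (rule that)
  qed
  \<comment> \<open>Half of the gap between t and \<tau> keeps the supports of all test functions in
    one compact subset of the open interval.\<close>
  define \<delta>0 where "\<delta>0 = (\<tau> - t) / 2"
  have \<delta>0: "\<delta>0 > 0" "t + \<delta>0 < \<tau>" using st by (simp_all add: \<delta>0_def field_simps)
  define \<delta> where "\<delta> k = \<delta>0 * inverse (real (Suc k))" for k
  have \<delta>: "\<delta> k > 0" "\<delta> k \<le> \<delta>0" for k using \<delta>0 by (auto simp: \<delta>_def field_simps)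
  have \<delta>_lim: "\<delta> \<longlonglongrightarrow> 0"
    using tendsto_mult[OF tendsto_const LIMSEQ_inverse_real_of_nat, of \<delta>0] by (simp add: \<delta>_def[abs_def])
  define \<eta> where "\<eta> k x = smooth_step ((x - s) / \<delta> k) - smooth_step ((x - t) / \<delta> k)" for k x
  have supp: "\<eta> k x = 0" if x: "x \<notin> {s..t + \<delta>0}" for k x
  proof -
    consider "x < s" | "x > t + \<delta>0" using x by force
    then show ?thesis
    proof cases
      case 1
      then have "(x - s) / \<delta> k \<le> 0" "(x - t) / \<delta> k \<le> 0"
        using \<delta>(1)[of k] \<open>s < t\<close> by (auto intro: divide_nonpos_pos)
      then show ?thesis by (simp add: \<eta>_def smooth_step_eq_0)
    next
      case 2
      then have "(x - s) / \<delta> k \<ge> 1" "(x - t) / \<delta> k \<ge> 1"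
        using \<delta>[of k] \<open>s < t\<close> by (auto simp: le_divide_eq)
      then show ?thesis by (simp add: \<eta>_def smooth_step_eq_1)
    qed
  qed
  have test: "test_function {0<..<\<tau>} (\<eta> k)" for k
  proof (rule test_functionI)
    have "C_k j (\<lambda>x. smooth_step (x / \<delta> k + - a / \<delta> k))" for j a
      by (rule C_k_compose_affine[OF bounded_linear_divide C_k_smooth_step])
    then show "C_k j (\<eta> k)" for j
      unfolding \<eta>_def by (intro C_k_diff) (simp_all add: diff_divide_distrib)
    show "{s..t + \<delta>0} \<subseteq> {0<..<\<tau>}" using st \<delta>0 by auto
  qed (use supp in auto)
  define D where "D k x = step_deriv ((x - s) / \<delta> k) / \<delta> k - step_deriv ((x - t) / \<delta> k) / \<delta> k" for k x
  have deriv: "frechet_derivative (\<eta> k) (at x) 1 = D k x" for k x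
  proof -
    have aux: "((\<lambda>x. smooth_step ((x - a) / \<delta> k)) has_real_derivative step_deriv ((x - a) / \<delta> k) * (1 / \<delta> k)) (at x)" for a
      by (rule DERIV_chain2[OF smooth_step_deriv]) (use \<delta>(1)[of k] in \<open>auto intro!: derivative_eq_intros\<close>)
    have "(\<eta> k has_real_derivative D k x) (at x)"
      unfolding \<eta>_def[abs_def] D_def using DERIV_diff[OF aux[of s] aux[of t]] by simp
    then have "(\<eta> k has_derivative (*) (D k x)) (at x)" by (simp add: has_field_derivative_def)
    then have "(*) (D k x) = frechet_derivative (\<eta> k) (at x)" by (rule frechet_derivative_at)
    from fun_cong[OF this, of 1] show ?thesis by simp
  qed
  have D0: "D k x = 0" if "x \<notin> {s..t + \<delta>0}" for k x
  proof -
    have "frechet_derivative (\<eta> k) (at x) = (\<lambda>v. 0)"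
      by (rule frechet_derivative_eq_0_off_closed[of "{s..t + \<delta>0}"]) (use that supp in auto)
    with deriv[of k x] show ?thesis by simp
  qed
  have lhs: "(LINT x:{0<..<\<tau>}|lebesgue. p x * frechet_derivative (\<eta> k) (at x) 1)
      = (LINT x|lborel. P x * (step_deriv ((x - s) / \<delta> k) / \<delta> k)) - (LINT x|lborel. P x * (step_deriv ((x - t) / \<delta> k) / \<delta> k))" for k
  proof -
    have "indicator {0<..<\<tau>} x *\<^sub>R (p x * frechet_derivative (\<eta> k) (at x) 1) = P x * D k x" for x
    proof (cases "x \<in> {s..t + \<delta>0}")
      case True
      then have "x \<in> {0<..<\<tau>}" using st \<delta>0 by auto
      then show ?thesis by (simp add: P_def deriv)
    qed (simp add: D0 deriv)
    then have "(LINT x:{0<..<\<tau>}|lebesgue. p x * frechet_derivative (\<eta> k) (at x) 1) = (LINT x|lebesgue. P x * D k x)"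
      unfolding set_lebesgue_integral_def by presburger
    also have "\<dots> = (LINT x|lborel. P x * D k x)"
    proof (rule integral_completion)
      have [measurable]: "P \<in> borel_measurable borel" "step_deriv \<in> borel_measurable borel"
        using Pcont continuous_step_deriv by (simp_all add: borel_measurable_continuous_onI)
      show "(\<lambda>x. P x * D k x) \<in> borel_measurable lborel" unfolding D_def by measurable
    qed
    also have "\<dots> = (LINT x|lborel. P x * (step_deriv ((x - s) / \<delta> k) / \<delta> k) - P x * (step_deriv ((x - t) / \<delta> k) / \<delta> k))"
      by (simp add: D_def right_diff_distrib)
    also have "\<dots> = (LINT x|lborel. P x * (step_deriv ((x - s) / \<delta> k) / \<delta> k)) - (LINT x|lborel. P x * (step_deriv ((x - t) / \<delta> k) / \<delta> k))"
      by (rule Bochner_Integration.integral_diff)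
        (rule step_deriv_convolution_tendsto(1)[OF Pcont C \<delta>_lim \<delta>(1)])+
    finally show ?thesis .
  qed
  have L1: "(\<lambda>k. LINT x:{0<..<\<tau>}|lebesgue. p x * frechet_derivative (\<eta> k) (at x) 1) \<longlonglongrightarrow> P s - P t"
    unfolding lhs by (intro tendsto_diff step_deriv_convolution_tendsto(2)[OF Pcont C \<delta>_lim \<delta>(1)])
  have L2: "(LINT x:{0<..<\<tau>}|lebesgue. p x * frechet_derivative (\<eta> k) (at x) 1) = - (LINT x|lebesgue. q x * \<eta> k x)" for k
    using wd test[of k] set_integral_mult_test_function[OF test[of k], of q]
    unfolding has_weak_derivative_on_def by simp
  have L3: "(\<lambda>k. LINT x|lebesgue. q x * \<eta> k x) \<longlonglongrightarrow> (LINT x|lebesgue. q x * indicator {s<..t} x)"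
  proof (rule integral_dominated_convergence)
    have int: "set_integrable lebesgue {s..t + \<delta>0} q"
    proof -
      have "compact {s..t + \<delta>0}" "{s..t + \<delta>0} \<subseteq> {0<..<\<tau>}" using st \<delta>0 by auto
      with q show ?thesis unfolding locally_integrable_def by blast
    qed
    then show "integrable lebesgue (\<lambda>x. \<bar>indicator {s..t + \<delta>0} x *\<^sub>R q x\<bar>)"
      unfolding set_integrable_def by (rule integrable_abs)
    have "set_integrable lebesgue {s<..t} q"
      by (rule set_integrable_subset[OF int]) (use \<delta>0 in auto)
    then show "(\<lambda>x. q x * indicator {s<..t} x) \<in> borel_measurable lebesgue"
      by (auto simp: set_integrable_def mult.commute dest: borel_measurable_integrable)
    show "(\<lambda>x. q x * \<eta> k x) \<in> borel_measurable lebesgue" for k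
      by (rule borel_measurable_integrable[OF integrable_mult_test_function[OF q test]])
    have "\<bar>\<eta> k x\<bar> \<le> indicator {s..t + \<delta>0} x" for k x
      using supp[of x k] smooth_step_nonneg[of "(x - s) / \<delta> k"] smooth_step_nonneg[of "(x - t) / \<delta> k"]
        smooth_step_le_1[of "(x - s) / \<delta> k"] smooth_step_le_1[of "(x - t) / \<delta> k"]
      by (cases "x \<in> {s..t + \<delta>0}") (auto simp: \<eta>_def)
    then show "AE x in lebesgue. norm (q x * \<eta> k x) \<le> \<bar>indicator {s..t + \<delta>0} x *\<^sub>R q x\<bar>" for k
      by (intro AE_I2) (simp add: abs_mult mult.commute mult_left_mono)
    \<comment> \<open>At each point a step is eventually exactly 0 or 1. The step starting at a is 0
      at a itself, whence the half-open interval in the limit.\<close>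
    have one: "\<forall>\<^sub>F k in sequentially. smooth_step ((x - a) / \<delta> k) = (if x > a then 1 else 0)" for x a
    proof (cases "x > a")
      case True
      then have "\<forall>\<^sub>F k in sequentially. \<delta> k < x - a" using order_tendstoD(2)[OF \<delta>_lim, of "x - a"] by simp
      then show ?thesis
        by eventually_elim (use True \<delta>(1) in \<open>auto intro!: smooth_step_eq_1 simp: le_divide_eq\<close>)
    next
      case False
      then show ?thesis using \<delta>(1)
        by (intro always_eventually allI) (auto intro!: smooth_step_eq_0 divide_nonpos_pos)
    qed
    have "(\<lambda>k. \<eta> k x) \<longlonglongrightarrow> indicator {s<..t} x" for x
    proof (rule tendsto_eventually)
      show "\<forall>\<^sub>F k in sequentially. \<eta> k x = indicator {s<..t} x"
        using one[of x s] one[of x t]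
        by eventually_elim (use \<open>s < t\<close> in \<open>auto simp: \<eta>_def indicator_def\<close>)
    qed
    then show "AE x in lebesgue. (\<lambda>k. q x * \<eta> k x) \<longlonglongrightarrow> q x * indicator {s<..t} x"
      by (intro AE_I2 tendsto_intros)
  qed
  have "P s - P t = - (LINT x|lebesgue. q x * indicator {s<..t} x)"
    by (rule LIMSEQ_unique[OF L1[unfolded L2] tendsto_minus[OF L3]])
  moreover have "(LINT x|lebesgue. q x * indicator {s<..t} x) = integral {s<..t} q"
  proof -
    have "compact {s..t}" "{s..t} \<subseteq> {0<..<\<tau>}" using st by auto
    with q have "set_integrable lebesgue {s..t} q" unfolding locally_integrable_def by blast
    then have "set_integrable lebesgue {s<..t} q" by (rule set_integrable_subset) auto
    then show ?thesis
      using set_lebesgue_integral_eq_integral(2)[of "{s<..t}" q]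
      by (simp add: set_lebesgue_integral_def mult.commute)
  qed
  moreover have "integral {s<..t} q = integral {s..t} q"
    by (rule integral_subset_negligible) (auto intro: negligible_subset[of "{s}"])
  moreover have "P s = p s" "P t = p t" using st by (simp_all add: P_def)
  ultimately show ?thesis by simp
qed simp

section \<open>Averages over short time intervals\<close>

lemma average_right_tendsto:
  fixes f :: "real \<Rightarrow> real"
  assumes f: "continuous_on {s..t} f" and "s < t" and h: "h \<longlonglongrightarrow> 0" "\<And>n. 0 < h n"
  shows "(\<lambda>n. integral {s..s + h n} f / h n) \<longlonglongrightarrow> f s"
proof (rule LIMSEQ_I)
  fix e :: real assume e: "e > 0"
  obtain d where d: "d > 0" "\<And>x. x \<in> {s..t} \<Longrightarrow> dist x s < d \<Longrightarrow> dist (f x) (f s) < e / 2"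
  proof -
    have "s \<in> {s..t}" "e / 2 > 0" using \<open>s < t\<close> e by auto
    with f have "\<exists>d>0. \<forall>x\<in>{s..t}. dist x s < d \<longrightarrow> dist (f x) (f s) < e / 2"
      unfolding continuous_on_iff by blast
    then show ?thesis using that by blast
  qed
  have "\<forall>\<^sub>F n in sequentially. h n < min d (t - s)"
    using h(1) d(1) \<open>s < t\<close> by (intro order_tendstoD(2)) auto
  then obtain N where N: "\<And>n. n \<ge> N \<Longrightarrow> h n < min d (t - s)" by (auto simp: eventually_sequentially)
  have "norm (integral {s..s + h n} f / h n - f s) < e" if "n \<ge> N" for n
  proof -
    have sub: "{s..s + h n} \<subseteq> {s..t}" using N[OF that] by auto
    have cont: "continuous_on {s..s + h n} (\<lambda>x. f x - f s)"
      by (intro continuous_intros continuous_on_subset[OF f sub])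
    have "integral {s..s + h n} (\<lambda>x. f x - f s) = integral {s..s + h n} f - h n * f s"
      using h(2)[of n]
      by (subst Henstock_Kurzweil_Integration.integral_diff)
        (auto intro!: integrable_continuous_real continuous_on_subset[OF f sub])
    moreover have "norm (integral {s..s + h n} (\<lambda>x. f x - f s)) \<le> e / 2 * (s + h n - s)"
    proof (rule integral_bound[OF _ cont])
      show "s \<le> s + h n" using h(2)[of n] by simp
      fix x assume x: "x \<in> {s..s + h n}"
      then have "dist x s < d" using N[OF that] by (simp add: dist_real_def)
      then show "norm (f x - f s) \<le> e / 2" using d(2)[of x] x sub by (auto simp: dist_real_def)
    qed
    ultimately have "\<bar>integral {s..s + h n} f - h n * f s\<bar> \<le> e / 2 * h n" by simp
    then have "\<bar>(integral {s..s + h n} f - h n * f s) / h n\<bar> \<le> e / 2"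
      using h(2)[of n] by (simp add: abs_divide divide_le_eq)
    moreover have "(integral {s..s + h n} f - h n * f s) / h n = integral {s..s + h n} f / h n - f s"
      using h(2)[of n] by (simp add: field_simps)
    ultimately show ?thesis using e by simp
  qed
  then show "\<exists>N. \<forall>n\<ge>N. norm (integral {s..s + h n} f / h n - f s) < e" by blast
qed

lemma integral_reflect_interval:
  fixes f :: "real \<Rightarrow> real"
  shows "integral {- b..- a} (\<lambda>x. f (- x)) = integral {a..b} f"
  by simp

lemma average_left_tendsto:
  fixes f :: "real \<Rightarrow> real"
  assumes f: "continuous_on {s..t} f" and "s < t" and h: "h \<longlonglongrightarrow> 0" "\<And>n. 0 < h n"
  shows "(\<lambda>n. integral {t - h n..t} f / h n) \<longlonglongrightarrow> f t"
proof -
  have "continuous_on {- t..- s} (\<lambda>x. f (- x))"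
    by (intro continuous_on_compose2[OF f] continuous_intros) auto
  from average_right_tendsto[OF this _ h] \<open>s < t\<close>
  have "(\<lambda>n. integral {- t..- t + h n} (\<lambda>x. f (- x)) / h n) \<longlonglongrightarrow> f t" by simp
  moreover have "integral {- t..- t + h n} (\<lambda>x. f (- x)) = integral {t - h n..t} f" for n
    using integral_reflect_interval[of t "t - h n" f] by simp
  ultimately show ?thesis by simp
qed

text \<open>Reflection turns the backward averages of the energy argument into the forward ones of
  the differentiation theorem for cubes.\<close>

lemma Lebesgue_differentiation_left:
  fixes f :: "real \<Rightarrow> real"
  assumes f: "\<And>a b. f integrable_on {a..b}" and h: "h \<longlonglongrightarrow> 0" "\<And>n. 0 < h n"
  shows "AE x in lebesgue. (\<lambda>n. integral {x - h n..x} f / h n) \<longlonglongrightarrow> f x"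
proof -
  have "(\<lambda>x. f (- x)) integrable_on cbox a b" for a b
    using f[of "- b" "- a"] Henstock_Kurzweil_Integration.integrable_reflect_real[where f=f and a="- b" and b="- a"] by simp
  then obtain N where N: "negligible N"
    "\<And>x e. \<lbrakk>x \<notin> N; 0 < e\<rbrakk> \<Longrightarrow> \<exists>d>0. \<forall>h. 0 < h \<and> h < d \<longrightarrow>
       norm (integral (cbox x (x + h *\<^sub>R One)) (\<lambda>x. f (- x)) /\<^sub>R h ^ DIM(real) - f (- x)) < e"
    by (rule integrable_ccontinuous_explicit) blast
  have lim: "(\<lambda>n. integral {x - h n..x} f / h n) \<longlonglongrightarrow> f x" if x: "- x \<notin> N" for x
  proof (rule LIMSEQ_I)
    fix e :: real assume "e > 0"
    then obtain d where d: "d > 0" "\<And>h. 0 < h \<Longrightarrow> h < d \<Longrightarrow>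
       norm (integral {- x..- x + h} (\<lambda>x. f (- x)) / h - f x) < e"
      using N(2)[OF x, of e] by (auto simp: divide_inverse mult.commute)
    have "\<forall>\<^sub>F n in sequentially. h n < d" using h(1) d(1) by (rule order_tendstoD(2))
    then obtain K where "\<And>n. n \<ge> K \<Longrightarrow> h n < d" by (auto simp: eventually_sequentially)
    moreover have "integral {- x..- x + h n} (\<lambda>x. f (- x)) = integral {x - h n..x} f" for n
      using integral_reflect_interval[of x "x - h n" f] by simp
    ultimately show "\<exists>K. \<forall>n\<ge>K. norm (integral {x - h n..x} f / h n - f x) < e"
      using d(2) h(2) by metis
  qed
  have "negligible (uminus ` N)"
    by (rule negligible_differentiable_image_negligible[OF _ N(1)])
      (auto intro!: differentiable_on_minus differentiable_on_ident)
  then have "AE x in lebesgue. x \<notin> uminus ` N"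
    unfolding negligible_iff_null_sets by (rule AE_not_in)
  then show ?thesis
  proof eventually_elim
    case (elim x)
    then have "- x \<notin> N" using image_eqI[of x uminus "- x" N] by auto
    then show ?case by (rule lim)
  qed
qed

text \<open>Weak continuity makes (z a, z b) continuous only in each variable separately. Rounding
  the second argument to a grid leaves countably many continuous functions of the first, and
  refining the grid recovers \<psi> by continuity in the second.\<close>

lemma measurable_separately_continuous:
  fixes K :: "real \<Rightarrow> real \<Rightarrow> real"
  assumes "\<And>b. continuous_on UNIV (\<lambda>a. K a b)" "\<And>a. continuous_on UNIV (K a)"
    and [measurable]: "\<psi> \<in> borel_measurable borel"
  shows "(\<lambda>r. K r (\<psi> r)) \<in> borel_measurable borel"
proof (rule borel_measurable_LIMSEQ_real)
  define grid where "grid n x = real_of_int \<lfloor>real (Suc n) * x\<rfloor> / real (Suc n)" for n x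
  have [measurable]: "(\<lambda>a. K a b) \<in> borel_measurable borel" for b
    using assms(1) by (simp add: borel_measurable_continuous_onI)
  show "(\<lambda>r. K r (grid n (\<psi> r))) \<in> borel_measurable borel" for n
  proof -
    have "(\<lambda>r. (\<lambda>i::int. \<lambda>r. K r (real_of_int i / real (Suc n))) \<lfloor>real (Suc n) * \<psi> r\<rfloor> r) \<in> borel_measurable borel"
      by (rule measurable_compose_countable) measurable
    then show ?thesis by (simp add: grid_def)
  qed
  fix r
  have "(\<lambda>n. grid n (\<psi> r)) \<longlonglongrightarrow> \<psi> r"
  proof (rule LIMSEQ_I)
    fix e :: real assume "e > 0"
    then obtain N where N: "inverse (real (Suc N)) < e" using reals_Archimedean by blast
    have "norm (grid n (\<psi> r) - \<psi> r) < e" if "n \<ge> N" for n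
    proof -
      have "real (Suc n) * \<psi> r - 1 < real_of_int \<lfloor>real (Suc n) * \<psi> r\<rfloor>"
        "real_of_int \<lfloor>real (Suc n) * \<psi> r\<rfloor> \<le> real (Suc n) * \<psi> r" by linarith+
      then have "\<bar>real_of_int \<lfloor>real (Suc n) * \<psi> r\<rfloor> - real (Suc n) * \<psi> r\<bar> \<le> 1" by linarith
      then have "\<bar>(real_of_int \<lfloor>real (Suc n) * \<psi> r\<rfloor> - real (Suc n) * \<psi> r) / real (Suc n)\<bar> \<le> inverse (real (Suc n))"
        by (simp add: abs_divide divide_simps)
      also have "\<dots> \<le> inverse (real (Suc N))" using that by (simp add: le_imp_inverse_le)
      finally show ?thesis using N by (simp add: grid_def diff_divide_distrib)
    qed
    then show "\<exists>N. \<forall>n\<ge>N. norm (grid n (\<psi> r) - \<psi> r) < e" by blast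
  qed
  moreover have "isCont (K r) (\<psi> r)" using assms(2) by (simp add: continuous_on_eq_continuous_at)
  ultimately show "(\<lambda>n. K r (grid n (\<psi> r))) \<longlonglongrightarrow> K r (\<psi> r)"
    using isCont_tendsto_compose by blast
qed

section \<open>The energy inequality\<close>

lemma integral_mono_AE_interval:
  fixes f g :: "real \<Rightarrow> real"
  assumes "set_integrable lebesgue {a..b} f" "set_integrable lebesgue {a..b} g"
    "AE r in lebesgue. r \<in> {a..b} \<longrightarrow> f r \<le> g r"
  shows "integral {a..b} f \<le> integral {a..b} g"
  using integral_mono_AE[OF assms(1,2)[unfolded set_integrable_def]] assms(3)
    set_lebesgue_integral_eq_integral(2)[OF assms(1)] set_lebesgue_integral_eq_integral(2)[OF assms(2)]
  by (auto simp: set_lebesgue_integral_def indicator_def elim: AE_mp)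

lemma set_integrable_bounded_borel:
  fixes f :: "real \<Rightarrow> real"
  assumes "f \<in> borel_measurable borel" "\<And>r. \<bar>f r\<bar> \<le> B"
  shows "set_integrable lebesgue {a..b} f"
  unfolding set_integrable_def
proof (rule Bochner_Integration.integrable_bound)
  have "{a..b} \<in> lmeasurable" by simp
  then show "integrable lebesgue (\<lambda>r. B * indicator {a..b} r)"
    by (intro integrable_mult_right integrable_real_indicator) (auto simp: fmeasurable_def)
  have [measurable]: "f \<in> borel_measurable lebesgue"
    by (rule measurable_completion) (use assms in simp)
  show "(\<lambda>r. indicator {a..b} r *\<^sub>R f r) \<in> borel_measurable lebesgue"
    by (intro borel_measurable_scaleR borel_measurable_indicator) auto
  have "0 \<le> B" using assms(2)[of 0] by linarith
  then show "AE r in lebesgue. norm (indicator {a..b} r *\<^sub>R f r) \<le> norm (B * indicator {a..b} r)"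
    using assms(2) by (auto simp: indicator_def)
qed

lemma set_integrable_subinterval:
  fixes f :: "real \<Rightarrow> real"
  assumes "set_integrable lebesgue {a..b} f" "a \<le> c" "d \<le> b"
  shows "set_integrable lebesgue {c..d} f"
  by (rule set_integrable_subset[OF assms(1)]) (use assms in auto)

lemma interval_average_tendsto_AE:
  fixes f :: "real \<Rightarrow> real"
  assumes f: "set_integrable lebesgue {0..T} f" and h: "h \<longlonglongrightarrow> 0" "\<And>n. 0 < h n"
  shows "AE r in lebesgue. r \<in> {0<..T} \<longrightarrow> (\<lambda>n. integral {r - h n..r} f / h n) \<longlonglongrightarrow> f r"
proof -
  \<comment> \<open>Extension by zero supplies integrability on every interval; for small h the
    averaging interval lies in [0, T], where nothing has changed.\<close>
  have ext: "(\<lambda>r. if r \<in> {0..T} then f r else 0) integrable_on {a..b}" for a b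
  proof -
    have "(\<lambda>r. if r \<in> {0..T} then f r else 0) integrable_on UNIV"
      using set_lebesgue_integral_eq_integral(1)[OF f] by (simp only: integrable_restrict_UNIV)
    then have "(\<lambda>r. if r \<in> {0..T} then f r else 0) integrable_on cbox a b"
      by (rule integrable_on_subcbox) auto
    then show ?thesis by simp
  qed
  show ?thesis
    using Lebesgue_differentiation_left[OF ext h]
  proof eventually_elim
    case (elim r)
    show ?case
    proof
      assume r: "r \<in> {0<..T}"
      then have "\<forall>\<^sub>F n in sequentially. h n < r" by (intro order_tendstoD(2)[OF h(1)]) auto
      then have "\<forall>\<^sub>F n in sequentially. integral {r - h n..r} (\<lambda>r. if r \<in> {0..T} then f r else 0) / h n
          = integral {r - h n..r} f / h n"
      proof eventually_elim
        case (elim n)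
        have "integral {r - h n..r} (\<lambda>r. if r \<in> {0..T} then f r else 0) = integral {r - h n..r} f"
          by (rule integral_cong) (use r elim in auto)
        then show ?case by simp
      qed
      from Lim_transform_eventually[OF elim this] show "(\<lambda>n. integral {r - h n..r} f / h n) \<longlonglongrightarrow> f r"
        using r by simp
    qed
  qed
qed

text \<open>Shifting one copy by h cancels the middle part and leaves only the two ends.\<close>

lemma integral_increment:
  fixes f :: "real \<Rightarrow> real"
  assumes f: "\<And>a b. f integrable_on {a..b}" and h: "h > 0" "s + h \<le> t"
  shows "(\<lambda>r. f r - f (r - h)) integrable_on {s + h..t}"
    and "integral {s + h..t} (\<lambda>r. f r - f (r - h)) = integral {t - h..t} f - integral {s..s + h} f"
proof -
  have sh: "(\<lambda>r. f (r - h)) integrable_on {s + h..t}"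
    using integrable_shift_real_ivl[of f s "t - h" "- h"] f by auto
  show "(\<lambda>r. f r - f (r - h)) integrable_on {s + h..t}" by (intro integrable_diff f sh)
  have "integral {s..s + h} f + integral {s + h..t} f = integral {s..t} f"
    "integral {s..t - h} f + integral {t - h..t} f = integral {s..t} f"
    using h by (intro Henstock_Kurzweil_Integration.integral_combine f; simp)+
  moreover have "integral {s..t - h} f = integral {s + h..t} (\<lambda>r. f (r - h))"
    using integral_shift_real_ivl[of s "- h" "t - h" f] by simp
  ultimately show "integral {s + h..t} (\<lambda>r. f r - f (r - h)) = integral {t - h..t} f - integral {s..s + h} f"
    using Henstock_Kurzweil_Integration.integral_diff[OF f sh] by simp
qed

text \<open>
  In the application \<open>\<zeta> r\<close> is the functional \<open>z'(r) \<in> E\<^sup>*\<close>, \<open>N\<close> is the norm of \<open>E\<close> and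
  \<open>\<nu> r = N (z r)\<close> for almost every \<open>r\<close>.
\<close>

locale weak_evolution =
  fixes E :: "'h::real_inner set" and N :: "'h \<Rightarrow> real" and T C M :: real
    and z :: "real \<Rightarrow> 'h" and \<nu> :: "real \<Rightarrow> real" and \<zeta> :: "real \<Rightarrow> 'h \<Rightarrow> real" and X :: "'h set"
  assumes T: "T > 0" and C: "C \<ge> 0"
    and E_diff: "\<And>x y. x \<in> E \<Longrightarrow> y \<in> E \<Longrightarrow> x - y \<in> E"
    and z_E: "AE r in lebesgue. r \<in> {0..T} \<longrightarrow> z r \<in> E \<and> N (z r) = \<nu> r"
    and \<nu>: "\<And>r. 0 \<le> \<nu> r" "set_integrable lebesgue {0..T} \<nu>" "set_integrable lebesgue {0..T} (\<lambda>r. (\<nu> r)\<^sup>2)"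
    and X: "countable X" "X \<subseteq> E"
    and dense: "AE r in lebesgue. r \<in> {0..T} \<longrightarrow> (\<forall>e>0. \<exists>x\<in>X. N (z r - x) < e)"
    and \<zeta>_diff: "\<And>r x y. r \<in> {0..T} \<Longrightarrow> x \<in> E \<Longrightarrow> y \<in> E \<Longrightarrow> \<zeta> r (x - y) = \<zeta> r x - \<zeta> r y"
    and \<zeta>_bound: "\<And>r x. r \<in> {0..T} \<Longrightarrow> x \<in> E \<Longrightarrow> \<bar>\<zeta> r x\<bar> \<le> C * \<nu> r * N x"
    and \<zeta>_int: "\<And>x. x \<in> E \<Longrightarrow> set_integrable lebesgue {0..T} (\<lambda>r. \<zeta> r x)"
    and z_\<zeta>: "\<And>x s t. x \<in> E \<Longrightarrow> 0 \<le> s \<Longrightarrow> s \<le> t \<Longrightarrow> t \<le> T \<Longrightarrow>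
        (z t - z s) \<bullet> x = integral {s..t} (\<lambda>r. \<zeta> r x)"
    and z_cont: "\<And>r. r \<in> {0..T} \<Longrightarrow> continuous_on {0..T} (\<lambda>t. z t \<bullet> z r)"
    and z_bdd: "\<And>r. r \<in> {0..T} \<Longrightarrow> norm (z r) \<le> M"
begin

definition W :: "real \<Rightarrow> real" where "W t = integral {0..t} (\<lambda>r. (\<nu> r)\<^sup>2)"

lemma \<nu>_int: "0 \<le> a \<Longrightarrow> b \<le> T \<Longrightarrow> set_integrable lebesgue {a..b} \<nu>"
  using set_integrable_subinterval[OF \<nu>(2)] by blast

lemma \<nu>2_int: "0 \<le> a \<Longrightarrow> b \<le> T \<Longrightarrow> set_integrable lebesgue {a..b} (\<lambda>r. (\<nu> r)\<^sup>2)"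
  using set_integrable_subinterval[OF \<nu>(3)] by blast

lemma \<nu>2_integrable_on: "0 \<le> a \<Longrightarrow> b \<le> T \<Longrightarrow> (\<lambda>r. (\<nu> r)\<^sup>2) integrable_on {a..b}"
  using \<nu>2_int by (intro set_lebesgue_integral_eq_integral(1))

lemma W_cont: "continuous_on {0..T} W"
  unfolding W_def[abs_def] by (rule indefinite_integral_continuous_1[OF \<nu>2_integrable_on]) (use T in auto)

lemma W_diff:
  assumes "0 \<le> a" "a \<le> b" "b \<le> T"
  shows "integral {a..b} (\<lambda>r. (\<nu> r)\<^sup>2) = W b - W a"
  using Henstock_Kurzweil_Integration.integral_combine[OF assms(1,2) \<nu>2_integrable_on[of 0 b]] assms
  by (simp add: W_def)

lemma W_mono: "0 \<le> a \<Longrightarrow> a \<le> b \<Longrightarrow> b \<le> T \<Longrightarrow> W a \<le> W b"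
  using W_diff[of a b] Henstock_Kurzweil_Integration.integral_nonneg[OF \<nu>2_integrable_on, of a b] by simp

text \<open>The product of values of \<nu> at two times is split into squares, so that only the
  integrable function \<nu>^2 and increments of its antiderivative W occur. Divided by h this is the
  majorant of the Fatou argument.\<close>

lemma increment_bound:
  assumes "0 \<le> s" "s \<le> t" "t \<le> T" "r \<in> {0..T}" "z r \<in> E" "N (z r) = \<nu> r"
  shows "\<bar>(z t - z s) \<bullet> z r\<bar> \<le> C / 2 * ((W t - W s) + (t - s) * (\<nu> r)\<^sup>2)"
proof -
  have "\<bar>(z t - z s) \<bullet> z r\<bar> = norm (integral {s..t} (\<lambda>\<sigma>. \<zeta> \<sigma> (z r)))"
    using z_\<zeta>[OF assms(5,1-3)] by simp
  also have "\<dots> \<le> integral {s..t} (\<lambda>\<sigma>. C / 2 * ((\<nu> \<sigma>)\<^sup>2 + (\<nu> r)\<^sup>2))"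
  proof (rule Henstock_Kurzweil_Integration.integral_norm_bound_integral)
    show "(\<lambda>\<sigma>. \<zeta> \<sigma> (z r)) integrable_on {s..t}"
      using set_integrable_subinterval[OF \<zeta>_int[OF assms(5)]] assms
      by (intro set_lebesgue_integral_eq_integral(1)) auto
    show "(\<lambda>\<sigma>. C / 2 * ((\<nu> \<sigma>)\<^sup>2 + (\<nu> r)\<^sup>2)) integrable_on {s..t}"
      using assms by (intro integrable_on_mult_right integrable_add \<nu>2_integrable_on) auto
    fix \<sigma> assume "\<sigma> \<in> {s..t}"
    then have "\<bar>\<zeta> \<sigma> (z r)\<bar> \<le> C * \<nu> \<sigma> * \<nu> r" using \<zeta>_bound[of \<sigma> "z r"] assms by auto
    also have "\<dots> = C / 2 * (2 * \<nu> \<sigma> * \<nu> r)" by simp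
    also have "\<dots> \<le> C / 2 * ((\<nu> \<sigma>)\<^sup>2 + (\<nu> r)\<^sup>2)"
      using C by (intro mult_left_mono sum_squares_bound) auto
    finally show "norm (\<zeta> \<sigma> (z r)) \<le> C / 2 * ((\<nu> \<sigma>)\<^sup>2 + (\<nu> r)\<^sup>2)" by simp
  qed
  also have "\<dots> = C / 2 * ((W t - W s) + (t - s) * (\<nu> r)\<^sup>2)"
    using assms
    by (subst integral_mult_right, subst Henstock_Kurzweil_Integration.integral_add)
      (auto simp: W_diff \<nu>2_integrable_on)
  finally show ?thesis .
qed

text \<open>Freezing the trajectory outside [0, T] frees the shifts r - h and the measurability
  statements from range conditions.\<close>

definition Z :: "real \<Rightarrow> 'h" where "Z r = z (max 0 (min T r))"

lemma Z_eq: "r \<in> {0..T} \<Longrightarrow> Z r = z r"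
  by (simp add: Z_def)

lemma Z_inner_cont: "continuous_on UNIV (\<lambda>t. Z t \<bullet> Z r)"
  unfolding Z_def using T by (intro continuous_on_compose2[OF z_cont] continuous_intros) auto

lemma Z_inner_cont': "continuous_on UNIV (\<lambda>t. Z r \<bullet> Z t)"
proof -
  have "(\<lambda>t. Z r \<bullet> Z t) = (\<lambda>t. Z t \<bullet> Z r)" by (rule ext) (rule inner_commute)
  then show ?thesis using Z_inner_cont[of r] by (simp only:)
qed

lemma Z_inner_bound: "\<bar>Z a \<bullet> Z b\<bar> \<le> M\<^sup>2"
proof -
  have Zb: "norm (Z r) \<le> M" for r unfolding Z_def using T by (intro z_bdd) auto
  have "\<bar>Z a \<bullet> Z b\<bar> \<le> norm (Z a) * norm (Z b)" by (rule Cauchy_Schwarz_ineq2)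
  also have "\<dots> \<le> M * M"
    using order_trans[OF norm_ge_zero Zb] by (intro mult_mono Zb) auto
  finally show ?thesis by (simp add: power2_eq_square)
qed

lemma Z_inner_measurable:
  assumes "\<psi> \<in> borel_measurable borel"
  shows "(\<lambda>r. Z r \<bullet> Z (\<psi> r)) \<in> borel_measurable borel"
  by (rule measurable_separately_continuous[of "\<lambda>a b. Z a \<bullet> Z b"])
    (rule Z_inner_cont Z_inner_cont' assms)+

abbreviation Y :: "real \<Rightarrow> real" where "Y r \<equiv> Z r \<bullet> Z r"

lemma Y_int: "set_integrable lebesgue {a..b} Y"
  by (rule set_integrable_bounded_borel[OF Z_inner_measurable Z_inner_bound]) simp

lemma Y_integrable_on: "Y integrable_on {a..b}"
  by (rule set_lebesgue_integral_eq_integral(1)[OF Y_int])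

lemma Z_inner_integrable_on: "(\<lambda>r. Z s \<bullet> Z r) integrable_on {a..b}"
  by (intro integrable_continuous_real continuous_on_subset[OF Z_inner_cont']) simp

text \<open>Averages of |Z|^2 just after s are compared with (Z s, Z r), which is continuous in r,
  at a cost that vanishes with the increment of W. This upper bound takes the place of right
  continuity of |Z|^2.\<close>

lemma Y_average_start:
  assumes "0 \<le> s" "h > 0" "s + h \<le> T"
  shows "integral {s..s + h} Y / h \<le> integral {s..s + h} (\<lambda>r. Z s \<bullet> Z r) / h + C * (W (s + h) - W s)"
proof -
  let ?w = "W (s + h) - W s"
  let ?g = "\<lambda>r. (Z s \<bullet> Z r + C / 2 * ?w) + C / 2 * h * (\<nu> r)\<^sup>2"
  have i1: "set_integrable lebesgue {s..s + h} (\<lambda>r. Z s \<bullet> Z r + C / 2 * ?w)"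
  proof (rule set_integral_add(1))
    show "set_integrable lebesgue {s..s + h} (\<lambda>r. Z s \<bullet> Z r)"
      by (rule set_integrable_bounded_borel[OF borel_measurable_continuous_onI[OF Z_inner_cont'] Z_inner_bound])
    show "set_integrable lebesgue {s..s + h} (\<lambda>r. C / 2 * ?w)"
      by (rule set_integrable_bounded_borel[where B="\<bar>C / 2 * ?w\<bar>"]) auto
  qed
  have i2: "set_integrable lebesgue {s..s + h} (\<lambda>r. C / 2 * h * (\<nu> r)\<^sup>2)"
    by (intro set_integrable_mult_right \<nu>2_int) (use assms in auto)
  have "integral {s..s + h} Y \<le> integral {s..s + h} ?g"
  proof (rule integral_mono_AE_interval[OF Y_int set_integral_add(1)[OF i1 i2]])
    show "AE r in lebesgue. r \<in> {s..s + h} \<longrightarrow> Y r \<le> ?g r"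
      using z_E
    proof eventually_elim
      case (elim r)
      show ?case
      proof
        assume r: "r \<in> {s..s + h}"
        then have rT: "r \<in> {0..T}" using assms by auto
        have "Y r = Z s \<bullet> Z r + (z r - z s) \<bullet> z r"
          using rT assms by (simp add: Z_eq inner_diff_left)
        also have "(z r - z s) \<bullet> z r \<le> C / 2 * ((W r - W s) + (r - s) * (\<nu> r)\<^sup>2)"
          using increment_bound[of s r r] elim rT r assms by auto
        also have "\<dots> \<le> C / 2 * (?w + h * (\<nu> r)\<^sup>2)"
          using C r assms by (intro mult_left_mono add_mono diff_right_mono W_mono mult_right_mono) auto
        finally show "Y r \<le> ?g r" by (simp add: algebra_simps)
      qed
    qed
  qed
  also have "\<dots> = integral {s..s + h} (\<lambda>r. Z s \<bullet> Z r) + h * (C / 2 * ?w) + C / 2 * h * ?w"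
  proof -
    have 1: "(\<lambda>r. Z s \<bullet> Z r + C / 2 * ?w) integrable_on {s..s + h}"
      "(\<lambda>r. C / 2 * h * (\<nu> r)\<^sup>2) integrable_on {s..s + h}"
      using i1 i2 by (simp_all add: set_lebesgue_integral_eq_integral(1))
    have 2: "integral {s..s + h} (\<lambda>r. Z s \<bullet> Z r + C / 2 * ?w) = integral {s..s + h} (\<lambda>r. Z s \<bullet> Z r) + h * (C / 2 * ?w)"
      using assms by (subst Henstock_Kurzweil_Integration.integral_add[OF Z_inner_integrable_on])
        (auto intro: integrable_const_ivl)
    have 3: "integral {s..s + h} (\<lambda>r. C / 2 * h * (\<nu> r)\<^sup>2) = C / 2 * h * ?w"
      using assms by (subst integral_mult_right) (simp add: W_diff)
    show ?thesis unfolding Henstock_Kurzweil_Integration.integral_add[OF 1] 2 3 ..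
  qed
  also have "\<dots> = integral {s..s + h} (\<lambda>r. Z s \<bullet> Z r) + C * ?w * h" by (simp add: algebra_simps)
  finally have "integral {s..s + h} Y / h \<le> (integral {s..s + h} (\<lambda>r. Z s \<bullet> Z r) + C * ?w * h) / h"
    using assms by (intro divide_right_mono) auto
  then show ?thesis using assms by (simp add: add_divide_distrib)
qed

text \<open>From |Z t - Z r|^2 \<ge> 0. At the final time a lower bound is enough, and weak
  continuity alone provides it.\<close>

lemma Y_average_end:
  assumes "h > 0"
  shows "2 * (integral {t - h..t} (\<lambda>r. Z t \<bullet> Z r) / h) - Y t \<le> integral {t - h..t} Y / h"
proof -
  have "integral {t - h..t} (\<lambda>r. 2 * (Z t \<bullet> Z r) - Y t) \<le> integral {t - h..t} Y"
  proof (rule integral_le)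
    show "(\<lambda>r. 2 * (Z t \<bullet> Z r) - Y t) integrable_on {t - h..t}"
      by (intro integrable_diff integrable_on_mult_right Z_inner_integrable_on) auto
    fix r
    have "0 \<le> (Z t - Z r) \<bullet> (Z t - Z r)" by simp
    then show "2 * (Z t \<bullet> Z r) - Y t \<le> Y r" by (simp add: inner_diff inner_commute)
  qed (rule Y_integrable_on)
  also have "integral {t - h..t} (\<lambda>r. 2 * (Z t \<bullet> Z r) - Y t) = 2 * integral {t - h..t} (\<lambda>r. Z t \<bullet> Z r) - h * Y t"
    using assms
    by (subst Henstock_Kurzweil_Integration.integral_diff)
      (auto intro!: integrable_on_mult_right Z_inner_integrable_on)
  finally have "(2 * integral {t - h..t} (\<lambda>r. Z t \<bullet> Z r) - h * Y t) / h \<le> integral {t - h..t} Y / h"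
    using assms by (intro divide_right_mono) auto
  then show ?thesis using assms by (simp add: diff_divide_distrib)
qed

definition \<Gamma> :: "real \<Rightarrow> real \<Rightarrow> real" where "\<Gamma> h r = (Z r - Z (r - h)) \<bullet> Z r"

lemma \<Gamma>_measurable: "\<Gamma> h \<in> borel_measurable borel"
proof -
  have "(\<lambda>r. Z r \<bullet> Z r - Z r \<bullet> Z (r - h)) \<in> borel_measurable borel"
    by (intro borel_measurable_diff Z_inner_measurable) auto
  moreover have "\<Gamma> h = (\<lambda>r. Z r \<bullet> Z r - Z r \<bullet> Z (r - h))"
    by (rule ext) (simp only: \<Gamma>_def inner_diff_left inner_commute[of "Z (_ - h)"])
  ultimately show ?thesis by simp
qed

lemma \<Gamma>_int: "set_integrable lebesgue {a..b} (\<Gamma> h)"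
proof (rule set_integrable_bounded_borel[OF \<Gamma>_measurable])
  show "\<bar>\<Gamma> h r\<bar> \<le> 2 * M\<^sup>2" for r
    unfolding \<Gamma>_def inner_diff_left using Z_inner_bound[of r r] Z_inner_bound[of "r - h" r] by linarith
qed

text \<open>Pointwise polarization; after integration the left side telescopes to the two
  ends.\<close>

lemma energy_increment:
  assumes "h > 0" "s + h \<le> t"
  shows "integral {t - h..t} Y - integral {s..s + h} Y \<le> 2 * integral {s + h..t} (\<Gamma> h)"
proof -
  have "integral {s + h..t} (\<lambda>r. Y r - Y (r - h)) \<le> integral {s + h..t} (\<lambda>r. 2 * \<Gamma> h r)"
  proof (rule integral_le)
    show "(\<lambda>r. Y r - Y (r - h)) integrable_on {s + h..t}"
      by (rule integral_increment(1)[OF Y_integrable_on assms])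
    show "(\<lambda>r. 2 * \<Gamma> h r) integrable_on {s + h..t}"
      by (intro integrable_on_mult_right set_lebesgue_integral_eq_integral(1) \<Gamma>_int)
    fix r
    have "0 \<le> (Z r - Z (r - h)) \<bullet> (Z r - Z (r - h))" by simp
    then show "Y r - Y (r - h) \<le> 2 * \<Gamma> h r" by (simp add: \<Gamma>_def inner_diff inner_commute)
  qed
  then show ?thesis
    by (simp add: integral_increment(2)[OF Y_integrable_on assms])
qed

text \<open>For fixed x almost every r is a Lebesgue point of
  \<open>\<lambda>\<sigma>. \<zeta> \<sigma> x\<close>, but here the test element z r changes with
  r. Exceptional sets are united over the countable set X only, and z r is approximated from X with
  an error controlled at Lebesgue points of \<nu>.\<close>

lemma increment_average_tendsto:
  assumes h: "h \<longlonglongrightarrow> 0" "\<And>n. 0 < h n"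
  shows "AE r in lebesgue. r \<in> {0<..T} \<longrightarrow> (\<lambda>n. \<Gamma> (h n) r / h n) \<longlonglongrightarrow> \<zeta> r (z r)"
proof -
  have "AE r in lebesgue. \<forall>x\<in>X. r \<in> {0<..T} \<longrightarrow> (\<lambda>n. integral {r - h n..r} (\<lambda>\<sigma>. \<zeta> \<sigma> x) / h n) \<longlonglongrightarrow> \<zeta> r x"
    unfolding AE_ball_countable[OF X(1)]
    using X(2) interval_average_tendsto_AE[OF \<zeta>_int h] by blast
  then show ?thesis
    using interval_average_tendsto_AE[OF \<nu>(2) h] z_E dense
  proof eventually_elim
    case (elim r)
    show ?case
    proof
      assume r: "r \<in> {0<..T}"
      then have rT: "r \<in> {0..T}" by simp
      have zr: "z r \<in> E" using elim(3) rT by simp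
      have avg\<zeta>: "\<And>x. x \<in> X \<Longrightarrow> (\<lambda>n. integral {r - h n..r} (\<lambda>\<sigma>. \<zeta> \<sigma> x) / h n) \<longlonglongrightarrow> \<zeta> r x"
        using elim(1) r by blast
      have avg\<nu>: "(\<lambda>n. integral {r - h n..r} \<nu> / h n) \<longlonglongrightarrow> \<nu> r" using elim(2) r by blast
      show "(\<lambda>n. \<Gamma> (h n) r / h n) \<longlonglongrightarrow> \<zeta> r (z r)"
      proof (rule LIMSEQ_I)
        fix e :: real assume e: "e > 0"
        \<comment> \<open>The error is C \<open>N (z r - x)\<close> times the sum of an average of
          \<nu>, eventually below \<nu> r + 1, and \<nu> r itself; the last summand 1 makes B
          positive.\<close>
        define B where "B = C * (2 * \<nu> r + 1) + 1"
        have B: "B > 0" using C \<nu>(1)[of r] by (simp add: B_def add_nonneg_pos)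
        obtain x where x: "x \<in> X" "N (z r - x) < e / (2 * B)"
          using elim(4) rT e B by (meson divide_pos_pos mult_pos_pos zero_less_numeral)
        have xE: "x \<in> E" using x X by blast
        have d: "z r - x \<in> E" using zr xE by (rule E_diff)
        have ev1: "\<forall>\<^sub>F n in sequentially. integral {r - h n..r} \<nu> / h n < \<nu> r + 1"
          by (rule order_tendstoD(2)[OF avg\<nu>]) simp
        have ev2: "\<forall>\<^sub>F n in sequentially. dist (integral {r - h n..r} (\<lambda>\<sigma>. \<zeta> \<sigma> x) / h n) (\<zeta> r x) < e / 2"
          by (rule tendstoD[OF avg\<zeta>[OF x(1)]]) (use e in simp)
        have ev3: "\<forall>\<^sub>F n in sequentially. h n < r" using r by (intro order_tendstoD(2)[OF h(1)]) auto
        have "\<forall>\<^sub>F n in sequentially. norm (\<Gamma> (h n) r / h n - \<zeta> r (z r)) < e"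
          using ev1 ev2 ev3
        proof eventually_elim
          case (elim n)
          have hn: "0 < h n" "0 \<le> r - h n" "r - h n \<le> r" "r \<le> T" using h(2)[of n] elim r by auto
          have io: "(\<lambda>\<sigma>. \<zeta> \<sigma> y) integrable_on {r - h n..r}" if "y \<in> E" for y
            using set_integrable_subinterval[OF \<zeta>_int[OF that] hn(2,4)] by (rule set_lebesgue_integral_eq_integral(1))
          have "\<Gamma> (h n) r = integral {r - h n..r} (\<lambda>\<sigma>. \<zeta> \<sigma> (z r))"
            using z_\<zeta>[OF zr hn(2,3,4)] hn rT by (simp add: \<Gamma>_def Z_eq)
          also have "\<dots> = integral {r - h n..r} (\<lambda>\<sigma>. \<zeta> \<sigma> (z r - x)) + integral {r - h n..r} (\<lambda>\<sigma>. \<zeta> \<sigma> x)"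
          proof (subst Henstock_Kurzweil_Integration.integral_add[OF io[OF d] io[OF xE], symmetric], rule integral_cong)
            fix \<sigma> assume "\<sigma> \<in> {r - h n..r}"
            then show "\<zeta> \<sigma> (z r) = \<zeta> \<sigma> (z r - x) + \<zeta> \<sigma> x" using \<zeta>_diff[of \<sigma>, OF _ zr xE] hn by auto
          qed
          finally have eq: "\<Gamma> (h n) r / h n - \<zeta> r (z r) = integral {r - h n..r} (\<lambda>\<sigma>. \<zeta> \<sigma> (z r - x)) / h n
              + (integral {r - h n..r} (\<lambda>\<sigma>. \<zeta> \<sigma> x) / h n - \<zeta> r x) - \<zeta> r (z r - x)"
            using \<zeta>_diff[OF rT zr xE] by (simp add: add_divide_distrib)
          have "norm (integral {r - h n..r} (\<lambda>\<sigma>. \<zeta> \<sigma> (z r - x))) \<le> integral {r - h n..r} (\<lambda>\<sigma>. C * N (z r - x) * \<nu> \<sigma>)"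
          proof (rule Henstock_Kurzweil_Integration.integral_norm_bound_integral[OF io[OF d]])
            show "(\<lambda>\<sigma>. C * N (z r - x) * \<nu> \<sigma>) integrable_on {r - h n..r}"
              using \<nu>_int[OF hn(2,4)] by (intro integrable_on_mult_right set_lebesgue_integral_eq_integral(1))
            show "norm (\<zeta> \<sigma> (z r - x)) \<le> C * N (z r - x) * \<nu> \<sigma>" if "\<sigma> \<in> {r - h n..r}" for \<sigma>
              using \<zeta>_bound[OF _ d, of \<sigma>] that hn by (auto simp: mult_ac)
          qed
          then have "\<bar>integral {r - h n..r} (\<lambda>\<sigma>. \<zeta> \<sigma> (z r - x))\<bar> / h n \<le> C * N (z r - x) * (integral {r - h n..r} \<nu> / h n)"
            using hn(1) by (simp add: divide_right_mono)
          then have b1: "\<bar>integral {r - h n..r} (\<lambda>\<sigma>. \<zeta> \<sigma> (z r - x)) / h n\<bar> \<le> C * N (z r - x) * (integral {r - h n..r} \<nu> / h n)"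
            using hn(1) by (simp add: abs_divide)
          have b2: "\<bar>\<zeta> r (z r - x)\<bar> \<le> C * N (z r - x) * \<nu> r"
            using \<zeta>_bound[OF rT d] by (simp add: mult_ac)
          show ?case
          proof (cases "N (z r - x) \<ge> 0")
            case True
            have "C * N (z r - x) * (integral {r - h n..r} \<nu> / h n) \<le> C * N (z r - x) * (\<nu> r + 1)"
              using elim(1) C True by (intro mult_left_mono) auto
            then have "\<bar>integral {r - h n..r} (\<lambda>\<sigma>. \<zeta> \<sigma> (z r - x)) / h n\<bar> + \<bar>\<zeta> r (z r - x)\<bar> \<le> C * N (z r - x) * (2 * \<nu> r + 1)"
              using b1 b2 by (simp add: algebra_simps)
            also have "\<dots> = (C * (2 * \<nu> r + 1)) * N (z r - x)" by simp
            also have "\<dots> \<le> B * N (z r - x)" using True by (intro mult_right_mono) (simp_all add: B_def)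
            also have "\<dots> \<le> B * (e / (2 * B))" using B x(2) by (intro mult_left_mono) auto
            also have "\<dots> = e / 2" using B by simp
            finally show ?thesis using elim(2) unfolding eq dist_real_def real_norm_def by linarith
          next
            \<comment> \<open>N is not assumed nonnegative; for a negative value the two bounds
              force both error terms to be zero.\<close>
            case False
            then have neg: "C * N (z r - x) \<le> 0" using C by (simp add: mult_nonneg_nonpos)
            have "integral {r - h n..r} \<nu> \<ge> 0"
              using \<nu>_int[OF hn(2,4)] \<nu>(1)
              by (intro Henstock_Kurzweil_Integration.integral_nonneg set_lebesgue_integral_eq_integral(1)) auto
            then have "integral {r - h n..r} \<nu> / h n \<ge> 0" using hn(1) by simp
            then have "\<bar>integral {r - h n..r} (\<lambda>\<sigma>. \<zeta> \<sigma> (z r - x)) / h n\<bar> \<le> 0" "\<bar>\<zeta> r (z r - x)\<bar> \<le> 0"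
              using b1 b2 neg \<nu>(1)[of r] mult_nonpos_nonneg order_trans by blast+
            then show ?thesis using elim(2) e unfolding eq dist_real_def real_norm_def by linarith
          qed
        qed
        then show "\<exists>n0. \<forall>n\<ge>n0. norm (\<Gamma> (h n) r / h n - \<zeta> r (z r)) < e"
          by (simp add: eventually_sequentially)
      qed
    qed
  qed
qed

text \<open>
  The polarization inequality \<open>|z(r)|\<^sup>2 - |z(r - h)|\<^sup>2 \<le> 2 (z(r) - z(r - h), z(r))\<close> is divided by \<open>h\<close>, integrated, and
  passed to the limit \<open>h \<rightarrow> 0\<close> with Fatou's lemma: the right-hand side converges almost everywhere and has a
  majorant whose integrals converge. Only one inequality is available this way, and only one is needed.
\<close>

lemma energy_inequality:
  assumes \<Phi>: "set_integrable lebesgue {0..T} \<Phi>" "AE r in lebesgue. r \<in> {0..T} \<longrightarrow> \<zeta> r (z r) \<le> \<Phi> r"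
    and st: "0 \<le> s" "s \<le> t" "t \<le> T"
  shows "(norm (z t))\<^sup>2 - (norm (z s))\<^sup>2 \<le> 2 * integral {s..t} \<Phi>"
proof (cases "s = t")
  case False
  then have "s < t" using st by simp
  \<comment> \<open>The step lengths start at t - s, so that s + h n \<le> t holds for every n and
    not only eventually.\<close>
  define h where "h n = (t - s) * inverse (real (Suc n))" for n
  have h0: "h n > 0" and hle: "s + h n \<le> t" for n
  proof -
    have "inverse (real (Suc n)) \<le> 1" by (simp add: inverse_le_1_iff)
    then have "(t - s) * inverse (real (Suc n)) \<le> (t - s) * 1" using \<open>s < t\<close> by (intro mult_left_mono) auto
    then show "s + h n \<le> t" by (simp add: h_def)
    show "h n > 0" using \<open>s < t\<close> by (simp add: h_def)
  qed
  have hlim: "h \<longlonglongrightarrow> 0"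
    using tendsto_mult[OF tendsto_const LIMSEQ_inverse_real_of_nat, of "t - s"] by (simp add: h_def[abs_def])
  define Wc where "Wc r = W (max 0 (min T r))" for r
  have Wc_cont: "continuous_on A Wc" for A
    unfolding Wc_def using T by (intro continuous_on_compose2[OF W_cont] continuous_intros) auto
  have Wc_int: "Wc integrable_on {a..b}" for a b
    by (intro integrable_continuous_real Wc_cont)
  have Wc: "Wc r = W r" if "r \<in> {0..T}" for r using that by (simp add: Wc_def)
  \<comment> \<open>By the increment bound H dominates the difference quotient G, so Fatou's lemma
    applies to the nonnegative functions H - G.\<close>
  define H where "H n r = C / 2 * ((Wc r - Wc (r - h n)) / h n + (\<nu> r)\<^sup>2)" for n r
  define G where "G n r = \<Gamma> (h n) r / h n" for n r
  let ?I = "\<lambda>n r. indicator {s + h n..t} r"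
  have Hint1: "set_integrable lebesgue {a..b} (\<lambda>r. (Wc r - Wc (r - h n)) / h n)" for a b n
    using h0[of n]
    by (intro absolutely_integrable_continuous_real continuous_intros Wc_cont continuous_on_compose2[OF Wc_cont[of UNIV]]) auto
  have Hint: "set_integrable lebesgue {s + h n..t} (H n)" for n
    unfolding H_def using st h0[of n] by (intro set_integrable_mult_right set_integral_add(1) Hint1 \<nu>2_int) auto
  have Gint: "set_integrable lebesgue {s + h n..t} (G n)" for n
  proof -
    have "G n = (\<lambda>r. (1 / h n) * \<Gamma> (h n) r)" by (simp add: G_def[abs_def])
    then show ?thesis by (simp only: set_integrable_mult_right[OF \<Gamma>_int])
  qed
  have int: "integrable lebesgue (\<lambda>r. ?I n r * (H n r - G n r))" for n
    using set_integral_diff(1)[OF Hint Gint, of n] by (simp add: set_integrable_def)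
  have HG: "AE r in lebesgue. 0 \<le> ?I n r * (H n r - G n r)" for n
    using z_E
  proof eventually_elim
    case (elim r)
    show ?case
    proof (cases "r \<in> {s + h n..t}")
      case True
      then have r: "r \<in> {0..T}" "r - h n \<in> {0..T}" using st h0[of n] by auto
      have "\<bar>\<Gamma> (h n) r\<bar> \<le> C / 2 * ((W r - W (r - h n)) + (r - (r - h n)) * (\<nu> r)\<^sup>2)"
        unfolding \<Gamma>_def Z_eq[OF r(1)] Z_eq[OF r(2)]
        using r h0[of n] elim by (intro increment_bound) auto
      then have "\<Gamma> (h n) r / h n \<le> (C / 2 * ((W r - W (r - h n)) + h n * (\<nu> r)\<^sup>2)) / h n"
        using h0[of n] by (intro divide_right_mono) auto
      also have "\<dots> = H n r"
        using h0[of n] by (simp only: H_def Wc[OF r(1)] Wc[OF r(2)]) (simp add: add_divide_distrib distrib_left)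
      finally show ?thesis using True by (simp add: G_def)
    qed simp
  qed
  let ?A = "C * (W t - W s) - integral {s..t} \<Phi>"
  have \<Phi>int: "set_integrable lebesgue {s..t} \<Phi>" using set_integrable_subinterval[OF \<Phi>(1)] st by blast
  have \<nu>int: "set_integrable lebesgue {s..t} (\<lambda>r. C * (\<nu> r)\<^sup>2)" using \<nu>2_int[of s t] st by (intro set_integrable_mult_right) auto
  let ?L = "\<lambda>r. indicator {s..t} r * (C * (\<nu> r)\<^sup>2 - \<Phi> r)"
  have Lint: "integrable lebesgue ?L"
    using set_integral_diff(1)[OF \<nu>int \<Phi>int] by (simp add: set_integrable_def)
  have A: "?A = (LINT r|lebesgue. ?L r)"
  proof -
    have "(LINT r|lebesgue. ?L r) = (LINT r:{s..t}|lebesgue. C * (\<nu> r)\<^sup>2 - \<Phi> r)" by (simp add: set_lebesgue_integral_def)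
    also have "\<dots> = (LINT r:{s..t}|lebesgue. C * (\<nu> r)\<^sup>2) - (LINT r:{s..t}|lebesgue. \<Phi> r)"
      by (rule set_integral_diff(2)[OF \<nu>int \<Phi>int])
    also have "\<dots> = ?A"
      using W_diff[of s t] st by (simp only: set_lebesgue_integral_eq_integral(2)[OF \<nu>int] set_lebesgue_integral_eq_integral(2)[OF \<Phi>int] integral_mult_right)
    finally show ?thesis by simp
  qed
  \<comment> \<open>At Lebesgue points of \<nu>^2 the majorant H tends to C \<nu>^2, so H - G tends
    to C \<nu>^2 - \<open>\<zeta> r (z r)\<close>, which is at least C \<nu>^2 - \<Phi>. For r > s
    the indicators are eventually 1.\<close>
  have lim: "AE r in lebesgue. ennreal (?L r) \<le> liminf (\<lambda>n. ennreal (?I n r * (H n r - G n r)))"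
  proof -
    have "AE r in lebesgue. r \<notin> {s}" by (rule AE_not_in) (simp add: negligible_iff_null_sets[symmetric])
    then show ?thesis
      using \<Phi>(2) increment_average_tendsto[OF hlim h0] interval_average_tendsto_AE[OF \<nu>(3) hlim h0]
    proof eventually_elim
      case (elim r)
      show ?case
      proof (cases "r \<in> {s<..t}")
        case True
        then have r: "r \<in> {0<..T}" "r \<in> {0..T}" using st by auto
        have G: "(\<lambda>n. G n r) \<longlonglongrightarrow> \<zeta> r (z r)" using elim(3) r by (simp add: G_def)
        have ev: "\<forall>\<^sub>F n in sequentially. h n < r - s" using True by (intro order_tendstoD(2)[OF hlim]) auto
        have "(\<lambda>n. C / 2 * (integral {r - h n..r} (\<lambda>r. (\<nu> r)\<^sup>2) / h n + (\<nu> r)\<^sup>2)) \<longlonglongrightarrow> C / 2 * ((\<nu> r)\<^sup>2 + (\<nu> r)\<^sup>2)"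
          using elim(4) r by (intro tendsto_intros) auto
        then have "(\<lambda>n. C / 2 * (integral {r - h n..r} (\<lambda>r. (\<nu> r)\<^sup>2) / h n + (\<nu> r)\<^sup>2) - G n r) \<longlonglongrightarrow> C * (\<nu> r)\<^sup>2 - \<zeta> r (z r)"
          using tendsto_diff[OF _ G] by fastforce
        moreover have "\<forall>\<^sub>F n in sequentially. C / 2 * (integral {r - h n..r} (\<lambda>r. (\<nu> r)\<^sup>2) / h n + (\<nu> r)\<^sup>2) - G n r
            = ?I n r * (H n r - G n r)"
          using ev
        proof eventually_elim
          case (elim n)
          have "r - h n \<in> {0..T}" "r - h n \<le> r" using elim True st h0[of n] by auto
          then show ?case using elim True r W_diff[of "r - h n" r] by (simp add: H_def Wc)
        qed
        ultimately have "(\<lambda>n. ?I n r * (H n r - G n r)) \<longlonglongrightarrow> C * (\<nu> r)\<^sup>2 - \<zeta> r (z r)"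
          by (rule Lim_transform_eventually)
        then have "(\<lambda>n. ennreal (?I n r * (H n r - G n r))) \<longlonglongrightarrow> ennreal (C * (\<nu> r)\<^sup>2 - \<zeta> r (z r))"
          by (rule tendsto_ennrealI)
        from lim_imp_Liminf[OF sequentially_bot this]
        have "liminf (\<lambda>n. ennreal (?I n r * (H n r - G n r))) = ennreal (C * (\<nu> r)\<^sup>2 - \<zeta> r (z r))" .
        moreover have "ennreal (?L r) \<le> ennreal (C * (\<nu> r)\<^sup>2 - \<zeta> r (z r))"
          using True elim(2) r by (intro ennreal_leI) auto
        ultimately show ?thesis by simp
      next
        case False
        then have L0: "?L r = 0" using elim(1) by (auto simp: indicator_def)
        show ?thesis unfolding L0 by simp
      qed
    qed
  qed
  \<comment> \<open>c bounds from below the difference quotient formed by the averages of |Z|^2 at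
    the two ends. It consists of continuous quantities and therefore has a limit.\<close>
  define c where "c n = (2 * (integral {t - h n..t} (\<lambda>r. Z t \<bullet> Z r) / h n) - Y t)
      - (integral {s..s + h n} (\<lambda>r. Z s \<bullet> Z r) / h n + C * (W (s + h n) - W s))" for n
  define b where "b n = C / 2 * ((integral {t - h n..t} Wc / h n - integral {s..s + h n} Wc / h n) + (W t - W (s + h n))) - c n / 2" for n
  have Ile: "(LINT r|lebesgue. ?I n r * (H n r - G n r)) \<le> b n" for n
  proof -
    have "(LINT r|lebesgue. ?I n r * (H n r - G n r)) = (LINT r:{s + h n..t}|lebesgue. H n r - G n r)"
      by (simp add: set_lebesgue_integral_def)
    also have "\<dots> = integral {s + h n..t} (H n) - integral {s + h n..t} (G n)"
      by (simp add: set_integral_diff(2)[OF Hint Gint] set_lebesgue_integral_eq_integral(2)[OF Hint] set_lebesgue_integral_eq_integral(2)[OF Gint])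
    also have "integral {s + h n..t} (H n) = C / 2 * ((integral {t - h n..t} Wc - integral {s..s + h n} Wc) / h n + (W t - W (s + h n)))"
    proof -
      have i: "(\<lambda>r. (Wc r - Wc (r - h n)) / h n) integrable_on {s + h n..t}"
        by (rule set_lebesgue_integral_eq_integral(1)[OF Hint1])
      have j: "(\<lambda>r. (\<nu> r)\<^sup>2) integrable_on {s + h n..t}" using st h0[of n] by (intro \<nu>2_integrable_on) auto
      show ?thesis
        unfolding H_def integral_mult_right Henstock_Kurzweil_Integration.integral_add[OF i j]
        using W_diff[of "s + h n" t] st h0[of n] hle[of n] integral_increment(2)[OF Wc_int h0 hle] by simp
    qed
    finally have eq: "(LINT r|lebesgue. ?I n r * (H n r - G n r)) =
        C / 2 * ((integral {t - h n..t} Wc - integral {s..s + h n} Wc) / h n + (W t - W (s + h n))) - integral {s + h n..t} (G n)" .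
    have "integral {s + h n..t} (G n) \<ge> c n / 2"
    proof -
      have "c n \<le> integral {t - h n..t} Y / h n - integral {s..s + h n} Y / h n"
        unfolding c_def using st hle[of n] by (intro diff_mono Y_average_end Y_average_start h0) auto
      also have "\<dots> = (integral {t - h n..t} Y - integral {s..s + h n} Y) / h n" by (simp add: diff_divide_distrib)
      also have "\<dots> \<le> (2 * integral {s + h n..t} (\<Gamma> (h n))) / h n"
        using h0[of n] by (intro divide_right_mono energy_increment h0 hle) simp
      also have "\<dots> = 2 * integral {s + h n..t} (G n)"
        by (simp add: G_def[abs_def])
      finally show ?thesis by simp
    qed
    then show ?thesis unfolding eq b_def by (simp add: diff_divide_distrib)
  qed
  let ?B = "C * (W t - W s) - (Y t - Y s) / 2"
  have sT: "s \<in> {0..T}" "t \<in> {0..T}" using st by auto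
  have Wlim: "(\<lambda>n. W (s + h n)) \<longlonglongrightarrow> W s"
  proof -
    have "(\<lambda>n. s + h n) \<longlonglongrightarrow> s + 0" by (intro tendsto_intros hlim)
    moreover have "isCont Wc s" using Wc_cont[of UNIV] by (simp add: continuous_on_eq_continuous_at)
    ultimately have "(\<lambda>n. Wc (s + h n)) \<longlonglongrightarrow> Wc s" using isCont_tendsto_compose by fastforce
    moreover have "s + h n \<in> {0..T}" for n using st hle[of n] h0[of n] by auto
    ultimately show ?thesis using sT by (simp add: Wc)
  qed
  have clim: "c \<longlonglongrightarrow> (2 * Y t - Y t) - (Y s + C * (W s - W s))"
    unfolding c_def[abs_def]
    by (intro tendsto_intros average_left_tendsto[OF continuous_on_subset[OF Z_inner_cont'] \<open>s < t\<close> hlim h0]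
        average_right_tendsto[OF continuous_on_subset[OF Z_inner_cont'] \<open>s < t\<close> hlim h0] Wlim) auto
  have blim: "b \<longlonglongrightarrow> ?B"
  proof -
    have "b \<longlonglongrightarrow> C / 2 * ((Wc t - Wc s) + (W t - W s)) - ((2 * Y t - Y t) - (Y s + C * (W s - W s))) / 2"
      unfolding b_def[abs_def]
      by (intro tendsto_intros clim average_left_tendsto[OF Wc_cont \<open>s < t\<close> hlim h0]
          average_right_tendsto[OF Wc_cont \<open>s < t\<close> hlim h0] Wlim) auto
    then show ?thesis using sT by (simp add: Wc algebra_simps)
  qed
  \<comment> \<open>Nonnegativity of the limit allows the final comparison of extended nonnegative
    reals to be read back in the reals.\<close>
  have b_nonneg: "b n \<ge> 0" for n
    using integral_nonneg_AE[OF HG, of n] Ile[of n] by linarith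
  have "ennreal ?A \<le> ennreal (LINT r|lebesgue. max 0 (?L r))"
    unfolding A using Lint by (intro ennreal_leI integral_mono) auto
  also have "\<dots> = (\<integral>\<^sup>+r. ennreal (max 0 (?L r)) \<partial>lebesgue)"
    using Lint by (intro nn_integral_eq_integral[symmetric]) auto
  also have "\<dots> = (\<integral>\<^sup>+r. ennreal (?L r) \<partial>lebesgue)"
    by (intro nn_integral_cong) (auto simp: max_def ennreal_neg)
  also have "\<dots> \<le> (\<integral>\<^sup>+r. liminf (\<lambda>n. ennreal (?I n r * (H n r - G n r))) \<partial>lebesgue)"
    by (rule nn_integral_mono_AE[OF lim])
  also have "\<dots> \<le> liminf (\<lambda>n. \<integral>\<^sup>+r. ennreal (?I n r * (H n r - G n r)) \<partial>lebesgue)"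
    using borel_measurable_integrable[OF int] by (intro nn_integral_liminf) auto
  also have "\<dots> \<le> liminf (\<lambda>n. ennreal (b n))"
  proof (intro Liminf_mono always_eventually allI)
    fix n
    have "(\<integral>\<^sup>+r. ennreal (?I n r * (H n r - G n r)) \<partial>lebesgue) = ennreal (LINT r|lebesgue. ?I n r * (H n r - G n r))"
      by (rule nn_integral_eq_integral[OF int HG])
    also have "\<dots> \<le> ennreal (b n)" by (intro ennreal_leI Ile)
    finally show "(\<integral>\<^sup>+r. ennreal (?I n r * (H n r - G n r)) \<partial>lebesgue) \<le> ennreal (b n)" .
  qed
  also have "\<dots> = ennreal ?B"
    by (rule lim_imp_Liminf[OF sequentially_bot tendsto_ennrealI[OF blim]])
  finally have "?A \<le> ?B"
    using LIMSEQ_le_const[OF blim, of 0] b_nonneg by (simp add: ennreal_le_iff)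
  \<comment> \<open>The term C (W t - W s), contributed by the majorant, stands on both sides and
    cancels.\<close>
  moreover have "y \<le> 2 * i" if "a - i \<le> a - y / 2" for a i y :: real using that by simp
  ultimately have "Y t - Y s \<le> 2 * integral {s..t} \<Phi>" by blast
  then show ?thesis using sT by (simp add: Z_eq power2_norm_eq_inner)
qed simp

end

section \<open>Differences of weak solutions\<close>

lemma AE_lebesgue_on_iff:
  "(AE r in lebesgue_on {a..b}. P r) \<longleftrightarrow> (AE r in lebesgue. r \<in> {a..b} \<longrightarrow> P r)" for a b :: real
  by (rule AE_restrict_space_iff) simp

lemma set_integrable_AE_cong:
  fixes f g :: "real \<Rightarrow> real"
  assumes "set_integrable lebesgue S f" "AE r in lebesgue. r \<in> S \<longrightarrow> f r = g r"
  shows "set_integrable lebesgue S g" "integral S g = integral S f"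
proof -
  obtain A where A: "A \<in> null_sets lebesgue" "{r. \<not> (r \<in> S \<longrightarrow> f r = g r)} \<subseteq> A"
    using assms(2) unfolding eventually_ae_filter by auto
  then have neg: "negligible A" by (simp add: negligible_iff_null_sets)
  have eq: "r \<in> S - A \<Longrightarrow> g r = f r" for r using A(2) by auto
  show "set_integrable lebesgue S g"
    by (rule absolutely_integrable_spike[OF assms(1) neg eq])
  show "integral S g = integral S f"
    by (rule integral_spike[OF neg eq[symmetric]])
qed

lemma E_norm_triangle:
  assumes "open \<Omega>" "x \<in> E_space \<Omega>" "y \<in> E_space \<Omega>"
  shows "E_norm \<Omega> (x - y) \<le> E_norm \<Omega> x + E_norm \<Omega> y"
  unfolding E_norm_eq E_grad_diff[OF assms] by (rule norm_triangle_ineq4)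

lemma E_norm_nonneg: "0 \<le> E_norm \<Omega> x"
  by (simp add: E_norm_eq)

lemma H_space_diff: "x \<in> H_space \<Omega> \<Longrightarrow> y \<in> H_space \<Omega> \<Longrightarrow> x - y \<in> H_space \<Omega>"
  by (auto simp: H_space_def L2_on_diff)

text \<open>The norms of the approximating simple functions are measurable, and their limit agrees
  with the norm of g almost everywhere. Such a version is required before integrals of sums can be
  split.\<close>

lemma E_norm_measurable_version:
  assumes \<Omega>: "open \<Omega>" and g: "L2_time_E \<Omega> \<tau> g"
  obtains G where "G \<in> borel_measurable (lebesgue_on {0..\<tau>})"
    "AE r in lebesgue_on {0..\<tau>}. G r = E_norm \<Omega> (g r)"
proof -
  let ?M = "lebesgue_on {0..\<tau>}" and ?E = "E_space \<Omega>" and ?N = "E_norm \<Omega>"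
  have E: "AE r in ?M. g r \<in> ?E" using g by (simp add: L2_time_E_def)
  obtain s where s: "\<And>k. simple_function ?M (s k)" "\<And>k. s k ` {0..\<tau>} \<subseteq> ?E"
    "AE r in ?M. (\<lambda>k. ?N (s k r - g r)) \<longlonglongrightarrow> 0"
    using g unfolding L2_time_E_def by blast
  have "AE r in ?M. r \<in> {0..\<tau>}" by (simp add: AE_lebesgue_on_iff)
  then have "AE r in ?M. lim (\<lambda>k. ?N (s k r)) = ?N (g r)"
    using E s(3)
  proof eventually_elim
    case (elim r)
    have sE: "s k r \<in> ?E" for k using s(2)[of k] elim(1) by auto
    have "\<bar>?N (s k r) - ?N (g r)\<bar> \<le> ?N (s k r - g r)" for k
      using norm_triangle_ineq3[of "E_grad \<Omega> (s k r)" "E_grad \<Omega> (g r)"]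
      by (simp add: E_norm_eq E_grad_diff[OF \<Omega> sE elim(2)])
    then have "(\<lambda>k. ?N (s k r) - ?N (g r)) \<longlonglongrightarrow> 0"
      by (intro Lim_null_comparison[OF _ elim(3)] always_eventually) auto
    then show ?case by (simp add: LIM_zero_iff limI)
  qed
  moreover have "(\<lambda>r. lim (\<lambda>k. ?N (s k r))) \<in> borel_measurable ?M"
    by (intro borel_measurable_lim_metric borel_measurable_simple_function simple_function_compose1[OF s(1), of "\<lambda>x. ?N x"])
  ultimately show ?thesis using that by blast
qed

text \<open>Supplies the data of the abstract evolution. The differences of values of the
  approximating simple functions form the countable set X, which comes arbitrarily close to almost
  every value of g1 - g2.\<close>

lemma L2_time_E_difference:
  assumes \<Omega>: "open \<Omega>" and g: "L2_time_E \<Omega> \<tau> g1" "L2_time_E \<Omega> \<tau> g2"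
  obtains \<nu> X where "\<And>r. 0 \<le> \<nu> r" "set_integrable lebesgue {0..\<tau>} \<nu>"
    "set_integrable lebesgue {0..\<tau>} (\<lambda>r. (\<nu> r)\<^sup>2)"
    "\<And>r. g1 r \<in> E_space \<Omega> \<Longrightarrow> g2 r \<in> E_space \<Omega> \<Longrightarrow> \<nu> r = E_norm \<Omega> (g1 r - g2 r)"
    "AE r in lebesgue. r \<in> {0..\<tau>} \<longrightarrow> g1 r \<in> E_space \<Omega> \<and> g2 r \<in> E_space \<Omega>"
    "countable X" "X \<subseteq> E_space \<Omega>"
    "AE r in lebesgue. r \<in> {0..\<tau>} \<longrightarrow> (\<forall>e>0. \<exists>x\<in>X. E_norm \<Omega> ((g1 r - g2 r) - x) < e)"
proof -
  let ?M = "lebesgue_on {0..\<tau>}" and ?E = "E_space \<Omega>" and ?N = "E_norm \<Omega>"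
  have E1: "AE r in ?M. g1 r \<in> ?E" and E2: "AE r in ?M. g2 r \<in> ?E"
    using g by (simp_all add: L2_time_E_def)
  obtain s1 where s1: "\<And>k. simple_function ?M (s1 k)" "\<And>k. s1 k ` {0..\<tau>} \<subseteq> ?E"
    "AE r in ?M. (\<lambda>k. ?N (s1 k r - g1 r)) \<longlonglongrightarrow> 0"
    using g(1) unfolding L2_time_E_def by blast
  obtain s2 where s2: "\<And>k. simple_function ?M (s2 k)" "\<And>k. s2 k ` {0..\<tau>} \<subseteq> ?E"
    "AE r in ?M. (\<lambda>k. ?N (s2 k r - g2 r)) \<longlonglongrightarrow> 0"
    using g(2) unfolding L2_time_E_def by blast
  define \<nu> where "\<nu> r = (if g1 r \<in> ?E \<and> g2 r \<in> ?E then ?N (g1 r - g2 r) else 0)" for r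
  define X where "X = (\<Union>k. (\<lambda>(a, b). a - b) ` (s1 k ` {0..\<tau>} \<times> s2 k ` {0..\<tau>}))"
  have \<nu>0: "0 \<le> \<nu> r" for r by (simp add: \<nu>_def E_norm_nonneg)
  have fin: "finite (s1 k ` {0..\<tau>})" "finite (s2 k ` {0..\<tau>})" for k
    using s1(1)[of k] s2(1)[of k] by (simp_all add: simple_function_def)
  have X: "countable X" "X \<subseteq> ?E"
  proof -
    show "countable X"
      unfolding X_def by (rule countable_UN, simp, rule countable_finite, intro finite_imageI[where h="\<lambda>(a, b). a - b"] finite_cartesian_product fin)
    show "X \<subseteq> ?E"
      unfolding X_def using s1(2) s2(2) by (fastforce intro: E_space_diff[OF \<Omega>])
  qed
  have conv: "AE r in ?M. (\<lambda>k. ?N ((g1 r - g2 r) - (s1 k r - s2 k r))) \<longlonglongrightarrow> 0"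
  proof -
    have "AE r in ?M. r \<in> {0..\<tau>}" by (simp add: AE_lebesgue_on_iff)
    then show ?thesis
      using E1 E2 s1(3) s2(3)
    proof eventually_elim
      case (elim r)
      have sE: "s1 k r \<in> ?E" "s2 k r \<in> ?E" for k using s1(2)[of k] s2(2)[of k] elim(1) by auto
      have le: "?N ((g1 r - g2 r) - (s1 k r - s2 k r)) \<le> ?N (s2 k r - g2 r) + ?N (s1 k r - g1 r)" for k
      proof -
        have "(g1 r - g2 r) - (s1 k r - s2 k r) = (s2 k r - g2 r) - (s1 k r - g1 r)" by (simp add: algebra_simps)
        then show ?thesis
          using E_norm_triangle[OF \<Omega> E_space_diff[OF \<Omega> sE(2) elim(3)] E_space_diff[OF \<Omega> sE(1) elim(2)]] by (simp only:)
      qed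
      have lim: "(\<lambda>k. ?N (s2 k r - g2 r) + ?N (s1 k r - g1 r)) \<longlonglongrightarrow> 0"
        using tendsto_add[OF elim(5) elim(4)] by simp
      show ?case
        by (rule tendsto_sandwich[OF _ _ tendsto_const lim])
          (auto intro!: always_eventually simp: E_norm_nonneg le)
    qed
  qed
  have lim\<nu>: "AE r in ?M. (\<lambda>k. ?N (s1 k r - s2 k r)) \<longlonglongrightarrow> \<nu> r"
  proof -
    have "AE r in ?M. r \<in> {0..\<tau>}" by (simp add: AE_lebesgue_on_iff)
    then show ?thesis
      using E1 E2 conv
    proof eventually_elim
      case (elim r)
      have sE: "s1 k r - s2 k r \<in> ?E" for k
      proof (rule E_space_diff[OF \<Omega>])
        show "s1 k r \<in> ?E" "s2 k r \<in> ?E" using s1(2)[of k] s2(2)[of k] elim(1) by auto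
      qed
      have gE: "g1 r - g2 r \<in> ?E" using elim by (auto intro: E_space_diff[OF \<Omega>])
      have "\<bar>?N (s1 k r - s2 k r) - \<nu> r\<bar> \<le> ?N ((g1 r - g2 r) - (s1 k r - s2 k r))" for k
        using elim norm_triangle_ineq3[of "E_grad \<Omega> (g1 r - g2 r)" "E_grad \<Omega> (s1 k r - s2 k r)"]
        by (simp add: \<nu>_def E_norm_eq E_grad_diff[OF \<Omega> gE sE] abs_minus_commute)
      then have "(\<lambda>k. ?N (s1 k r - s2 k r) - \<nu> r) \<longlonglongrightarrow> 0"
        by (intro Lim_null_comparison[OF _ elim(4)] always_eventually) auto
      then show ?case by (simp add: LIM_zero_iff)
    qed
  qed
  have sm: "(\<lambda>r. ?N (s1 k r - s2 k r)) \<in> borel_measurable ?M" for k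
    by (intro borel_measurable_simple_function simple_function_compose2[OF s1(1) s2(1), where h="\<lambda>a b. ?N (a - b)"])
  define L where "L r = lim (\<lambda>k. ?N (s1 k r - s2 k r))" for r
  have Lm: "L \<in> borel_measurable ?M" unfolding L_def by (rule borel_measurable_lim_metric) (rule sm)
  have L\<nu>: "AE r in ?M. L r = \<nu> r" using lim\<nu> by eventually_elim (simp add: L_def limI)
  have L2int: "integrable ?M (\<lambda>r. (L r)\<^sup>2)"
  proof (rule integrableI_bounded)
    show "(\<lambda>r. (L r)\<^sup>2) \<in> borel_measurable ?M" using Lm by measurable
    let ?I = "\<lambda>g. \<integral>\<^sup>+r. ennreal ((?N (g r))\<^sup>2) \<partial>?M"
    obtain G1 where G1: "G1 \<in> borel_measurable ?M" "AE r in ?M. G1 r = ?N (g1 r)"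
      using E_norm_measurable_version[OF \<Omega> g(1)] by blast
    obtain G2 where G2: "G2 \<in> borel_measurable ?M" "AE r in ?M. G2 r = ?N (g2 r)"
      using E_norm_measurable_version[OF \<Omega> g(2)] by blast
    note [measurable] = G1(1) G2(1) Lm
    have "(\<integral>\<^sup>+r. ennreal (norm ((L r)\<^sup>2)) \<partial>?M) \<le> (\<integral>\<^sup>+r. 2 * ennreal ((G1 r)\<^sup>2) + 2 * ennreal ((G2 r)\<^sup>2) \<partial>?M)"
    proof (rule nn_integral_mono_AE)
      show "AE r in ?M. ennreal (norm ((L r)\<^sup>2)) \<le> 2 * ennreal ((G1 r)\<^sup>2) + 2 * ennreal ((G2 r)\<^sup>2)"
        using L\<nu> G1(2) G2(2) E1 E2
      proof eventually_elim
        case (elim r)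
        have "L r \<le> G1 r + G2 r"
          using elim E_norm_triangle[OF \<Omega> elim(4,5)] by (simp add: \<nu>_def)
        moreover have "0 \<le> L r" using elim(1) \<nu>0[of r] by simp
        ultimately have "(L r)\<^sup>2 \<le> (G1 r + G2 r)\<^sup>2" by (rule power_mono)
        also have "\<dots> \<le> 2 * (G1 r)\<^sup>2 + 2 * (G2 r)\<^sup>2"
          using sum_squares_bound[of "G1 r" "G2 r"] by (simp add: power2_sum)
        finally have "ennreal ((L r)\<^sup>2) \<le> ennreal (2 * (G1 r)\<^sup>2 + 2 * (G2 r)\<^sup>2)" by (rule ennreal_leI)
        then show ?case by (simp add: ennreal_plus ennreal_mult)
      qed
    qed
    also have "\<dots> = 2 * (\<integral>\<^sup>+r. ennreal ((G1 r)\<^sup>2) \<partial>?M) + 2 * (\<integral>\<^sup>+r. ennreal ((G2 r)\<^sup>2) \<partial>?M)"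
      by (simp add: nn_integral_add nn_integral_cmult)
    also have "(\<integral>\<^sup>+r. ennreal ((G1 r)\<^sup>2) \<partial>?M) = ?I g1"
      by (rule nn_integral_cong_AE) (use G1(2) in \<open>eventually_elim; simp\<close>)
    also have "(\<integral>\<^sup>+r. ennreal ((G2 r)\<^sup>2) \<partial>?M) = ?I g2"
      by (rule nn_integral_cong_AE) (use G2(2) in \<open>eventually_elim; simp\<close>)
    also have "2 * ?I g1 + 2 * ?I g2 < \<infinity>"
      using g by (simp add: L2_time_E_def ennreal_mult_less_top)
    finally show "(\<integral>\<^sup>+r. ennreal (norm ((L r)\<^sup>2)) \<partial>?M) < \<infinity>" .
  qed
  \<comment> \<open>The interval has finite measure, and 2 |L| \<le> 1 + L^2.\<close>
  have Lint: "integrable ?M L"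
  proof (rule Bochner_Integration.integrable_bound)
    show "integrable ?M (\<lambda>r. 1 + (L r)\<^sup>2)"
      using L2int by (intro Bochner_Integration.integrable_add) (simp_all add: emeasure_restrict_space)
    show "AE r in ?M. norm (L r) \<le> norm (1 + (L r)\<^sup>2)"
    proof (intro AE_I2)
      fix r
      have "2 * \<bar>L r\<bar> * 1 \<le> \<bar>L r\<bar>\<^sup>2 + 1\<^sup>2" by (rule sum_squares_bound)
      then show "norm (L r) \<le> norm (1 + (L r)\<^sup>2)" by simp
    qed
  qed (rule Lm)
  have on: "set_integrable lebesgue {0..\<tau>} f" if "integrable ?M f" for f :: "real \<Rightarrow> real"
    using that by (simp add: set_integrable_def integrable_restrict_space)
  have eq: "AE r in lebesgue. r \<in> {0..\<tau>} \<longrightarrow> L r = \<nu> r" using L\<nu> by (simp add: AE_lebesgue_on_iff)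
  show ?thesis
  proof (rule that[OF \<nu>0])
    show "set_integrable lebesgue {0..\<tau>} \<nu>" by (rule set_integrable_AE_cong(1)[OF on[OF Lint] eq])
    show "set_integrable lebesgue {0..\<tau>} (\<lambda>r. (\<nu> r)\<^sup>2)"
      by (rule set_integrable_AE_cong(1)[OF on[OF L2int]]) (use eq in \<open>eventually_elim; simp\<close>)
    show "\<nu> r = ?N (g1 r - g2 r)" if "g1 r \<in> ?E" "g2 r \<in> ?E" for r using that by (simp add: \<nu>_def)
    show "AE r in lebesgue. r \<in> {0..\<tau>} \<longrightarrow> g1 r \<in> ?E \<and> g2 r \<in> ?E"
      using E1 E2 unfolding AE_lebesgue_on_iff by eventually_elim simp
    show "AE r in lebesgue. r \<in> {0..\<tau>} \<longrightarrow> (\<forall>e>0. \<exists>x\<in>X. ?N ((g1 r - g2 r) - x) < e)"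
      using conv unfolding AE_lebesgue_on_iff
    proof eventually_elim
      case (elim r)
      show ?case
      proof (intro impI allI)
        fix e :: real assume r: "r \<in> {0..\<tau>}" and "e > 0"
        then have "\<forall>\<^sub>F k in sequentially. ?N ((g1 r - g2 r) - (s1 k r - s2 k r)) < e"
          using elim by (intro order_tendstoD(2)) auto
        then obtain k where "?N ((g1 r - g2 r) - (s1 k r - s2 k r)) < e" by (auto simp: eventually_sequentially)
        moreover have "s1 k r - s2 k r \<in> X"
          unfolding X_def using r by (intro UN_I[of k] rev_image_eqI[of "(s1 k r, s2 k r)"]) auto
        ultimately show "\<exists>x\<in>X. ?N ((g1 r - g2 r) - x) < e" by blast
      qed
    qed
  qed (rule X)+
qed

lemma diffusion_diff_right:
  assumes "open \<Omega>" "\<phi> \<in> E_space \<Omega>" "\<psi> \<in> E_space \<Omega>"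
  shows "diffusion \<Omega> d1 d2 d3 x (\<phi> - \<psi>) = diffusion \<Omega> d1 d2 d3 x \<phi> - diffusion \<Omega> d1 d2 d3 x \<psi>"
  using diffusion_add_right[OF assms(1,2) E_space_scaleR[OF assms(1,3), of "-1"]]
    diffusion_scaleR_right[OF assms(1,3), where c="-1"] by simp

text \<open>Brings the difference of two weak solutions into the form of the abstract evolution.
  Besides the energy inequality it yields the control of time increments against \<open>E\<close> on
  which the sampling in time rests.\<close>

lemma solution_difference:
  fixes \<Omega> :: "'a::euclidean_space set" and g1 g2 :: "real \<Rightarrow> 'a state"
  assumes \<Omega>: "open \<Omega>" and A: "A = diffusion \<Omega> d1 d2 d3"
    and sol: "global_weak_solution \<Omega> A f x1 g1" "global_weak_solution \<Omega> A f x2 g2"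
    and T: "T > 0" and M: "\<And>t. 0 \<le> t \<Longrightarrow> norm (g1 t) \<le> M" "\<And>t. 0 \<le> t \<Longrightarrow> norm (g2 t) \<le> M"
    and C: "C \<ge> 0"
    and bound: "\<And>x y \<phi>. x \<in> E_space \<Omega> \<Longrightarrow> y \<in> E_space \<Omega> \<Longrightarrow> \<phi> \<in> E_space \<Omega> \<Longrightarrow> norm x \<le> M \<Longrightarrow> norm y \<le> M \<Longrightarrow>
      \<bar>A (x - y) \<phi> + (f x - f y) \<bullet> \<phi>\<bar> \<le> C * E_norm \<Omega> (x - y) * E_norm \<Omega> \<phi>"
    and coercive: "\<And>x y. x \<in> E_space \<Omega> \<Longrightarrow> y \<in> E_space \<Omega> \<Longrightarrow> norm x \<le> M \<Longrightarrow> norm y \<le> M \<Longrightarrow>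
      A (x - y) (x - y) + (f x - f y) \<bullet> (x - y) \<le> - c * (E_norm \<Omega> (x - y))\<^sup>2 + K * (norm (x - y))\<^sup>2"
  obtains \<nu> where "\<And>r. 0 \<le> \<nu> r" "set_integrable lebesgue {0..T} \<nu>" "set_integrable lebesgue {0..T} (\<lambda>r. (\<nu> r)\<^sup>2)"
    "AE r in lebesgue. r \<in> {0..T} \<longrightarrow> g1 r - g2 r \<in> E_space \<Omega> \<and> E_norm \<Omega> (g1 r - g2 r) = \<nu> r"
    "set_integrable lebesgue {0..T} (\<lambda>r. (norm (g1 r - g2 r))\<^sup>2)"
    "\<And>s t. 0 \<le> s \<Longrightarrow> s \<le> t \<Longrightarrow> t \<le> T \<Longrightarrow> (norm (g1 t - g2 t))\<^sup>2 - (norm (g1 s - g2 s))\<^sup>2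
      \<le> 2 * integral {s..t} (\<lambda>r. - c * (\<nu> r)\<^sup>2 + K * (norm (g1 r - g2 r))\<^sup>2)"
    "\<And>s t \<phi>. 0 \<le> s \<Longrightarrow> s \<le> t \<Longrightarrow> t \<le> T \<Longrightarrow> \<phi> \<in> E_space \<Omega> \<Longrightarrow>
      \<bar>(g1 t - g2 t) \<bullet> \<phi> - (g1 s - g2 s) \<bullet> \<phi>\<bar> \<le> C * E_norm \<Omega> \<phi> * integral {s..t} \<nu>"
proof -
  let ?E = "E_space \<Omega>" and ?N = "E_norm \<Omega>"
  \<comment> \<open>The longer interval makes T an interior time, as the integrated form of the weak
    derivative demands.\<close>
  define \<tau> where "\<tau> = T + 1"
  have \<tau>: "\<tau> > 0" "T < \<tau>" using T by (simp_all add: \<tau>_def)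
  have w1: "weak_solution \<Omega> A f \<tau> x1 g1" and w2: "weak_solution \<Omega> A f \<tau> x2 g2"
    using sol \<tau>(1) by (auto simp: global_weak_solution_def)
  define z where "z r = g1 r - g2 r" for r
  obtain \<nu> X where \<nu>: "\<And>r. 0 \<le> \<nu> r" "set_integrable lebesgue {0..\<tau>} \<nu>"
    "set_integrable lebesgue {0..\<tau>} (\<lambda>r. (\<nu> r)\<^sup>2)"
    "\<And>r. g1 r \<in> ?E \<Longrightarrow> g2 r \<in> ?E \<Longrightarrow> \<nu> r = ?N (g1 r - g2 r)"
    and gE: "AE r in lebesgue. r \<in> {0..\<tau>} \<longrightarrow> g1 r \<in> ?E \<and> g2 r \<in> ?E"
    and X: "countable X" "X \<subseteq> ?E"
    "AE r in lebesgue. r \<in> {0..\<tau>} \<longrightarrow> (\<forall>e>0. \<exists>x\<in>X. ?N ((g1 r - g2 r) - x) < e)"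
    using L2_time_E_difference[OF \<Omega>, of \<tau> g1 g2] w1 w2 unfolding weak_solution_def by blast
  have \<nu>T: "set_integrable lebesgue {0..T} \<nu>" "set_integrable lebesgue {0..T} (\<lambda>r. (\<nu> r)\<^sup>2)"
    using set_integrable_subinterval[OF \<nu>(2), of 0 T] set_integrable_subinterval[OF \<nu>(3), of 0 T] \<tau> by auto
  \<comment> \<open>The default 0 off \<open>E\<close> makes the bound by \<nu> hold at every time
    of [0, T] and not only almost everywhere; the default for r \<le> 0 makes the left endpoint
    trivial in the limits below.\<close>
  define \<zeta> where "\<zeta> r \<phi> = (if 0 < r \<and> g1 r \<in> ?E \<and> g2 r \<in> ?E
      then A (g1 r - g2 r) \<phi> + (f (g1 r) - f (g2 r)) \<bullet> \<phi> else 0)" for r \<phi>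
  have \<zeta>_bound: "\<bar>\<zeta> r \<phi>\<bar> \<le> C * \<nu> r * ?N \<phi>" if "r \<in> {0..T}" "\<phi> \<in> ?E" for r \<phi>
    using bound[of "g1 r" "g2 r" \<phi>] that M \<nu>(4)[of r] \<nu>(1)[of r] C by (simp add: \<zeta>_def E_norm_nonneg)
  define q where "q \<phi> r = (A (g1 r) \<phi> + f (g1 r) \<bullet> \<phi>) - (A (g2 r) \<phi> + f (g2 r) \<bullet> \<phi>)" for \<phi> r
  have q\<zeta>: "AE r in lebesgue. r \<in> {s..T} \<longrightarrow> q \<phi> r = \<zeta> r \<phi>" if "s > 0" for s \<phi>
    using gE
  proof eventually_elim
    case (elim r)
    then show ?case
      using that \<tau> by (auto simp: q_def \<zeta>_def A diffusion_diff_left[OF \<Omega>] inner_diff_left)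
  qed
  have wd1: "has_weak_derivative_on {0<..<\<tau>} 1 (\<lambda>t. g1 t \<bullet> \<phi>) (\<lambda>t. A (g1 t) \<phi> + f (g1 t) \<bullet> \<phi>)"
    and wd2: "has_weak_derivative_on {0<..<\<tau>} 1 (\<lambda>t. g2 t \<bullet> \<phi>) (\<lambda>t. A (g2 t) \<phi> + f (g2 t) \<bullet> \<phi>)"
    if "\<phi> \<in> ?E" for \<phi>
    using w1 w2 that unfolding weak_solution_def by blast+
  have qint: "set_integrable lebesgue {s..t} (q \<phi>)" if "0 < s" "t \<le> T" "\<phi> \<in> ?E" for s t \<phi>
  proof -
    have K: "compact {s..t}" "{s..t} \<subseteq> {0<..<\<tau>}" using that \<tau> by auto
    then show ?thesis
      unfolding q_def using wd1[OF that(3)] wd2[OF that(3)]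
      by (intro set_integral_diff(1)) (auto simp: has_weak_derivative_on_def locally_integrable_def)
  qed
  have \<zeta>int0: "set_integrable lebesgue {s..t} (\<lambda>r. \<zeta> r \<phi>)" and \<zeta>eq: "integral {s..t} (\<lambda>r. \<zeta> r \<phi>) = integral {s..t} (q \<phi>)"
    if "0 < s" "t \<le> T" "\<phi> \<in> ?E" for s t \<phi>
  proof -
    have ae: "AE r in lebesgue. r \<in> {s..t} \<longrightarrow> q \<phi> r = \<zeta> r \<phi>"
      using q\<zeta>[OF that(1)] by eventually_elim (use that in auto)
    show "set_integrable lebesgue {s..t} (\<lambda>r. \<zeta> r \<phi>)" "integral {s..t} (\<lambda>r. \<zeta> r \<phi>) = integral {s..t} (q \<phi>)"
      using set_integrable_AE_cong[OF qint[OF that] ae] by auto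
  qed
  have \<zeta>int: "set_integrable lebesgue {0..T} (\<lambda>r. \<zeta> r \<phi>)" if \<phi>: "\<phi> \<in> ?E" for \<phi>
    unfolding set_integrable_def
  proof (rule Bochner_Integration.integrable_bound)
    show "integrable lebesgue (\<lambda>r. indicator {0..T} r *\<^sub>R (C * ?N \<phi> * \<nu> r))"
      using set_integrable_mult_right[OF \<nu>T(1), of "C * ?N \<phi>"] by (simp add: set_integrable_def)
    show "AE r in lebesgue. norm (indicator {0..T} r *\<^sub>R \<zeta> r \<phi>) \<le> norm (indicator {0..T} r *\<^sub>R (C * ?N \<phi> * \<nu> r))"
    proof (intro AE_I2)
      fix r
      show "norm (indicator {0..T} r *\<^sub>R \<zeta> r \<phi>) \<le> norm (indicator {0..T} r *\<^sub>R (C * ?N \<phi> * \<nu> r))"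
        using \<zeta>_bound[OF _ \<phi>, of r] by (cases "r \<in> {0..T}") (auto simp: mult_ac intro: order_trans)
    qed
    \<comment> \<open>Local integrability does not reach the time 0, so measurability is obtained as
      a limit over the intervals [1/(n+1), T].\<close>
    show "(\<lambda>r. indicator {0..T} r *\<^sub>R \<zeta> r \<phi>) \<in> borel_measurable lebesgue"
    proof (rule borel_measurable_LIMSEQ_real)
      fix n
      show "(\<lambda>r. indicator {inverse (real (Suc n))..T} r *\<^sub>R \<zeta> r \<phi>) \<in> borel_measurable lebesgue"
        using \<zeta>int0[OF _ order_refl \<phi>, of "inverse (real (Suc n))"]
        unfolding set_integrable_def by (intro borel_measurable_integrable) simp
    next
      fix r
      have "\<forall>\<^sub>F n in sequentially. indicator {inverse (real (Suc n))..T} r *\<^sub>R \<zeta> r \<phi> = indicator {0..T} r *\<^sub>R \<zeta> r \<phi>"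
      proof (cases "r > 0")
        case True
        have "\<forall>\<^sub>F n in sequentially. inverse (real (Suc n)) < r"
          by (rule order_tendstoD(2)[OF LIMSEQ_inverse_real_of_nat True])
        then show ?thesis
        proof eventually_elim
          case (elim n)
          then have "r \<in> {inverse (real (Suc n))..T} \<longleftrightarrow> r \<in> {0..T}" using True by auto
          then show ?case by (simp add: indicator_def)
        qed
      next
        case False
        then show ?thesis by (simp add: \<zeta>_def)
      qed
      then show "(\<lambda>n. indicator {inverse (real (Suc n))..T} r *\<^sub>R \<zeta> r \<phi>) \<longlonglongrightarrow> indicator {0..T} r *\<^sub>R \<zeta> r \<phi>"
        by (rule tendsto_eventually)
    qed
  qed
  have EH: "?E \<subseteq> H_space \<Omega>" by (rule E_space_H_space)
  have gH: "g1 r \<in> H_space \<Omega>" "g2 r \<in> H_space \<Omega>" if "r \<in> {0..\<tau>}" for r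
    using w1 w2 that unfolding weak_solution_def weakly_continuous_on_def by blast+
  have zc: "continuous_on {0..T} (\<lambda>t. z t \<bullet> h)" if "h \<in> H_space \<Omega>" for h
  proof -
    have "continuous_on {0..\<tau>} (\<lambda>t. g1 t \<bullet> h)" "continuous_on {0..\<tau>} (\<lambda>t. g2 t \<bullet> h)"
      using w1 w2 that unfolding weak_solution_def weakly_continuous_on_def by blast+
    then have "continuous_on {0..\<tau>} (\<lambda>t. z t \<bullet> h)"
      unfolding z_def inner_diff_left by (rule continuous_on_diff)
    then show ?thesis by (rule continuous_on_subset) (use \<tau> in auto)
  qed
  have incr: "z t \<bullet> \<phi> - z s \<bullet> \<phi> = integral {s..t} (\<lambda>r. \<zeta> r \<phi>)" if "0 < s" "s \<le> t" "t \<le> T" "\<phi> \<in> ?E" for s t \<phi>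
  proof -
    have c1: "continuous_on {0..\<tau>} (\<lambda>t. g1 t \<bullet> \<phi>)" "continuous_on {0..\<tau>} (\<lambda>t. g2 t \<bullet> \<phi>)"
      using w1 w2 that(4) EH unfolding weak_solution_def weakly_continuous_on_def by blast+
    have t\<tau>: "t < \<tau>" using that \<tau> by simp
    have K: "compact {s..t}" "{s..t} \<subseteq> {0<..<\<tau>}" using that \<tau> by auto
    have i1: "(\<lambda>t. A (g1 t) \<phi> + f (g1 t) \<bullet> \<phi>) integrable_on {s..t}" "(\<lambda>t. A (g2 t) \<phi> + f (g2 t) \<bullet> \<phi>) integrable_on {s..t}"
      using wd1[OF that(4)] wd2[OF that(4)] K
      unfolding has_weak_derivative_on_def locally_integrable_def
      by (intro set_lebesgue_integral_eq_integral(1); blast)+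
    have "integral {s..t} (q \<phi>) = (g1 t \<bullet> \<phi> - g1 s \<bullet> \<phi>) - (g2 t \<bullet> \<phi> - g2 s \<bullet> \<phi>)"
      unfolding q_def[abs_def] Henstock_Kurzweil_Integration.integral_diff[OF i1]
      using weak_derivative_integral[OF wd1[OF that(4)] c1(1) that(1,2) t\<tau>]
        weak_derivative_integral[OF wd2[OF that(4)] c1(2) that(1,2) t\<tau>] by simp
    then show ?thesis using \<zeta>eq[OF that(1,3,4)] by (simp add: z_def inner_diff_left)
  qed
  have z\<zeta>: "(z t - z s) \<bullet> \<phi> = integral {s..t} (\<lambda>r. \<zeta> r \<phi>)" if \<phi>: "\<phi> \<in> ?E" and st: "0 \<le> s" "s \<le> t" "t \<le> T" for \<phi> s t
  proof (cases "s = 0 \<and> 0 < t")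
    case False
    then consider "0 < s" | "s = t" using st by fastforce
    then show ?thesis
    proof cases
      case 1
      then show ?thesis using incr[OF _ st(2,3) \<phi>] by (simp add: inner_diff_left)
    qed simp
  next
    case True
    then have t: "0 < t" and s: "s = 0" by auto
    have io: "(\<lambda>r. \<zeta> r \<phi>) integrable_on {0..t}"
      using set_integrable_subinterval[OF \<zeta>int[OF \<phi>], of 0 t] st by (intro set_lebesgue_integral_eq_integral(1)) auto
    \<comment> \<open>The identity is extended to s = 0 by continuity: D is constant on (0, t] and,
      z being weakly continuous, continuous on [0, t].\<close>
    define D where "D r = z r \<bullet> \<phi> - integral {0..r} (\<lambda>r. \<zeta> r \<phi>)" for r
    have Dc: "continuous_on {0..t} D"
      unfolding D_def
      by (intro continuous_on_diff indefinite_integral_continuous_1 io continuous_on_subset[OF zc])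
        (use \<phi> EH st in auto)
    have Deq: "D r = D t" if "0 < r" "r \<le> t" for r
      using incr[OF that(1,2) st(3) \<phi>]
        Henstock_Kurzweil_Integration.integral_combine[OF _ that(2) io] that(1) by (simp add: D_def)
    define \<sigma> where "\<sigma> n = t * inverse (real (Suc n))" for n
    have \<sigma>: "0 < \<sigma> n" "\<sigma> n \<le> t" for n
    proof -
      have "inverse (real (Suc n)) \<le> 1" by (simp add: inverse_le_1_iff)
      then have "t * inverse (real (Suc n)) \<le> t * 1" using t by (intro mult_left_mono) auto
      then show "\<sigma> n \<le> t" by (simp add: \<sigma>_def)
      show "0 < \<sigma> n" using t by (simp add: \<sigma>_def)
    qed
    have "\<sigma> \<longlonglongrightarrow> 0"
      using tendsto_mult[OF tendsto_const LIMSEQ_inverse_real_of_nat, of t] by (simp add: \<sigma>_def[abs_def])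
    then have "(\<lambda>n. D (\<sigma> n)) \<longlonglongrightarrow> D 0"
      using t \<sigma> by (intro continuous_on_tendsto_compose[OF Dc]) (auto intro!: always_eventually less_imp_le)
    moreover have "D (\<sigma> n) = D t" for n using Deq \<sigma> by blast
    ultimately have "D 0 = D t" by (simp add: LIMSEQ_const_iff)
    then show ?thesis by (simp add: D_def s inner_diff_left)
  qed
  have zE: "AE r in lebesgue. r \<in> {0..T} \<longrightarrow> z r \<in> ?E \<and> ?N (z r) = \<nu> r"
    using gE
  proof eventually_elim
    case (elim r)
    then show ?case using \<tau> \<nu>(4)[of r] by (auto simp: z_def intro: E_space_diff[OF \<Omega>])
  qed
  note \<nu>_eq = \<nu>(4) and \<nu>_nonneg = \<nu>(1)
  interpret weak_evolution ?E ?N T C "2 * M" z \<nu> \<zeta> X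
  proof
    show "AE r in lebesgue. r \<in> {0..T} \<longrightarrow> (\<forall>e>0. \<exists>x\<in>X. ?N (z r - x) < e)"
      using X(3) by eventually_elim (use \<tau> in \<open>auto simp: z_def\<close>)
    show "continuous_on {0..T} (\<lambda>t. z t \<bullet> z r)" if "r \<in> {0..T}" for r
      using that \<tau> unfolding z_def[of r] by (intro zc H_space_diff gH) auto
    show "norm (z r) \<le> 2 * M" if "r \<in> {0..T}" for r
      using norm_triangle_ineq4[of "g1 r" "g2 r"] M[of r] that by (simp add: z_def)
    show "\<zeta> r (x - y) = \<zeta> r x - \<zeta> r y" if "x \<in> ?E" "y \<in> ?E" for r x y
      using that by (simp add: \<zeta>_def A diffusion_diff_right[OF \<Omega>] inner_diff_right)
  qed (use T C \<nu>(1) \<nu>T zE X(1,2) \<zeta>_bound \<zeta>int z\<zeta> in \<open>auto intro: E_space_diff[OF \<Omega>]\<close>)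
  have yint: "set_integrable lebesgue {0..T} (\<lambda>r. (norm (z r))\<^sup>2)"
    by (rule set_integrable_AE_cong(1)[OF Y_int]) (auto simp: Z_eq power2_norm_eq_inner)
  have \<Phi>int: "set_integrable lebesgue {0..T} (\<lambda>r. - c * (\<nu> r)\<^sup>2 + K * (norm (z r))\<^sup>2)"
    by (intro set_integral_add(1) set_integrable_mult_right \<nu>T yint)
  have \<Phi>le: "AE r in lebesgue. r \<in> {0..T} \<longrightarrow> \<zeta> r (z r) \<le> - c * (\<nu> r)\<^sup>2 + K * (norm (z r))\<^sup>2"
  proof -
    have "AE r in lebesgue. r \<notin> {0::real}" by (rule AE_not_in) (simp add: negligible_iff_null_sets[symmetric])
    then show ?thesis using gE
    proof eventually_elim
      case (elim r)
      show ?case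
      proof
        assume r: "r \<in> {0..T}"
        then have g: "g1 r \<in> ?E" "g2 r \<in> ?E" "0 < r" using elim \<tau> by auto
        then show "\<zeta> r (z r) \<le> - c * (\<nu> r)\<^sup>2 + K * (norm (z r))\<^sup>2"
          using coercive[OF g(1,2) M(1) M(2)] \<nu>_eq[OF g(1,2)] by (simp add: \<zeta>_def z_def)
      qed
    qed
  qed
  show ?thesis
  proof (rule that[OF \<nu>_nonneg \<nu>T])
    show "AE r in lebesgue. r \<in> {0..T} \<longrightarrow> g1 r - g2 r \<in> ?E \<and> ?N (g1 r - g2 r) = \<nu> r"
      using zE by (simp add: z_def)
    show "set_integrable lebesgue {0..T} (\<lambda>r. (norm (g1 r - g2 r))\<^sup>2)" using yint by (simp add: z_def)
    show "(norm (g1 t - g2 t))\<^sup>2 - (norm (g1 s - g2 s))\<^sup>2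
      \<le> 2 * integral {s..t} (\<lambda>r. - c * (\<nu> r)\<^sup>2 + K * (norm (g1 r - g2 r))\<^sup>2)" if "0 \<le> s" "s \<le> t" "t \<le> T" for s t
      using energy_inequality[OF \<Phi>int \<Phi>le that] by (simp add: z_def)
    fix s t \<phi> assume st: "0 \<le> s" "s \<le> t" "t \<le> T" and \<phi>: "\<phi> \<in> ?E"
    have "\<bar>(z t - z s) \<bullet> \<phi>\<bar> = norm (integral {s..t} (\<lambda>r. \<zeta> r \<phi>))" using z\<zeta>[OF \<phi> st] by simp
    also have "\<dots> \<le> integral {s..t} (\<lambda>r. C * ?N \<phi> * \<nu> r)"
    proof (rule Henstock_Kurzweil_Integration.integral_norm_bound_integral)
      show "(\<lambda>r. \<zeta> r \<phi>) integrable_on {s..t}"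
        by (intro set_lebesgue_integral_eq_integral(1) set_integrable_subinterval[OF \<zeta>int[OF \<phi>]] st)
      show "(\<lambda>r. C * ?N \<phi> * \<nu> r) integrable_on {s..t}"
        by (intro integrable_on_mult_right set_lebesgue_integral_eq_integral(1) \<nu>_int st)
      show "norm (\<zeta> r \<phi>) \<le> C * ?N \<phi> * \<nu> r" if "r \<in> {s..t}" for r
        using \<zeta>_bound[OF _ \<phi>, of r] that st by (auto simp: mult_ac)
    qed
    finally show "\<bar>(g1 t - g2 t) \<bullet> \<phi> - (g1 s - g2 s) \<bullet> \<phi>\<bar> \<le> C * ?N \<phi> * integral {s..t} \<nu>"
      by (simp add: z_def inner_diff_left)
  qed
qed

section \<open>Quasi-stability on the attractor\<close>

text \<open>A Gronwall estimate by absorption: K T \<le> 1/4 lets the integral term take at most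
  half of the supremum of y over [s, T]. A supremum replaces a maximum because y is only known to be
  bounded and integrable.\<close>

lemma short_time_estimates:
  fixes y \<nu> :: "real \<Rightarrow> real"
  assumes T: "T > 0" and c: "c > 0" and K: "K \<ge> 0" "K * T \<le> 1 / 4"
    and y: "\<And>t. t \<in> {0..T} \<Longrightarrow> 0 \<le> y t" "\<And>t. t \<in> {0..T} \<Longrightarrow> y t \<le> B" "set_integrable lebesgue {0..T} y"
    and \<nu>: "set_integrable lebesgue {0..T} (\<lambda>r. (\<nu> r)\<^sup>2)"
    and energy: "\<And>s t. 0 \<le> s \<Longrightarrow> s \<le> t \<Longrightarrow> t \<le> T \<Longrightarrow> y t - y s \<le> 2 * integral {s..t} (\<lambda>r. - c * (\<nu> r)\<^sup>2 + K * y r)"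
  shows "\<And>s t. 0 \<le> s \<Longrightarrow> s \<le> t \<Longrightarrow> t \<le> T \<Longrightarrow> y t \<le> 2 * y s"
    and "integral {0..T} (\<lambda>r. (\<nu> r)\<^sup>2) \<le> y 0 / c"
    and "T * y T \<le> 2 * integral {0..T} y"
proof -
  have yio: "y integrable_on {a..b}" if "0 \<le> a" "b \<le> T" for a b
    by (intro set_lebesgue_integral_eq_integral(1) set_integrable_subinterval[OF y(3)] that)
  have \<nu>io: "(\<lambda>r. (\<nu> r)\<^sup>2) integrable_on {a..b}" if "0 \<le> a" "b \<le> T" for a b
    by (intro set_lebesgue_integral_eq_integral(1) set_integrable_subinterval[OF \<nu>] that)
  show two: "y t \<le> 2 * y s" if st: "0 \<le> s" "s \<le> t" "t \<le> T" for s t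
  proof -
    define m where "m = Sup (y ` {s..T})"
    have bdd: "bdd_above (y ` {s..T})" using y(2) st by (intro bdd_aboveI[of _ B]) auto
    have m: "y r \<le> m" if "r \<in> {s..T}" for r unfolding m_def using bdd that by (intro cSup_upper) auto
    have m0: "0 \<le> m" using m[of s] y(1)[of s] st by auto
    have "y r \<le> y s + m / 2" if r: "r \<in> {s..T}" for r
    proof -
      have "integral {s..r} (\<lambda>r. - c * (\<nu> r)\<^sup>2 + K * y r) \<le> integral {s..r} (\<lambda>_. K * m)"
      proof (rule integral_le)
        show "(\<lambda>r. - c * (\<nu> r)\<^sup>2 + K * y r) integrable_on {s..r}"
          using st r by (intro integrable_add integrable_on_mult_right \<nu>io yio) auto
        fix x assume "x \<in> {s..r}"
        then have "K * y x \<le> K * m" using m[of x] r K(1) by (intro mult_left_mono) auto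
        moreover have "0 \<le> c * (\<nu> x)\<^sup>2" using c by simp
        ultimately show "- c * (\<nu> x)\<^sup>2 + K * y x \<le> K * m" by simp
      qed (rule integrable_const_ivl)
      also have "\<dots> = (r - s) * (K * m)" using r by simp
      also have "\<dots> \<le> T * (K * m)" using r st K(1) m0 by (intro mult_right_mono) auto
      also have "\<dots> \<le> 1 / 4 * m" using mult_right_mono[OF K(2) m0] by (simp add: mult_ac)
      finally show ?thesis using energy[of s r] st r by auto
    qed
    then have "m \<le> y s + m / 2" unfolding m_def using st by (intro cSup_least) auto
    then show ?thesis using m[of t] st by auto
  qed
  have y0: "integral {0..T} y \<le> T * (2 * y 0)"
  proof -
    have "integral {0..T} y \<le> integral {0..T} (\<lambda>_. 2 * y 0)"
      by (rule integral_le) (use yio[of 0 T] two[of 0] in \<open>auto intro: integrable_const_ivl\<close>)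
    then show ?thesis using T by simp
  qed
  have "y T - y 0 \<le> 2 * integral {0..T} (\<lambda>r. - c * (\<nu> r)\<^sup>2 + K * y r)" using energy[of 0 T] T by simp
  also have "integral {0..T} (\<lambda>r. - c * (\<nu> r)\<^sup>2 + K * y r)
      = - c * integral {0..T} (\<lambda>r. (\<nu> r)\<^sup>2) + K * integral {0..T} y"
    by (subst Henstock_Kurzweil_Integration.integral_add)
      (auto intro!: integrable_on_mult_right integrable_neg \<nu>io yio)
  also have "K * integral {0..T} y \<le> K * (T * (2 * y 0))" using K(1) y0 by (rule mult_left_mono[rotated])
  also have "\<dots> \<le> 1 / 4 * (2 * y 0)" using mult_right_mono[OF K(2), of "2 * y 0"] y(1)[of 0] T by (simp add: mult_ac)
  finally have "2 * (c * integral {0..T} (\<lambda>r. (\<nu> r)\<^sup>2)) \<le> 2 * y 0" using y(1)[of T] T by simp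
  then show "integral {0..T} (\<lambda>r. (\<nu> r)\<^sup>2) \<le> y 0 / c" using c by (simp add: field_simps)
  have "integral {0..T} (\<lambda>_. y T) \<le> integral {0..T} (\<lambda>r. 2 * y r)"
    by (rule integral_le) (use two[of _ T] yio[of 0 T] in \<open>auto intro: integrable_const_ivl integrable_on_mult_right\<close>)
  then show "T * y T \<le> 2 * integral {0..T} y" using T by simp
qed

text \<open>Cauchy-Schwarz, obtained from Young's inequality with the optimal weight \<theta>. It
  gives the time increments their Hoelder exponent 1/2.\<close>

lemma integral_le_sqrt:
  fixes \<nu> :: "real \<Rightarrow> real"
  assumes \<nu>: "set_integrable lebesgue {0..T} \<nu>" "set_integrable lebesgue {0..T} (\<lambda>r. (\<nu> r)\<^sup>2)"
    and V: "V > 0" "integral {0..T} (\<lambda>r. (\<nu> r)\<^sup>2) \<le> V" and \<Delta>: "\<Delta> > 0" "b - a \<le> \<Delta>"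
    and ab: "0 \<le> a" "a \<le> b" "b \<le> T"
  shows "integral {a..b} \<nu> \<le> sqrt (\<Delta> * V)"
proof -
  define \<theta> where "\<theta> = sqrt (V / \<Delta>)"
  have \<theta>: "\<theta> > 0" "\<theta> * \<Delta> = sqrt (\<Delta> * V)" "V / \<theta> = sqrt (\<Delta> * V)"
    using V(1) \<Delta>(1) by (auto simp: \<theta>_def real_sqrt_divide real_sqrt_mult real_div_sqrt field_simps)
  have io: "\<nu> integrable_on {a..b}" "(\<lambda>r. (\<nu> r)\<^sup>2) integrable_on {a..b}"
    by (intro set_lebesgue_integral_eq_integral(1) set_integrable_subinterval[OF \<nu>(1)] set_integrable_subinterval[OF \<nu>(2)] ab)+
  have "integral {a..b} \<nu> \<le> integral {a..b} (\<lambda>r. \<theta> / 2 + 1 / (2 * \<theta>) * (\<nu> r)\<^sup>2)"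
  proof (rule integral_le[OF io(1)])
    show "(\<lambda>r. \<theta> / 2 + 1 / (2 * \<theta>) * (\<nu> r)\<^sup>2) integrable_on {a..b}"
      by (intro integrable_add integrable_const_ivl integrable_on_mult_right io)
    fix r
    have "2 * \<nu> r * \<theta> \<le> (\<nu> r)\<^sup>2 + \<theta>\<^sup>2" by (rule sum_squares_bound)
    then show "\<nu> r \<le> \<theta> / 2 + 1 / (2 * \<theta>) * (\<nu> r)\<^sup>2"
      using \<theta>(1) by (simp add: field_simps power2_eq_square)
  qed
  also have "\<dots> = (b - a) * \<theta> / 2 + 1 / (2 * \<theta>) * integral {a..b} (\<lambda>r. (\<nu> r)\<^sup>2)"
    using ab by (subst Henstock_Kurzweil_Integration.integral_add)
      (auto intro!: integrable_const_ivl integrable_on_mult_right integrable_on_divide io)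
  also have "integral {a..b} (\<lambda>r. (\<nu> r)\<^sup>2) \<le> integral {0..T} (\<lambda>r. (\<nu> r)\<^sup>2)"
    using ab io(2) set_lebesgue_integral_eq_integral(1)[OF \<nu>(2)] by (intro integral_subset_le) auto
  also have "(b - a) * \<theta> / 2 + 1 / (2 * \<theta>) * integral {0..T} (\<lambda>r. (\<nu> r)\<^sup>2) \<le> \<Delta> * \<theta> / 2 + 1 / (2 * \<theta>) * V"
    using \<theta>(1) V \<Delta> by (intro add_mono divide_right_mono mult_right_mono mult_left_mono) auto
  also have "\<dots> = sqrt (\<Delta> * V)" using \<theta> by (simp add: mult.commute)
  finally show ?thesis using \<theta>(1) by (simp add: divide_right_mono)
qed

lemma Oregonator_quasi_stability:
  fixes \<Omega> :: "'a::euclidean_space set" and S :: "real \<Rightarrow> 'a state \<Rightarrow> 'a state"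
  assumes \<Omega>: "open \<Omega>" "bounded \<Omega>" and n: "DIM('a) \<le> 3"
    and d: "d1 > 0" "d2 > 0" "d3 > 0"
    and pos: "a1 > 0" "a3 > 0" "b1 > 0" "b2 > 0" "c2 > 0" "c3 > 0" "F > 0" "G1 > 0" "G2 > 0"
    and S: "oregonator_semiflow \<Omega> d1 d2 d3 a1 a3 b1 b2 c2 c3 F G1 G2 S"
    and att: "global_attractor (H_plus \<Omega>) S \<A>"
  obtains T L C and I :: "(nat \<times> 'a state) set" and p where "T > 0" "L \<ge> 0" "C \<ge> 0" "finite I"
    "\<And>i x y. i \<in> I \<Longrightarrow> x \<in> \<A> \<Longrightarrow> y \<in> \<A> \<Longrightarrow> \<bar>p i x - p i y\<bar> \<le> L * dist x y"
    "\<And>x y. x \<in> \<A> \<Longrightarrow> y \<in> \<A> \<Longrightarrow>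
      (dist (S T x) (S T y))\<^sup>2 \<le> (dist x y)\<^sup>2 / 8 + C * (\<Sum>i\<in>I. (p i x - p i y)\<^sup>2)"
proof -
  let ?E = "E_space \<Omega>" and ?N = "E_norm \<Omega>"
  define A where "A = diffusion \<Omega> d1 d2 d3"
  define f :: "'a state \<Rightarrow> 'a state" where "f = oregonator_reaction a1 a3 b1 b2 c2 c3 F G1 G2"
  have AX: "\<A> \<subseteq> H_plus \<Omega>" and inv: "\<And>t. t \<ge> 0 \<Longrightarrow> S t ` \<A> = \<A>" and cpt: "compact \<A>"
    using att by (auto simp: global_attractor_def)
  have sol: "global_weak_solution \<Omega> A f x (\<lambda>t. S t x)" if "x \<in> \<A>" for x
    using S AX that unfolding oregonator_semiflow_def Let_def A_def f_def by blast
  have S0: "S 0 x = x" if "x \<in> \<A>" for x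
    using sol[OF that] unfolding global_weak_solution_def weak_solution_def using zero_less_one by blast
  obtain M0 where M0: "\<And>x. x \<in> \<A> \<Longrightarrow> norm x \<le> M0"
    using compact_imp_bounded[OF cpt] unfolding bounded_iff by blast
  define M where "M = max M0 0"
  have M: "M \<ge> 0" "\<And>x. x \<in> \<A> \<Longrightarrow> norm x \<le> M" using M0 by (auto simp: M_def le_max_iff_disj)
  \<comment> \<open>Invariance of the attractor turns its boundedness in \<open>H\<close> into a
    bound at all times.\<close>
  have SM: "norm (S t x) \<le> M" if "x \<in> \<A>" "0 \<le> t" for x t using inv[OF that(2)] that(1) M(2) by blast
  obtain c K C where c: "c > 0" and K: "K \<ge> 0" and C: "C > 0" and
    bound: "\<And>x y \<phi>. x \<in> ?E \<Longrightarrow> y \<in> ?E \<Longrightarrow> \<phi> \<in> ?E \<Longrightarrow> norm x \<le> M \<Longrightarrow> norm y \<le> M \<Longrightarrow>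
      \<bar>A (x - y) \<phi> + (f x - f y) \<bullet> \<phi>\<bar> \<le> C * ?N (x - y) * ?N \<phi>" and
    coercive: "\<And>x y. x \<in> ?E \<Longrightarrow> y \<in> ?E \<Longrightarrow> norm x \<le> M \<Longrightarrow> norm y \<le> M \<Longrightarrow>
      A (x - y) (x - y) + (f x - f y) \<bullet> (x - y) \<le> - c * (?N (x - y))\<^sup>2 + K * (norm (x - y))\<^sup>2"
    unfolding A_def using Oregonator_difference_bounds[OF \<Omega> n d pos f_def M(1)] by blast
  \<comment> \<open>The time must satisfy K T \<le> 1/4; the summand 1 covers K = 0.\<close>
  define T where "T = 1 / (4 * (K + 1))"
  have T: "T > 0" "K * T \<le> 1 / 4" using K by (simp_all add: T_def field_simps)
  \<comment> \<open>With V = w(0) / c the gradient term contributes 2 \<epsilon> V / T = w(0) / 16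
    to the bound for w(T).\<close>
  define \<epsilon> where "\<epsilon> = c * T / 32"
  have \<epsilon>: "\<epsilon> > 0" using c T by (simp add: \<epsilon>_def)
  obtain G C1 where G: "finite G" "G \<subseteq> ?E" and C1: "C1 \<ge> 0" and fin: "\<And>x. x \<in> ?E \<Longrightarrow>
    (norm x)\<^sup>2 \<le> \<epsilon> * (?N x)\<^sup>2 + C1 * (\<Sum>h\<in>G. (x \<bullet> h)\<^sup>2)"
    using finite_functionals_E[OF \<Omega> \<epsilon>] by blast
  define Q where "Q = (\<Sum>h\<in>G. (?N h)\<^sup>2)"
  have Q: "Q \<ge> 0" by (simp add: Q_def sum_nonneg)
  \<comment> \<open>The number of sampling intervals is taken so large that the Hoelder error
    between sampling times contributes at most another w(0) / 16.\<close>
  obtain J0 :: nat where J0: "64 * C1 * C\<^sup>2 * Q * T / c \<le> real J0" using real_arch_simple by blast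
  define J where "J = Suc J0"
  define \<Delta> where "\<Delta> = T / real J"
  have \<Delta>: "\<Delta> > 0" "real J * \<Delta> = T" using T by (simp_all add: \<Delta>_def J_def)
  have \<Delta>_small: "4 * C1 * C\<^sup>2 * Q * \<Delta> / c \<le> 1 / 16"
  proof -
    have "a / real J \<le> 1" if "a \<le> real J0" for a using that by (simp add: J_def divide_le_eq)
    from this[OF J0] show ?thesis by (simp add: \<Delta>_def mult_ac)
  qed
  define p where "p = (\<lambda>(j, h) x. S (real j * \<Delta>) x \<bullet> h)"
  define I where "I = {..J} \<times> G"
  \<comment> \<open>The factor 2 exceeds the Lipschitz constant sqrt 2 of S t on [0, T], and the sum
    of norms dominates the norm of each h.\<close>
  define L where "L = 2 * (\<Sum>h\<in>G. norm h)"
  \<comment> \<open>The first half provides the Lipschitz constant of the sampled functionals.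
    Coinciding points are treated apart because the bound V for the gradient integral has to be
    positive.\<close>
  have key: "(norm (S t x - S t y))\<^sup>2 \<le> 2 * (norm (x - y))\<^sup>2 \<and>
      (norm (S T x - S T y))\<^sup>2 \<le> (norm (x - y))\<^sup>2 / 8 + 4 * C1 * (\<Sum>i\<in>I. (p i x - p i y)\<^sup>2)"
    if x: "x \<in> \<A>" and y: "y \<in> \<A>" and t: "0 \<le> t" "t \<le> T" for x y t
  proof (cases "x = y")
    case True
    then show ?thesis using C1 by simp
  next
    case False
    define z where "z r = S r x - S r y" for r
    define w where "w r = (norm (z r))\<^sup>2" for r
    obtain \<nu> where \<nu>: "\<And>r. 0 \<le> \<nu> r" "set_integrable lebesgue {0..T} \<nu>" "set_integrable lebesgue {0..T} (\<lambda>r. (\<nu> r)\<^sup>2)"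
      and zE: "AE r in lebesgue. r \<in> {0..T} \<longrightarrow> z r \<in> ?E \<and> ?N (z r) = \<nu> r"
      and wint: "set_integrable lebesgue {0..T} w"
      and energy: "\<And>s t. 0 \<le> s \<Longrightarrow> s \<le> t \<Longrightarrow> t \<le> T \<Longrightarrow> w t - w s \<le> 2 * integral {s..t} (\<lambda>r. - c * (\<nu> r)\<^sup>2 + K * w r)"
      and incr: "\<And>s t \<phi>. 0 \<le> s \<Longrightarrow> s \<le> t \<Longrightarrow> t \<le> T \<Longrightarrow> \<phi> \<in> ?E \<Longrightarrow>
        \<bar>z t \<bullet> \<phi> - z s \<bullet> \<phi>\<bar> \<le> C * ?N \<phi> * integral {s..t} \<nu>"
      unfolding z_def w_def
      using solution_difference[OF \<Omega>(1) A_def sol[OF x] sol[OF y] T(1) SM[OF x] SM[OF y] less_imp_le[OF C] bound coercive]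
      by blast
    have wb: "w r \<le> (2 * M)\<^sup>2" if "r \<in> {0..T}" for r
      unfolding w_def z_def using norm_triangle_ineq4[of "S r x" "S r y"] SM[OF x, of r] SM[OF y, of r] that
      by (intro power_mono) auto
    have wn: "0 \<le> w r" for r by (simp add: w_def)
    note st = short_time_estimates[where y=w, OF T(1) c K T(2) wn wb wint \<nu>(3) energy]
    have w0: "w 0 = (norm (x - y))\<^sup>2" by (simp add: w_def z_def S0 x y)
    have w0pos: "w 0 > 0" using False by (simp add: w0)
    define V where "V = w 0 / c"
    have V: "V > 0" "integral {0..T} (\<lambda>r. (\<nu> r)\<^sup>2) \<le> V"
      using w0pos c st(2) by (simp_all add: V_def)
    define B where "B h = 2 * (\<Sum>j\<le>J. (z (real j * \<Delta>) \<bullet> h)\<^sup>2) + 2 * (C\<^sup>2 * (?N h)\<^sup>2 * (\<Delta> * V))" for h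
    have B: "(z r \<bullet> h)\<^sup>2 \<le> B h" if r: "r \<in> {0..T}" and h: "h \<in> G" for r h
    proof -
      \<comment> \<open>The last sampling time not after r; for r = T this is J itself, hence J + 1
        sampling times.\<close>
      define j where "j = nat \<lfloor>r / \<Delta>\<rfloor>"
      have r\<Delta>: "0 \<le> r / \<Delta>" "r / \<Delta> \<le> real J" using r \<Delta> by (auto simp: divide_le_eq)
      have j: "real j \<le> r / \<Delta>" "r / \<Delta> \<le> real j + 1" using r\<Delta>(1) unfolding j_def by linarith+
      then have "j \<le> J" using r\<Delta>(2) by linarith
      have jr: "0 \<le> real j * \<Delta>" "real j * \<Delta> \<le> r" "r - real j * \<Delta> \<le> \<Delta>"
        using j \<Delta>(1) by (auto simp: le_divide_eq divide_le_eq algebra_simps)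
      have "\<bar>z r \<bullet> h - z (real j * \<Delta>) \<bullet> h\<bar> \<le> C * ?N h * integral {real j * \<Delta>..r} \<nu>"
        by (rule incr[OF jr(1,2)]) (use r h G(2) in auto)
      also have "\<dots> \<le> C * ?N h * sqrt (\<Delta> * V)"
        using C r by (intro mult_left_mono integral_le_sqrt[OF \<nu>(2,3) V \<Delta>(1) jr(3,1,2)]) (auto simp: E_norm_nonneg)
      finally have "\<bar>z r \<bullet> h - z (real j * \<Delta>) \<bullet> h\<bar>\<^sup>2 \<le> (C * ?N h * sqrt (\<Delta> * V))\<^sup>2" by (intro power_mono) auto
      then have 1: "(z r \<bullet> h - z (real j * \<Delta>) \<bullet> h)\<^sup>2 \<le> C\<^sup>2 * (?N h)\<^sup>2 * (\<Delta> * V)"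
        using \<Delta>(1) V(1) by (simp add: power_mult_distrib)
      have 2: "(z (real j * \<Delta>) \<bullet> h)\<^sup>2 \<le> (\<Sum>j\<le>J. (z (real j * \<Delta>) \<bullet> h)\<^sup>2)"
        using \<open>j \<le> J\<close> by (intro member_le_sum[of j "{..J}" "\<lambda>j. (z (real j * \<Delta>) \<bullet> h)\<^sup>2"]) auto
      have "(a + b)\<^sup>2 \<le> 2 * a\<^sup>2 + 2 * b\<^sup>2" for a b :: real
        using sum_squares_bound[of a b] by (simp add: power2_sum)
      from this[of "z r \<bullet> h - z (real j * \<Delta>) \<bullet> h" "z (real j * \<Delta>) \<bullet> h"] 1 2
      show ?thesis by (simp add: B_def)
    qed
    have sumB: "(\<Sum>h\<in>G. B h) = 2 * (\<Sum>i\<in>I. (p i x - p i y)\<^sup>2) + 2 * C\<^sup>2 * Q * \<Delta> * V"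
    proof -
      have "(\<Sum>i\<in>I. (p i x - p i y)\<^sup>2) = (\<Sum>j\<le>J. \<Sum>h\<in>G. (z (real j * \<Delta>) \<bullet> h)\<^sup>2)"
        unfolding I_def by (subst sum.cartesian_product) (auto intro!: sum.cong simp: p_def z_def inner_diff_left)
      also have "\<dots> = (\<Sum>h\<in>G. \<Sum>j\<le>J. (z (real j * \<Delta>) \<bullet> h)\<^sup>2)" by (rule sum.swap)
      finally show ?thesis
        by (simp add: B_def sum.distrib sum_distrib_left sum_distrib_right Q_def mult_ac)
    qed
    have "integral {0..T} w \<le> integral {0..T} (\<lambda>r. \<epsilon> * (\<nu> r)\<^sup>2 + C1 * (\<Sum>h\<in>G. B h))"
    proof (rule integral_mono_AE_interval[OF wint])
      show "set_integrable lebesgue {0..T} (\<lambda>r. \<epsilon> * (\<nu> r)\<^sup>2 + C1 * (\<Sum>h\<in>G. B h))"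
        by (intro set_integral_add(1) set_integrable_mult_right \<nu>(3) absolutely_integrable_continuous_real continuous_on_const)
      show "AE r in lebesgue. r \<in> {0..T} \<longrightarrow> w r \<le> \<epsilon> * (\<nu> r)\<^sup>2 + C1 * (\<Sum>h\<in>G. B h)"
        using zE
      proof eventually_elim
        case (elim r)
        show ?case
        proof
          assume r: "r \<in> {0..T}"
          have "w r \<le> \<epsilon> * (\<nu> r)\<^sup>2 + C1 * (\<Sum>h\<in>G. (z r \<bullet> h)\<^sup>2)"
            using fin[of "z r"] elim r by (simp add: w_def)
          also have "\<dots> \<le> \<epsilon> * (\<nu> r)\<^sup>2 + C1 * (\<Sum>h\<in>G. B h)"
            using C1 by (intro add_left_mono mult_left_mono sum_mono B r) auto
          finally show "w r \<le> \<epsilon> * (\<nu> r)\<^sup>2 + C1 * (\<Sum>h\<in>G. B h)" .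
        qed
      qed
    qed
    also have "\<dots> = \<epsilon> * integral {0..T} (\<lambda>r. (\<nu> r)\<^sup>2) + T * (C1 * (\<Sum>h\<in>G. B h))"
      using T set_lebesgue_integral_eq_integral(1)[OF \<nu>(3)]
      by (subst Henstock_Kurzweil_Integration.integral_add) (auto intro: integrable_const_ivl integrable_on_mult_right)
    also have "\<dots> \<le> \<epsilon> * V + T * (C1 * (\<Sum>h\<in>G. B h))"
      using \<epsilon> V(2) by (intro add_right_mono mult_left_mono) auto
    finally have "T * w T \<le> 2 * (\<epsilon> * V + T * (C1 * (\<Sum>h\<in>G. B h)))" using st(3) by simp
    also have "\<epsilon> * V = T * (w 0 / 32)" using c by (simp add: \<epsilon>_def V_def)
    finally have "T * w T \<le> T * (w 0 / 16 + 2 * (C1 * (\<Sum>h\<in>G. B h)))" by (simp add: distrib_left mult_ac)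
    then have "w T \<le> w 0 / 16 + 2 * (C1 * (\<Sum>h\<in>G. B h))" using T(1) by simp
    also have "\<dots> = w 0 / 16 + 4 * C1 * (\<Sum>i\<in>I. (p i x - p i y)\<^sup>2) + (4 * C1 * C\<^sup>2 * Q * \<Delta> / c) * w 0"
      unfolding sumB V_def by (simp add: algebra_simps)
    also have "\<dots> \<le> w 0 / 16 + 4 * C1 * (\<Sum>i\<in>I. (p i x - p i y)\<^sup>2) + 1 / 16 * w 0"
      using w0pos by (intro add_left_mono mult_right_mono \<Delta>_small) auto
    finally have "w T \<le> w 0 / 8 + 4 * C1 * (\<Sum>i\<in>I. (p i x - p i y)\<^sup>2)" by simp
    moreover have "w t \<le> 2 * w 0" using st(1)[of 0 t] t by simp
    ultimately show ?thesis by (simp add: w0) (simp add: w_def z_def)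
  qed
  show ?thesis
  proof (rule that[of T L "4 * C1" I p])
    show "L \<ge> 0" by (simp add: L_def sum_nonneg)
    show "finite I" using G by (simp add: I_def)
    show "(dist (S T x) (S T y))\<^sup>2 \<le> (dist x y)\<^sup>2 / 8 + 4 * C1 * (\<Sum>i\<in>I. (p i x - p i y)\<^sup>2)"
      if "x \<in> \<A>" "y \<in> \<A>" for x y
      using key[OF that, of T] T by (simp add: dist_norm)
    fix i x y assume i: "i \<in> I" and xy: "x \<in> \<A>" "y \<in> \<A>"
    obtain j h where jh: "i = (j, h)" "j \<le> J" "h \<in> G" using i by (auto simp: I_def)
    let ?t = "real j * \<Delta>"
    have t: "0 \<le> ?t" "?t \<le> T" using \<Delta> jh(2) mult_right_mono[of "real j" "real J" \<Delta>] by auto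
    have "(norm (S ?t x - S ?t y))\<^sup>2 \<le> 2 * (norm (x - y))\<^sup>2" using key[OF xy t] by blast
    also have "\<dots> \<le> (2 * norm (x - y))\<^sup>2" by (simp add: power_mult_distrib)
    finally have S2: "norm (S ?t x - S ?t y) \<le> 2 * norm (x - y)" by (rule power2_le_imp_le) simp
    have "\<bar>p i x - p i y\<bar> \<le> norm (S ?t x - S ?t y) * norm h"
      by (simp add: jh p_def inner_diff_left[symmetric] Cauchy_Schwarz_ineq2)
    also have "\<dots> \<le> (2 * norm (x - y)) * (\<Sum>h\<in>G. norm h)"
      using S2 G(1) jh(3) by (intro mult_mono member_le_sum) auto
    finally show "\<bar>p i x - p i y\<bar> \<le> L * dist x y" by (simp add: L_def dist_norm mult_ac)
  qed (use T C1 in auto)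
qed

section \<open>Coverings and dimensions\<close>

text \<open>On a set of diameter r the functionals vary by at most L r, while pieces of width
  \<theta> r are wanted. The number of pieces thus depends on L / \<theta> alone and is the same at
  every scale.\<close>

lemma quasi_stability_covers:
  fixes \<A> :: "'m::metric_space set" and p :: "'i \<Rightarrow> 'm \<Rightarrow> real"
  assumes \<A>: "bounded \<A>" "V ` \<A> = \<A>" and I: "finite I" and L: "L \<ge> 0" and C: "C \<ge> 0"
    and lip: "\<And>i x y. i \<in> I \<Longrightarrow> x \<in> \<A> \<Longrightarrow> y \<in> \<A> \<Longrightarrow> \<bar>p i x - p i y\<bar> \<le> L * dist x y"
    and qs: "\<And>x y. x \<in> \<A> \<Longrightarrow> y \<in> \<A> \<Longrightarrow>
      (dist (V x) (V y))\<^sup>2 \<le> (dist x y)\<^sup>2 / 8 + C * (\<Sum>i\<in>I. (p i x - p i y)\<^sup>2)"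
  obtains K :: nat and \<rho> :: real where "K \<ge> 1" "\<rho> > 0"
    "\<And>n. \<exists>\<P>. finite \<P> \<and> card \<P> \<le> K ^ n \<and> \<Union>\<P> = \<A> \<and> (\<forall>P\<in>\<P>. \<forall>x\<in>P. \<forall>y\<in>P. dist x y \<le> \<rho> / 2 ^ n)"
proof -
  obtain e where e: "\<And>x y. x \<in> \<A> \<Longrightarrow> y \<in> \<A> \<Longrightarrow> dist x y \<le> e"
    using \<A>(1) bounded_two_points by metis
  \<comment> \<open>The maximum with 1 keeps \<rho> positive even if the set is a single
    point.\<close>
  define \<rho> where "\<rho> = max e 1"
  have \<rho>: "\<rho> > 0" "\<And>x y. x \<in> \<A> \<Longrightarrow> y \<in> \<A> \<Longrightarrow> dist x y \<le> \<rho>" using e by (auto simp: \<rho>_def le_max_iff_disj)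
  define q where "q = C * real (card I) + 1"
  have q: "q > 0" using C by (simp add: q_def add_nonneg_pos)
  \<comment> \<open>With oscillation \<theta> r the sum over I contributes at most r^2 / 8, which
    together with the 1/8 of the hypothesis makes (r / 2)^2.\<close>
  define \<theta> where "\<theta> = 1 / sqrt (8 * q)"
  have \<theta>: "\<theta> > 0" "q * \<theta>\<^sup>2 = 1 / 8" using q by (simp_all add: \<theta>_def power_divide)
  have C\<theta>: "C * (real (card I) * \<theta>\<^sup>2) \<le> 1 / 8"
    unfolding \<theta>(2)[symmetric] by (simp add: q_def algebra_simps)
  obtain N :: nat where N: "L / \<theta> \<le> real N" using real_arch_simple by blast
  have LN: "L \<le> real N * \<theta>" using N \<theta>(1) by (simp add: divide_le_eq)
  define K where "K = (2 * N + 1) ^ card I"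
  have K: "K \<ge> 1" by (simp add: K_def)
  have split: "\<exists>\<Q>. finite \<Q> \<and> card \<Q> \<le> K \<and> \<Union>\<Q> = V ` B \<and> (\<forall>Q\<in>\<Q>. \<forall>x\<in>Q. \<forall>y\<in>Q. dist x y \<le> r / 2)"
    if B: "B \<subseteq> \<A>" and r: "r > 0" "\<And>x y. x \<in> B \<Longrightarrow> y \<in> B \<Longrightarrow> dist x y \<le> r" for B r
  proof -
    have Lr: "L * r \<le> real N * (\<theta> * r)" using mult_right_mono[OF LN, of r] r(1) by (simp add: mult.assoc)
    have osc: "\<bar>p i x - p i y\<bar> \<le> L * r" if i: "i \<in> I" and xy: "x \<in> B" "y \<in> B" for i x y
      by (rule order_trans[OF lip]) (use i xy B r(2) L in \<open>auto intro: mult_left_mono\<close>)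
    obtain \<P> where \<P>: "finite \<P>" "card \<P> \<le> K" "\<Union>\<P> = B"
      "\<And>P i x y. P \<in> \<P> \<Longrightarrow> i \<in> I \<Longrightarrow> x \<in> P \<Longrightarrow> y \<in> P \<Longrightarrow> \<bar>p i x - p i y\<bar> \<le> \<theta> * r"
      using finite_quantization[OF I mult_pos_pos[OF \<theta>(1) r(1)] Lr, of B p] osc unfolding K_def by metis
    show ?thesis
    proof (intro exI conjI ballI)
      show "finite ((`) V ` \<P>)" using \<P>(1) by simp
      show "card ((`) V ` \<P>) \<le> K" using card_image_le[OF \<P>(1), of "(`) V"] \<P>(2) by linarith
      show "\<Union>((`) V ` \<P>) = V ` B" using \<P>(3) by blast
      fix Q a b assume "Q \<in> (`) V ` \<P>" "a \<in> Q" "b \<in> Q"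
      then obtain P x y where P: "P \<in> \<P>" "x \<in> P" "y \<in> P" "a = V x" "b = V y" by blast
      then have xy: "x \<in> B" "y \<in> B" using \<P>(3) by auto
      have "(\<Sum>i\<in>I. (p i x - p i y)\<^sup>2) \<le> (\<Sum>i\<in>I. (\<theta> * r)\<^sup>2)"
      proof (rule sum_mono)
        fix i assume "i \<in> I"
        then have "\<bar>p i x - p i y\<bar>\<^sup>2 \<le> (\<theta> * r)\<^sup>2" using \<P>(4)[OF P(1) _ P(2,3)] by (intro power_mono) auto
        then show "(p i x - p i y)\<^sup>2 \<le> (\<theta> * r)\<^sup>2" by simp
      qed
      then have "C * (\<Sum>i\<in>I. (p i x - p i y)\<^sup>2) \<le> C * (real (card I) * (\<theta> * r)\<^sup>2)"
        using C by (intro mult_left_mono) simp_all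
      also have "\<dots> = (C * (real (card I) * \<theta>\<^sup>2)) * r\<^sup>2" by (simp add: power_mult_distrib)
      also have "\<dots> \<le> 1 / 8 * r\<^sup>2" by (intro mult_right_mono C\<theta>) simp
      finally have "C * (\<Sum>i\<in>I. (p i x - p i y)\<^sup>2) \<le> 1 / 8 * r\<^sup>2" .
      moreover have "(dist x y)\<^sup>2 \<le> r\<^sup>2" using r(2)[OF xy] by (intro power_mono) auto
      ultimately have "(dist a b)\<^sup>2 \<le> (r / 2)\<^sup>2"
        using qs[of x y] subsetD[OF B xy(1)] subsetD[OF B xy(2)] P(4,5) by (simp add: power_divide)
      then show "dist a b \<le> r / 2" by (rule power2_le_imp_le) (use r in simp)
    qed
  qed
  have "\<exists>\<P>. finite \<P> \<and> card \<P> \<le> K ^ n \<and> \<Union>\<P> = \<A> \<and> (\<forall>P\<in>\<P>. \<forall>x\<in>P. \<forall>y\<in>P. dist x y \<le> \<rho> / 2 ^ n)" for n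
  proof (induction n)
    case 0
    show ?case by (rule exI[of _ "{\<A>}"]) (use \<rho>(2) in auto)
  next
    case (Suc n)
    then obtain \<P> where \<P>: "finite \<P>" "card \<P> \<le> K ^ n" "\<Union>\<P> = \<A>"
      "\<And>P x y. P \<in> \<P> \<Longrightarrow> x \<in> P \<Longrightarrow> y \<in> P \<Longrightarrow> dist x y \<le> \<rho> / 2 ^ n" by blast
    define good where "good P \<Q> \<longleftrightarrow> finite \<Q> \<and> card \<Q> \<le> K \<and> \<Union>\<Q> = V ` P
        \<and> (\<forall>Q\<in>\<Q>. \<forall>x\<in>Q. \<forall>y\<in>Q. dist x y \<le> \<rho> / 2 ^ n / 2)" for P \<Q>
    have "\<forall>P\<in>\<P>. \<exists>\<Q>. good P \<Q>"
    proof
      fix P assume P: "P \<in> \<P>"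
      show "\<exists>\<Q>. good P \<Q>" unfolding good_def
        by (rule split) (use P \<P>(3,4) \<rho>(1) in auto)
    qed
    then obtain \<Q> where good: "\<forall>P\<in>\<P>. good P (\<Q> P)" by (rule bchoice[THEN exE])
    have \<Q>: "finite (\<Q> P)" "card (\<Q> P) \<le> K" "\<Union>(\<Q> P) = V ` P"
      "\<And>Q x y. Q \<in> \<Q> P \<Longrightarrow> x \<in> Q \<Longrightarrow> y \<in> Q \<Longrightarrow> dist x y \<le> \<rho> / 2 ^ n / 2" if "P \<in> \<P>" for P
      using bspec[OF good that] unfolding good_def by blast+
    show ?case
    proof (intro exI conjI ballI)
      show "finite (\<Union>P\<in>\<P>. \<Q> P)" using \<P>(1) \<Q>(1) by blast
      have "card (\<Union>P\<in>\<P>. \<Q> P) \<le> (\<Sum>P\<in>\<P>. card (\<Q> P))" by (rule card_UN_le[OF \<P>(1)])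
      also have "\<dots> \<le> (\<Sum>P\<in>\<P>. K)" by (intro sum_mono \<Q>(2))
      also have "\<dots> \<le> K ^ Suc n" using \<P>(2) by (simp add: mult.commute)
      finally show "card (\<Union>P\<in>\<P>. \<Q> P) \<le> K ^ Suc n" .
      \<comment> \<open>Invariance under V turns the cover of the image back into a cover of \<A>,
        so the refinement can be iterated.\<close>
      have "\<Union>(\<Union>P\<in>\<P>. \<Q> P) = (\<Union>P\<in>\<P>. \<Union>(\<Q> P))" by blast
      also have "\<dots> = (\<Union>P\<in>\<P>. V ` P)" using \<Q>(3) by (intro SUP_cong) auto
      also have "\<dots> = V ` \<A>" using \<P>(3) by blast
      finally show "\<Union>(\<Union>P\<in>\<P>. \<Q> P) = \<A>" using \<A>(2) by simp
      fix Q x y assume "Q \<in> (\<Union>P\<in>\<P>. \<Q> P)" "x \<in> Q" "y \<in> Q"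
      then have "dist x y \<le> \<rho> / 2 ^ n / 2" using \<Q>(4) by blast
      then show "dist x y \<le> \<rho> / 2 ^ Suc n" by (simp add: mult.commute)
    qed
  qed
  then show ?thesis by (rule that[OF K \<rho>(1)])
qed

text \<open>The exponent exceeds log2 K by 1, so K 2^(-s) = 1/2 and every refinement halves the
  covering sum.\<close>

lemma hausdorff_dim_finite:
  fixes \<A> :: "'m::metric_space set"
  assumes K: "K \<ge> 1" and \<rho>: "\<rho> > 0" and bdd: "bounded \<A>"
    and cov: "\<And>n. \<exists>\<P>. finite \<P> \<and> card \<P> \<le> K ^ n \<and> \<Union>\<P> = \<A> \<and> (\<forall>P\<in>\<P>. \<forall>x\<in>P. \<forall>y\<in>P. dist x y \<le> \<rho> / 2 ^ n)"
  shows "hausdorff_dim \<A> < \<infinity>"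
proof -
  define s where "s = log 2 (real K) + 1"
  have s: "s > 0" using K by (simp add: s_def add_nonneg_pos)
  have K2: "real K * (1 / 2) powr s = 1 / 2"
  proof -
    have "(2::real) powr s = real K * 2" using K by (simp add: s_def powr_add)
    then show ?thesis using K by (simp add: powr_divide)
  qed
  have zero: "hausdorff_premeasure s \<delta> \<A> = 0" if \<delta>: "\<delta> > 0" for \<delta>
  proof -
    have half: "(\<lambda>n. a * (1 / 2) ^ n) \<longlonglongrightarrow> 0" for a :: real
      using tendsto_mult[OF tendsto_const LIMSEQ_power_zero[of "1 / 2 :: real"], of a] by simp
    have "\<forall>\<^sub>F n in sequentially. \<rho> * (1 / 2) ^ n < \<delta>" by (rule order_tendstoD(2)[OF half \<delta>])
    then have ev: "\<forall>\<^sub>F n in sequentially. hausdorff_premeasure s \<delta> \<A> \<le> ennreal (\<rho> powr s * (1 / 2) ^ n)"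
    proof eventually_elim
      case (elim n)
      obtain \<P> where \<P>: "finite \<P>" "card \<P> \<le> K ^ n" "\<Union>\<P> = \<A>"
        "\<And>P x y. P \<in> \<P> \<Longrightarrow> x \<in> P \<Longrightarrow> y \<in> P \<Longrightarrow> dist x y \<le> \<rho> / 2 ^ n" using cov[of n] by blast
      obtain e where e: "bij_betw e {0..<card \<P>} \<P>" using ex_bij_betw_nat_finite[OF \<P>(1)] by blast
      \<comment> \<open>The finite cover is padded to a sequence by empty sets, whose terms are
        \<open>0 powr s = 0\<close>.\<close>
      define U where "U i = (if i < card \<P> then e i else {})" for i
      have eP: "e i \<in> \<P>" if "i < card \<P>" for i using bij_betwE[OF e] that by auto
      have diam: "diameter (U i) \<le> \<rho> / 2 ^ n" and bU: "bounded (U i)" for i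
      proof -
        have "diameter P \<le> \<rho> / 2 ^ n" if P: "P \<in> \<P>" for P
        proof (cases "P = {}")
          case False
          have "(SUP xy\<in>P \<times> P. dist (fst xy) (snd xy)) \<le> \<rho> / 2 ^ n"
            using False \<P>(4)[OF P] by (intro cSUP_least) auto
          then show ?thesis using False by (simp add: diameter_def case_prod_beta')
        qed (use \<rho> in simp)
        then show "diameter (U i) \<le> \<rho> / 2 ^ n" using eP \<rho> by (auto simp: U_def)
        show "bounded (U i)" using eP[of i] \<P>(3) bounded_subset[OF bdd] by (auto simp: U_def)
      qed
      have small: "\<rho> / 2 ^ n = \<rho> * (1 / 2) ^ n" by (simp add: power_one_over)
      have "\<A> \<subseteq> (\<Union>i. U i)"
      proof
        fix x assume "x \<in> \<A>"
        then obtain P where "P \<in> \<P>" "x \<in> P" using \<P>(3) by blast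
        then have "P \<in> e ` {0..<card \<P>}" using e by (simp add: bij_betw_def)
        then obtain i where "i < card \<P>" "e i = P" by auto
        then show "x \<in> (\<Union>i. U i)" using \<open>x \<in> P\<close> by (auto simp: U_def intro!: exI[of _ i])
      qed
      then have "hausdorff_premeasure s \<delta> \<A> \<le> (\<Sum>i. ennreal (diameter (U i) powr s))"
        unfolding hausdorff_premeasure_def
      proof (intro INF_lower CollectI conjI allI)
        show "diameter (U i) \<le> \<delta>" for i using diam[of i] elim small by linarith
      qed (use bU in auto)
      also have "\<dots> = (\<Sum>i<card \<P>. ennreal (diameter (U i) powr s))"
        by (rule suminf_finite) (auto simp: U_def)
      also have "\<dots> \<le> (\<Sum>i<card \<P>. ennreal ((\<rho> / 2 ^ n) powr s))"
        using s bU diam by (intro sum_mono ennreal_leI powr_mono2) (auto simp: diameter_ge_0)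
      also have "\<dots> = ennreal (real (card \<P>) * (\<rho> / 2 ^ n) powr s)"
        by (simp add: ennreal_mult ennreal_of_nat_eq_real_of_nat)
      also have "\<dots> \<le> ennreal (real (K ^ n) * (\<rho> / 2 ^ n) powr s)"
        using \<P>(2) by (intro ennreal_leI mult_right_mono) (auto simp del: of_nat_power)
      also have "real (K ^ n) * (\<rho> / 2 ^ n) powr s = \<rho> powr s * (1 / 2) ^ n"
      proof -
        have "(\<rho> / 2 ^ n) powr s = \<rho> powr s * ((1 / 2) powr s) ^ n"
          unfolding small using \<rho> by (simp add: powr_mult powr_powr mult.commute flip: powr_realpow)
        then have "real (K ^ n) * (\<rho> / 2 ^ n) powr s = \<rho> powr s * (real K * (1 / 2) powr s) ^ n"
          by (simp add: power_mult_distrib)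
        then show ?thesis by (simp only: K2)
      qed
      finally show ?case .
    qed
    have "(\<lambda>n. ennreal (\<rho> powr s * (1 / 2) ^ n)) \<longlonglongrightarrow> ennreal 0"
      by (intro tendsto_ennrealI half)
    then have "hausdorff_premeasure s \<delta> \<A> \<le> ennreal 0"
      by (rule tendsto_lowerbound[OF _ ev]) simp
    then show ?thesis by simp
  qed
  have "hausdorff_measure s \<A> = 0" 
  proof -
    have "hausdorff_measure s \<A> \<le> 0" unfolding hausdorff_measure_def by (rule SUP_least) (simp add: zero)
    then show ?thesis by simp
  qed
  then have "hausdorff_dim \<A> \<le> ereal s"
    unfolding hausdorff_dim_def using s by (intro Inf_lower) blast
  then show ?thesis by (rule le_less_trans) simp
qed

text \<open>One point of each piece serves as the centre of a ball, which keeps the centres in X. As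
  the diameters decrease geometrically, a radius \<epsilon> is reached after a number of refinements
  of order ln (1/\<epsilon>).\<close>

lemma fractal_dim_finite:
  fixes \<A> X :: "'m::metric_space set"
  assumes K: "K \<ge> 1" and \<rho>: "\<rho> > 0" and X: "\<A> \<subseteq> X"
    and cov: "\<And>n. \<exists>\<P>. finite \<P> \<and> card \<P> \<le> K ^ n \<and> \<Union>\<P> = \<A> \<and> (\<forall>P\<in>\<P>. \<forall>x\<in>P. \<forall>y\<in>P. dist x y \<le> \<rho> / 2 ^ n)"
  shows "fractal_dim X \<A> < \<infinity>"
proof -
  have cn: "covering_number X \<epsilon> \<A> \<le> enat (K ^ n)" if \<epsilon>: "\<rho> / 2 ^ n < \<epsilon>" for \<epsilon> n
  proof -
    obtain \<P> where \<P>: "finite \<P>" "card \<P> \<le> K ^ n" "\<Union>\<P> = \<A>"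
      "\<And>P x y. P \<in> \<P> \<Longrightarrow> x \<in> P \<Longrightarrow> y \<in> P \<Longrightarrow> dist x y \<le> \<rho> / 2 ^ n" using cov[of n] by blast
    define c where "c P = (SOME x. x \<in> P)" for P :: "'m set"
    have c: "c P \<in> P" if "P \<noteq> {}" for P using that by (simp add: c_def some_in_eq)
    define D where "D = c ` (\<P> - {{}})"
    have "covering_number X \<epsilon> \<A> \<le> enat (card D)"
      unfolding covering_number_def
    proof (rule INF_lower, intro CollectI conjI)
      show "finite D" using \<P>(1) by (simp add: D_def)
      show "D \<subseteq> X" 
      proof
        fix x assume "x \<in> D"
        then obtain P where "P \<in> \<P>" "P \<noteq> {}" "x = c P" by (auto simp: D_def)
        then show "x \<in> X" using c[of P] \<P>(3) X by blast
      qed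
      show "\<A> \<subseteq> (\<Union>d\<in>D. ball d \<epsilon>)"
      proof
        fix x assume "x \<in> \<A>"
        then obtain P where P: "P \<in> \<P>" "x \<in> P" using \<P>(3) by blast
        then have "c P \<in> D" "dist (c P) x \<le> \<rho> / 2 ^ n" using c[of P] \<P>(4)[OF P(1)] by (auto simp: D_def)
        then show "x \<in> (\<Union>d\<in>D. ball d \<epsilon>)" using \<epsilon> by (auto intro!: bexI[of _ "c P"])
      qed
    qed
    also have "card D \<le> K ^ n"
    proof -
      have "card D \<le> card (\<P> - {{}})" unfolding D_def using \<P>(1) by (intro card_image_le) simp
      also have "\<dots> \<le> card \<P>" by (rule card_mono[OF \<P>(1)]) blast
      finally show ?thesis using \<P>(2) by linarith
    qed
    finally show ?thesis by simp
  qed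
  \<comment> \<open>From n \<le> log2 (1/\<epsilon>) + |log2 \<rho>| + 2, divided by ln
    (1/\<epsilon>) \<ge> 1.\<close>
  define B where "B = ln (real K) * (1 / ln 2 + \<bar>log 2 \<rho>\<bar> + 2)"
  have K0: "ln (real K) \<ge> 0" using K by simp
  have B: "B \<ge> 0" using K0 by (simp add: B_def)
  let ?f = "\<lambda>\<epsilon>. case covering_number X \<epsilon> \<A> of enat N \<Rightarrow> ereal (ln (real N) / ln (1 / \<epsilon>)) | \<infinity> \<Rightarrow> \<infinity>"
  \<comment> \<open>Radii below 1/e have ln (1/\<epsilon>) \<ge> 1, so additive constants can be
    absorbed into multiples of it.\<close>
  have le: "?f \<epsilon> \<le> ereal B" if \<epsilon>: "0 < \<epsilon>" "\<epsilon> < exp (- 1)" for \<epsilon>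
  proof -
    have l1: "ln (1 / \<epsilon>) \<ge> 1"
      using \<epsilon> ln_less_cancel_iff[of \<epsilon> "exp (- 1)"] by (simp add: ln_div)
    \<comment> \<open>The successor makes \<rho> / 2^n strictly smaller than \<epsilon>, as open
      balls demand; \<open>nat\<close> sends negative logarithms to 0.\<close>
    define n where "n = Suc (nat \<lceil>log 2 (\<rho> / \<epsilon>)\<rceil>)"
    have "log 2 (\<rho> / \<epsilon>) < real n" unfolding n_def by linarith
    then have "\<rho> / \<epsilon> < 2 ^ n" using \<rho> \<epsilon> by (simp add: log_less_iff powr_realpow)
    then have "\<rho> / 2 ^ n < \<epsilon>" using \<epsilon> by (simp add: field_simps)
    from cn[OF this] obtain N where N: "covering_number X \<epsilon> \<A> = enat N" "N \<le> K ^ n"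
      by (cases "covering_number X \<epsilon> \<A>") auto
    have lnN: "ln (real N) \<le> real n * ln (real K)"
    \<comment> \<open>The value 0 is separated because the logarithm is compared only at positive
      arguments.\<close>
    proof (cases "N = 0")
      case False
      then have "ln (real N) \<le> ln (real (K ^ n))" using N(2) K by (subst ln_le_cancel_iff) (auto simp del: of_nat_power)
      also have "\<dots> = real n * ln (real K)" using K by (simp add: ln_realpow)
      finally show ?thesis .
    qed (use K0 in simp)
    have "log 2 (\<rho> / \<epsilon>) = log 2 \<rho> + ln (1 / \<epsilon>) / ln 2" using \<rho> \<epsilon> by (simp add: log_def ln_div diff_divide_distrib)
    moreover have "real n \<le> \<bar>log 2 (\<rho> / \<epsilon>)\<bar> + 2" unfolding n_def by linarith
    moreover have "0 \<le> ln (1 / \<epsilon>) / ln 2" using l1 by simp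
    ultimately have nle: "real n \<le> \<bar>log 2 \<rho>\<bar> + 2 + ln (1 / \<epsilon>) / ln 2" by linarith
    also have "\<dots> \<le> (\<bar>log 2 \<rho>\<bar> + 2) * ln (1 / \<epsilon>) + 1 / ln 2 * ln (1 / \<epsilon>)"
      using mult_left_mono[OF l1, of "\<bar>log 2 \<rho>\<bar> + 2"] by simp
    finally have "real n \<le> (1 / ln 2 + \<bar>log 2 \<rho>\<bar> + 2) * ln (1 / \<epsilon>)" by (simp add: algebra_simps)
    from mult_right_mono[OF this K0] lnN have "ln (real N) \<le> B * ln (1 / \<epsilon>)" by (simp add: B_def mult_ac)
    then have "ln (real N) / ln (1 / \<epsilon>) \<le> B" using l1 by (simp add: divide_le_eq)
    then show ?thesis by (simp add: N(1))
  qed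
  have "\<forall>\<^sub>F \<epsilon> in at_right 0. ?f \<epsilon> \<le> ereal B"
    unfolding eventually_at_right_field using le by (intro exI[of _ "exp (- 1)"]) auto
  then have "fractal_dim X \<A> \<le> ereal B"
    unfolding fractal_dim_def by (rule Limsup_bounded)
  then show ?thesis by (rule le_less_trans) simp
qed

theorem theorem2:
  fixes \<Omega> :: "(real ^ 'n) set"
    and d1 d2 d3 a1 a3 b1 b2 c2 c3 F G1 G2 :: real
    and S :: "real \<Rightarrow> (real ^ 'n) state \<Rightarrow> (real ^ 'n) state"
    and \<A> :: "(real ^ 'n) state set"
  assumes "CARD('n) \<le> 3"
    and "bounded_Lipschitz_domain \<Omega>"
    and "d1 > 0" "d2 > 0" "d3 > 0" "a1 > 0" "a3 > 0" "b1 > 0" "b2 > 0" "c2 > 0" "c3 > 0"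
      "F > 0" "G1 > 0" "G2 > 0"
    and "oregonator_semiflow \<Omega> d1 d2 d3 a1 a3 b1 b2 c2 c3 F G1 G2 S"
    and "global_attractor (H_plus \<Omega>) S \<A>"
  shows "hausdorff_dim \<A> < \<infinity> \<and> fractal_dim (H_space \<Omega>) \<A> < \<infinity>"
proof -
  have \<Omega>: "open \<Omega>" "bounded \<Omega>" using assms(2) by (auto simp: bounded_Lipschitz_domain_def)
  have n: "DIM(real ^ 'n) \<le> 3" using assms(1) by simp
  obtain T L C and I :: "(nat \<times> (real ^ 'n) state) set" and p where
    T: "T > 0" and qs: "L \<ge> 0" "C \<ge> 0" "finite I"
      "\<And>i x y. i \<in> I \<Longrightarrow> x \<in> \<A> \<Longrightarrow> y \<in> \<A> \<Longrightarrow> \<bar>p i x - p i y\<bar> \<le> L * dist x y"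
      "\<And>x y. x \<in> \<A> \<Longrightarrow> y \<in> \<A> \<Longrightarrow>
        (dist (S T x) (S T y))\<^sup>2 \<le> (dist x y)\<^sup>2 / 8 + C * (\<Sum>i\<in>I. (p i x - p i y)\<^sup>2)"
    using Oregonator_quasi_stability[OF \<Omega> n assms(3-16)] by blast
  have \<A>: "compact \<A>" "\<A> \<subseteq> H_plus \<Omega>" "S T ` \<A> = \<A>" using assms(16) T by (auto simp: global_attractor_def)
  have bdd: "bounded \<A>" using \<A>(1) by (rule compact_imp_bounded)
  have sub: "\<A> \<subseteq> H_space \<Omega>" using \<A>(2) by (auto simp: H_plus_def)
  obtain K :: nat and \<rho> :: real where K: "K \<ge> 1" "\<rho> > 0" and
    cov: "\<And>n. \<exists>\<P>. finite \<P> \<and> card \<P> \<le> K ^ n \<and> \<Union>\<P> = \<A> \<and> (\<forall>P\<in>\<P>. \<forall>x\<in>P. \<forall>y\<in>P. dist x y \<le> \<rho> / 2 ^ n)"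
    using quasi_stability_covers[where V="S T" and p=p, OF bdd \<A>(3) qs(3,1,2,4,5)] by blast
  show ?thesis
    using hausdorff_dim_finite[OF K bdd cov] fractal_dim_finite[OF K sub cov] by blast
qed

end
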